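(* Let $u_0\in H^1(\mathbb S)$ with $h:=\int_{\mathbb S}u_{0x}^2\,dx\neq1$. If $u$ is a global admissible conservative weak solution, in the sense defined below, of the problem $$u_t-u^2u_x=\partial_x^{-1}(u-uu_x^2)-f(t),\qquad u(0,x)=u_0(x),\qquad u(t,x+1)=u(t,x),$$ then $u$ is unique. That is, any two such solutions with the same initial datum $u_0$ coincide for a.e. $t\ge0$ and a.e. $x$.
   Context: $\mathbb S=\mathbb R/\mathbb Z$; functions on $\mathbb S$ are identified with 1-periodic functions on $\mathbb R$. For $w$ on $\mathbb S$ write - $\overline w=\int_{\mathbb S}w\,dx$; - $\mathbb Pw=w-\overline w$; - $\partial_x^{-1}w(x)=\int_0^x\mathbb Pw(y)\,dy$. Test functions $\psi\in C_0^\infty(\mathbb R^+;\mathcal D(\mathbb S))$ are smooth, 1-periodic in $x$, and compactly supported in $t\in[0,\infty)$. Also $$f(t)=\frac{1}{1-h}\int_{\mathbb S}(1-u_x^2)\,\partial_x^{-1}(u-uu_x^2)(y)\,dy.$$ A function $u\in L^\infty(\mathbb R^+;H^1(\mathbb S))$ is a global admissible conservative weak solution if all of the following hold. (i) For all test functions $\psi$, $$\int_{\mathbb R^+}\!\int_{\mathbb S}(u\psi_{tx}+u^2u_x\psi_x)\,dx\,dt=\int_{\mathbb R^+}\!\int_{\mathbb S}\big(u-uu_x^2-\overline{u-uu_x^2}\big)\psi\,dx\,dt+\int_{\mathbb S}u_{0x}\psi(0,x)\,dx.$$ (ii) For all test functions $\psi$, $$\int_{\mathbb R^+}\!\int_{\mathbb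 S}(u\psi_t-\tfrac13u^3\psi_x)\,dx\,dt=-\int_{\mathbb R^+}\!\int_{\mathbb S}\big(\partial_x^{-1}(u-uu_x^2)-f(t)\big)\psi\,dx\,dt-\int_{\mathbb S}u_0\psi(0,x)\,dx.$$ (iii) $\int_{\mathbb S}u_x^2\,dx$ and $\int_{\mathbb S}(u-uu_x^2)\,dx$ are constant in time. (iv) For all test functions $\psi$, $$\int_{\mathbb R^+}\!\int_{\mathbb S}(u_x^2\psi_t-u^2u_x^2\psi_x)\,dz\,dt=-\int_{\mathbb R^+}\!\int_{\mathbb S}\big((u^2)_x-2u_x\overline{u-uu_x^2}\big)\psi\,dz\,dt-\int_{\mathbb S}u_{0x}^2\psi(0,z)\,dz.$$ *)

theory Defs
  imports "HOL-Analysis.Analysis"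
begin

definition pdt :: "(real \<Rightarrow> real \<Rightarrow> real) \<Rightarrow> real \<Rightarrow> real \<Rightarrow> real" where
  "pdt psi = (\<lambda>t x. deriv (\<lambda>s. psi s x) t)"

definition pdx :: "(real \<Rightarrow> real \<Rightarrow> real) \<Rightarrow> real \<Rightarrow> real \<Rightarrow> real" where
  "pdx psi = (\<lambda>t x. deriv (\<lambda>y. psi t y) x)"

fun iter_partial :: "bool list \<Rightarrow> (real \<Rightarrow> real \<Rightarrow> real) \<Rightarrow> real \<Rightarrow> real \<Rightarrow> real" where
  "iter_partial [] psi = psi"
| "iter_partial (True # ds) psi = pdt (iter_partial ds psi)"
| "iter_partial (False # ds) psi = pdx (iter_partial ds psi)"

definition smooth2 :: "(real \<Rightarrow> real \<Rightarrow> real) \<Rightarrow> bool" where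
  "smooth2 psi \<longleftrightarrow> (\<forall>ds.
      continuous_on UNIV (\<lambda>(t, x). iter_partial ds psi t x) \<and>
      (\<forall>t x. (\<lambda>s. iter_partial ds psi s x) differentiable (at t) \<and>
             (\<lambda>y. iter_partial ds psi t y) differentiable (at x)))"

definition smooth1 :: "(real \<Rightarrow> real) \<Rightarrow> bool" where
  "smooth1 phi \<longleftrightarrow> (\<forall>n. continuous_on UNIV ((deriv ^^ n) phi) \<and>
                         (\<forall>x. (deriv ^^ n) phi differentiable (at x)))"

definition periodic1 :: "(real \<Rightarrow> 'a) \<Rightarrow> bool" where
  "periodic1 g \<longleftrightarrow> (\<forall>x. g (x + 1) = g x)"

text \<open>Test functions in C_0^infinity(R^+; D(S)): smooth, 1-periodic in x, vanishing for
  large t (a smooth function on [0,oo)x R is represented by a smooth extension to R^2).\<close>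
definition test_fun :: "(real \<Rightarrow> real \<Rightarrow> real) \<Rightarrow> bool" where
  "test_fun psi \<longleftrightarrow> smooth2 psi \<and> (\<forall>t x. psi t (x + 1) = psi t x) \<and>
     (\<exists>T. \<forall>t x. t \<ge> T \<longrightarrow> psi t x = 0)"

definition Smean :: "(real \<Rightarrow> real) \<Rightarrow> real" where
  "Smean w = (LINT x:{0..1}|lborel. w x)"

definition Sproj :: "(real \<Rightarrow> real) \<Rightarrow> real \<Rightarrow> real" where
  "Sproj w = (\<lambda>x. w x - Smean w)"

definition dxinv :: "(real \<Rightarrow> real) \<Rightarrow> real \<Rightarrow> real" where
  "dxinv w = (\<lambda>x. LBINT y=0..x. Sproj w y)"

definition weak_deriv_per :: "(real \<Rightarrow> real) \<Rightarrow> (real \<Rightarrow> real) \<Rightarrow> bool" where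
  "weak_deriv_per g g' \<longleftrightarrow> (\<forall>phi. smooth1 phi \<and> periodic1 phi \<longrightarrow>
      (LINT x:{0..1}|lborel. g x * deriv phi x) = - (LINT x:{0..1}|lborel. g' x * phi x))"

definition H1_per :: "(real \<Rightarrow> real) \<Rightarrow> (real \<Rightarrow> real) \<Rightarrow> bool" where
  "H1_per g g' \<longleftrightarrow> periodic1 g \<and> periodic1 g' \<and>
     g \<in> borel_measurable borel \<and> g' \<in> borel_measurable borel \<and>
     set_integrable lborel {0..1::real} (\<lambda>x. (g x)\<^sup>2) \<and>
     set_integrable lborel {0..1::real} (\<lambda>x. (g' x)\<^sup>2) \<and>
     weak_deriv_per g g'"

definition ff :: "real \<Rightarrow> (real \<Rightarrow> real \<Rightarrow> real) \<Rightarrow> (real \<Rightarrow> real \<Rightarrow> real) \<Rightarrow> real \<Rightarrow> real" where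
  "ff h u ux t = 1 / (1 - h) *
     (LINT y:{0..1}|lborel. (1 - (ux t y)\<^sup>2) * dxinv (\<lambda>x. u t x - u t x * (ux t x)\<^sup>2) y)"

definition adm_cons_sol ::
  "(real \<Rightarrow> real) \<Rightarrow> (real \<Rightarrow> real) \<Rightarrow> (real \<Rightarrow> real \<Rightarrow> real) \<Rightarrow> (real \<Rightarrow> real \<Rightarrow> real) \<Rightarrow> bool" where
  "adm_cons_sol u0 u0x u ux \<longleftrightarrow>
     (let h = (LINT x:{0..1}|lborel. (u0x x)\<^sup>2);
          m = (\<lambda>t. Smean (\<lambda>x. u t x - u t x * (ux t x)\<^sup>2)) in
     \<comment> \<open>u \<in> L^\<infinity>(R^+; H^1(S))\<close>
     (\<lambda>(t, x). u t x) \<in> borel_measurable (borel :: (real \<times> real) measure) \<and>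
     (\<lambda>(t, x). ux t x) \<in> borel_measurable (borel :: (real \<times> real) measure) \<and>
     (AE t in lborel. t \<ge> 0 \<longrightarrow> H1_per (u t) (ux t)) \<and>
     (\<exists>C. AE t in lborel. t \<ge> 0 \<longrightarrow>
          (LINT x:{0..1}|lborel. (u t x)\<^sup>2 + (ux t x)\<^sup>2) \<le> C) \<and>
     \<comment> \<open>(i)\<close>
     (\<forall>psi. test_fun psi \<longrightarrow>
        (LINT t:{0..}|lborel. LINT x:{0..1}|lborel.
            u t x * pdt (pdx psi) t x + (u t x)\<^sup>2 * ux t x * pdx psi t x)
        = (LINT t:{0..}|lborel. LINT x:{0..1}|lborel.
            (u t x - u t x * (ux t x)\<^sup>2 - m t) * psi t x)
          + (LINT x:{0..1}|lborel. u0x x * psi 0 x)) \<and>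
     \<comment> \<open>(ii)\<close>
     (\<forall>psi. test_fun psi \<longrightarrow>
        (LINT t:{0..}|lborel. LINT x:{0..1}|lborel.
            u t x * pdt psi t x - 1/3 * (u t x) ^ 3 * pdx psi t x)
        = - (LINT t:{0..}|lborel. LINT x:{0..1}|lborel.
            (dxinv (\<lambda>y. u t y - u t y * (ux t y)\<^sup>2) x - ff h u ux t) * psi t x)
          - (LINT x:{0..1}|lborel. u0 x * psi 0 x)) \<and>
     \<comment> \<open>(iii)\<close>
     (\<exists>c1 c2. AE t in lborel. t \<ge> 0 \<longrightarrow>
        (LINT x:{0..1}|lborel. (ux t x)\<^sup>2) = c1 \<and>
        (LINT x:{0..1}|lborel. u t x - u t x * (ux t x)\<^sup>2) = c2) \<and>
     \<comment> \<open>(iv)\<close>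
     (\<forall>psi. test_fun psi \<longrightarrow>
        (LINT t:{0..}|lborel. LINT z:{0..1}|lborel.
            (ux t z)\<^sup>2 * pdt psi t z - (u t z)\<^sup>2 * (ux t z)\<^sup>2 * pdx psi t z)
        = - (LINT t:{0..}|lborel. LINT z:{0..1}|lborel.
            (2 * u t z * ux t z - 2 * ux t z * m t) * psi t z)
          - (LINT z:{0..1}|lborel. (u0x z)\<^sup>2 * psi 0 z)))"

end

theory Submission
  imports Defs
begin

text \<open>Put \<open>w = u\<^sub>x\<^sup>2\<close>, \<open>q = 1 + w\<close> and let \<open>E\<close> be the potential with \<open>E\<^sub>x = q\<close> and
  \<open>E\<^sub>t = u\<^sup>2 q - 2 m u\<close>, where \<open>m\<close> is the conserved mean of \<open>u - u u\<^sub>x\<^sup>2\<close>; it exists by (iv).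
  In the coordinate \<open>\<beta> = E(t,x)\<close> the functions \<open>X = E(t,\<cdot>)\<^sup>-\<^sup>1\<close> and \<open>U = u(t,X)\<close> are Lipschitz,
  because \<open>2 \<bar>u\<^sub>x\<bar> \<le> q\<close>, and formally solve the semilinear system
  \<open>X\<^sub>t - 2 m U X\<^sub>\<beta> = - U\<^sup>2\<close>, \<open>U\<^sub>t - 2 m U U\<^sub>\<beta> = G\<close>, where \<open>G = \<partial>\<^sub>x\<^sup>-\<^sup>1(u - u u\<^sub>x\<^sup>2) - f\<close> is an
  integral of \<open>U (2 dX - d\<beta>) - m dX\<close> and hence depends Lipschitz continuously on \<open>(X, U)\<close> in the
  supremum norm. To make this rigorous without differentiability almost everywhere, \<open>E\<close> and \<open>u\<close> are
  averaged over space-time squares of side \<open>\<epsilon>\<close>; along the curves on which the averaged \<open>E\<close> changes at the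
  constant rate \<open>- 2 m a\<close> the commutator errors are at most a multiple of \<open>\<epsilon>\<^sup>1\<^sup>/\<^sup>2\<close> times the average
  of \<open>\<bar>u\<^sub>x\<bar>\<close>, which vanishes in the limit since the energy is absolutely continuous at almost every
  time. This yields expansions of \<open>X\<close> and \<open>U\<close> over a time step \<open>\<tau>\<close> with error \<open>O(\<tau>\<^sup>2)\<close>,
  and a discrete Gronwall argument shows that two solutions have the same \<open>X\<close> and \<open>U\<close>.\<close>

subsection \<open>Smooth cut-offs\<close>

text \<open>In the variable x the problem is not Lipschitz: u is only Hoelder continuous of exponent
  1/2, so curves x' = - u^2 may fail to be unique. Along such a curve E changes at the rate E_t -
  u^2 E_x = - 2 m u, which contains no derivative of u; with u frozen to a this becomes the
  prescribed rate - 2 m a. By Cauchy-Schwarz \<epsilon>^(1/2) times the average of |u_x| is merely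
  bounded, as the average of w may be of order 1/\<epsilon>. The missing smallness comes from the
  energy above a level N, which is uniform in position but not in time; hence it is integrated in
  time before \<epsilon> tends to 0. One-step errors O(\<tau>^2), summed over S/\<tau> steps, leave
  O(\<tau>). Since m enters the rate, the two solutions must also be shown to have the same mean,
  and since E grows by 1 + energy in each period, their energies must equal h at almost every
  time.\<close>

lemma smooth1_coinduct:
  assumes "P f"
    and step: "\<And>g. P g \<Longrightarrow> \<exists>g'. P g' \<and> (\<forall>x. (g has_real_derivative g' x) (at x))"
  shows "smooth1 f"
proof -
  have P: "P ((deriv ^^ n) f)" for n
  proof (induction n)
    case (Suc n)
    then obtain g' where "P g'" and d: "\<And>x. ((deriv ^^ n) f has_real_derivative g' x) (at x)"
      using step by blast
    have "deriv ((deriv ^^ n) f) = g'" using d DERIV_imp_deriv by blast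
    with \<open>P g'\<close> show ?case by simp
  qed (use assms in simp)
  have "(deriv ^^ n) f differentiable (at x)" for n x
    using step[OF P[of n]] real_differentiable_def by blast
  moreover from this have "continuous_on UNIV ((deriv ^^ n) f)" for n
    by (meson differentiable_imp_continuous_within continuous_on_eq_continuous_within)
  ultimately show ?thesis unfolding smooth1_def by auto
qed

lemma smooth1_has_deriv:
  assumes "smooth1 f" shows "(f has_real_derivative deriv f x) (at x)"
  using assms unfolding smooth1_def
  by (metis DERIV_deriv_iff_real_differentiable funpow_0)

lemma smooth1_deriv: "smooth1 f \<Longrightarrow> smooth1 (deriv f)"
  unfolding smooth1_def by (metis funpow_swap1 comp_apply funpow_Suc_right)

lemma smooth1_continuous: "smooth1 f \<Longrightarrow> continuous_on A f"
  unfolding smooth1_def by (metis funpow_0 continuous_on_subset subset_UNIV)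

text \<open>The class contains a derivative of each of its members, so that its members are smooth by
  coinduction; this gives the closure of \<^const>\<open>smooth1\<close> under products and compositions.\<close>
inductive smooth_alg :: "(real \<Rightarrow> real) \<Rightarrow> bool" where
  base: "smooth1 f \<Longrightarrow> smooth_alg f"
| add: "smooth_alg f \<Longrightarrow> smooth_alg g \<Longrightarrow> smooth_alg (\<lambda>x. f x + g x)"
| mult: "smooth_alg f \<Longrightarrow> smooth_alg g \<Longrightarrow> smooth_alg (\<lambda>x. f x * g x)"
| comp: "smooth_alg f \<Longrightarrow> smooth_alg g \<Longrightarrow> smooth_alg (\<lambda>x. f (g x))"

lemma smooth_alg_deriv:
  "smooth_alg f \<Longrightarrow> \<exists>f'. smooth_alg f' \<and> (\<forall>x. (f has_real_derivative f' x) (at x))"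
proof (induction rule: smooth_alg.induct)
  case (base f)
  then show ?case using smooth1_deriv smooth1_has_deriv smooth_alg.base by blast
next
  case (add f g)
  then obtain f' g' where 1: "smooth_alg f'" "smooth_alg g'"
    "\<And>x. (f has_real_derivative f' x) (at x)" "\<And>x. (g has_real_derivative g' x) (at x)" by blast
  show ?case
    by (rule exI[of _ "\<lambda>x. f' x + g' x"]) (intro conjI allI smooth_alg.add DERIV_add 1)
next
  case (mult f g)
  then obtain f' g' where 1: "smooth_alg f'" "smooth_alg g'"
    "\<And>x. (f has_real_derivative f' x) (at x)" "\<And>x. (g has_real_derivative g' x) (at x)" by blast
  show ?case
    by (rule exI[of _ "\<lambda>x. f' x * g x + g' x * f x"])
      (intro conjI allI smooth_alg.add smooth_alg.mult DERIV_mult 1 mult)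
next
  case (comp f g)
  then obtain f' g' where 1: "smooth_alg f'" "smooth_alg g'"
    "\<And>x. (f has_real_derivative f' x) (at x)" "\<And>x. (g has_real_derivative g' x) (at x)" by blast
  show ?case
    by (rule exI[of _ "\<lambda>x. f' (g x) * g' x"])
      (intro conjI allI smooth_alg.mult smooth_alg.comp[of f' g] DERIV_chain2[of f] 1 comp)
qed

lemma smooth1_iff_alg: "smooth1 f \<longleftrightarrow> smooth_alg f"
  by (metis smooth_alg.base smooth1_coinduct[of smooth_alg, OF _ smooth_alg_deriv])

lemma smooth1_add: "smooth1 f \<Longrightarrow> smooth1 g \<Longrightarrow> smooth1 (\<lambda>x. f x + g x)"
  and smooth1_mult: "smooth1 f \<Longrightarrow> smooth1 g \<Longrightarrow> smooth1 (\<lambda>x. f x * g x)"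
  and smooth1_comp: "smooth1 f \<Longrightarrow> smooth1 g \<Longrightarrow> smooth1 (\<lambda>x. f (g x))"
  unfolding smooth1_iff_alg by (fact smooth_alg.add smooth_alg.mult smooth_alg.comp)+

lemma smooth1_const: "smooth1 (\<lambda>x. c)"
  by (rule smooth1_coinduct[of "\<lambda>f. \<exists>c. f = (\<lambda>x. c)"]) (auto intro!: exI[of _ "\<lambda>x. 0"])

lemma smooth1_antideriv:
  assumes "smooth1 f" "\<And>x. (F has_real_derivative f x) (at x)"
  shows "smooth1 F"
  by (rule smooth1_coinduct[of "\<lambda>g. g = F \<or> smooth1 g"])
    (simp, metis assms smooth1_deriv smooth1_has_deriv)

lemma smooth1_ident: "smooth1 (\<lambda>x. x)"
  by (rule smooth1_antideriv[OF smooth1_const[of 1]]) auto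

lemma smooth1_affine: "smooth1 (\<lambda>x. a * x + b)"
  by (intro smooth1_add smooth1_mult smooth1_const smooth1_ident)

lemma smooth1_cos: "smooth1 cos"
proof (rule smooth1_coinduct[of "\<lambda>f. \<exists>a b. f = (\<lambda>x. a * cos x + b * sin x)"])
  show "\<exists>a b. cos = (\<lambda>x::real. a * cos x + b * sin x)"
    by (rule exI[of _ 1], rule exI[of _ 0]) auto
next
  fix g :: "real \<Rightarrow> real" assume "\<exists>a b. g = (\<lambda>x. a * cos x + b * sin x)"
  then obtain a b where g: "g = (\<lambda>x. a * cos x + b * sin x)" by blast
  show "\<exists>g'. (\<exists>a b. g' = (\<lambda>x. a * cos x + b * sin x)) \<and> (\<forall>x. (g has_real_derivative g' x) (at x))"
    by (rule exI[of _ "\<lambda>x. b * cos x + (- a) * sin x"])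
      (intro conjI exI[of _ b] exI[of _ "-a"], auto simp: g intro!: derivative_eq_intros)
qed

text \<open>Products of exp(-1/x) with polynomials in 1/x, extended by zero. With y = 1/x the
  derivative of p(y) exp(-y) is y^2 (p - p')(y) exp(-y), so the family is closed under
  differentiation and coinduction yields smoothness, also at 0.\<close>

definition flat :: "real poly \<Rightarrow> real \<Rightarrow> real" where
  "flat p x = (if x > 0 then poly p (1/x) * exp (- 1/x) else 0)"

text \<open>The free exponent k carries the induction on coefficients: p = a + y p1 turns y^k p into
  a y^k + y^(k+1) p1.\<close>

lemma poly_mult_exp_tendsto_0:
  "((\<lambda>y::real. y ^ k * poly p y / exp y) \<longlongrightarrow> 0) at_top"
proof (induction p arbitrary: k)
  case (pCons a p)
  have "((\<lambda>y::real. a * (y ^ k / exp y) + y ^ Suc k * poly p y / exp y) \<longlongrightarrow> a * 0 + 0) at_top"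
    by (intro tendsto_intros tendsto_power_div_exp_0 pCons)
  then show ?case by (simp add: algebra_simps add_divide_distrib)
qed simp

lemma flat_deriv:
  "(flat p has_real_derivative flat ([:0,0,1:] * (p - pderiv p)) x) (at x)"
proof -
  consider "x > 0" | "x < 0" | "x = 0" by linarith
  then show ?thesis
  proof cases
    case 1
    have "((\<lambda>x. poly p (1/x) * exp (- 1/x)) has_real_derivative flat ([:0,0,1:] * (p - pderiv p)) x) (at x)"
      using 1 by (auto simp: flat_def intro!: derivative_eq_intros
          simp: field_simps power2_eq_square)
    then show ?thesis
      using has_field_derivative_transform_within_open[of "\<lambda>x. poly p (1/x) * exp (- 1/x)" _ x "{0<..}" "flat p"] 1
      by (auto simp: flat_def)
  next
    case 2
    have "((\<lambda>x. 0) has_real_derivative flat ([:0,0,1:] * (p - pderiv p)) x) (at x)"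
      using 2 by (auto simp: flat_def)
    then show ?thesis
      using has_field_derivative_transform_within_open[of "\<lambda>x. 0" _ x "{..<0}" "flat p"] 2
      by (auto simp: flat_def)
  next
    case 3
    \<comment> \<open>For h = 1/y the difference quotient is y p(y) exp(-y), which tends to 0 at
      infinity.\<close>
    have "((\<lambda>h. flat p h / h) \<longlongrightarrow> 0) (at_right 0)"
    proof -
      have "((\<lambda>h. (inverse h) ^ 1 * poly p (inverse h) / exp (inverse h)) \<longlongrightarrow> 0) (at_right (0::real))"
        by (rule filterlim_compose[OF poly_mult_exp_tendsto_0 filterlim_inverse_at_top_right])
      moreover have "\<forall>\<^sub>F h in at_right (0::real). (inverse h) ^ 1 * poly p (inverse h) / exp (inverse h) = flat p h / h"
        by (rule eventually_at_right_less[THEN eventually_mono])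
          (simp add: flat_def field_simps exp_minus)
      ultimately show ?thesis by (rule Lim_transform_eventually)
    qed
    moreover have "((\<lambda>h. flat p h / h) \<longlongrightarrow> 0) (at_left 0)"
      by (rule Lim_transform_eventually[OF tendsto_const], rule eventually_at_left_real[of "-1", THEN eventually_mono])
        (auto simp: flat_def)
    ultimately have "((\<lambda>h. flat p h / h) \<longlongrightarrow> 0) (at 0)"
      by (simp add: filterlim_at_split)
    then show ?thesis using 3 by (simp add: has_field_derivative_iff flat_def)
  qed
qed

lemma smooth1_flat: "smooth1 (flat p)"
  by (rule smooth1_coinduct[of "\<lambda>f. \<exists>p. f = flat p"]) (metis, metis flat_deriv)

text \<open>The function exp(-1/x), zero on the left half-line, increases to 1 at infinity. So
  \<open>kbump\<close> of n g(x) is a smooth approximation of the indicator of {g > 0} and needs no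
  normalisation.\<close>

definition kbump :: "real \<Rightarrow> real" where "kbump = flat 1"

lemma kbump_eq: "kbump x = (if x > 0 then exp (- 1/x) else 0)"
  by (simp add: kbump_def flat_def)

lemma smooth1_kbump: "smooth1 kbump" by (simp add: kbump_def smooth1_flat)

lemma kbump_bounds: "0 \<le> kbump x" "kbump x \<le> 1" by (auto simp: kbump_eq)

lemma kbump_limit: "(\<lambda>n. kbump (real n * x)) \<longlonglongrightarrow> (if x > 0 then 1 else 0)"
proof (cases "x > 0")
  case True
  have "(\<lambda>n. exp (- (1/x) * (1 / real n))) \<longlonglongrightarrow> exp (- (1/x) * 0)"
    by (intro tendsto_intros lim_1_over_n)
  moreover have "\<forall>\<^sub>F n in sequentially. exp (- (1/x) * (1 / real n)) = kbump (real n * x)"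
    by (rule eventually_sequentiallyI[of 1]) (use True in \<open>auto simp: kbump_eq field_simps\<close>)
  ultimately show ?thesis using True by (simp add: Lim_transform_eventually)
next
  case False
  then have "kbump (real n * x) = 0" for n
    by (simp add: kbump_eq not_less mult_nonneg_nonpos)
  then show ?thesis using False by simp
qed

section \<open>Test functions of product form\<close>

lemma smooth1_funpow_deriv: "smooth1 f \<Longrightarrow> smooth1 ((deriv ^^ n) f)"
  by (induction n) (auto intro: smooth1_deriv)

lemma pdt_separated:
  assumes "smooth1 eta" shows "pdt (\<lambda>t x. eta t * phi x) = (\<lambda>t x. deriv eta t * phi x)"
  unfolding pdt_def
  by (intro ext DERIV_imp_deriv DERIV_cmult_right smooth1_has_deriv assms)

lemma pdx_separated:
  assumes "smooth1 phi" shows "pdx (\<lambda>t x. eta t * phi x) = (\<lambda>t x. eta t * deriv phi x)"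
  unfolding pdx_def
  by (intro ext DERIV_imp_deriv DERIV_cmult smooth1_has_deriv assms)

text \<open>Every mixed partial derivative of eta(t) phi(x) is a product of iterated one-variable
  derivatives, so \<open>smooth2\<close> reduces to \<open>smooth1\<close>. Products are the only
  test functions inserted in the weak identities.\<close>

lemma test_fun_separated:
  assumes "smooth1 eta" "smooth1 phi" "periodic1 phi" "\<And>t. t \<ge> T \<Longrightarrow> eta t = 0"
  shows "test_fun (\<lambda>t x. eta t * phi x)"
proof -
  have ex: "\<exists>i j. iter_partial ds (\<lambda>t x. eta t * phi x) = (\<lambda>t x. (deriv ^^ i) eta t * (deriv ^^ j) phi x)" for ds
  proof (induction ds)
    case Nil
    show ?case by (rule exI[of _ 0], rule exI[of _ 0]) simp
  next
    case (Cons d ds)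
    then obtain i j where ij: "iter_partial ds (\<lambda>t x. eta t * phi x) = (\<lambda>t x. (deriv ^^ i) eta t * (deriv ^^ j) phi x)"
      by blast
    show ?case
    proof (cases d)
      case True
      show ?thesis
        by (rule exI[of _ "Suc i"], rule exI[of _ j])
          (simp add: True ij pdt_separated[OF smooth1_funpow_deriv[OF assms(1)]])
    next
      case False
      show ?thesis
        by (rule exI[of _ i], rule exI[of _ "Suc j"])
          (simp add: False ij pdx_separated[OF smooth1_funpow_deriv[OF assms(2)]])
    qed
  qed
  have cont: "continuous_on UNIV (\<lambda>(t, x). (deriv ^^ i) eta t * (deriv ^^ j) phi x)" for i j
    unfolding split_def
    by (intro continuous_intros continuous_on_compose2[OF smooth1_continuous[OF smooth1_funpow_deriv[OF assms(1)]], of UNIV]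
          continuous_on_compose2[OF smooth1_continuous[OF smooth1_funpow_deriv[OF assms(2)]], of UNIV]) auto
  have dt: "(\<lambda>s. (deriv ^^ i) eta s * (deriv ^^ j) phi x) differentiable (at t)"
    and dx: "(\<lambda>y. (deriv ^^ i) eta t * (deriv ^^ j) phi y) differentiable (at x)" for i j t x
    unfolding real_differentiable_def
    by (rule exI, rule DERIV_cmult_right, rule smooth1_has_deriv, rule smooth1_funpow_deriv, rule assms)
      (rule exI, rule DERIV_cmult, rule smooth1_has_deriv, rule smooth1_funpow_deriv, rule assms)
  have *: "continuous_on UNIV (\<lambda>(t, x). iter_partial ds (\<lambda>t x. eta t * phi x) t x) \<and>
      (\<forall>t x. (\<lambda>s. iter_partial ds (\<lambda>t x. eta t * phi x) s x) differentiable (at t) \<and>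
             (\<lambda>y. iter_partial ds (\<lambda>t x. eta t * phi x) t y) differentiable (at x))" for ds
  proof -
    obtain i j where "iter_partial ds (\<lambda>t x. eta t * phi x) = (\<lambda>t x. (deriv ^^ i) eta t * (deriv ^^ j) phi x)"
      using ex by blast
    then show ?thesis using cont dt dx by simp
  qed
  have "smooth2 (\<lambda>t x. eta t * phi x)"
    unfolding smooth2_def by (intro allI *)
  then show ?thesis
    using assms(3,4) unfolding test_fun_def periodic1_def
    by (intro conjI exI[of _ T]) auto
qed

subsection \<open>Locally integrable functions and oriented integrals\<close>

definition loc_int :: "(real \<Rightarrow> real) \<Rightarrow> bool" where
  "loc_int f \<longleftrightarrow> f \<in> borel_measurable borel \<and> (\<forall>a b. set_integrable lborel {a..b} f)"

text \<open>The orientation makes additivity hold for endpoints in any order, so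
  \<open>oint f a\<close> is a primitive on the whole line and increments need no case
  distinction.\<close>

definition oint :: "(real \<Rightarrow> real) \<Rightarrow> real \<Rightarrow> real \<Rightarrow> real" where
  "oint f a b = (LBINT x=a..b. f x)"

lemma loc_int_measurable [measurable_dest]: "loc_int f \<Longrightarrow> f \<in> borel_measurable borel"
  by (simp add: loc_int_def)

lemma loc_int_set: "loc_int f \<Longrightarrow> set_integrable lborel {a..b} f"
  by (simp add: loc_int_def)

lemma loc_int_add: "loc_int f \<Longrightarrow> loc_int g \<Longrightarrow> loc_int (\<lambda>x. f x + g x)"
  and loc_int_diff: "loc_int f \<Longrightarrow> loc_int g \<Longrightarrow> loc_int (\<lambda>x. f x - g x)"
  by (auto simp: loc_int_def)

lemma loc_int_cmult: "loc_int f \<Longrightarrow> loc_int (\<lambda>x. c * f x)"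
  by (auto simp: loc_int_def)

lemma loc_int_uminus: "loc_int f \<Longrightarrow> loc_int (\<lambda>x. - f x)"
  using loc_int_cmult[of f "-1"] by simp

lemma loc_int_abs: "loc_int f \<Longrightarrow> loc_int (\<lambda>x. \<bar>f x\<bar>)"
  by (auto simp: loc_int_def intro: set_integrable_abs)

lemma loc_int_dominated:
  assumes "loc_int g" "f \<in> borel_measurable borel" "\<And>x. \<bar>f x\<bar> \<le> g x"
  shows "loc_int f"
  unfolding loc_int_def
proof (intro conjI allI)
  fix a b
  show "set_integrable lborel {a..b} f"
  proof (rule set_integrable_bound[OF loc_int_set[OF assms(1)]])
    show "set_borel_measurable lborel {a..b} f"
      unfolding set_borel_measurable_def using assms(2) by measurable
    show "AE x in lborel. x \<in> {a..b} \<longrightarrow> norm (f x) \<le> norm (g x)"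
      using assms(3) by (auto intro: order_trans abs_ge_self)
  qed
qed fact

lemma loc_int_continuous: "continuous_on UNIV f \<Longrightarrow> loc_int f"
  unfolding loc_int_def
  by (auto intro: borel_measurable_continuous_onI borel_integrable_atLeastAtMost' continuous_on_subset)

lemma loc_int_const: "loc_int (\<lambda>x. c)"
  by (rule loc_int_continuous) auto

lemma loc_int_mult_continuous:
  assumes "loc_int f" and g: "continuous_on UNIV g"
  shows "loc_int (\<lambda>x. g x * f x)"
  unfolding loc_int_def
proof (intro conjI allI)
  have [measurable]: "f \<in> borel_measurable borel" "g \<in> borel_measurable borel"
    using assms by (auto simp: loc_int_def intro: borel_measurable_continuous_onI)
  show "(\<lambda>x. g x * f x) \<in> borel_measurable borel" by measurable
  fix a b :: real
  have "bounded (g ` {a..b})"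
    by (intro compact_imp_bounded compact_continuous_image continuous_on_subset[OF g]) auto
  then have "\<exists>B. \<forall>x\<in>{a..b}. \<bar>g x\<bar> \<le> B" by (simp add: bounded_iff)
  then obtain B where B: "\<And>x. x \<in> {a..b} \<Longrightarrow> \<bar>g x\<bar> \<le> B" by blast
  show "set_integrable lborel {a..b} (\<lambda>x. g x * f x)"
  proof (rule set_integrable_bound)
    show "set_integrable lborel {a..b} (\<lambda>x. B * f x)"
      using loc_int_set[OF assms(1)] by simp
    show "set_borel_measurable lborel {a..b} (\<lambda>x. g x * f x)"
      unfolding set_borel_measurable_def by measurable
    show "AE x in lborel. x \<in> {a..b} \<longrightarrow> norm (g x * f x) \<le> norm (B * f x)"
      using B by (auto simp: abs_mult intro!: mult_right_mono AE_I2 intro: order_trans[OF _ abs_ge_self])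
  qed
qed

lemma oint_Icc: "a \<le> b \<Longrightarrow> oint f a b = (LINT x:{a..b}|lborel. f x)"
  unfolding oint_def by (rule interval_integral_Icc) simp

lemma oint_swap: "oint f a b = - oint f b a"
  unfolding oint_def by (rule interval_integral_endpoints_reverse)

lemma oint_same [simp]: "oint f a a = 0"
  unfolding oint_def by simp

lemma loc_int_interval: "loc_int f \<Longrightarrow> interval_lebesgue_integrable lborel (ereal a) (ereal b) f"
  unfolding interval_lebesgue_integrable_def loc_int_def
  using set_integrable_subset[of lborel "{a..b}" f "{a<..<b}"] set_integrable_subset[of lborel "{b..a}" f "{b<..<a}"]
  by (auto simp: subset_eq)

lemma oint_combine: "loc_int f \<Longrightarrow> oint f a b + oint f b c = oint f a c"
  unfolding oint_def
  by (rule interval_integral_sum) (simp add: loc_int_interval flip: ereal_min ereal_max)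

lemma oint_diff_base: "loc_int f \<Longrightarrow> oint f a c - oint f a b = oint f b c"
  using oint_combine[of f a b c] by simp

lemma oint_add: "loc_int f \<Longrightarrow> loc_int g \<Longrightarrow> oint (\<lambda>x. f x + g x) a b = oint f a b + oint g a b"
  and oint_diff: "loc_int f \<Longrightarrow> loc_int g \<Longrightarrow> oint (\<lambda>x. f x - g x) a b = oint f a b - oint g a b"
  unfolding oint_def by (simp_all add: loc_int_interval)

lemma oint_cmult: "oint (\<lambda>x. c * f x) a b = c * oint f a b"
  unfolding oint_def by simp

lemma oint_uminus: "oint (\<lambda>x. - f x) a b = - oint f a b"
  using oint_cmult[of "-1" f] by simp

lemma oint_const [simp]: "oint (\<lambda>x. c) a b = c * (b - a)"
  unfolding oint_def by (simp add: algebra_simps)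

lemma oint_mono:
  assumes "a \<le> b" "loc_int f" "loc_int g" "\<And>x. a \<le> x \<Longrightarrow> x \<le> b \<Longrightarrow> f x \<le> g x"
  shows "oint f a b \<le> oint g a b"
  unfolding oint_Icc[OF assms(1)]
  by (rule set_integral_mono) (use assms in \<open>auto intro: loc_int_set\<close>)

lemma oint_mono_AE:
  assumes "a \<le> b" "loc_int f" "loc_int g" "AE x in lborel. a \<le> x \<longrightarrow> x \<le> b \<longrightarrow> f x \<le> g x"
  shows "oint f a b \<le> oint g a b"
  unfolding oint_Icc[OF assms(1)]
  by (rule set_integral_mono_AE) (use assms in \<open>auto intro: loc_int_set\<close>)

lemma oint_nonneg: "a \<le> b \<Longrightarrow> (\<And>x. a \<le> x \<Longrightarrow> x \<le> b \<Longrightarrow> 0 \<le> f x) \<Longrightarrow> 0 \<le> oint f a b"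
  by (auto simp: oint_Icc set_lebesgue_integral_def indicator_def intro!: integral_nonneg_AE)

lemma oint_abs_le:
  assumes "a \<le> b" "loc_int f" shows "\<bar>oint f a b\<bar> \<le> oint (\<lambda>x. \<bar>f x\<bar>) a b"
  using oint_mono[OF assms(1,2) loc_int_abs[OF assms(2)]]
    oint_mono[OF assms(1) loc_int_uminus[OF assms(2)] loc_int_abs[OF assms(2)]]
  by (auto simp: oint_uminus abs_le_iff)

lemma oint_bound:
  assumes "a \<le> b" "loc_int f" "\<And>x. a \<le> x \<Longrightarrow> x \<le> b \<Longrightarrow> \<bar>f x\<bar> \<le> B"
  shows "\<bar>oint f a b\<bar> \<le> B * (b - a)"
  using oint_abs_le[OF assms(1,2)] oint_mono[OF assms(1) loc_int_abs[OF assms(2)] loc_int_const[of B]] assms(3)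
  by auto

lemma oint_subset_le:
  assumes f: "loc_int f" and le: "a \<le> b" "b \<le> c" "c \<le> d" and nn: "\<And>x. 0 \<le> f x"
  shows "oint f b c \<le> oint f a d"
  using oint_combine[OF f, of a b c] oint_combine[OF f, of a c d]
    oint_nonneg[OF le(1), of f] oint_nonneg[OF le(3), of f] nn by simp

lemma oint_cong:
  assumes "\<And>x. min a b \<le> x \<Longrightarrow> x \<le> max a b \<Longrightarrow> f x = g x"
  shows "oint f a b = oint g a b"
  unfolding oint_def
  by (rule interval_integral_cong) (use assms in \<open>auto simp: einterval_iff min_def max_def split: if_splits\<close>)

lemma oint_cong_AE:
  assumes "f \<in> borel_measurable borel" "g \<in> borel_measurable borel" "AE x in lborel. f x = g x"
  shows "oint f a b = oint g a b"
proof -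
  have *: "oint f a b = oint g a b" if "a \<le> b" for a b
    unfolding oint_Icc[OF that] by (rule set_lebesgue_integral_cong_AE) (use assms in auto)
  show ?thesis
    using *[of a b] *[of b a] oint_swap[of f a b] oint_swap[of g a b] by linarith
qed

lemma oint_continuous: 
  assumes f: "loc_int f" shows "continuous_on UNIV (\<lambda>x. oint f a x)"
proof -
  have "isCont (\<lambda>x. oint f a x) x" for x
  proof -
    have "f integrable_on {x-1..x+1}"
      using set_borel_integral_eq_integral(1)[OF loc_int_set[OF f]] by auto
    then have "continuous_on {x-1..x+1} (\<lambda>y. integral {x-1..y} f)"
      by (rule indefinite_integral_continuous_1)
    then have "continuous_on {x-1..x+1} (\<lambda>y. oint f a (x-1) + integral {x-1..y} f)"
      by (intro continuous_intros)
    then have "continuous_on {x-1..x+1} (\<lambda>y. oint f a y)"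
    proof (rule continuous_on_eq)
      fix y assume "y \<in> {x-1..x+1}"
      then show "oint f a (x-1) + integral {x-1..y} f = oint f a y"
        using oint_combine[OF f, of a "x-1" y] set_borel_integral_eq_integral(2)[OF loc_int_set[OF f, of "x-1" y]]
        by (simp add: oint_Icc)
    qed
    then show ?thesis by (rule continuous_on_interior) simp
  qed
  then show ?thesis by (simp add: continuous_at_imp_continuous_on)
qed

lemma oint_FTC:
  assumes "continuous_on UNIV f"
  shows "((\<lambda>x. oint f a x) has_real_derivative f x) (at x)"
proof -
  let ?l = "min a x - 1" and ?r = "max a x + 1"
  have "((\<lambda>u. LBINT y=a..u. f y) has_vector_derivative (f x)) (at x within {?l..?r})"
    by (rule interval_integral_FTC2) (auto intro: continuous_on_subset[OF assms])
  then have "((\<lambda>u. oint f a u) has_vector_derivative (f x)) (at x)"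
    unfolding oint_def by (subst (asm) at_within_interior) auto
  then show ?thesis by (simp add: has_real_derivative_iff_has_vector_derivative)
qed

lemma oint_shift:
  assumes "f \<in> borel_measurable borel" shows "oint (\<lambda>x. f (x + c)) a b = oint f (a + c) (b + c)"
proof -
  have *: "oint (\<lambda>x. f (x + c)) a b = oint f (a + c) (b + c)" if "a \<le> b" for a b
  proof -
    have "oint f (a + c) (b + c) = (\<integral>x. indicator {a+c..b+c} x * f x \<partial>lborel)"
      using that by (simp add: oint_Icc set_lebesgue_integral_def)
    also have "\<dots> = (\<integral>x. indicator {a+c..b+c} (c + 1 * x) * f (c + 1 * x) \<partial>lborel)"
      using lborel_integral_real_affine[of 1 "\<lambda>x. indicator {a+c..b+c} x * f x" c] by simp
    also have "\<dots> = (\<integral>x. indicator {a..b} x * f (x + c) \<partial>lborel)"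
      by (intro Bochner_Integration.integral_cong) (auto simp: indicator_def add.commute)
    also have "\<dots> = oint (\<lambda>x. f (x + c)) a b"
      using that by (simp add: oint_Icc set_lebesgue_integral_def)
    finally show ?thesis by simp
  qed
  show ?thesis
  proof (cases "a \<le> b")
    case False
    then show ?thesis
      using *[of b a] oint_swap[of "\<lambda>x. f (x + c)" a b] oint_swap[of f "a+c" "b+c"] by simp
  qed (rule *)
qed

lemma oint_periodic:
  assumes f: "loc_int f" and per: "\<And>x. f (x + 1) = f x"
  shows "oint f a (a + 1) = oint f 0 1"
proof -
  have "oint f 1 (a + 1) = oint f 0 a"
    using oint_shift[of f 1 0 a] f by (simp add: per loc_int_def)
  then show ?thesis
    using oint_combine[OF f, of a 0 1] oint_combine[OF f, of a 1 "a+1"] oint_swap[of f a 0] by simp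
qed

text \<open>Translation by integers spreads integrability from one period to [0, n], and a shift by
  - n gives [- n, n].\<close>

lemma loc_int_periodicI:
  assumes m: "f \<in> borel_measurable borel" and "set_integrable lborel {0..1} f" and per: "\<And>x. f (x + 1) = f x"
  shows "loc_int f"
proof -
  have shift: "set_integrable lborel {a+c..b+c} f" if "set_integrable lborel {a..b} f" "\<And>x. f (x + c) = f x" for a b c
  proof -
    have "integrable lborel (\<lambda>x. indicator {a..b} x *\<^sub>R f x)" using that by (simp add: set_integrable_def)
    then have "integrable lborel (\<lambda>x. indicator {a..b} (- c + 1 * x) *\<^sub>R f (- c + 1 * x))"
      by (intro lborel_integrable_real_affine) auto
    moreover have "f (x - c) = f x" for x using that(2)[of "x - c"] by simp
    then have "(\<lambda>x. indicator {a..b} (- c + 1 * x) *\<^sub>R f (- c + 1 * x)) = (\<lambda>x. indicator {a+c..b+c} x *\<^sub>R f x)"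
      by (auto simp: indicator_def fun_eq_iff)
    ultimately show ?thesis by (simp add: set_integrable_def)
  qed
  have 1: "set_integrable lborel {0..real n} f" for n
  proof (induction n)
    case 0 then show ?case using set_integrable_subset[OF assms(2), of "{0..0}"] by auto
  next
    case (Suc n)
    have per': "f (x + real n) = f x" for x
    proof (induction n arbitrary: x)
      case (Suc n)
      have "f (x + real (Suc n)) = f (x + real n + 1)" by (simp add: algebra_simps)
      then show ?case using per Suc by simp
    qed simp
    have "set_integrable lborel {0+real n..1+real n} f"
      by (rule shift[OF assms(2) per'])
    then have "set_integrable lborel ({0..real n} \<union> {real n..1 + real n}) f"
      using Suc by (intro set_integrable_Un) auto
    moreover have "{0..real n} \<union> {real n..1 + real n} = {0..real (Suc n)}" by auto
    ultimately show ?case by simp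
  qed
  have 2: "set_integrable lborel {- real n..real n} f" for n
  proof -
    have per': "f (x + (- real n)) = f x" for x
    proof (induction n arbitrary: x)
      case (Suc n)
      have "f (x + (- real n)) = f (x + (- real (Suc n)) + 1)" by (simp add: algebra_simps)
      then show ?case using per[of "x + (- real (Suc n))"] Suc[of x] by metis
    qed simp
    have "set_integrable lborel {0 + - real n..real (2*n) + - real n} f"
      by (rule shift[OF 1 per'])
    then show ?thesis by simp
  qed
  show ?thesis
    unfolding loc_int_def
  proof (intro conjI allI m)
    fix a b :: real
    obtain n where "real n \<ge> max \<bar>a\<bar> \<bar>b\<bar>" using real_arch_simple by blast
    then show "set_integrable lborel {a..b} f"
      by (intro set_integrable_subset[OF 2[of n]]) auto
  qed
qed

section \<open>Integration over rectangles and integration by parts\<close>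

definition loc_int2 :: "(real \<Rightarrow> real \<Rightarrow> real) \<Rightarrow> bool" where
  "loc_int2 p \<longleftrightarrow> (\<lambda>(t, x). p t x) \<in> borel_measurable borel \<and>
     (\<forall>a b c d. set_integrable lborel ({a..b} \<times> {c..d}) (\<lambda>(t, x). p t x))"

lemma section_measurable:
  assumes "(\<lambda>(t, x). p t x) \<in> borel_measurable (borel :: (real \<times> real) measure)"
  shows "p t \<in> borel_measurable borel" "(\<lambda>t. p t x) \<in> borel_measurable borel"
proof -
  have [measurable]: "(\<lambda>(t, x). p t x) \<in> borel_measurable (borel \<Otimes>\<^sub>M borel)"
    using assms by (simp add: borel_prod)
  show "p t \<in> borel_measurable borel" "(\<lambda>t. p t x) \<in> borel_measurable borel"
    by measurable
qed

lemma oint_measurable: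
  assumes "(\<lambda>(t, x). p t x) \<in> borel_measurable (borel :: (real \<times> real) measure)"
  shows "(\<lambda>t. oint (p t) c d) \<in> borel_measurable borel"
proof -
  have [measurable]: "(\<lambda>(t, x). p t x) \<in> borel_measurable (borel \<Otimes>\<^sub>M borel)"
    using assms by (simp add: borel_prod)
  have *: "(\<lambda>t. oint (p t) c d) \<in> borel_measurable borel" if "c \<le> d" for c d
    unfolding oint_Icc[OF that] set_lebesgue_integral_def by measurable
  show ?thesis
    using *[of c d] *[of d c] by (subst oint_swap) (cases "c \<le> d", auto simp: oint_swap[of _ d c])
qed

text \<open>Tonelli: the absolute integrals of the slices over [c, d] are bounded uniformly in t,
  hence integrable in t over [a, b].\<close>

lemma loc_int2I:
  assumes m: "(\<lambda>(t, x). p t x) \<in> borel_measurable (borel :: (real \<times> real) measure)"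
    and l: "\<And>t. loc_int (p t)"
    and b: "\<And>t c d. c \<le> d \<Longrightarrow> oint (\<lambda>x. \<bar>p t x\<bar>) c d \<le> C c d"
  shows "loc_int2 p"
  unfolding loc_int2_def
proof (intro conjI allI m)
  fix a b c d :: real
  have [measurable]: "(\<lambda>(t, x). p t x) \<in> borel_measurable (borel \<Otimes>\<^sub>M borel)"
    using m by (simp add: borel_prod)
  show "set_integrable lborel ({a..b} \<times> {c..d}) (\<lambda>(t, x). p t x)"
  proof (cases "c \<le> d")
    case True
    have mm: "(\<lambda>t. oint (\<lambda>x. \<bar>p t x\<bar>) c d) \<in> borel_measurable borel"
      using m by (intro oint_measurable) (simp add: split_beta')
    have C: "loc_int (\<lambda>t. oint (\<lambda>x. \<bar>p t x\<bar>) c d)"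
      by (rule loc_int_dominated[OF loc_int_const[of "C c d"] mm])
        (use b[OF True] oint_nonneg[OF True] in auto)
    have "integrable (lborel \<Otimes>\<^sub>M lborel) (\<lambda>z. indicator ({a..b} \<times> {c..d}) z *\<^sub>R (case z of (t, x) \<Rightarrow> p t x))"
    proof (rule lborel_pair.Fubini_integrable)
      show "(\<lambda>z. indicator ({a..b} \<times> {c..d}) z *\<^sub>R (case z of (t, x) \<Rightarrow> p t x)) \<in> borel_measurable (lborel \<Otimes>\<^sub>M lborel)"
        by measurable
      have "(\<lambda>t. \<integral>x. norm (indicator ({a..b} \<times> {c..d}) (t, x) *\<^sub>R (case (t, x) of (t, x) \<Rightarrow> p t x)) \<partial>lborel)
        = (\<lambda>t. indicator {a..b} t *\<^sub>R oint (\<lambda>x. \<bar>p t x\<bar>) c d)"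
        by (simp add: oint_Icc[OF True] set_lebesgue_integral_def fun_eq_iff indicator_times abs_mult mult.assoc)
      then show "integrable lborel (\<lambda>t. \<integral>x. norm (indicator ({a..b} \<times> {c..d}) (t, x) *\<^sub>R (case (t, x) of (t, x) \<Rightarrow> p t x)) \<partial>lborel)"
        using loc_int_set[OF C, of a b] by (simp add: set_integrable_def)
      show "AE t in lborel. integrable lborel (\<lambda>x. indicator ({a..b} \<times> {c..d}) (t, x) *\<^sub>R (case (t, x) of (t, x) \<Rightarrow> p t x))"
        using loc_int_set[OF l] by (auto simp: set_integrable_def indicator_times mult.assoc)
    qed
    then show ?thesis by (simp add: set_integrable_def lborel_prod)
  qed (simp add: set_integrable_def)
qed

lemma loc_int2_integrable:
  assumes "loc_int2 p"
  shows "integrable (lborel \<Otimes>\<^sub>M lborel) (\<lambda>(t, x). indicator {a..b} t * (indicator {c..d} x * p t x))"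
  using assms unfolding loc_int2_def set_integrable_def lborel_prod
  by (auto simp: indicator_times split_beta' mult.assoc dest!: conjunct2 elim!: allE[of _ a])

lemma oint_loc_int:
  assumes "loc_int2 p"
  shows "loc_int (\<lambda>t. oint (p t) c d)"
proof -
  have *: "loc_int (\<lambda>t. oint (p t) c d)" if "c \<le> d" for c d
    unfolding loc_int_def
  proof (intro conjI allI)
    show "(\<lambda>t. oint (p t) c d) \<in> borel_measurable borel"
      using assms by (intro oint_measurable) (simp add: loc_int2_def)
    fix a b :: real
    show "set_integrable lborel {a..b} (\<lambda>t. oint (p t) c d)"
      using lborel_pair.integrable_fst[OF loc_int2_integrable[OF assms, of a b c d]]
      by (simp add: set_integrable_def oint_Icc[OF that] set_lebesgue_integral_def)
  qed
  show ?thesis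
  proof (cases "c \<le> d")
    case False
    then show ?thesis using loc_int_uminus[OF *[of d c]] by (subst oint_swap) simp
  qed (rule *)
qed

lemma oint_Fubini:
  assumes "loc_int2 p"
  shows "oint (\<lambda>t. oint (p t) c d) a b = oint (\<lambda>x. oint (\<lambda>t. p t x) a b) c d"
proof -
  have *: "oint (\<lambda>t. oint (p t) c d) a b = oint (\<lambda>x. oint (\<lambda>t. p t x) a b) c d" if "a \<le> b" "c \<le> d" for a b c d
  proof -
    have "(\<integral>x. \<integral>t. indicator {a..b} t * (indicator {c..d} x * p t x) \<partial>lborel \<partial>lborel)
        = (\<integral>x. indicator {c..d} x * (\<integral>t. indicator {a..b} t * p t x \<partial>lborel) \<partial>lborel)"
      by (simp add: mult.left_commute[of "indicator {a..b} _"])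
    then show ?thesis
      using lborel_pair.Fubini_integral[OF loc_int2_integrable[OF assms, of a b c d]]
      by (simp add: oint_Icc that set_lebesgue_integral_def)
  qed
  show ?thesis
    using *[of a b c d] *[of b a c d] *[of a b d c] *[of b a d c]
    by (cases "a \<le> b"; cases "c \<le> d")
      (simp_all add: oint_swap[of _ a b] oint_swap[of _ c d] oint_uminus not_le)
qed

lemma loc_int2_swap: 
  assumes "loc_int2 p" shows "loc_int2 (\<lambda>x t. p t x)"
  unfolding loc_int2_def
proof (intro conjI allI)
  have [measurable]: "(\<lambda>(t, x). p t x) \<in> borel_measurable (borel \<Otimes>\<^sub>M borel)"
    using assms by (simp add: borel_prod loc_int2_def)
  have "(\<lambda>(x, t). p t x) \<in> borel_measurable (borel \<Otimes>\<^sub>M borel)" by measurable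
  then show "(\<lambda>(x, t). p t x) \<in> borel_measurable borel" by (simp add: borel_prod)
  fix a b c d
  show "set_integrable lborel ({a..b} \<times> {c..d}) (\<lambda>(x, t). p t x)"
    using lborel_pair.integrable_product_swap[OF loc_int2_integrable[OF assms, of c d a b]]
    unfolding set_integrable_def lborel_prod[symmetric]
    by (simp add: split_beta' indicator_times mult.commute mult.left_commute)
qed

lemma loc_int2_add: "loc_int2 p \<Longrightarrow> loc_int2 q \<Longrightarrow> loc_int2 (\<lambda>t x. p t x + q t x)"
  and loc_int2_diff: "loc_int2 p \<Longrightarrow> loc_int2 q \<Longrightarrow> loc_int2 (\<lambda>t x. p t x - q t x)"
  unfolding loc_int2_def by (auto simp: split_beta')

lemma loc_int2_cmult: "loc_int2 p \<Longrightarrow> loc_int2 (\<lambda>t x. c * p t x)"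
  unfolding loc_int2_def by (auto simp: split_beta')

lemma loc_int2_dominated:
  assumes "loc_int2 q" "(\<lambda>(t, x). p t x) \<in> borel_measurable borel" "\<And>t x. \<bar>p t x\<bar> \<le> q t x"
  shows "loc_int2 p"
  unfolding loc_int2_def
proof (intro conjI allI)
  fix a b c d
  show "set_integrable lborel ({a..b} \<times> {c..d}) (\<lambda>(t, x). p t x)"
  proof (rule set_integrable_bound)
    show "set_integrable lborel ({a..b} \<times> {c..d}) (\<lambda>(t, x). q t x)"
      using assms(1) by (simp add: loc_int2_def)
    show "set_borel_measurable lborel ({a..b} \<times> {c..d}) (\<lambda>(t, x). p t x)"
      unfolding set_borel_measurable_def using assms(2)
      by (intro borel_measurable_scaleR borel_measurable_indicator) (auto simp flip: borel_prod)
    show "AE z in lborel. z \<in> {a..b} \<times> {c..d} \<longrightarrow> norm (case z of (t, x) \<Rightarrow> p t x) \<le> norm (case z of (t, x) \<Rightarrow> q t x)"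
      using assms(3) by (auto intro!: AE_I2 intro: order_trans[OF _ abs_ge_self])
  qed
qed fact

lemma loc_int2_product:
  assumes f: "loc_int f" and h: "loc_int h"
  shows "loc_int2 (\<lambda>x y. f x * h y)"
  unfolding loc_int2_def
proof (intro conjI allI)
  have [measurable]: "f \<in> borel_measurable borel" "h \<in> borel_measurable borel"
    using assms by (auto simp: loc_int_def)
  have "(\<lambda>(x, y). f x * h y) \<in> borel_measurable (borel \<Otimes>\<^sub>M borel)" by measurable
  then show "(\<lambda>(x, y). f x * h y) \<in> borel_measurable borel" by (simp add: borel_prod)
  fix a b c d
  have "integrable (lborel \<Otimes>\<^sub>M lborel) (\<lambda>z. (indicator {a..b} (fst z) * f (fst z)) * (indicator {c..d} (snd z) * h (snd z)))"
  proof (rule lborel_pair.Fubini_integrable)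
    have "integrable lborel (\<lambda>x. indicator {a..b} x * f x)" "integrable lborel (\<lambda>x. indicator {c..d} x * h x)"
      using loc_int_set[OF f, of a b] loc_int_set[OF h, of c d] by (auto simp: set_integrable_def)
    then show "integrable lborel (\<lambda>x. \<integral>y. norm (indicator {a..b} (fst (x, y)) * f (fst (x, y)) * (indicator {c..d} (snd (x, y)) * h (snd (x, y)))) \<partial>lborel)"
      "AE x in lborel. integrable lborel (\<lambda>y. indicator {a..b} (fst (x, y)) * f (fst (x, y)) * (indicator {c..d} (snd (x, y)) * h (snd (x, y))))"
      by (auto simp: norm_mult abs_mult dest: integrable_abs)
  qed measurable
  then show "set_integrable lborel ({a..b} \<times> {c..d}) (\<lambda>(x, y). f x * h y)"
    unfolding set_integrable_def lborel_prod
    by (simp add: split_beta' indicator_times mult_ac)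
qed

text \<open>F and H are merely primitives of locally integrable functions, so no pointwise product
  rule is at hand. The double integral of f(x) h(y) over the triangle a \<le> y \<le> x \<le> b,
  computed in both orders, replaces it.\<close>

lemma oint_by_parts:
  assumes f: "loc_int f" and h: "loc_int h"
    and F: "\<And>x. F x = F a + oint f a x" and H: "\<And>x. H x = H a + oint h a x"
  shows "oint (\<lambda>x. f x * H x + F x * h x) a b = F b * H b - F a * H a"
proof -
  have *: "oint (\<lambda>x. f x * oint h a x + oint f a x * h x) a b = oint f a b * oint h a b" if "a \<le> b" for a b
  proof -
    have [measurable]: "f \<in> borel_measurable borel" "h \<in> borel_measurable borel"
      using assms by (auto simp: loc_int_def)
    let ?p = "\<lambda>x y. f x * h y * indicator {..x} y"
    have fh: "loc_int2 (\<lambda>x y. \<bar>f x\<bar> * \<bar>h y\<bar>)" by (intro loc_int2_product loc_int_abs f h)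
    have "(\<lambda>(x, y). f x * h y * (if y \<le> x then 1 else 0)) \<in> borel_measurable (borel \<Otimes>\<^sub>M borel)"
      by measurable
    then have "(\<lambda>(x, y). ?p x y) \<in> borel_measurable borel"
      by (simp add: borel_prod indicator_def of_bool_def)
    then have p: "loc_int2 ?p"
      by (rule loc_int2_dominated[OF fh]) (auto simp: indicator_def abs_mult)
    have 1: "oint (?p x) a b = f x * oint h a x" if "x \<in> {a..b}" for x
    proof -
      have "oint (?p x) a b = (\<integral>y. f x * (indicator {a..x} y * h y) \<partial>lborel)"
        using that unfolding oint_Icc[OF \<open>a \<le> b\<close>] set_lebesgue_integral_def
        by (intro Bochner_Integration.integral_cong) (auto simp: indicator_def)
      then show ?thesis using that by (simp add: oint_Icc set_lebesgue_integral_def)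
    qed
    have 2: "oint (\<lambda>x. ?p x y) a b = h y * oint f y b" if "y \<in> {a..b}" for y
    proof -
      have "oint (\<lambda>x. ?p x y) a b = (\<integral>x. h y * (indicator {y..b} x * f x) \<partial>lborel)"
        using that unfolding oint_Icc[OF \<open>a \<le> b\<close>] set_lebesgue_integral_def
        by (intro Bochner_Integration.integral_cong) (auto simp: indicator_def)
      then show ?thesis using that by (simp add: oint_Icc set_lebesgue_integral_def)
    qed
    have c: "continuous_on UNIV (oint h a)" "continuous_on UNIV (oint f a)"
      using oint_continuous f h by auto
    have l1: "loc_int (\<lambda>x. f x * oint h a x)" 
      using loc_int_mult_continuous[OF f c(1)] by (simp add: mult.commute)
    have l2: "loc_int (\<lambda>x. oint f a x * h x)" by (intro loc_int_mult_continuous h c)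
    have "oint (\<lambda>x. f x * oint h a x) a b = oint (\<lambda>x. oint (?p x) a b) a b"
      using that 1 by (intro oint_cong) auto
    also have "\<dots> = oint (\<lambda>y. oint (\<lambda>x. ?p x y) a b) a b" by (rule oint_Fubini[OF p])
    also have "\<dots> = oint (\<lambda>y. oint f a b * h y - oint f a y * h y) a b"
    proof (rule oint_cong)
      fix y assume "min a b \<le> y" "y \<le> max a b"
      then have "oint (\<lambda>x. ?p x y) a b = h y * oint f y b" using that 2 by simp
      then show "oint (\<lambda>x. ?p x y) a b = oint f a b * h y - oint f a y * h y"
        using oint_combine[OF f, of a y b] by (simp add: algebra_simps flip: \<open>oint f a y + oint f y b = oint f a b\<close>)
    qed
    also have "\<dots> = oint f a b * oint h a b - oint (\<lambda>y. oint f a y * h y) a b"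
      by (subst oint_diff) (auto intro: loc_int_cmult h l2 simp: oint_cmult)
    finally show ?thesis using oint_add[OF l1 l2, of a b] by simp
  qed
  have c: "continuous_on UNIV (oint h c)" "continuous_on UNIV (oint f c)" for c
    using oint_continuous f h by auto
  have gen: "oint (\<lambda>x. f x * H x + F x * h x) c d = F d * H d - F c * H c" if "c \<le> d" for c d
  proof -
    have F': "F x = F c + oint f c x" for x using F[of x] F[of c] oint_combine[OF f, of a c x] by simp
    have H': "H x = H c + oint h c x" for x using H[of x] H[of c] oint_combine[OF h, of a c x] by simp
    have l1: "loc_int (\<lambda>x. f x * oint h c x)" 
      using loc_int_mult_continuous[OF f c(1)] by (simp add: mult.commute)
    have l2: "loc_int (\<lambda>x. oint f c x * h x)" by (intro loc_int_mult_continuous h c)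
    have "oint (\<lambda>x. f x * H x + F x * h x) c d
        = oint (\<lambda>x. (H c * f x + F c * h x) + (f x * oint h c x + oint f c x * h x)) c d"
    proof (rule oint_cong)
      fix x
      show "f x * H x + F x * h x = (H c * f x + F c * h x) + (f x * oint h c x + oint f c x * h x)"
        unfolding F'[of x] H'[of x] by (simp add: algebra_simps)
    qed
    also have "\<dots> = H c * oint f c d + F c * oint h c d + oint f c d * oint h c d"
      by (subst oint_add) (auto intro!: loc_int_add loc_int_cmult f h l1 l2 simp: oint_add oint_cmult loc_int_cmult f h *[OF that])
    also have "\<dots> = F d * H d - F c * H c"
      using F'[of d] H'[of d] by (simp add: algebra_simps)
    finally show ?thesis .
  qed
  show ?thesis
    using gen[of a b] gen[of b a] oint_swap[of "\<lambda>x. f x * H x + F x * h x" a b] by linarith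
qed

subsection \<open>Energy coordinates at a fixed time\<close>

text \<open>One time slice. The number e is the value of the potential at x = 0; the slice
  determines E only up to this constant, which carries part of the time evolution.\<close>

locale profile =
  fixes u ux :: "real \<Rightarrow> real" and e h M :: real
  assumes w_loc: "loc_int (\<lambda>x. (ux x)\<^sup>2)"
    and ux_meas: "ux \<in> borel_measurable borel"
    and u_oint: "u y - u x = oint ux x y"
    and u_per: "u (x + 1) = u x" and ux_per: "ux (x + 1) = ux x"
    and h_eq: "oint (\<lambda>x. (ux x)\<^sup>2) 0 1 = h"
    and u_bound: "\<bar>u x\<bar> \<le> M"
begin

definition w :: "real \<Rightarrow> real" where "w x = (ux x)\<^sup>2"
definition E :: "real \<Rightarrow> real" where "E x = e + x + oint w 0 x"
definition X :: "real \<Rightarrow> real" where "X = inv E"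
definition m :: real where "m = oint (\<lambda>x. u x * (1 - w x)) 0 1"
definition P :: "real \<Rightarrow> real" where "P x = oint (\<lambda>y. u y * (1 - w y) - m) 0 x"
definition G :: "real \<Rightarrow> real" where "G x = P x - 1 / (1 - h) * oint (\<lambda>y. (1 - w y) * P y) 0 1"

lemma w_nonneg: "0 \<le> w x" by (simp add: w_def)
lemma w_li: "loc_int w" using w_loc by (simp add: w_def[abs_def])
lemma w_per: "w (x + 1) = w x" by (simp add: w_def ux_per)
lemma ux_le: "2 * \<bar>ux x\<bar> \<le> 1 + w x"
  using zero_le_power2[of "\<bar>ux x\<bar> - 1"] by (simp add: w_def power2_eq_square algebra_simps)

lemma q_li: "loc_int (\<lambda>x. 1 + w x)" by (intro loc_int_add loc_int_const w_li)

lemma ux_li: "loc_int ux"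
proof (rule loc_int_dominated[OF q_li ux_meas])
  show "\<bar>ux x\<bar> \<le> 1 + w x" for x using ux_le[of x] by simp
qed

lemma h_nonneg: "0 \<le> h"
  using oint_nonneg[of 0 1 "\<lambda>x. (ux x)\<^sup>2"] h_eq by simp

lemma M_nonneg: "0 \<le> M" using u_bound[of 0] by simp

lemma w_period: "oint w a (a + 1) = h"
  using oint_periodic[OF w_li w_per] h_eq by (simp add: w_def[abs_def])

lemma E_diff: "E y - E x = oint (\<lambda>x. 1 + w x) x y"
  unfolding E_def oint_add[OF loc_int_const w_li] using oint_combine[OF w_li, of 0 x y] by simp

lemma E_ge: "x \<le> y \<Longrightarrow> y - x \<le> E y - E x"
  unfolding E_diff oint_add[OF loc_int_const w_li] using oint_nonneg[of x y w] w_nonneg by simp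

lemma E_mono: "x \<le> y \<Longrightarrow> E x \<le> E y" using E_ge[of x y] by simp

lemma E_le_iff: "E x \<le> E y \<longleftrightarrow> x \<le> y"
  using E_ge[of x y] E_ge[of y x] by (cases "x \<le> y") auto

text \<open>E has density q \<ge> 1 and so expands distances. Hence its inverse is 1-Lipschitz, and
  an error in the energy level bounds the error in position.\<close>

lemma E_abs_ge: "\<bar>x - y\<bar> \<le> \<bar>E x - E y\<bar>"
  using E_ge[of x y] E_ge[of y x] by (cases "x \<le> y") auto

lemma E_per: "E (x + 1) = E x + (1 + h)"
  using E_diff[of "x+1" x] by (simp add: oint_add[OF loc_int_const w_li] w_period)

lemma E_cont: "continuous_on A E"
proof -
  have "continuous_on UNIV E"
    unfolding E_def[abs_def] by (intro continuous_intros oint_continuous w_li)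
  then show ?thesis by (rule continuous_on_subset) simp
qed

lemma inj_E: "inj E" by (rule injI) (use E_le_iff in \<open>metis order_antisym order_refl\<close>)

lemma surj_E: "surj E"
proof -
  have "\<exists>x. E x = b" for b
  proof -
    let ?d = "\<bar>b - E 0\<bar>"
    have "E (- ?d) \<le> b" "b \<le> E ?d" using E_ge[of "- ?d" 0] E_ge[of 0 ?d] by auto
    then show ?thesis
      using IVT'[of E "- ?d" b ?d] E_cont by auto
  qed
  then show ?thesis by (metis surjI)
qed

lemma E_X [simp]: "E (X b) = b" unfolding X_def by (rule surj_f_inv_f[OF surj_E])
lemma X_E [simp]: "X (E x) = x" unfolding X_def by (rule inv_f_f[OF inj_E])

lemma X_lip: "\<bar>X a - X b\<bar> \<le> \<bar>a - b\<bar>" using E_abs_ge[of "X a" "X b"] by simp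
lemma X_mono: "a \<le> b \<Longrightarrow> X a \<le> X b" using E_le_iff[of "X a" "X b"] by simp
lemma X_per: "X (b + (1 + h)) = X b + 1"
  using E_per[of "X b"] X_E[of "X b + 1"] by simp

lemma oint_q_X: "oint (\<lambda>x. 1 + w x) (X a) (X b) = b - a"
  using E_diff[of "X b" "X a"] by simp

text \<open>Since 1 - w = 2 - q, the measure (1 - w) dx becomes 2 dX - d\<beta> in energy
  coordinates; no derivative of u enters any longer.\<close>

lemma oint_1w_X: "oint (\<lambda>x. 1 - w x) (X a) (X b) = 2 * (X b - X a) - (b - a)"
  using oint_q_X[of a b] by (simp add: oint_add oint_diff loc_int_const w_li)

lemma u_lip: "\<bar>u x - u y\<bar> \<le> 1/2 * \<bar>E x - E y\<bar>"
proof -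
  have *: "\<bar>u y - u x\<bar> \<le> 1/2 * \<bar>E y - E x\<bar>" if "x \<le> y" for x y
  proof -
    have "\<bar>u y - u x\<bar> \<le> oint (\<lambda>x. \<bar>ux x\<bar>) x y" unfolding u_oint using oint_abs_le[OF that ux_li] .
    also have "\<dots> \<le> oint (\<lambda>x. 1/2 * (1 + w x)) x y"
    proof (intro oint_mono that loc_int_abs loc_int_cmult q_li ux_li)
      show "\<bar>ux x\<bar> \<le> 1/2 * (1 + w x)" for x using ux_le[of x] by simp
    qed
    also have "\<dots> = 1/2 * (E y - E x)" unfolding oint_cmult E_diff ..
    finally show ?thesis using E_mono[OF that] by simp
  qed
  show ?thesis using *[of x y] *[of y x] by (cases "x \<le> y") (auto simp: abs_minus_commute)
qed

lemma u_cont: "continuous_on UNIV u"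
proof -
  have "continuous_on UNIV (\<lambda>x. u 0 + oint ux 0 x)"
    by (intro continuous_intros oint_continuous ux_li)
  then show ?thesis by (simp flip: u_oint)
qed

definition U :: "real \<Rightarrow> real" where "U b = u (X b)"

lemma U_lip: "\<bar>U a - U b\<bar> \<le> 1/2 * \<bar>a - b\<bar>" using u_lip[of "X a" "X b"] by (simp add: U_def)
lemma U_E: "U (E x) = u x" by (simp add: U_def)

lemma w1_li: "loc_int (\<lambda>x. 1 - w x)" by (intro loc_int_diff loc_int_const w_li)

lemma uw_li: "loc_int (\<lambda>x. u x * (1 - w x))"
  by (rule loc_int_mult_continuous[OF w1_li u_cont])

lemma uw_per: "u (x + 1) * (1 - w (x + 1)) = u x * (1 - w x)" by (simp add: u_per w_per)

lemma m_period: "oint (\<lambda>x. u x * (1 - w x)) a (a + 1) = m"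
  unfolding m_def by (rule oint_periodic[OF uw_li uw_per])

lemma w1_le: "\<bar>1 - w x\<bar> \<le> 1 + w x" using w_nonneg[of x] by simp

lemma m_bound: "\<bar>m\<bar> \<le> M * (1 + h)"
proof -
  have "\<bar>m\<bar> \<le> oint (\<lambda>x. \<bar>u x * (1 - w x)\<bar>) 0 1"
    unfolding m_def by (rule oint_abs_le[OF _ uw_li]) simp
  also have "\<dots> \<le> oint (\<lambda>x. M * (1 + w x)) 0 1"
    by (intro oint_mono loc_int_abs loc_int_cmult q_li uw_li)
      (auto simp: abs_mult intro!: mult_mono u_bound w1_le M_nonneg)
  also have "\<dots> = M * (1 + h)" using w_period[of 0] by (simp add: oint_cmult oint_add loc_int_const w_li)
  finally show ?thesis .
qed

text \<open>Lipschitz constant of the primitive P with respect to E: |u (1 - w)| \<le> M q and |m|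
  \<le> M (1 + h) \<le> M (1 + h) q.\<close>

definition K2 :: real where "K2 = M * (2 + h)"

lemma K2_nonneg: "0 \<le> K2" using M_nonneg h_nonneg by (simp add: K2_def)

lemma P_li: "loc_int (\<lambda>x. u x * (1 - w x) - m)" by (intro loc_int_diff loc_int_const uw_li)

lemma P_diff: "P y - P x = oint (\<lambda>x. u x * (1 - w x) - m) x y"
  unfolding P_def by (rule oint_diff_base[OF P_li])

lemma P_lip: "\<bar>P x - P y\<bar> \<le> K2 * \<bar>E x - E y\<bar>"
proof -
  have *: "\<bar>P y - P x\<bar> \<le> K2 * \<bar>E y - E x\<bar>" if "x \<le> y" for x y
  proof -
    have "\<bar>P y - P x\<bar> \<le> oint (\<lambda>x. \<bar>u x * (1 - w x) - m\<bar>) x y" unfolding P_diff using oint_abs_le[OF that P_li] .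
    also have "\<dots> \<le> oint (\<lambda>x. K2 * (1 + w x)) x y"
    proof (intro oint_mono that loc_int_abs loc_int_cmult q_li P_li)
      fix x
      have "\<bar>u x * (1 - w x)\<bar> \<le> M * (1 + w x)"
        by (auto simp: abs_mult intro!: mult_mono u_bound w1_le M_nonneg)
      moreover have "M * (1 + h) * 1 \<le> M * (1 + h) * (1 + w x)"
        by (intro mult_left_mono) (auto simp: M_nonneg h_nonneg w_nonneg)
      moreover have "\<bar>m\<bar> \<le> M * (1 + h)" by (rule m_bound)
      moreover have "K2 * (1 + w x) = M * (1 + w x) + M * (1 + h) * (1 + w x)"
        by (simp add: K2_def algebra_simps)
      ultimately show "\<bar>u x * (1 - w x) - m\<bar> \<le> K2 * (1 + w x)" by (smt (verit))
    qed
    also have "\<dots> = K2 * (E y - E x)" unfolding oint_cmult E_diff ..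
    finally show ?thesis using that E_mono[OF that] by simp
  qed
  show ?thesis using *[of x y] *[of y x] by (cases "x \<le> y") (auto simp: abs_minus_commute)
qed

lemma P_per: "P (x + 1) = P x"
  using P_diff[of "x+1" x] by (simp add: oint_diff uw_li loc_int_const m_period)

lemma P_cont: "continuous_on UNIV P"
  unfolding P_def[abs_def] by (rule oint_continuous[OF P_li])

lemma P1w_li: "loc_int (\<lambda>y. (1 - w y) * P y)"
  using loc_int_mult_continuous[OF w1_li P_cont] by (simp add: mult.commute)

lemma G_diff: "G x - G y = P x - P y" by (simp add: G_def)

lemma G_lip: "\<bar>G x - G y\<bar> \<le> K2 * \<bar>E x - E y\<bar>" unfolding G_diff by (rule P_lip)

text \<open>The primitive P based at the energy level b. The point x = 0 lies at a level that
  depends on the solution, whereas one and the same level b can be used for two solutions.\<close>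

definition pr :: "real \<Rightarrow> real \<Rightarrow> real" where "pr b c = P (X c) - P (X b)"

lemma pr_lip: "\<bar>pr b c - pr b d\<bar> \<le> K2 * \<bar>c - d\<bar>"
  using P_lip[of "X c" "X d"] by (simp add: pr_def)

lemma pr_bound: "b \<le> c \<Longrightarrow> c \<le> b + (1 + h) \<Longrightarrow> \<bar>pr b c\<bar> \<le> K2 * (1 + h)"
  using P_lip[of "X c" "X b"] mult_left_mono[of "c - b" "1 + h" K2] K2_nonneg by (simp add: pr_def)

text \<open>The normalisation of \<^term>\<open>G\<close> makes it independent of the base point of the primitive \<^term>\<open>P\<close>.\<close>
lemma G_X:
  assumes "h \<noteq> 1"
  shows "(1 - h) * G (X b) = - oint (\<lambda>x. pr b (E x) * (1 - w x)) (X b) (X (b + (1 + h)))"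
proof -
  have "oint (\<lambda>x. pr b (E x) * (1 - w x)) (X b) (X (b + (1 + h)))
      = oint (\<lambda>x. (1 - w x) * P x - P (X b) * (1 - w x)) (X b) (X b + 1)"
    unfolding X_per by (rule oint_cong) (simp add: pr_def algebra_simps)
  \<comment> \<open>The integral of 1 - w over a period is 1 - h, so a constant added to P is
    reproduced by the normalised mean and cancels in G.\<close>
  also have "\<dots> = oint (\<lambda>x. (1 - w x) * P x) (X b) (X b + 1) - P (X b) * (1 - h)"
    by (simp add: oint_diff P1w_li loc_int_cmult w1_li oint_cmult w_li loc_int_const w_period)
  also have "oint (\<lambda>x. (1 - w x) * P x) (X b) (X b + 1) = oint (\<lambda>x. (1 - w x) * P x) 0 1"
    by (rule oint_periodic[OF P1w_li]) (simp add: w_per P_per)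
  finally have "oint (\<lambda>x. pr b (E x) * (1 - w x)) (X b) (X (b + (1 + h)))
    = oint (\<lambda>x. (1 - w x) * P x) 0 1 - P (X b) * (1 - h)" .
  moreover have "(1 - h) * G (X b) = (1 - h) * P (X b) - oint (\<lambda>x. (1 - w x) * P x) 0 1"
    using assms by (simp add: G_def right_diff_distrib)
  ultimately show ?thesis by (simp only: mult.commute)
qed

text \<open>The integral is the Stieltjes integral of V against 2 dX - d\<beta>. Its sums involve X
  only at grid levels, so two solutions can be compared on one grid. On a cell of length d, V varies
  by at most K d and the mass of q is d; the n cells together cost n K d^2.\<close>

lemma riemann_sum:
  assumes le: "b \<le> b'" and n: "n > 0" and K: "\<And>c d. \<bar>V c - V d\<bar> \<le> K * \<bar>c - d\<bar>"
  defines "\<And>i::nat. \<beta> i \<equiv> b + real i * ((b' - b) / real n)"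
  shows "\<bar>oint (\<lambda>x. V (E x) * (1 - w x)) (X b) (X b')
     - (\<Sum>i<n. V (\<beta> i) * (2 * (X (\<beta> (Suc i)) - X (\<beta> i)) - (b' - b) / real n))\<bar> \<le> K * (b' - b)\<^sup>2 / real n"
proof -
  define d where "d = (b' - b) / real n"
  have d: "d \<ge> 0" "real n * d = b' - b" using le n by (auto simp: d_def)
  have bs: "\<beta> (Suc i) = \<beta> i + d" for i by (simp add: \<beta>_def d_def[symmetric] algebra_simps)
  have b0: "\<beta> 0 = b" and bn: "\<beta> n = b'" using n by (auto simp: \<beta>_def)
  have K0: "K \<ge> 0" using K[of 1 0] by simp
  have Vc: "continuous_on UNIV (\<lambda>x. V (E x))"
  proof (rule continuous_on_compose2[of UNIV V UNIV E])
    show "continuous_on UNIV V"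
    proof (rule continuous_onI)
      fix x e :: real assume "e > 0"
      have "K * \<bar>x' - x\<bar> \<le> (K + 1) * \<bar>x' - x\<bar>" for x' by (simp add: algebra_simps)
      then have "dist x' x < e / (K + 1) \<Longrightarrow> dist (V x') (V x) \<le> e" for x'
        using K[of x' x] K0 by (simp add: dist_real_def pos_less_divide_eq mult.commute) (smt (verit))
      then show "\<exists>d>0. \<forall>x'\<in>UNIV. dist x' x < d \<longrightarrow> dist (V x') (V x) \<le> e"
        using \<open>e > 0\<close> K0 by (intro exI[of _ "e / (K + 1)"]) auto
    qed
  qed (auto intro: E_cont)
  have li: "loc_int (\<lambda>x. V (E x) * (1 - w x))" by (rule loc_int_mult_continuous[OF w1_li Vc])
  have piece: "\<bar>oint (\<lambda>x. V (E x) * (1 - w x)) (X (\<beta> i)) (X (\<beta> (Suc i)))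
      - V (\<beta> i) * (2 * (X (\<beta> (Suc i)) - X (\<beta> i)) - d)\<bar> \<le> K * d * d" for i
  proof -
    have X: "X (\<beta> i) \<le> X (\<beta> (Suc i))" by (rule X_mono) (simp add: bs d)
    have l2: "loc_int (\<lambda>x. (V (E x) - V (\<beta> i)) * (1 - w x))"
      by (intro loc_int_mult_continuous[OF w1_li] continuous_intros Vc)
    have "oint (\<lambda>x. V (E x) * (1 - w x)) (X (\<beta> i)) (X (\<beta> (Suc i)))
      - V (\<beta> i) * (2 * (X (\<beta> (Suc i)) - X (\<beta> i)) - d)
      = oint (\<lambda>x. V (E x) * (1 - w x)) (X (\<beta> i)) (X (\<beta> (Suc i))) - oint (\<lambda>x. V (\<beta> i) * (1 - w x)) (X (\<beta> i)) (X (\<beta> (Suc i)))"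
      unfolding oint_cmult oint_1w_X by (simp add: bs)
    also have "\<dots> = oint (\<lambda>x. (V (E x) - V (\<beta> i)) * (1 - w x)) (X (\<beta> i)) (X (\<beta> (Suc i)))"
      by (subst oint_diff[symmetric, OF li loc_int_cmult[OF w1_li]]) (simp only: left_diff_distrib)
    finally have "\<bar>oint (\<lambda>x. V (E x) * (1 - w x)) (X (\<beta> i)) (X (\<beta> (Suc i)))
      - V (\<beta> i) * (2 * (X (\<beta> (Suc i)) - X (\<beta> i)) - d)\<bar>
      \<le> oint (\<lambda>x. \<bar>(V (E x) - V (\<beta> i)) * (1 - w x)\<bar>) (X (\<beta> i)) (X (\<beta> (Suc i)))"
      using oint_abs_le[OF X l2] by simp
    also have "\<dots> \<le> oint (\<lambda>x. (K * d) * (1 + w x)) (X (\<beta> i)) (X (\<beta> (Suc i)))"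
    proof (intro oint_mono X loc_int_abs l2 loc_int_cmult q_li)
      fix x assume "X (\<beta> i) \<le> x" "x \<le> X (\<beta> (Suc i))"
      then have "\<beta> i \<le> E x" "E x \<le> \<beta> i + d" using E_mono[of "X (\<beta> i)" x] E_mono[of x "X (\<beta> (Suc i))"] by (auto simp: bs)
      then have "K * \<bar>E x - \<beta> i\<bar> \<le> K * d" using K0 by (intro mult_left_mono) auto
      then have "\<bar>V (E x) - V (\<beta> i)\<bar> \<le> K * d" using K[of "E x" "\<beta> i"] by linarith
      then show "\<bar>(V (E x) - V (\<beta> i)) * (1 - w x)\<bar> \<le> K * d * (1 + w x)"
        unfolding abs_mult by (intro mult_mono w1_le) (use K0 d in auto)
    qed
    also have "\<dots> = K * d * d" unfolding oint_cmult oint_q_X by (simp add: bs)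
    finally show ?thesis .
  qed
  have tel: "oint (\<lambda>x. V (E x) * (1 - w x)) (X (\<beta> 0)) (X (\<beta> k))
      = (\<Sum>i<k. oint (\<lambda>x. V (E x) * (1 - w x)) (X (\<beta> i)) (X (\<beta> (Suc i))))" for k
  proof (induction k)
    case (Suc k)
    show ?case
      unfolding sum.lessThan_Suc Suc.IH[symmetric] by (rule oint_combine[OF li, symmetric])
  qed simp
  have "\<bar>oint (\<lambda>x. V (E x) * (1 - w x)) (X b) (X b')
     - (\<Sum>i<n. V (\<beta> i) * (2 * (X (\<beta> (Suc i)) - X (\<beta> i)) - d))\<bar> \<le> (\<Sum>i<n. K * d * d)"
    using tel[of n] unfolding b0 bn
    by (simp only: sum_subtractf[symmetric]) (intro order_trans[OF sum_abs] sum_mono piece)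
  also have "\<dots> = K * (b' - b)\<^sup>2 / real n"
    using n by (simp add: d_def power2_eq_square field_simps)
  finally show ?thesis by (simp add: d_def)
qed

text \<open>\<open>G_X\<close> is used at the level of x itself: over one period |pr| \<le> K2 (1 +
  h), and q has mass 1 + h.\<close>

lemma G_bound:
  assumes "h \<noteq> 1"
  shows "\<bar>G x\<bar> \<le> K2 * (1 + h)\<^sup>2 / \<bar>1 - h\<bar>"
proof -
  let ?b = "E x"
  have X: "X ?b \<le> X (?b + (1 + h))" using h_nonneg by (intro X_mono) auto
  have c: "continuous_on UNIV (\<lambda>x. pr ?b (E x))" unfolding pr_def X_E by (intro continuous_intros P_cont)
  have l: "loc_int (\<lambda>x. pr ?b (E x) * (1 - w x))" by (rule loc_int_mult_continuous[OF w1_li c])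
  have "\<bar>oint (\<lambda>x. pr ?b (E x) * (1 - w x)) (X ?b) (X (?b + (1 + h)))\<bar>
      \<le> oint (\<lambda>x. \<bar>pr ?b (E x) * (1 - w x)\<bar>) (X ?b) (X (?b + (1 + h)))"
    by (rule oint_abs_le[OF X l])
  also have "\<dots> \<le> oint (\<lambda>x. (K2 * (1 + h)) * (1 + w x)) (X ?b) (X (?b + (1 + h)))"
  proof (intro oint_mono X loc_int_abs l loc_int_cmult q_li)
    fix y assume "X ?b \<le> y" "y \<le> X (?b + (1 + h))"
    then have "\<bar>pr ?b (E y)\<bar> \<le> K2 * (1 + h)"
      using E_mono[of "X ?b" y] E_mono[of y "X (?b + (1 + h))"] by (intro pr_bound) auto
    then show "\<bar>pr ?b (E y) * (1 - w y)\<bar> \<le> K2 * (1 + h) * (1 + w y)"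
      unfolding abs_mult by (intro mult_mono w1_le) (use K2_nonneg h_nonneg in auto)
  qed
  also have "\<dots> = K2 * (1 + h)\<^sup>2" unfolding oint_cmult oint_q_X by (simp add: power2_eq_square)
  finally have "\<bar>1 - h\<bar> * \<bar>G x\<bar> \<le> K2 * (1 + h)\<^sup>2"
    using G_X[OF assms, of ?b] by (simp flip: abs_mult)
  then show ?thesis using assms by (simp add: field_simps)
qed

end

text \<open>Summation by parts. Only the size of D is small, its increments have no bounded total
  variation of that order, so the difference is moved to V.\<close>

lemma abel_bound:
  fixes V D :: "nat \<Rightarrow> real"
  assumes D: "\<And>i. i \<le> n \<Longrightarrow> \<bar>D i\<bar> \<le> \<mu>" and V: "\<And>i. i < n \<Longrightarrow> \<bar>V (Suc i) - V i\<bar> \<le> k"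
    and B: "\<bar>V 0\<bar> \<le> B" "\<bar>V n\<bar> \<le> B"
  shows "\<bar>\<Sum>i<n. V i * (D (Suc i) - D i)\<bar> \<le> (2 * B + real n * k) * \<mu>"
proof -
  have mu: "\<mu> \<ge> 0" using D[of 0] by simp
  have eq: "(\<Sum>i<k. V i * (D (Suc i) - D i)) = V k * D k - V 0 * D 0 - (\<Sum>i<k. (V (Suc i) - V i) * D (Suc i))" for k
    by (induction k) (auto simp: algebra_simps)
  have "\<bar>\<Sum>i<n. (V (Suc i) - V i) * D (Suc i)\<bar> \<le> (\<Sum>i<n. k * \<mu>)"
    by (rule order_trans[OF sum_abs], rule sum_mono)
      (auto simp: abs_mult intro!: mult_mono V D order_trans[OF abs_ge_zero V])
  moreover have "\<bar>V n * D n\<bar> \<le> B * \<mu>" "\<bar>V 0 * D 0\<bar> \<le> B * \<mu>"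
    using B D[of n] D[of 0] mu by (auto simp: abs_mult intro!: mult_mono order_trans[OF abs_ge_zero B(1)])
  ultimately show ?thesis unfolding eq by (simp add: algebra_simps)
qed

section \<open>Lipschitz dependence of the mean and the forcing on X and U\<close>

locale two_profiles = p1: profile u1 ux1 e1 h M + p2: profile u2 ux2 e2 h M
  for u1 ux1 e1 u2 ux2 e2 h M
begin

text \<open>On a common grid the difference of the two sums consists of V1 - V2 against 2 dX1 -
  d\<beta>, of variation at most b' - b, and of twice V2 against d(X1 - X2). The latter is treated
  by \<open>abel_bound\<close>, where V2 has variation at most K (b' - b). Refining the grid removes
  the Riemann errors.\<close>

lemma stieltjes_compare:
  assumes le: "b \<le> b'"
    and V1: "\<And>c d. \<bar>V1 c - V1 d\<bar> \<le> K * \<bar>c - d\<bar>" and V2: "\<And>c d. \<bar>V2 c - V2 d\<bar> \<le> K * \<bar>c - d\<bar>"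
    and B: "\<And>c. b \<le> c \<Longrightarrow> c \<le> b' \<Longrightarrow> \<bar>V2 c\<bar> \<le> B"
    and V: "\<And>c. b \<le> c \<Longrightarrow> c \<le> b' \<Longrightarrow> \<bar>V1 c - V2 c\<bar> \<le> \<nu>"
    and X: "\<And>c. b \<le> c \<Longrightarrow> c \<le> b' \<Longrightarrow> \<bar>p1.X c - p2.X c\<bar> \<le> \<mu>"
  shows "\<bar>oint (\<lambda>x. V1 (p1.E x) * (1 - p1.w x)) (p1.X b) (p1.X b')
        - oint (\<lambda>x. V2 (p2.E x) * (1 - p2.w x)) (p2.X b) (p2.X b')\<bar>
      \<le> \<nu> * (b' - b) + (4 * B + 2 * K * (b' - b)) * \<mu>" (is "\<bar>?I1 - ?I2\<bar> \<le> ?R")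
proof (rule field_le_epsilon)
  fix e :: real assume "e > 0"
  have K0: "K \<ge> 0" using V1[of 1 0] by simp
  obtain n :: nat where n0: "n > 0" and n: "2 * K * (b' - b)\<^sup>2 / e \<le> real n"
    using reals_Archimedean2[of "max 0 (2 * K * (b' - b)\<^sup>2 / e)"] by (auto intro: less_imp_le)
  then have small: "2 * (K * (b' - b)\<^sup>2 / real n) \<le> e" using \<open>e > 0\<close> by (simp add: field_simps)
  define d where "d = (b' - b) / real n"
  define \<beta> where "\<beta> i = b + real i * d" for i :: nat
  have d: "d \<ge> 0" "real n * d = b' - b" using le n0 by (auto simp: d_def)
  have bs: "\<beta> (Suc i) = \<beta> i + d" for i by (simp add: \<beta>_def algebra_simps)
  have rng: "b \<le> \<beta> i" "\<beta> i \<le> b'" if "i \<le> n" for i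
    using that d mult_right_mono[of "real i" "real n" d] by (auto simp: \<beta>_def)
  define S1 where "S1 = (\<Sum>i<n. V1 (\<beta> i) * (2 * (p1.X (\<beta> (Suc i)) - p1.X (\<beta> i)) - d))"
  define S2 where "S2 = (\<Sum>i<n. V2 (\<beta> i) * (2 * (p2.X (\<beta> (Suc i)) - p2.X (\<beta> i)) - d))"
  have I1: "\<bar>?I1 - S1\<bar> \<le> K * (b' - b)\<^sup>2 / real n"
    unfolding S1_def \<beta>_def d_def by (rule p1.riemann_sum[OF le n0 V1])
  have I2: "\<bar>?I2 - S2\<bar> \<le> K * (b' - b)\<^sup>2 / real n"
    unfolding S2_def \<beta>_def d_def by (rule p2.riemann_sum[OF le n0 V2])
  define D where "D i = p1.X (\<beta> i) - p2.X (\<beta> i)" for i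
  define A1 where "A1 = (\<Sum>i<n. (V1 (\<beta> i) - V2 (\<beta> i)) * (2 * (p1.X (\<beta> (Suc i)) - p1.X (\<beta> i)) - d))"
  define A2 where "A2 = (\<Sum>i<n. V2 (\<beta> i) * (D (Suc i) - D i))"
  have S: "S1 - S2 = A1 + 2 * A2"
    unfolding A1_def A2_def S1_def S2_def D_def sum_distrib_left sum.distrib[symmetric] sum_subtractf[symmetric]
    by (intro sum.cong) (auto simp: algebra_simps)
  have A1: "\<bar>A1\<bar> \<le> (\<Sum>i<n. \<nu> * d)"
    unfolding A1_def
  proof (rule order_trans[OF sum_abs], rule sum_mono)
    fix i assume "i \<in> {..<n}"
    then have "\<bar>V1 (\<beta> i) - V2 (\<beta> i)\<bar> \<le> \<nu>" using V rng[of i] by auto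
    \<comment> \<open>Increments of X over a cell lie in [0, d], hence twice the increment minus d
      lies in [- d, d].\<close>
    moreover have "\<bar>2 * (p1.X (\<beta> (Suc i)) - p1.X (\<beta> i)) - d\<bar> \<le> d"
      using p1.X_lip[of "\<beta> (Suc i)" "\<beta> i"] p1.X_mono[of "\<beta> i" "\<beta> (Suc i)"] d by (auto simp: bs)
    ultimately show "\<bar>(V1 (\<beta> i) - V2 (\<beta> i)) * (2 * (p1.X (\<beta> (Suc i)) - p1.X (\<beta> i)) - d)\<bar> \<le> \<nu> * d"
      unfolding abs_mult by (intro mult_mono) auto
  qed
  have A2: "\<bar>A2\<bar> \<le> (2 * B + real n * (K * d)) * \<mu>"
    unfolding A2_def
  proof (rule abel_bound)
    show "\<bar>V2 (\<beta> (Suc i)) - V2 (\<beta> i)\<bar> \<le> K * d" for i using V2[of "\<beta> (Suc i)" "\<beta> i"] d by (simp add: bs)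
  qed (use X B rng in \<open>auto simp: D_def\<close>)
  have "real n * (K * d) = K * (b' - b)" "(\<Sum>i<n. \<nu> * d) = \<nu> * (b' - b)"
    using d by (simp_all add: mult.left_commute)
  note A = A1[unfolded this] A2[unfolded this]
  have "2 * ((2 * B + K * (b' - b)) * \<mu>) = (4 * B + 2 * K * (b' - b)) * \<mu>"
    by (simp add: algebra_simps)
  then have "\<bar>S1 - S2\<bar> \<le> ?R" using S A by linarith
  then show "\<bar>?I1 - ?I2\<bar> \<le> ?R + e" using I1 I2 small by linarith
qed

text \<open>Both constants come from \<open>stieltjes_compare\<close> over at most one energy
  period: \<open>cm\<close> with V = U, K = 1/2, B = M, and \<open>cG\<close> with V =
  \<open>pr b\<close>, K = \<open>K2\<close>, B = \<open>K2 * (1 + h)\<close>. The division by |1 -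
  h| inverts the prefactor in \<open>G_X\<close>.\<close>

definition cm :: real where "cm = 2 * (1 + h) + 4 * M"
definition cG :: real where
  "cG = ((2 * cm + 2 * (M * (1 + h))) * (1 + h) + 6 * p1.K2 * (1 + h)) / \<bar>1 - h\<bar>"

context
  fixes \<mu> :: real
  assumes dX: "\<And>b. \<bar>p1.X b - p2.X b\<bar> \<le> \<mu>" and dU: "\<And>b. \<bar>p1.U b - p2.U b\<bar> \<le> \<mu>"
begin

lemma mu_nonneg: "0 \<le> \<mu>" using dX[of 0] by simp

lemma u_compare:
  assumes "b \<le> b'" "b' \<le> b + (1 + h)"
  shows "\<bar>oint (\<lambda>x. u1 x * (1 - p1.w x)) (p1.X b) (p1.X b')
        - oint (\<lambda>x. u2 x * (1 - p2.w x)) (p2.X b) (p2.X b')\<bar> \<le> cm * \<mu>"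
proof -
  have "\<bar>oint (\<lambda>x. p1.U (p1.E x) * (1 - p1.w x)) (p1.X b) (p1.X b')
        - oint (\<lambda>x. p2.U (p2.E x) * (1 - p2.w x)) (p2.X b) (p2.X b')\<bar>
      \<le> \<mu> * (b' - b) + (4 * M + 2 * (1/2) * (b' - b)) * \<mu>"
    by (rule stieltjes_compare[OF assms(1) p1.U_lip p2.U_lip _ dU dX]) (simp add: p2.U_def p2.u_bound)
  also have "\<dots> = (2 * (b' - b) + 4 * M) * \<mu>" by (simp add: algebra_simps)
  also have "\<dots> \<le> cm * \<mu>" unfolding cm_def using assms mu_nonneg by (intro mult_right_mono) auto
  finally show ?thesis by (simp add: p1.U_E p2.U_E)
qed

lemma m_compare: "\<bar>p1.m - p2.m\<bar> \<le> cm * \<mu>"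
  using u_compare[of 0 "1 + h"] p1.h_nonneg
    p1.m_period[of "p1.X 0"] p2.m_period[of "p2.X 0"] p1.X_per[of 0] p2.X_per[of 0] by simp

lemma pr_compare:
  assumes "b \<le> c" "c \<le> b + (1 + h)"
  shows "\<bar>p1.pr b c - p2.pr b c\<bar> \<le> (2 * cm + 2 * (M * (1 + h))) * \<mu>"
proof -
  have e1: "p1.pr b c = oint (\<lambda>x. u1 x * (1 - p1.w x)) (p1.X b) (p1.X c) - p1.m * (p1.X c - p1.X b)"
    unfolding p1.pr_def p1.P_diff by (simp add: oint_diff p1.uw_li loc_int_const)
  have e2: "p2.pr b c = oint (\<lambda>x. u2 x * (1 - p2.w x)) (p2.X b) (p2.X c) - p2.m * (p2.X c - p2.X b)"
    unfolding p2.pr_def p2.P_diff by (simp add: oint_diff p2.uw_li loc_int_const)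
  have x01: "0 \<le> p1.X c - p1.X b" "p1.X c - p1.X b \<le> 1"
    using p1.X_mono[OF assms(1)] p1.X_mono[OF assms(2)] p1.X_per[of b] by auto
  have "p1.m * (p1.X c - p1.X b) - p2.m * (p2.X c - p2.X b)
      = (p1.m - p2.m) * (p1.X c - p1.X b) + p2.m * ((p1.X c - p2.X c) - (p1.X b - p2.X b))"
    by (simp add: algebra_simps)
  moreover have "\<bar>(p1.m - p2.m) * (p1.X c - p1.X b)\<bar> \<le> (cm * \<mu>) * 1"
    unfolding abs_mult
    by (rule mult_mono[OF m_compare]) (use x01 order_trans[OF abs_ge_zero m_compare] in auto)
  moreover have "\<bar>p2.m * ((p1.X c - p2.X c) - (p1.X b - p2.X b))\<bar> \<le> (M * (1 + h)) * (2 * \<mu>)"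
    unfolding abs_mult by (rule mult_mono[OF p2.m_bound])
     (use dX[of b] dX[of c] p1.M_nonneg p1.h_nonneg in auto)
  ultimately show ?thesis
    unfolding e1 e2 distrib_right using u_compare[OF assms] by linarith
qed

lemma G_compare:
  assumes "h \<noteq> 1"
  shows "\<bar>p1.G (p1.X b) - p2.G (p2.X b)\<bar> \<le> cG * \<mu>"
proof -
  have "\<bar>oint (\<lambda>x. p1.pr b (p1.E x) * (1 - p1.w x)) (p1.X b) (p1.X (b + (1 + h)))
       - oint (\<lambda>x. p2.pr b (p2.E x) * (1 - p2.w x)) (p2.X b) (p2.X (b + (1 + h)))\<bar>
      \<le> ((2 * cm + 2 * (M * (1 + h))) * \<mu>) * (b + (1 + h) - b) + (4 * (p1.K2 * (1 + h)) + 2 * p1.K2 * (b + (1 + h) - b)) * \<mu>"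
  proof (rule stieltjes_compare[where ?V1.0 = "p1.pr b" and ?V2.0 = "p2.pr b"])
    show "b \<le> b + (1 + h)" using p1.h_nonneg by simp
    show "\<bar>p1.pr b c - p1.pr b d\<bar> \<le> p1.K2 * \<bar>c - d\<bar>" for c d by (rule p1.pr_lip)
    show "\<bar>p2.pr b c - p2.pr b d\<bar> \<le> p1.K2 * \<bar>c - d\<bar>" for c d by (rule p2.pr_lip)
    show "\<bar>p2.pr b c\<bar> \<le> p1.K2 * (1 + h)" if "b \<le> c" "c \<le> b + (1 + h)" for c
      by (rule p2.pr_bound[OF that])
    show "\<bar>p1.pr b c - p2.pr b c\<bar> \<le> (2 * cm + 2 * (M * (1 + h))) * \<mu>"
      if "b \<le> c" "c \<le> b + (1 + h)" for c by (rule pr_compare[OF that])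
    show "\<bar>p1.X c - p2.X c\<bar> \<le> \<mu>" for c by (rule dX)
  qed
  also have "\<dots> = ((2 * cm + 2 * (M * (1 + h))) * (1 + h) + 6 * p1.K2 * (1 + h)) * \<mu>"
    by (simp add: algebra_simps)
  finally have "\<bar>(1 - h) * p1.G (p1.X b) - (1 - h) * p2.G (p2.X b)\<bar> \<le> \<dots>"
    unfolding p1.G_X[OF assms] p2.G_X[OF assms] by linarith
  then have "\<bar>1 - h\<bar> * \<bar>p1.G (p1.X b) - p2.G (p2.X b)\<bar>
      \<le> ((2 * cm + 2 * (M * (1 + h))) * (1 + h) + 6 * p1.K2 * (1 + h)) * \<mu>"
    by (simp add: abs_mult[symmetric] right_diff_distrib)
  then show ?thesis using assms unfolding cG_def by (simp add: field_simps)
qed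

end

end

subsection \<open>Averages over space-time boxes\<close>

lemma mvt_between:
  fixes f f' :: "real \<Rightarrow> real"
  assumes "\<And>x. (f has_real_derivative f' x) (at x)"
  shows "\<exists>z. \<bar>z - a\<bar> \<le> \<bar>b - a\<bar> \<and> f b - f a = f' z * (b - a)"
proof -
  consider "a < b" | "a = b" | "b < a" by linarith
  then show ?thesis
  proof cases
    case 1
    from MVT2[OF this, of f f'] assms obtain z where "a < z" "z < b" "f b - f a = (b - a) * f' z" by blast
    then show ?thesis by (intro exI[of _ z]) auto
  next
    case 3
    from MVT2[OF this, of f f'] assms obtain z where "b < z" "z < a" "f a - f b = (a - b) * f' z" by blast
    then show ?thesis by (intro exI[of _ z]) (auto simp: algebra_simps)
  qed auto
qed

context
  fixes \<Phi> p :: "real \<Rightarrow> real \<Rightarrow> real" and y :: "real \<Rightarrow> real" and S :: "real set" and t0 a :: real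
  assumes t0: "t0 \<in> S"
    and \<Phi>t: "((\<lambda>t. \<Phi> t (y t0)) has_real_derivative a) (at t0 within S)"
    and \<Phi>x: "\<And>t x. (\<Phi> t has_real_derivative p t x) (at x)"
    and p: "continuous_on UNIV (\<lambda>(t, x). p t x)"
begin

text \<open>Joint differentiability of \<Phi> is not given: its time derivative is known only at x =
  y t0 and within S. The increment is therefore split into an x-increment at time r, handled by the
  mean value theorem and the joint continuity of p, and a t-increment at the fixed point y
  t0.\<close>

lemma partial_split:
  "\<exists>z. (\<forall>r. \<Phi> r (y r) = \<Phi> r (y t0) + p r (z r) * (y r - y t0)) \<and>
    ((y \<longlongrightarrow> y t0) (at t0 within S) \<longrightarrow> ((\<lambda>r. p r (z r)) \<longlongrightarrow> p t0 (y t0)) (at t0 within S))"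
proof -
  have "\<forall>r. \<exists>z. \<bar>z - y t0\<bar> \<le> \<bar>y r - y t0\<bar> \<and> \<Phi> r (y r) - \<Phi> r (y t0) = p r z * (y r - y t0)"
    using mvt_between[OF \<Phi>x] by blast
  then obtain z where z: "\<And>r. \<bar>z r - y t0\<bar> \<le> \<bar>y r - y t0\<bar>"
    "\<And>r. \<Phi> r (y r) - \<Phi> r (y t0) = p r (z r) * (y r - y t0)" by metis
  show ?thesis
  proof (intro exI[of _ z] conjI allI impI)
    show "\<Phi> r (y r) = \<Phi> r (y t0) + p r (z r) * (y r - y t0)" for r using z(2)[of r] by simp
    assume y: "(y \<longlongrightarrow> y t0) (at t0 within S)"
    have "(z \<longlongrightarrow> y t0) (at t0 within S)"
    proof (rule Lim_transform_bound[of "\<lambda>r. z r - y t0" "\<lambda>r. y r - y t0", THEN LIM_zero_cancel])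
      show "\<forall>\<^sub>F r in at t0 within S. norm (z r - y t0) \<le> norm (y r - y t0)" using z(1) by simp
      show "((\<lambda>r. y r - y t0) \<longlongrightarrow> 0) (at t0 within S)" using y by (rule LIM_zero)
    qed
    then have "((\<lambda>r. (r, z r)) \<longlongrightarrow> (t0, y t0)) (at t0 within S)" by (intro tendsto_intros)
    moreover have "isCont (\<lambda>(t, x). p t x) (t0, y t0)" using p by (simp add: continuous_on_eq_continuous_at)
    ultimately have "((\<lambda>r. (\<lambda>(t, x). p t x) (r, z r)) \<longlongrightarrow> (\<lambda>(t, x). p t x) (t0, y t0)) (at t0 within S)"
      using isCont_tendsto_compose by blast
    then show "((\<lambda>r. p r (z r)) \<longlongrightarrow> p t0 (y t0)) (at t0 within S)" by simp
  qed
qed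

lemma partial_chain:
  assumes y: "(y has_real_derivative y') (at t0 within S)"
  shows "((\<lambda>r. \<Phi> r (y r)) has_real_derivative a + p t0 (y t0) * y') (at t0 within S)"
proof -
  obtain z where z: "\<And>r. \<Phi> r (y r) = \<Phi> r (y t0) + p r (z r) * (y r - y t0)"
    and lim: "(y \<longlongrightarrow> y t0) (at t0 within S) \<Longrightarrow> ((\<lambda>r. p r (z r)) \<longlongrightarrow> p t0 (y t0)) (at t0 within S)"
    using partial_split by blast
  have "(y \<longlongrightarrow> y t0) (at t0 within S)"
    using DERIV_continuous[OF y] by (simp add: continuous_within)
  then have "((\<lambda>r. (\<Phi> r (y t0) - \<Phi> t0 (y t0)) / (r - t0) + p r (z r) * ((y r - y t0) / (r - t0)))
      \<longlongrightarrow> a + p t0 (y t0) * y') (at t0 within S)"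
    using y \<Phi>t lim unfolding has_field_derivative_iff by (intro tendsto_intros) auto
  moreover have "(\<Phi> r (y t0) - \<Phi> t0 (y t0)) / (r - t0) + p r (z r) * ((y r - y t0) / (r - t0))
      = (\<Phi> r (y r) - \<Phi> t0 (y t0)) / (r - t0)" for r
    by (simp only: z[of r] times_divide_eq_right add_divide_distrib[symmetric]) (simp add: algebra_simps)
  ultimately show ?thesis unfolding has_field_derivative_iff by simp
qed

text \<open>Here y is any selection of solutions, with no continuity assumed. The bound p \<ge> 1
  dominates |y r - y t0| by the increments of b and of \<Phi> at y t0; this gives continuity first
  and then convergence of the quotient.\<close>

lemma partial_implicit:
  assumes p1: "\<And>t x. 1 \<le> p t x" and b: "(b has_real_derivative b') (at t0 within S)"
    and eq: "\<And>r. r \<in> S \<Longrightarrow> \<Phi> r (y r) = b r"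
  shows "(y has_real_derivative (b' - a) / p t0 (y t0)) (at t0 within S)"
proof -
  obtain z where z: "\<And>r. \<Phi> r (y r) = \<Phi> r (y t0) + p r (z r) * (y r - y t0)"
    and lim: "(y \<longlongrightarrow> y t0) (at t0 within S) \<Longrightarrow> ((\<lambda>r. p r (z r)) \<longlongrightarrow> p t0 (y t0)) (at t0 within S)"
    using partial_split by blast
  have ev: "\<forall>\<^sub>F r in at t0 within S. r \<in> S" by (simp add: eventually_at_filter)
  have eq2: "p r (z r) * (y r - y t0) = (b r - b t0) - (\<Phi> r (y t0) - \<Phi> t0 (y t0))" if "r \<in> S" for r
    using z[of r] eq[OF that] eq[OF t0] by simp
  have "((\<lambda>r. y r - y t0) \<longlongrightarrow> 0) (at t0 within S)"
  proof (rule Lim_transform_bound[of _ "\<lambda>r. (b r - b t0) - (\<Phi> r (y t0) - \<Phi> t0 (y t0))"])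
    show "\<forall>\<^sub>F r in at t0 within S. norm (y r - y t0) \<le> norm (b r - b t0 - (\<Phi> r (y t0) - \<Phi> t0 (y t0)))"
      using ev
    proof eventually_elim
      case (elim r)
      have "1 * \<bar>y r - y t0\<bar> \<le> \<bar>p r (z r)\<bar> * \<bar>y r - y t0\<bar>"
        using p1[of r "z r"] by (intro mult_right_mono) auto
      then show ?case by (simp add: eq2[OF elim, symmetric] abs_mult)
    qed
    have "(b \<longlongrightarrow> b t0) (at t0 within S)" "((\<lambda>r. \<Phi> r (y t0)) \<longlongrightarrow> \<Phi> t0 (y t0)) (at t0 within S)"
      using DERIV_continuous[OF b] DERIV_continuous[OF \<Phi>t] by (simp_all add: continuous_within)
    then have "((\<lambda>r. (b r - b t0) - (\<Phi> r (y t0) - \<Phi> t0 (y t0))) \<longlongrightarrow> (b t0 - b t0) - (\<Phi> t0 (y t0) - \<Phi> t0 (y t0))) (at t0 within S)"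
      by (intro tendsto_intros)
    then show "((\<lambda>r. (b r - b t0) - (\<Phi> r (y t0) - \<Phi> t0 (y t0))) \<longlongrightarrow> 0) (at t0 within S)" by simp
  qed
  then have "((\<lambda>r. p r (z r)) \<longlongrightarrow> p t0 (y t0)) (at t0 within S)" using lim LIM_zero_cancel by blast
  moreover have "p t0 (y t0) \<noteq> 0" using p1[of t0 "y t0"] by linarith
  ultimately have "((\<lambda>r. ((b r - b t0) / (r - t0) - (\<Phi> r (y t0) - \<Phi> t0 (y t0)) / (r - t0)) / p r (z r))
      \<longlongrightarrow> (b' - a) / p t0 (y t0)) (at t0 within S)"
    using b \<Phi>t unfolding has_field_derivative_iff by (intro tendsto_intros) auto
  then show ?thesis
    unfolding has_field_derivative_iff
  proof (rule Lim_transform_eventually)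
    show "\<forall>\<^sub>F r in at t0 within S. ((b r - b t0) / (r - t0) - (\<Phi> r (y t0) - \<Phi> t0 (y t0)) / (r - t0)) / p r (z r)
        = (y r - y t0) / (r - t0)"
      using ev
    proof eventually_elim
      case (elim r)
      have "p r (z r) \<noteq> 0" using p1[of r "z r"] by linarith
      then show ?case
        unfolding diff_divide_distrib[symmetric] eq2[OF elim, symmetric] by simp
    qed
  qed
qed

end

text \<open>Integrability is required on every slice, not just on almost every one, so that
  additivity of slice integrals can be used at each single time.\<close>

definition section_int :: "(real \<Rightarrow> real \<Rightarrow> real) \<Rightarrow> bool" where
  "section_int f \<longleftrightarrow> loc_int2 f \<and> (\<forall>t. loc_int (f t))"

text \<open>The square lies forward in time from (t, x), so an average at t \<ge> 0 only involves
  times on the half-line where the equation is known.\<close>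

definition box_avg :: "(real \<Rightarrow> real \<Rightarrow> real) \<Rightarrow> real \<Rightarrow> real \<Rightarrow> real \<Rightarrow> real" where
  "box_avg f \<epsilon> t x = (1 / \<epsilon>\<^sup>2) * oint (\<lambda>r. oint (f r) x (x + \<epsilon>)) t (t + \<epsilon>)"

lemma section_intD: "section_int f \<Longrightarrow> loc_int2 f" "section_int f \<Longrightarrow> loc_int (f t)" by (auto simp: section_int_def)

lemma section_int_measurable: "section_int f \<Longrightarrow> (\<lambda>(t, x). f t x) \<in> borel_measurable borel"
  by (simp add: section_int_def loc_int2_def)

lemma section_int_oint: "section_int f \<Longrightarrow> loc_int (\<lambda>r. oint (f r) a b)" by (intro oint_loc_int section_intD)

lemma section_int_add: "section_int f \<Longrightarrow> section_int g \<Longrightarrow> section_int (\<lambda>t x. f t x + g t x)"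
  and section_int_diff: "section_int f \<Longrightarrow> section_int g \<Longrightarrow> section_int (\<lambda>t x. f t x - g t x)"
  by (auto simp: section_int_def loc_int_add loc_int_diff loc_int2_add loc_int2_diff)

lemma section_int_cmult: "section_int f \<Longrightarrow> section_int (\<lambda>t x. c * f t x)"
  by (auto simp: section_int_def loc_int_cmult loc_int2_cmult)

lemma section_int_const: "section_int (\<lambda>t x. c)"
  unfolding section_int_def
  by (auto intro!: loc_int2I[where C="\<lambda>c' d. \<bar>c\<bar> * (d - c')"] loc_int_const)

lemma section_int_dominated:
  assumes "section_int g" "(\<lambda>(t, x). f t x) \<in> borel_measurable borel" "\<And>t x. \<bar>f t x\<bar> \<le> g t x"
  shows "section_int f"
  unfolding section_int_def
  using loc_int2_dominated[OF section_intD(1)[OF assms(1)] assms(2,3)]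
    loc_int_dominated[OF section_intD(2)[OF assms(1)] section_measurable(1)[OF assms(2)] assms(3)] by auto

lemma section_int_abs: "section_int f \<Longrightarrow> section_int (\<lambda>t x. \<bar>f t x\<bar>)"
proof -
  assume f: "section_int f"
  have "(\<lambda>(t, x). f t x) \<in> borel_measurable borel" by (rule section_int_measurable[OF f])
  then have "(\<lambda>z. \<bar>(\<lambda>(t, x). f t x) z\<bar>) \<in> borel_measurable borel" by measurable
  then have m: "(\<lambda>(t, x). \<bar>f t x\<bar>) \<in> borel_measurable borel" by (simp add: split_beta')
  have "loc_int2 (\<lambda>t x. \<bar>f t x\<bar>)"
    unfolding loc_int2_def
  proof (intro conjI allI m)
    fix a b c d
    have "set_integrable lborel ({a..b} \<times> {c..d}) (\<lambda>(t, x). f t x)" using section_intD(1)[OF f] by (simp add: loc_int2_def)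
    from set_integrable_abs[OF this]
    show "set_integrable lborel ({a..b} \<times> {c..d}) (\<lambda>(t, x). \<bar>f t x\<bar>)" by (simp add: split_beta')
  qed
  then show "section_int (\<lambda>t x. \<bar>f t x\<bar>)" using f by (simp add: section_int_def loc_int_abs)
qed

lemma section_int_time: 
  assumes "loc_int f" shows "section_int (\<lambda>t x. f t)"
  using loc_int2_product[OF assms loc_int_const[of 1]] by (simp add: section_int_def loc_int_const)

lemma box_avg_add: "section_int f \<Longrightarrow> section_int g \<Longrightarrow> box_avg (\<lambda>t x. f t x + g t x) \<epsilon> t x = box_avg f \<epsilon> t x + box_avg g \<epsilon> t x"
  and box_avg_diff: "section_int f \<Longrightarrow> section_int g \<Longrightarrow> box_avg (\<lambda>t x. f t x - g t x) \<epsilon> t x = box_avg f \<epsilon> t x - box_avg g \<epsilon> t x"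
  unfolding box_avg_def by (simp_all add: oint_add oint_diff section_intD section_int_oint distrib_left right_diff_distrib)

lemma box_avg_cmult: "box_avg (\<lambda>t x. c * f t x) \<epsilon> t x = c * box_avg f \<epsilon> t x"
  unfolding box_avg_def by (simp add: oint_cmult)

lemma box_avg_const: "\<epsilon> > 0 \<Longrightarrow> box_avg (\<lambda>t x. c) \<epsilon> t x = c"
  unfolding box_avg_def by (simp add: power2_eq_square)

lemma box_avg_time: "\<epsilon> > 0 \<Longrightarrow> box_avg (\<lambda>t x. f t) \<epsilon> t x = (1 / \<epsilon>) * oint f t (t + \<epsilon>)"
proof -
  assume "\<epsilon> > 0"
  have "oint (\<lambda>r. oint (\<lambda>x. f r) x (x + \<epsilon>)) t (t + \<epsilon>) = \<epsilon> * oint f t (t + \<epsilon>)"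
    unfolding oint_const oint_cmult[symmetric] by (rule oint_cong) simp
  then show ?thesis using \<open>\<epsilon> > 0\<close> unfolding box_avg_def by (simp add: power2_eq_square)
qed

lemma box_avg_mono:
  assumes f: "section_int f" and g: "section_int g" and \<epsilon>: "\<epsilon> > 0" and T: "AE r in lborel. 0 \<le> r \<longrightarrow> r \<in> T" and t: "0 \<le> t"
    and le: "\<And>r z. r \<in> T \<Longrightarrow> t \<le> r \<Longrightarrow> r \<le> t + \<epsilon> \<Longrightarrow> x \<le> z \<Longrightarrow> z \<le> x + \<epsilon> \<Longrightarrow> f r z \<le> g r z"
  shows "box_avg f \<epsilon> t x \<le> box_avg g \<epsilon> t x"
proof -
  have "oint (\<lambda>r. oint (f r) x (x + \<epsilon>)) t (t + \<epsilon>) \<le> oint (\<lambda>r. oint (g r) x (x + \<epsilon>)) t (t + \<epsilon>)"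
  proof (rule oint_mono_AE)
    show "AE r in lborel. t \<le> r \<longrightarrow> r \<le> t + \<epsilon> \<longrightarrow> oint (f r) x (x + \<epsilon>) \<le> oint (g r) x (x + \<epsilon>)"
      using T
    proof eventually_elim
      case (elim r)
      show ?case
      proof (intro impI oint_mono section_intD f g)
        fix z assume "t \<le> r" "r \<le> t + \<epsilon>" "x \<le> z" "z \<le> x + \<epsilon>"
        then show "f r z \<le> g r z" using elim t by (intro le) auto
      qed (use \<epsilon> in auto)
    qed
  qed (use \<epsilon> f g section_int_oint in auto)
  then show ?thesis unfolding box_avg_def by (intro mult_left_mono) auto
qed

lemma box_avg_diff_const_le:
  assumes f: "section_int f" and g: "section_int g" and \<epsilon>: "\<epsilon> > 0" and T: "AE r in lborel. 0 \<le> r \<longrightarrow> r \<in> T" and t: "0 \<le> t"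
    and le: "\<And>r z. r \<in> T \<Longrightarrow> t \<le> r \<Longrightarrow> r \<le> t + \<epsilon> \<Longrightarrow> x \<le> z \<Longrightarrow> z \<le> x + \<epsilon> \<Longrightarrow> \<bar>f r z - c\<bar> \<le> g r z"
  shows "\<bar>box_avg f \<epsilon> t x - c\<bar> \<le> box_avg g \<epsilon> t x"
proof -
  have "box_avg f \<epsilon> t x \<le> box_avg (\<lambda>t x. c + g t x) \<epsilon> t x"
    by (rule box_avg_mono[OF f section_int_add[OF section_int_const g] \<epsilon> T t]) (use le in \<open>force simp: abs_le_iff\<close>)
  moreover have "box_avg (\<lambda>t x. c - g t x) \<epsilon> t x \<le> box_avg f \<epsilon> t x"
    by (rule box_avg_mono[OF section_int_diff[OF section_int_const g] f \<epsilon> T t]) (use le in \<open>force simp: abs_le_iff\<close>)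
  ultimately show ?thesis
    using \<epsilon> by (simp add: box_avg_add box_avg_diff section_int_const g box_avg_const abs_le_iff)
qed

text \<open>Integration in time first leaves B, a continuous function whose increments are integrals
  of p. The average is a sliding mean of B and thus differentiable at every point, although F is
  only absolutely continuous in x.\<close>

lemma box_avg_deriv_x:
  assumes F: "section_int F" and p: "section_int p" and sec: "\<And>y. loc_int (\<lambda>r. F r y)"
    and Fp: "\<And>t x y. F t y - F t x = oint (p t) x y"
  shows "((\<lambda>x. box_avg F \<epsilon> t x) has_real_derivative box_avg p \<epsilon> t x) (at x)"
proof -
  define B where "B y = oint (\<lambda>r. F r y) t (t + \<epsilon>)" for y
  define Q where "Q z = oint (\<lambda>r. p r z) t (t + \<epsilon>)" for z
  have Q: "loc_int Q" unfolding Q_def by (rule oint_loc_int[OF loc_int2_swap[OF section_intD(1)[OF p]]])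
  have B: "B y - B x = oint Q x y" for x y
  proof -
    have "B y - B x = oint (\<lambda>r. oint (p r) x y) t (t + \<epsilon>)"
      unfolding B_def by (subst oint_diff[symmetric]) (auto simp: sec Fp)
    then show ?thesis unfolding Q_def by (simp add: oint_Fubini[OF section_intD(1)[OF p]])
  qed
  have "continuous_on UNIV (\<lambda>y. B 0 + oint Q 0 y)" by (intro continuous_intros oint_continuous Q)
  then have cB: "continuous_on UNIV B" by (simp flip: B)
  have avF: "box_avg F \<epsilon> t x = (1 / \<epsilon>\<^sup>2) * (oint B 0 (x + \<epsilon>) - oint B 0 x)" for x
    unfolding box_avg_def oint_Fubini[OF section_intD(1)[OF F]] B_def[symmetric]
    by (simp add: oint_diff_base loc_int_continuous[OF cB])
  have "((\<lambda>x. (1 / \<epsilon>\<^sup>2) * (oint B 0 (x + \<epsilon>) - oint B 0 x)) has_real_derivative (1 / \<epsilon>\<^sup>2) * (B (x + \<epsilon>) * 1 - B x)) (at x)"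
    by (intro DERIV_cmult DERIV_diff oint_FTC[OF cB] DERIV_chain2[OF oint_FTC[OF cB]])
      (auto intro!: derivative_eq_intros)
  moreover have "(1 / \<epsilon>\<^sup>2) * (B (x + \<epsilon>) * 1 - B x) = box_avg p \<epsilon> t x"
    unfolding box_avg_def oint_Fubini[OF section_intD(1)[OF p]] Q_def[symmetric] by (simp add: B)
  ultimately show ?thesis unfolding avF by simp
qed

text \<open>The balance law holds only at times in T. The continuous function A agrees on T, hence
  at almost every t \<ge> 0, with the integral of F over [x, x + \<epsilon>] and may replace it
  under the time integral.\<close>

lemma box_avg_deriv_t:
  assumes F: "section_int F" and p: "section_int p" and T: "AE r in lborel. 0 \<le> r \<longrightarrow> r \<in> T" and t: "0 \<le> t" and \<epsilon>: "\<epsilon> > 0"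
    and Fp: "\<And>t b. t \<in> T \<Longrightarrow> oint (F t) 0 b = oint (F 0) 0 b + oint (\<lambda>r. oint (p r) 0 b) 0 t"
  shows "((\<lambda>t. box_avg F \<epsilon> t x) has_real_derivative box_avg p \<epsilon> t x) (at t within {0..})"
proof -
  define A where "A s = oint (F 0) x (x + \<epsilon>) + oint (\<lambda>r. oint (p r) x (x + \<epsilon>)) 0 s" for s
  have cA: "continuous_on UNIV A"
    unfolding A_def by (intro continuous_intros oint_continuous section_int_oint p)
  have A: "oint (F s) x (x + \<epsilon>) = A s" if "s \<in> T" for s
  proof -
    have "oint (F s) x (x + \<epsilon>) = oint (F s) 0 (x + \<epsilon>) - oint (F s) 0 x"
      by (simp add: oint_diff_base section_intD F)
    also have "\<dots> = (oint (F 0) 0 (x + \<epsilon>) - oint (F 0) 0 x) + oint (\<lambda>r. oint (p r) 0 (x + \<epsilon>) - oint (p r) 0 x) 0 s"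
      unfolding Fp[OF that] by (subst oint_diff) (auto intro: section_int_oint p)
    finally show ?thesis unfolding A_def by (simp add: oint_diff_base section_intD F p)
  qed
  have avF: "box_avg F \<epsilon> t x = (1 / \<epsilon>\<^sup>2) * (oint A 0 (t + \<epsilon>) - oint A 0 t)" if "0 \<le> t" for t
  proof -
    have "oint (\<lambda>r. oint (F r) x (x + \<epsilon>)) t (t + \<epsilon>) = oint A t (t + \<epsilon>)"
    proof (rule antisym; rule oint_mono_AE)
      show "AE r in lborel. t \<le> r \<longrightarrow> r \<le> t + \<epsilon> \<longrightarrow> oint (F r) x (x + \<epsilon>) \<le> A r"
        "AE r in lborel. t \<le> r \<longrightarrow> r \<le> t + \<epsilon> \<longrightarrow> A r \<le> oint (F r) x (x + \<epsilon>)"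
        using T A that by (auto elim!: eventually_mono)
    qed (use \<epsilon> in \<open>auto intro: section_int_oint F loc_int_continuous cA\<close>)
    then show ?thesis unfolding box_avg_def by (simp add: oint_diff_base loc_int_continuous[OF cA])
  qed
  have "((\<lambda>t. (1 / \<epsilon>\<^sup>2) * (oint A 0 (t + \<epsilon>) - oint A 0 t)) has_real_derivative (1 / \<epsilon>\<^sup>2) * (A (t + \<epsilon>) * 1 - A t)) (at t)"
    by (intro DERIV_cmult DERIV_diff oint_FTC[OF cA] DERIV_chain2[OF oint_FTC[OF cA]])
      (auto intro!: derivative_eq_intros)
  moreover have "(1 / \<epsilon>\<^sup>2) * (A (t + \<epsilon>) * 1 - A t) = box_avg p \<epsilon> t x"
    unfolding box_avg_def A_def by (simp add: oint_diff_base section_int_oint p)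
  ultimately have "((\<lambda>t. (1 / \<epsilon>\<^sup>2) * (oint A 0 (t + \<epsilon>) - oint A 0 t)) has_real_derivative box_avg p \<epsilon> t x) (at t within {0..})"
    by (metis has_field_derivative_at_within)
  then show ?thesis
    by (rule has_field_derivative_transform_within[of _ _ _ _ 1]) (use t avF in auto)
qed

lemma oint_strip_le:
  assumes p: "section_int p" and x: "c \<le> x" "x \<le> y" "y \<le> d"
  shows "\<bar>oint (\<lambda>r. oint (p r) x y) t t'\<bar> \<le> \<bar>oint (\<lambda>r. oint (\<lambda>z. \<bar>p r z\<bar>) c d) t t'\<bar>"
proof -
  have *: "\<bar>oint (\<lambda>r. oint (p r) x y) t t'\<bar> \<le> oint (\<lambda>r. oint (\<lambda>z. \<bar>p r z\<bar>) c d) t t'" if "t \<le> t'" for t t'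
  proof -
    have "\<bar>oint (\<lambda>r. oint (p r) x y) t t'\<bar> \<le> oint (\<lambda>r. \<bar>oint (p r) x y\<bar>) t t'"
      by (intro oint_abs_le that section_int_oint p)
    also have "\<dots> \<le> oint (\<lambda>r. oint (\<lambda>z. \<bar>p r z\<bar>) c d) t t'"
    proof (intro oint_mono that loc_int_abs section_int_oint p section_int_abs)
      fix r
      have "\<bar>oint (p r) x y\<bar> \<le> oint (\<lambda>z. \<bar>p r z\<bar>) x y" by (intro oint_abs_le x section_intD p)
      also have "\<dots> \<le> oint (\<lambda>z. \<bar>p r z\<bar>) c d" by (intro oint_subset_le x loc_int_abs section_intD p) simp
      finally show "\<bar>oint (p r) x y\<bar> \<le> oint (\<lambda>z. \<bar>p r z\<bar>) c d" .
    qed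
    finally show ?thesis .
  qed
  show ?thesis
    using *[of t t'] *[of t' t] oint_swap[of "\<lambda>r. oint (p r) x y" t t']
      oint_swap[of "\<lambda>r. oint (\<lambda>z. \<bar>p r z\<bar>) c d" t t'] by (cases "t \<le> t'") auto
qed

text \<open>Continuity in x at fixed t comes from the integrable time integral Q. A change of t adds
  and removes strips in time; their absolute integrals over a wider x-interval, S and S', vanish in
  the limit and do not depend on the point within distance 1 of x.\<close>

lemma box_avg_continuous:
  assumes p: "section_int p" and \<epsilon>: "\<epsilon> > 0"
  shows "continuous_on UNIV (\<lambda>(t, x). box_avg p \<epsilon> t x)"
proof -
  have "isCont (\<lambda>(t, x). box_avg p \<epsilon> t x) (t, x)" for t x
  proof -
    define Q where "Q z = oint (\<lambda>r. p r z) t (t + \<epsilon>)" for z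
    define J where "J t x = oint (\<lambda>r. oint (p r) x (x + \<epsilon>)) t (t + \<epsilon>)" for t x
    define S where "S t' = oint (\<lambda>r. oint (\<lambda>z. \<bar>p r z\<bar>) (x - 1) (x + 1 + \<epsilon>)) t t'" for t'
    define S' where "S' t' = oint (\<lambda>r. oint (\<lambda>z. \<bar>p r z\<bar>) (x - 1) (x + 1 + \<epsilon>)) (t + \<epsilon>) (t' + \<epsilon>)" for t'
    have Q: "loc_int Q" unfolding Q_def by (rule oint_loc_int[OF loc_int2_swap[OF section_intD(1)[OF p]]])
    have JQ: "J t x' = oint Q 0 (x' + \<epsilon>) - oint Q 0 x'" for x'
      unfolding J_def oint_Fubini[OF section_intD(1)[OF p]] Q_def[symmetric] by (simp add: oint_diff_base Q)
    have abs_li: "loc_int (\<lambda>r. oint (\<lambda>z. \<bar>p r z\<bar>) (x - 1) (x + 1 + \<epsilon>))"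
      by (intro section_int_oint section_int_abs p)
    have cS: "continuous_on UNIV S"
      unfolding S_def by (rule oint_continuous[OF abs_li])
    have cS': "continuous_on UNIV S'"
      unfolding S'_def
      by (rule continuous_on_compose2[OF oint_continuous[OF abs_li]]) (auto intro: continuous_intros)
    have "isCont (\<lambda>x'. J t x') x"
    proof -
      have "continuous_on UNIV (\<lambda>x'. J t x')"
        unfolding JQ
        by (intro continuous_intros oint_continuous[OF Q] continuous_on_compose2[OF oint_continuous[OF Q], of UNIV "\<lambda>x. x + \<epsilon>"]) auto
      then show ?thesis by (simp add: continuous_on_eq_continuous_at)
    qed
    then have l1: "((\<lambda>z. J t (snd z) - J t x) \<longlongrightarrow> 0) (at (t, x))"
      by (intro LIM_zero isCont_tendsto_compose[where g="J t"] tendsto_eq_intros) auto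
    have pfst: "(fst \<longlongrightarrow> t) (at (t, x))" and psnd: "(snd \<longlongrightarrow> x) (at (t, x))"
      using tendsto_fst[OF tendsto_ident_at, of "(t, x)" UNIV] tendsto_snd[OF tendsto_ident_at, of "(t, x)" UNIV] by simp_all
    have sc: "isCont S t" "isCont S' t" using cS cS' by (auto simp: continuous_on_eq_continuous_at)
    have l2: "((\<lambda>z. \<bar>S (fst z)\<bar> + \<bar>S' (fst z)\<bar>) \<longlongrightarrow> \<bar>S t\<bar> + \<bar>S' t\<bar>) (at (t, x))"
      by (intro tendsto_intros isCont_tendsto_compose[OF sc(1)] isCont_tendsto_compose[OF sc(2)] pfst)
    have near: "\<forall>\<^sub>F z in at (t, x). \<bar>snd z - x\<bar> < 1"
    proof -
      have "((\<lambda>z. \<bar>snd z - x\<bar>) \<longlongrightarrow> \<bar>x - x\<bar>) (at (t, x))" by (intro tendsto_intros psnd)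
      then show ?thesis by (rule order_tendstoD) simp
    qed
    have l3: "((\<lambda>z. J (fst z) (snd z) - J t (snd z)) \<longlongrightarrow> 0) (at (t, x))"
    proof (rule Lim_null_comparison)
      show "((\<lambda>z. \<bar>S (fst z)\<bar> + \<bar>S' (fst z)\<bar>) \<longlongrightarrow> 0) (at (t, x))"
        using l2 by (simp add: S_def S'_def)
      show "\<forall>\<^sub>F z in at (t, x). norm (J (fst z) (snd z) - J t (snd z)) \<le> \<bar>S (fst z)\<bar> + \<bar>S' (fst z)\<bar>"
        using near
      proof eventually_elim
        case (elim z)
        let ?f = "\<lambda>r. oint (p r) (snd z) (snd z + \<epsilon>)"
        have f: "loc_int ?f" by (intro section_int_oint p)
        have "J (fst z) (snd z) - J t (snd z) = oint ?f (t + \<epsilon>) (fst z + \<epsilon>) - oint ?f t (fst z)"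
          unfolding J_def
          using oint_combine[OF f, of t "fst z" "fst z + \<epsilon>"] oint_combine[OF f, of t "t + \<epsilon>" "fst z + \<epsilon>"] by simp
        moreover have "\<bar>oint ?f t (fst z)\<bar> \<le> \<bar>S (fst z)\<bar>" "\<bar>oint ?f (t + \<epsilon>) (fst z + \<epsilon>)\<bar> \<le> \<bar>S' (fst z)\<bar>"
          unfolding S_def S'_def by (intro oint_strip_le p; use elim \<epsilon> in auto)+
        ultimately show ?case by simp
      qed
    qed
    from tendsto_add[OF l1 l3] have "((\<lambda>z. J (fst z) (snd z) - J t x) \<longlongrightarrow> 0) (at (t, x))" by simp
    then have "((\<lambda>z. J (fst z) (snd z)) \<longlongrightarrow> J t x) (at (t, x))" by (rule LIM_zero_cancel)
    then have "((\<lambda>z. (1 / \<epsilon>\<^sup>2) * J (fst z) (snd z)) \<longlongrightarrow> (1 / \<epsilon>\<^sup>2) * J t x) (at (t, x))" by (intro tendsto_intros)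
    then show ?thesis by (simp add: isCont_def box_avg_def J_def split_beta')
  qed
  then show ?thesis by (auto simp: continuous_on_eq_continuous_at)
qed

subsection \<open>Evolution of the energy potential\<close>

lemma box_avg_mono_all:
  assumes "section_int f" "section_int g" "\<epsilon> > 0" "\<And>r z. f r z \<le> g r z"
  shows "box_avg f \<epsilon> t x \<le> box_avg g \<epsilon> t x"
proof -
  have "oint (\<lambda>r. oint (f r) x (x + \<epsilon>)) t (t + \<epsilon>) \<le> oint (\<lambda>r. oint (g r) x (x + \<epsilon>)) t (t + \<epsilon>)"
    using assms(3) by (intro oint_mono section_int_oint section_intD(2) assms) auto
  then show ?thesis unfolding box_avg_def by (intro mult_left_mono) auto
qed

lemma box_avg_abs_le:
  assumes "section_int f" "\<epsilon> > 0" shows "\<bar>box_avg f \<epsilon> t x\<bar> \<le> box_avg (\<lambda>r z. \<bar>f r z\<bar>) \<epsilon> t x"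
proof -
  have "box_avg f \<epsilon> t x \<le> box_avg (\<lambda>r z. \<bar>f r z\<bar>) \<epsilon> t x"
    by (intro box_avg_mono_all section_int_abs assms) simp
  moreover have "box_avg (\<lambda>r z. (-1) * f r z) \<epsilon> t x \<le> box_avg (\<lambda>r z. \<bar>f r z\<bar>) \<epsilon> t x"
    by (intro box_avg_mono_all section_int_abs section_int_cmult assms) simp
  ultimately show ?thesis by (simp only: box_avg_cmult)
qed

lemma oint_measurable2:
  assumes "(\<lambda>(t, x). f t x) \<in> borel_measurable (borel :: (real \<times> real) measure)"
  shows "(\<lambda>(t, x). oint (f t) 0 x) \<in> borel_measurable (borel :: (real \<times> real) measure)"
proof -
  have [measurable]: "(\<lambda>(t, x). f t x) \<in> borel_measurable (borel \<Otimes>\<^sub>M borel)"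
    using assms by (simp add: borel_prod)
  have "oint (f t) 0 x = (\<integral>y. (if 0 \<le> y \<and> y \<le> x then f t y else 0) \<partial>lborel)
      - (\<integral>y. (if x \<le> y \<and> y \<le> 0 then f t y else 0) \<partial>lborel)" for t x
  proof -
    have i: "(\<integral>y. (if a \<le> y \<and> y \<le> b then f t y else 0) \<partial>lborel) = oint (f t) a b" if "a \<le> b" for a b
      using that by (auto simp: oint_Icc set_lebesgue_integral_def intro!: Bochner_Integration.integral_cong)
    have z: "(\<integral>y. (if a \<le> y \<and> y \<le> b then f t y else 0) \<partial>lborel) = 0" if "b < a" for a b
      by (rule integral_eq_zero_AE) (use that in auto)
    show ?thesis
    proof (cases x "0::real" rule: linorder_cases)
      case less
      then show ?thesis using i[of x 0] z[of x 0] oint_swap[of "f t" 0 x] by simp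
    next
      case equal
      then show ?thesis by simp
    next
      case greater
      then show ?thesis using i[of 0 x] z[of 0 x] by simp
    qed
  qed
  moreover have "(\<lambda>(t, x). (\<integral>y. (if 0 \<le> y \<and> y \<le> x then f t y else 0) \<partial>lborel)
      - (\<integral>y. (if x \<le> y \<and> y \<le> 0 then f t y else 0) \<partial>lborel)) \<in> borel_measurable (borel \<Otimes>\<^sub>M borel)"
    by measurable
  ultimately show ?thesis by (simp add: borel_prod)
qed

lemma section_int_space_id: "section_int (\<lambda>t x. x)"
  using loc_int2_product[OF loc_int_const[of 1] loc_int_continuous[of "\<lambda>x. x"]]
  by (simp add: section_int_def loc_int_continuous)

text \<open>This part of \<open>flow\<close> involves neither the forcing nor the potential: for a
  weak solution both are constructed on top of it.\<close>

locale pre_flow =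
  fixes u ux :: "real \<Rightarrow> real \<Rightarrow> real" and T :: "real set" and h M m :: real
  assumes u_meas: "(\<lambda>(t, x). u t x) \<in> borel_measurable borel"
    and ux_meas: "(\<lambda>(t, x). ux t x) \<in> borel_measurable borel"
    and w_loc: "loc_int (\<lambda>x. (ux t x)\<^sup>2)"
    and u_oint: "u t y - u t x = oint (ux t) x y"
    and u_per: "u t (x + 1) = u t x" and ux_per: "ux t (x + 1) = ux t x"
    and w_le: "oint (\<lambda>x. (ux t x)\<^sup>2) 0 1 \<le> h"
    and w_eq: "t \<in> T \<Longrightarrow> oint (\<lambda>x. (ux t x)\<^sup>2) 0 1 = h"
    and u_bound: "\<bar>u t x\<bar> \<le> M"
    and T0: "0 \<in> T"
begin

definition w :: "real \<Rightarrow> real \<Rightarrow> real" where "w t x = (ux t x)\<^sup>2"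
definition rE :: "real \<Rightarrow> real \<Rightarrow> real" where "rE t x = (u t x)\<^sup>2 * (1 + w t x) - 2 * m * u t x"

lemma prof: "t \<in> T \<Longrightarrow> profile (u t) (ux t) h M"
  by unfold_locales (use w_loc u_oint u_per ux_per w_eq u_bound section_measurable(1)[OF ux_meas] in auto)

text \<open>Off T the energy of the slice may differ from h; with its own energy as parameter the
  slice is still a profile. E and w do not depend on that parameter.\<close>

lemma prof_any: "profile (u t) (ux t) (oint (\<lambda>x. (ux t x)\<^sup>2) 0 1) M"
  by unfold_locales (use w_loc u_oint u_per ux_per u_bound section_measurable(1)[OF ux_meas] in auto)

lemma w_prof: "profile.w (ux t) = w t"
  by (simp add: profile.w_def[OF prof_any] fun_eq_iff w_def)

lemma w_nonneg: "0 \<le> w t x" by (simp add: w_def)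
lemma w_li: "loc_int (w t)" using w_loc by (simp add: w_def[abs_def])
lemma h_nonneg: "0 \<le> h" using profile.h_nonneg[OF prof[OF T0]] .
lemma M_nonneg: "0 \<le> M" using profile.M_nonneg[OF prof[OF T0]] .

lemma w_per: "w t (x + 1) = w t x" by (simp add: w_def ux_per)

lemma w_period: "oint (w t) a (a + 1) \<le> h"
  using oint_periodic[OF w_li w_per] w_le by (simp add: w_def[abs_def])

lemma w_short: "x \<le> y \<Longrightarrow> y \<le> x + 1 \<Longrightarrow> oint (w t) x y \<le> h"
  using oint_subset_le[OF w_li[of t], of x x y "x+1"] w_period[of t x] w_nonneg by simp

lemma w_long: "oint (w t) x (x + real n) \<le> real n * h"
proof (induction n)
  case (Suc n)
  have "oint (w t) x (x + real (Suc n)) = oint (w t) x (x + real n) + oint (w t) (x + real n) (x + real n + 1)"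
    by (simp add: oint_combine[OF w_li] add.commute add.left_commute)
  then show ?case using Suc w_period[of t "x + real n"] by (simp add: algebra_simps)
qed simp

lemma w_oint_le: "x \<le> y \<Longrightarrow> oint (w t) x y \<le> real (nat \<lceil>y - x\<rceil>) * h"
proof -
  assume xy: "x \<le> y"
  have "y \<le> x + real (nat \<lceil>y - x\<rceil>)" using real_nat_ceiling_ge[of "y - x"] by linarith
  then have "oint (w t) x y \<le> oint (w t) x (x + real (nat \<lceil>y - x\<rceil>))"
    by (intro oint_subset_le w_li w_nonneg) (use xy in auto)
  also have "\<dots> \<le> real (nat \<lceil>y - x\<rceil>) * h" by (rule w_long)
  finally show ?thesis .
qed

lemma u_meas': "(\<lambda>z. u (fst z) (snd z)) \<in> borel_measurable borel"
  and ux_meas': "(\<lambda>z. ux (fst z) (snd z)) \<in> borel_measurable borel"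
  using u_meas ux_meas by (simp_all add: split_beta')

lemma w_meas: "(\<lambda>(t, x). w t x) \<in> borel_measurable borel"
  unfolding w_def split_beta' using ux_meas' by measurable

lemma w_section_int: "section_int w"
proof -
  have "loc_int2 w"
  proof (rule loc_int2I[OF w_meas w_li])
    fix t c d :: real assume "c \<le> d"
    then show "oint (\<lambda>x. \<bar>w t x\<bar>) c d \<le> real (nat \<lceil>d - c\<rceil>) * h"
      using w_oint_le[of c d t] by (simp add: w_nonneg)
  qed
  then show ?thesis by (simp add: section_int_def w_li)
qed

lemma q_section_int: "section_int (\<lambda>t x. 1 + w t x)" by (intro section_int_add section_int_const w_section_int)

lemma ux_le: "2 * \<bar>ux t x\<bar> \<le> 1 + w t x"
  using zero_le_power2[of "\<bar>ux t x\<bar> - 1"] by (simp add: w_def power2_eq_square algebra_simps)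

lemma ux_section_int: "section_int ux"
proof (rule section_int_dominated[OF q_section_int ux_meas])
  show "\<bar>ux t x\<bar> \<le> 1 + w t x" for t x using ux_le[of t x] by simp
qed

lemma u_section_int: "section_int u"
  by (rule section_int_dominated[OF section_int_const[of M] u_meas u_bound])

lemma u2_le: "(u t x)\<^sup>2 \<le> M\<^sup>2"
  using u_bound[of t x] M_nonneg by (metis abs_le_square_iff abs_of_nonneg)

lemma u2q_section_int: "section_int (\<lambda>t x. (u t x)\<^sup>2 * (1 + w t x))"
proof (rule section_int_dominated[OF section_int_cmult[OF q_section_int, of "M\<^sup>2"]])
  show "(\<lambda>(t, x). (u t x)\<^sup>2 * (1 + w t x)) \<in> borel_measurable borel"
    unfolding w_def split_beta' using ux_meas' u_meas' by measurable
  show "\<bar>(u t x)\<^sup>2 * (1 + w t x)\<bar> \<le> M\<^sup>2 * (1 + w t x)" for t x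
    using w_nonneg[of t x] by (auto simp: abs_mult intro!: mult_right_mono u2_le)
qed

lemma u2ux_section_int: "section_int (\<lambda>t x. (u t x)\<^sup>2 * ux t x)"
proof (rule section_int_dominated[OF section_int_cmult[OF section_int_abs[OF ux_section_int], of "M\<^sup>2"]])
  show "(\<lambda>(t, x). (u t x)\<^sup>2 * ux t x) \<in> borel_measurable borel"
    unfolding split_beta' using ux_meas' u_meas' by measurable
  show "\<bar>(u t x)\<^sup>2 * ux t x\<bar> \<le> M\<^sup>2 * \<bar>ux t x\<bar>" for t x
    by (auto simp: abs_mult intro!: mult_right_mono u2_le)
qed

lemma rE_section_int: "section_int rE"
  unfolding rE_def[abs_def] by (intro section_int_diff section_int_cmult u2q_section_int u_section_int)

lemma W_section_int: "section_int (\<lambda>t x. oint (w t) 0 x)"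
proof -
  have li: "loc_int2 (\<lambda>t x. oint (w t) 0 x)"
  proof (rule loc_int2I[OF oint_measurable2[OF w_meas]])
    show "loc_int (\<lambda>x. oint (w t) 0 x)" for t
      by (intro loc_int_continuous oint_continuous w_li)
    fix t c d :: real assume cd: "c \<le> d"
    let ?n = "nat \<lceil>max \<bar>c\<bar> \<bar>d\<bar>\<rceil>"
    have b: "\<bar>oint (w t) 0 x\<bar> \<le> real ?n * h" if "c \<le> x" "x \<le> d" for x
    proof -
      have 1: "real (nat \<lceil>\<bar>x\<bar>\<rceil>) * h \<le> real ?n * h"
        using that by (intro mult_right_mono h_nonneg of_nat_mono nat_mono ceiling_mono) auto
      have 2: "\<bar>oint (w t) 0 x\<bar> \<le> real (nat \<lceil>\<bar>x\<bar>\<rceil>) * h"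
        using w_oint_le[of 0 x t] w_oint_le[of x 0 t] oint_swap[of "w t" 0 x]
          oint_nonneg[of 0 x "w t"] oint_nonneg[of x 0 "w t"] w_nonneg by (cases "0 \<le> x") auto
      from 2 1 show ?thesis by (rule order_trans)
    qed
    have "oint (\<lambda>x. \<bar>oint (w t) 0 x\<bar>) c d \<le> oint (\<lambda>x. real ?n * h) c d"
      by (intro oint_mono cd loc_int_abs loc_int_const loc_int_continuous oint_continuous w_li b)
    then show "oint (\<lambda>x. \<bar>oint (w t) 0 x\<bar>) c d \<le> real ?n * h * (d - c)" by simp
  qed
  show ?thesis
    unfolding section_int_def using li by (auto intro: loc_int_continuous oint_continuous w_li)
qed

end

text \<open>Only the times in \<open>T\<close> are meaningful. At the remaining times, which form a null set, the data
  merely satisfy the bounds that make all space-time integrals finite.\<close>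
locale flow = pre_flow u ux T h M m
  for u ux :: "real \<Rightarrow> real \<Rightarrow> real" and T :: "real set" and h M m :: real +
  fixes Gf :: "real \<Rightarrow> real \<Rightarrow> real" and e :: "real \<Rightarrow> real"
  assumes h1: "h \<noteq> 1"
    and e_loc: "loc_int e"
    and T_nonneg: "t \<in> T \<Longrightarrow> 0 \<le> t"
    and T_AE: "AE t in lborel. 0 \<le> t \<longrightarrow> t \<in> T"
    and Gf_section_int: "section_int Gf" and Gf_eq: "t \<in> T \<Longrightarrow> Gf t x = profile.G (u t) (ux t) h x"
    and boxE: "t \<in> T \<Longrightarrow> oint (profile.E (ux t) (e t)) 0 b = oint (profile.E (ux 0) (e 0)) 0 b
      + oint (\<lambda>r. oint (\<lambda>x. (u r x)\<^sup>2 * (1 + (ux r x)\<^sup>2) - 2 * m * u r x) 0 b) 0 t"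
    and boxu: "t \<in> T \<Longrightarrow> oint (u t) 0 b = oint (u 0) 0 b
      + oint (\<lambda>r. oint (\<lambda>x. (u r x)\<^sup>2 * ux r x + Gf r x) 0 b) 0 t"
begin

abbreviation "E t \<equiv> profile.E (ux t) (e t)"
abbreviation "X t \<equiv> profile.X (ux t) (e t)"
abbreviation "U t \<equiv> profile.U (u t) (ux t) (e t)"
definition ru :: "real \<Rightarrow> real \<Rightarrow> real" where "ru t x = (u t x)\<^sup>2 * ux t x + Gf t x"
text \<open>\<open>RN N t\<close> is the energy above the level \<open>N\<close> at time \<open>t\<close>. It tends to 0 and bounds, up to
  \<open>N\<close> times the length, the energy of short intervals uniformly in their position.\<close>
definition Rf :: "real \<Rightarrow> real \<Rightarrow> real \<Rightarrow> real" where "Rf N t x = max 0 (w t x - N)"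
definition RN :: "real \<Rightarrow> real \<Rightarrow> real" where "RN N t = oint (Rf N t) 0 1"
text \<open>\<open>CG\<close> bounds the forcing, \<open>CH\<close> is the constant in
  \<open>u_Hoelder\<close>, and \<open>C0\<close>, \<open>C1\<close> bound the rates of position and
  value along the averaged paths. They depend on h, M and m only, so two flows with the same
  parameters share them.\<close>

definition CG :: real where "CG = profile.K2 h M * (1 + h)\<^sup>2 / \<bar>1 - h\<bar>"
definition CH :: real where "CH = 3 * (h + 1) + M\<^sup>2 * (h + 1) + CG"
definition C0 :: real where "C0 = M\<^sup>2 + 4 * \<bar>m\<bar> * M"
definition C1 :: real where "C1 = CG + M * CH * (1 + 4 * h) + 2 * \<bar>m\<bar> * M"

lemma ru_section_int: "section_int ru"
  unfolding ru_def[abs_def] by (intro section_int_add u2ux_section_int Gf_section_int)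

lemma E_eq: "E t x = e t + (x + oint (w t) 0 x)"
  by (simp add: profile.E_def[OF prof_any] w_prof)

lemma E_section_int: "section_int E"
  unfolding E_eq[abs_def] by (intro section_int_add section_int_time e_loc section_int_space_id W_section_int)

lemma E_sec: "loc_int (\<lambda>r. E r y)"
  unfolding E_eq[abs_def] by (intro loc_int_add e_loc loc_int_const section_int_oint w_section_int)

lemma u_sec: "loc_int (\<lambda>r. u r y)"
  by (rule loc_int_dominated[OF loc_int_const section_measurable(2)[OF u_meas] u_bound])

lemma E_diff: "E t y - E t x = oint (\<lambda>x. 1 + w t x) x y"
  using profile.E_diff[OF prof_any[of t], where e="e t"] by (simp add: w_prof)

lemma boxE': "t \<in> T \<Longrightarrow> oint (E t) 0 b = oint (E 0) 0 b + oint (\<lambda>r. oint (rE r) 0 b) 0 t"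
  using boxE[of t b] by (simp add: rE_def[abs_def] w_def)

lemma boxu': "t \<in> T \<Longrightarrow> oint (u t) 0 b = oint (u 0) 0 b + oint (\<lambda>r. oint (ru r) 0 b) 0 t"
  using boxu[of t b] by (simp add: ru_def[abs_def])

lemma box_diff:
  assumes F: "section_int F" and p: "section_int p" 
    and Fp: "\<And>t b. t \<in> T \<Longrightarrow> oint (F t) 0 b = oint (F 0) 0 b + oint (\<lambda>r. oint (p r) 0 b) 0 t"
    and t: "s \<in> T" "t \<in> T"
  shows "oint (F t) x y - oint (F s) x y = oint (\<lambda>r. oint (p r) x y) s t"
proof -
  have *: "oint (F t) x y = oint (F 0) x y + oint (\<lambda>r. oint (p r) x y) 0 t" if "t \<in> T" for t
  proof -
    have "oint (F t) x y = oint (F t) 0 y - oint (F t) 0 x" by (simp add: oint_diff_base section_intD F)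
    also have "\<dots> = (oint (F 0) 0 y - oint (F 0) 0 x) + oint (\<lambda>r. oint (p r) 0 y - oint (p r) 0 x) 0 t"
      unfolding Fp[OF that] by (subst oint_diff) (auto intro: section_int_oint p)
    finally show ?thesis by (simp add: oint_diff_base section_intD F p)
  qed
  show ?thesis unfolding *[OF t(1)] *[OF t(2)] by (simp add: oint_diff_base section_int_oint p)
qed

lemma Rf_bounds: "0 \<le> Rf N t x" "N \<ge> 0 \<Longrightarrow> Rf N t x \<le> w t x" "w t x \<le> N + Rf N t x"
  using w_nonneg[of t x] by (auto simp: Rf_def)

lemma Rf_section_int: "N \<ge> 0 \<Longrightarrow> section_int (Rf N)"
proof (rule section_int_dominated[OF w_section_int])
  have "(\<lambda>z. w (fst z) (snd z)) \<in> borel_measurable borel" using w_meas by (simp add: split_beta')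
  then show "(\<lambda>(t, x). Rf N t x) \<in> borel_measurable borel"
    unfolding Rf_def split_beta' by measurable
qed (use Rf_bounds in auto)

lemma RN_li: "N \<ge> 0 \<Longrightarrow> loc_int (RN N)"
  unfolding RN_def[abs_def] by (intro section_int_oint Rf_section_int)

lemma RN_bounds: "N \<ge> 0 \<Longrightarrow> 0 \<le> RN N t" "N \<ge> 0 \<Longrightarrow> RN N t \<le> h"
proof -
  assume N: "N \<ge> 0"
  show "0 \<le> RN N t" unfolding RN_def by (intro oint_nonneg Rf_bounds) simp
  have "RN N t \<le> oint (w t) 0 1"
    unfolding RN_def by (intro oint_mono section_intD(2) Rf_section_int w_section_int Rf_bounds(2) N) simp
  then show "RN N t \<le> h" using w_period[of t 0] by simp
qed

lemma w_RN:
  assumes N: "N \<ge> 0" and xy: "x \<le> y" "y \<le> x + 1"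
  shows "oint (w t) x y \<le> N * (y - x) + RN N t"
proof -
  have li: "loc_int (Rf N t)" by (intro section_intD(2) Rf_section_int N)
  have "oint (w t) x y \<le> oint (\<lambda>z. N + Rf N t z) x y"
    by (intro oint_mono xy w_li loc_int_add loc_int_const li Rf_bounds(3))
  also have "\<dots> = N * (y - x) + oint (Rf N t) x y" by (simp add: oint_add loc_int_const li)
  also have "oint (Rf N t) x y \<le> oint (Rf N t) x (x + 1)"
    by (intro oint_subset_le li Rf_bounds(1)) (use xy in auto)
  also have "\<dots> = RN N t" unfolding RN_def
    by (rule oint_periodic[OF li]) (simp add: Rf_def w_per)
  finally show ?thesis by simp
qed

lemma RN_tendsto: "(\<lambda>n. RN (real n) t) \<longlonglongrightarrow> 0"
proof -
  have "(\<lambda>n. \<integral>x. indicator {0..1} x * Rf (real n) t x \<partial>lborel) \<longlonglongrightarrow> (\<integral>x. 0 \<partial>(lborel::real measure))"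
  proof (rule integral_dominated_convergence[where w="\<lambda>x. indicator {0..1} x * w t x"])
    show "integrable lborel (\<lambda>x. indicator {0..1} x * w t x)"
      using loc_int_set[OF w_li, of 0 1 t] by (simp add: set_integrable_def)
    show "(\<lambda>x. indicator {0..1} x * Rf (real n) t x) \<in> borel_measurable lborel" for n
      using loc_int_measurable[OF section_intD(2)[OF Rf_section_int[of "real n"], of t]] by simp
    show "AE x in lborel. (\<lambda>n. indicator {0..1} x * Rf (real n) t x) \<longlonglongrightarrow> 0"
    proof (rule AE_I2)
      fix x :: real
      obtain n0 where "w t x \<le> real n0" using real_arch_simple by blast
      then have "Rf (real n) t x = 0" if "n \<ge> n0" for n
        using that by (simp add: Rf_def max_def)
      then show "(\<lambda>n. indicator {0..1} x * Rf (real n) t x) \<longlonglongrightarrow> 0"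
        by (intro tendsto_eventually eventually_sequentiallyI[of n0]) simp
    qed
    show "AE x in lborel. norm (indicator {0..1} x * Rf (real n) t x) \<le> indicator {0..1} x * w t x" for n
      using Rf_bounds[of "real n" t] by (auto simp: abs_mult intro!: AE_I2 mult_left_mono)
  qed simp
  then show ?thesis by (simp add: RN_def oint_Icc set_lebesgue_integral_def)
qed

text \<open>The convergence at single times is not uniform in time. Domination by h gives
  convergence of the time integrals, which is what \<open>path_expansion\<close> needs.\<close>

lemma RN_oint_tendsto: "0 \<le> S \<Longrightarrow> (\<lambda>n. oint (RN (real n)) 0 S) \<longlonglongrightarrow> 0"
proof -
  assume S: "0 \<le> S"
  have "(\<lambda>n. \<integral>x. indicator {0..S} x * RN (real n) x \<partial>lborel) \<longlonglongrightarrow> (\<integral>x. 0 \<partial>(lborel::real measure))"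
  proof (rule integral_dominated_convergence[where w="\<lambda>x. indicator {0..S} x * h"])
    show "integrable lborel (\<lambda>x. indicator {0..S} x * h)"
      using loc_int_set[OF loc_int_const[of h], of 0 S] by (simp add: set_integrable_def)
    show "(\<lambda>x. indicator {0..S} x * RN (real n) x) \<in> borel_measurable lborel" for n
      using loc_int_measurable[OF RN_li[of "real n"]] by simp
    show "AE x in lborel. (\<lambda>n. indicator {0..S} x * RN (real n) x) \<longlonglongrightarrow> 0"
      by (intro AE_I2 tendsto_mult_right_zero RN_tendsto)
    show "AE x in lborel. norm (indicator {0..S} x * RN (real n) x) \<le> indicator {0..S} x * h" for n
      using RN_bounds[of "real n"] by (auto simp: abs_mult intro!: AE_I2 mult_left_mono)
  qed simp
  then show ?thesis using S by (simp add: oint_Icc set_lebesgue_integral_def)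
qed

text \<open>Young's inequality |u_x| \<le> s w + 1/(4 s) with s = sqrt \<epsilon> takes the place of
  Cauchy-Schwarz: the energy contributes s h, the length at most \<epsilon>/(4 s) = s/4.\<close>

lemma ux_int:
  assumes "0 < \<epsilon>" "\<epsilon> \<le> 1" "x \<le> y" "y \<le> x + \<epsilon>"
  shows "oint (\<lambda>z. \<bar>ux t z\<bar>) x y \<le> (h + 1) * sqrt \<epsilon>"
proof -
  define s where "s = sqrt \<epsilon>"
  have s: "s > 0" "s * s = \<epsilon>" using assms by (auto simp: s_def)
  have "oint (\<lambda>z. \<bar>ux t z\<bar>) x y \<le> oint (\<lambda>z. s * w t z + 1 / (4 * s)) x y"
  proof (intro oint_mono loc_int_abs loc_int_add loc_int_cmult loc_int_const w_li section_intD(2) ux_section_int assms)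
    fix z
    have "0 \<le> (2 * s * \<bar>ux t z\<bar> - 1)\<^sup>2" by simp
    then have "4 * s * \<bar>ux t z\<bar> \<le> 4 * s * (s * w t z + 1 / (4 * s))"
      using s(1) by (simp add: w_def power2_eq_square algebra_simps)
    then show "\<bar>ux t z\<bar> \<le> s * w t z + 1 / (4 * s)" using s(1) by simp
  qed
  also have "\<dots> = s * oint (w t) x y + 1 / (4 * s) * (y - x)"
    by (simp add: oint_add loc_int_cmult w_li loc_int_const oint_cmult)
  also have "\<dots> \<le> s * h + 1 / (4 * s) * \<epsilon>"
    using w_short[of x y t] assms s by (intro add_mono mult_left_mono) auto
  also have "1 / (4 * s) * \<epsilon> = s / 4" using s by (simp add: field_simps)
  finally show ?thesis unfolding s_def[symmetric] using s(1) by (simp add: algebra_simps)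
qed

lemma u_space:
  assumes "0 < \<epsilon>" "\<epsilon> \<le> 1" "\<bar>x - y\<bar> \<le> \<epsilon>"
  shows "\<bar>u t x - u t y\<bar> \<le> (h + 1) * sqrt \<epsilon>"
proof -
  have *: "\<bar>u t y - u t x\<bar> \<le> (h + 1) * sqrt \<epsilon>" if "x \<le> y" "y \<le> x + \<epsilon>" for x y
    unfolding u_oint using oint_abs_le[OF that(1) section_intD(2)[OF ux_section_int]] ux_int[OF assms(1,2) that] by (rule order_trans)
  show ?thesis using *[of x y] *[of y x] assms(3) by (cases "x \<le> y") (auto simp: abs_minus_commute)
qed

lemma CG_nonneg: "0 \<le> CG" 
  unfolding CG_def using profile.K2_nonneg[OF prof[OF T0]] by simp

lemma Gf_bound: "t \<in> T \<Longrightarrow> \<bar>Gf t x\<bar> \<le> CG"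
  unfolding Gf_eq CG_def by (rule profile.G_bound[OF prof h1])

lemma CH_ge: "CH \<ge> 3 * (h + 1) + M\<^sup>2 * (h + 1) + CG" "CH \<ge> 0"
  using CG_nonneg h_nonneg by (auto simp: CH_def)

text \<open>Regularity in time is inherited from regularity in space. Over a time \<epsilon> the
  integral of u over an interval of length \<epsilon> changes by O(\<epsilon>^(3/2)), and it differs
  from \<epsilon> u(x) by the same order; division by \<epsilon> gives the exponent 1/2.\<close>

lemma u_Hoelder:
  assumes "0 < \<epsilon>" "\<epsilon> \<le> 1" "\<bar>x - y\<bar> \<le> \<epsilon>" "\<bar>t - s\<bar> \<le> \<epsilon>" "t \<in> T" "s \<in> T"
  shows "\<bar>u t x - u s y\<bar> \<le> CH * sqrt \<epsilon>"
proof -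
  have \<epsilon>s: "\<epsilon> \<le> sqrt \<epsilon>" using assms(1,2) by (intro real_le_rsqrt) (simp add: power2_eq_square mult_left_le)
  have ru: "\<bar>oint (ru r) x (x + \<epsilon>)\<bar> \<le> (M\<^sup>2 * (h + 1) + CG) * sqrt \<epsilon>" if "r \<in> T" for r
  proof -
    have "\<bar>oint (ru r) x (x + \<epsilon>)\<bar> \<le> oint (\<lambda>z. \<bar>ru r z\<bar>) x (x + \<epsilon>)"
      using assms(1) by (intro oint_abs_le section_intD(2) ru_section_int) simp
    also have "\<dots> \<le> oint (\<lambda>z. M\<^sup>2 * \<bar>ux r z\<bar> + CG) x (x + \<epsilon>)"
    proof (intro oint_mono loc_int_abs loc_int_add loc_int_cmult loc_int_const section_intD(2) ux_section_int ru_section_int)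
      fix z
      have "\<bar>(u r z)\<^sup>2 * ux r z\<bar> \<le> M\<^sup>2 * \<bar>ux r z\<bar>" by (auto simp: abs_mult intro!: mult_right_mono u2_le)
      then show "\<bar>ru r z\<bar> \<le> M\<^sup>2 * \<bar>ux r z\<bar> + CG" using Gf_bound[OF that, of z] by (simp add: ru_def)
    qed (use assms(1) in simp)
    also have "\<dots> = M\<^sup>2 * oint (\<lambda>z. \<bar>ux r z\<bar>) x (x + \<epsilon>) + CG * \<epsilon>"
      by (simp add: oint_add oint_cmult loc_int_cmult loc_int_abs section_intD(2) ux_section_int loc_int_const)
    also have "\<dots> \<le> M\<^sup>2 * ((h + 1) * sqrt \<epsilon>) + CG * sqrt \<epsilon>"
      using ux_int[OF assms(1,2), of x "x + \<epsilon>" r] \<epsilon>s CG_nonneg assms(1) by (intro add_mono mult_left_mono) auto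
    finally show ?thesis by (simp add: algebra_simps)
  qed
  have time: "\<bar>oint (u t) x (x + \<epsilon>) - oint (u s) x (x + \<epsilon>)\<bar> \<le> (M\<^sup>2 * (h + 1) + CG) * sqrt \<epsilon> * \<epsilon>"
    if "s \<le> t" "t \<le> s + \<epsilon>" "s \<in> T" "t \<in> T" for s t
  proof -
    have li: "loc_int (\<lambda>r. oint (ru r) x (x + \<epsilon>))" by (intro section_int_oint ru_section_int)
    have "\<bar>oint (\<lambda>r. oint (ru r) x (x + \<epsilon>)) s t\<bar> \<le> oint (\<lambda>r. \<bar>oint (ru r) x (x + \<epsilon>)\<bar>) s t"
      by (rule oint_abs_le[OF that(1) li])
    also have "\<dots> \<le> oint (\<lambda>r. (M\<^sup>2 * (h + 1) + CG) * sqrt \<epsilon>) s t"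
    proof (rule oint_mono_AE[OF that(1) loc_int_abs[OF li] loc_int_const])
      show "AE r in lborel. s \<le> r \<longrightarrow> r \<le> t \<longrightarrow> \<bar>oint (ru r) x (x + \<epsilon>)\<bar> \<le> (M\<^sup>2 * (h + 1) + CG) * sqrt \<epsilon>"
        using T_AE by eventually_elim (use ru T_nonneg[OF that(3)] in auto)
    qed
    also have "\<dots> \<le> (M\<^sup>2 * (h + 1) + CG) * sqrt \<epsilon> * \<epsilon>"
      using that h_nonneg CG_nonneg assms(1) by (simp add: mult_left_mono)
    finally show ?thesis using box_diff[OF u_section_int ru_section_int boxu' that(3,4)] by simp
  qed
  have mean: "\<bar>oint (u t) x (x + \<epsilon>) - \<epsilon> * u t x\<bar> \<le> (h + 1) * sqrt \<epsilon> * \<epsilon>" for t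
  proof -
    have li: "loc_int (\<lambda>z. u t z - u t x)" by (intro loc_int_diff loc_int_const section_intD(2) u_section_int)
    have "\<bar>oint (\<lambda>z. u t z - u t x) x (x + \<epsilon>)\<bar> \<le> (h + 1) * sqrt \<epsilon> * (x + \<epsilon> - x)"
      by (intro oint_bound li u_space) (use assms(1,2) in auto)
    then show ?thesis by (simp add: oint_diff section_intD(2) u_section_int loc_int_const mult.commute)
  qed
  have "\<bar>oint (u t) x (x + \<epsilon>) - oint (u s) x (x + \<epsilon>)\<bar> \<le> (M\<^sup>2 * (h + 1) + CG) * sqrt \<epsilon> * \<epsilon>"
    using time[of s t] time[of t s] assms(4-6) by (cases "s \<le> t") (auto simp: abs_minus_commute)
  then have "\<bar>\<epsilon> * u t x - \<epsilon> * u s x\<bar> \<le> (M\<^sup>2 * (h + 1) + CG) * sqrt \<epsilon> * \<epsilon> + 2 * ((h + 1) * sqrt \<epsilon> * \<epsilon>)"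
    using mean[of t] mean[of s] by linarith
  then have "\<epsilon> * \<bar>u t x - u s x\<bar> \<le> \<epsilon> * ((M\<^sup>2 * (h + 1) + CG) * sqrt \<epsilon> + 2 * ((h + 1) * sqrt \<epsilon>))"
  proof -
    have "\<bar>\<epsilon> * u t x - \<epsilon> * u s x\<bar> = \<epsilon> * \<bar>u t x - u s x\<bar>"
      using assms(1) unfolding right_diff_distrib[symmetric] by (simp add: abs_mult)
    moreover assume "\<bar>\<epsilon> * u t x - \<epsilon> * u s x\<bar> \<le> (M\<^sup>2 * (h + 1) + CG) * sqrt \<epsilon> * \<epsilon> + 2 * ((h + 1) * sqrt \<epsilon> * \<epsilon>)"
    ultimately show ?thesis by (simp add: algebra_simps)
  qed
  then have "\<bar>u t x - u s x\<bar> \<le> (M\<^sup>2 * (h + 1) + CG) * sqrt \<epsilon> + 2 * ((h + 1) * sqrt \<epsilon>)"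
    using assms(1) by simp
  then have "\<bar>u t x - u s y\<bar> \<le> (M\<^sup>2 * (h + 1) + CG) * sqrt \<epsilon> + 2 * ((h + 1) * sqrt \<epsilon>) + (h + 1) * sqrt \<epsilon>"
    using u_space[OF assms(1-3), of s] by linarith
  also have "\<dots> = CH * sqrt \<epsilon>" by (simp add: CH_def algebra_simps)
  finally show ?thesis .
qed

end

subsection \<open>Averaged characteristics\<close>

text \<open>The rate g' may be close to c only in the mean, not pointwise. Giving the irregular part
  of the error through an antiderivative H allows the mean value theorem for g - c r - k r - D H and
  for its counterpart with the sign of g - c r reversed.\<close>

lemma increment_bound:
  fixes g H :: "real \<Rightarrow> real"
  assumes le: "a \<le> b"
    and g: "\<And>r. a \<le> r \<Longrightarrow> r \<le> b \<Longrightarrow> (g has_real_derivative g' r) (at r within {a..b})"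
    and H: "\<And>r. (H has_real_derivative H' r) (at r)"
    and bd: "\<And>r. a \<le> r \<Longrightarrow> r \<le> b \<Longrightarrow> \<bar>g' r - c\<bar> \<le> k + D * H' r"
  shows "\<bar>g b - g a - c * (b - a)\<bar> \<le> k * (b - a) + D * (H b - H a)"
proof (cases "a < b")
  case True
  have *: "\<sigma> * (g b - g a - c * (b - a)) \<le> k * (b - a) + D * (H b - H a)" if \<sigma>: "\<sigma> = 1 \<or> \<sigma> = -1" for \<sigma>
  proof -
    let ?f = "\<lambda>r. \<sigma> * (g r - c * r) - k * r - D * H r"
    let ?f' = "\<lambda>r. \<sigma> * (g' r - c) - k - D * H' r"
    have "(?f has_real_derivative ?f' r) (at r within {a..b})" if "a \<le> r" "r \<le> b" for r
    proof -
      have "(?f has_real_derivative \<sigma> * (g' r - c * 1) - k * 1 - D * H' r) (at r within {a..b})"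
        by (intro DERIV_diff DERIV_cmult g[OF that] has_field_derivative_at_within[OF H] DERIV_ident)
      then show ?thesis by simp
    qed
    then have "\<exists>r\<in>{a<..<b}. ?f b - ?f a = (\<lambda>x. x * ?f' r) (b - a)"
      by (intro mvt_simple[OF True]) (auto simp: has_field_derivative_def mult_commute_abs)
    then obtain r where r: "r \<in> {a<..<b}" "?f b - ?f a = (b - a) * ?f' r" by blast
    have "?f' r \<le> 0" using bd[of r] r(1) \<sigma> by (auto simp: abs_le_iff)
    then have "?f b - ?f a \<le> 0" using r(2) True by (simp add: mult_nonneg_nonpos)
    then show ?thesis by (simp add: algebra_simps)
  qed
  show ?thesis using *[of 1] *[of "-1"] by simp
qed (use le in auto)

context flow
begin

section \<open>Paths with a prescribed averaged energy level\<close>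

abbreviation "q \<equiv> \<lambda>t x. 1 + w t x"
abbreviation "aux \<equiv> \<lambda>t x. \<bar>ux t x\<bar>"

lemma box_avg_q_ge1: "\<epsilon> > 0 \<Longrightarrow> 1 \<le> box_avg q \<epsilon> t x"
  using box_avg_mono_all[OF section_int_const q_section_int, of \<epsilon> 1 t x] w_nonneg by (simp add: box_avg_const)

lemma box_avg_E_dx: "((\<lambda>x. box_avg E \<epsilon> t x) has_real_derivative box_avg q \<epsilon> t x) (at x)"
  by (rule box_avg_deriv_x[OF E_section_int q_section_int E_sec E_diff])

lemma box_avg_u_dx: "((\<lambda>x. box_avg u \<epsilon> t x) has_real_derivative box_avg ux \<epsilon> t x) (at x)"
  by (rule box_avg_deriv_x[OF u_section_int ux_section_int u_sec u_oint])

lemma box_avg_E_dt: "\<epsilon> > 0 \<Longrightarrow> 0 \<le> t \<Longrightarrow> ((\<lambda>t. box_avg E \<epsilon> t x) has_real_derivative box_avg rE \<epsilon> t x) (at t within {0..})"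
  by (rule box_avg_deriv_t[OF E_section_int rE_section_int T_AE _ _ boxE'])

lemma box_avg_u_dt: "\<epsilon> > 0 \<Longrightarrow> 0 \<le> t \<Longrightarrow> ((\<lambda>t. box_avg u \<epsilon> t x) has_real_derivative box_avg ru \<epsilon> t x) (at t within {0..})"
  by (rule box_avg_deriv_t[OF u_section_int ru_section_int T_AE _ _ boxu'])

text \<open>The velocity found by implicit differentiation when the averaged E is to have slope - 2
  m a in time. As E_t = u^2 q - 2 m u, it is - u^2 + 2 m (u - a) / q up to commutators.\<close>

definition path_speed :: "real \<Rightarrow> real \<Rightarrow> real \<Rightarrow> real \<Rightarrow> real" where
  "path_speed a \<epsilon> r z = (- 2 * m * a - box_avg rE \<epsilon> r z) / box_avg q \<epsilon> r z"

lemma box_avg_E_surj: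
  assumes \<epsilon>: "\<epsilon> > 0" shows "\<exists>z. box_avg E \<epsilon> r z = \<beta>"
proof -
  let ?F = "box_avg E \<epsilon> r"
  let ?c = "\<bar>\<beta> - ?F 0\<bar>"
  obtain z1 where "?F ?c - ?F 0 = box_avg q \<epsilon> r z1 * (?c - 0)" using mvt_between[OF box_avg_E_dx] by blast
  then have 1: "?F 0 + ?c \<le> ?F ?c" using mult_right_mono[OF box_avg_q_ge1[OF \<epsilon>, of r z1], of ?c] by simp
  obtain z2 where "?F (-?c) - ?F 0 = box_avg q \<epsilon> r z2 * (- ?c - 0)" using mvt_between[OF box_avg_E_dx] by blast
  then have 2: "?F (-?c) \<le> ?F 0 - ?c" using mult_right_mono[OF box_avg_q_ge1[OF \<epsilon>, of r z2], of ?c] by simp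
  have "isCont ?F x" for x by (rule DERIV_isCont[OF box_avg_E_dx])
  then have "continuous_on {-?c..?c} ?F" by (simp add: continuous_at_imp_continuous_on)
  moreover have "?F (-?c) \<le> \<beta>" "\<beta> \<le> ?F ?c" "- ?c \<le> ?c" using 1 2 by linarith+
  ultimately show ?thesis using IVT'[of ?F "-?c" \<beta> ?c] by blast
qed

lemma box_avg_E_inj:
  assumes \<epsilon>: "\<epsilon> > 0" and "box_avg E \<epsilon> r x = box_avg E \<epsilon> r y" shows "x = y"
proof -
  obtain z where "box_avg E \<epsilon> r y - box_avg E \<epsilon> r x = box_avg q \<epsilon> r z * (y - x)" using mvt_between[OF box_avg_E_dx] by blast
  then show ?thesis using box_avg_q_ge1[OF \<epsilon>, of r z] assms(2) by auto
qed

text \<open>The slope parameter \<open>a\<close> is first 0, which gives Lipschitz bounds in time at fixed \<open>E\<close>, and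
  then the value of \<open>u\<close> at the starting point, which makes the transport term vanish to first order.\<close>
lemma path_exists:
  assumes \<epsilon>: "\<epsilon> > 0" and t0: "0 \<le> t0" "t0 \<le> s"
  shows "\<exists>y. y t0 = x0 \<and> (\<forall>r. box_avg E \<epsilon> r (y r) = box_avg E \<epsilon> t0 x0 - 2 * m * a * (r - t0)) \<and>
    (\<forall>r. t0 \<le> r \<longrightarrow> r \<le> s \<longrightarrow> (y has_real_derivative path_speed a \<epsilon> r (y r)) (at r within {t0..s}) \<and>
      ((\<lambda>r. box_avg u \<epsilon> r (y r)) has_real_derivative box_avg ru \<epsilon> r (y r) + box_avg ux \<epsilon> r (y r) * path_speed a \<epsilon> r (y r)) (at r within {t0..s}))"
proof -
  \<comment> \<open>The point is selected separately at each time; its differentiability follows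
    afterwards from \<open>partial_implicit\<close>.\<close>
  obtain y where y: "\<And>r. box_avg E \<epsilon> r (y r) = box_avg E \<epsilon> t0 x0 - 2 * m * a * (r - t0)"
    using choice[OF allI[OF box_avg_E_surj[OF \<epsilon>]], of "\<lambda>r. r"
        "\<lambda>r. box_avg E \<epsilon> t0 x0 - 2 * m * a * (r - t0)"] by blast
  have y0: "y t0 = x0" by (rule box_avg_E_inj[OF \<epsilon>, of t0]) (simp add: y)
  have d: "(y has_real_derivative path_speed a \<epsilon> r (y r)) (at r within {t0..s})"
    "((\<lambda>r. box_avg u \<epsilon> r (y r)) has_real_derivative box_avg ru \<epsilon> r (y r) + box_avg ux \<epsilon> r (y r) * path_speed a \<epsilon> r (y r)) (at r within {t0..s})"
    if r: "t0 \<le> r" "r \<le> s" for r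
  proof -
    have sub: "{t0..s} \<subseteq> {0..}" using t0 by auto
    have rS: "r \<in> {t0..s}" "0 \<le> r" using r t0 by auto
    show y': "(y has_real_derivative path_speed a \<epsilon> r (y r)) (at r within {t0..s})"
      unfolding path_speed_def
    proof (rule partial_implicit[of r "{t0..s}" "box_avg E \<epsilon>" y _ "box_avg q \<epsilon>" "\<lambda>r. box_avg E \<epsilon> t0 x0 - 2 * m * a * (r - t0)"])
      show "((\<lambda>t. box_avg E \<epsilon> t (y r)) has_real_derivative box_avg rE \<epsilon> r (y r)) (at r within {t0..s})"
        by (rule has_field_derivative_subset[OF box_avg_E_dt[OF \<epsilon> rS(2)] sub])
      show "((\<lambda>r. box_avg E \<epsilon> t0 x0 - 2 * m * a * (r - t0)) has_real_derivative - 2 * m * a) (at r within {t0..s})"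
        by (auto intro!: derivative_eq_intros)
    qed (use rS box_avg_E_dx box_avg_continuous[OF q_section_int \<epsilon>] box_avg_q_ge1[OF \<epsilon>] y in auto)
    show "((\<lambda>r. box_avg u \<epsilon> r (y r)) has_real_derivative box_avg ru \<epsilon> r (y r) + box_avg ux \<epsilon> r (y r) * path_speed a \<epsilon> r (y r)) (at r within {t0..s})"
    proof (rule partial_chain[OF rS(1) _ box_avg_u_dx box_avg_continuous[OF ux_section_int \<epsilon>] y'])
      show "((\<lambda>t. box_avg u \<epsilon> t (y r)) has_real_derivative box_avg ru \<epsilon> r (y r)) (at r within {t0..s})"
        by (rule has_field_derivative_subset[OF box_avg_u_dt[OF \<epsilon> rS(2)] sub])
    qed
  qed
  show ?thesis by (intro exI[of _ y] conjI allI impI y0 y d)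
qed

section \<open>Commutator estimates and rates along the paths\<close>

definition AR :: "real \<Rightarrow> real \<Rightarrow> real \<Rightarrow> real" where
  "AR N \<epsilon> r = (1 / \<epsilon>) * oint (RN N) r (r + \<epsilon>)"

context
  fixes \<epsilon> r z a :: real
  assumes \<epsilon>: "0 < \<epsilon>" "\<epsilon> \<le> 1" and r: "0 \<le> r" 
begin

lemma box_avg_u_near:
  assumes "r' \<in> T" "r \<le> r'" "r' \<le> r + \<epsilon>" "z \<le> z'" "z' \<le> z + \<epsilon>"
  shows "\<bar>u r' z' - box_avg u \<epsilon> r z\<bar> \<le> CH * sqrt \<epsilon>"
proof -
  have "\<bar>box_avg u \<epsilon> r z - u r' z'\<bar> \<le> box_avg (\<lambda>r z. CH * sqrt \<epsilon>) \<epsilon> r z"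
    by (rule box_avg_diff_const_le[OF u_section_int section_int_const \<epsilon>(1) T_AE r], rule u_Hoelder[OF \<epsilon>]) (use assms in auto)
  then show ?thesis using \<epsilon> by (simp add: box_avg_const abs_minus_commute)
qed

lemma box_avg_u_bound: "\<bar>box_avg u \<epsilon> r z\<bar> \<le> M"
  using box_avg_diff_const_le[OF u_section_int section_int_const \<epsilon>(1) T_AE r, of z 0 M] u_bound \<epsilon> by (simp add: box_avg_const)

lemma box_avg_G_bound: "\<bar>box_avg Gf \<epsilon> r z\<bar> \<le> CG"
  using box_avg_diff_const_le[OF Gf_section_int section_int_const \<epsilon>(1) T_AE r, of z 0 CG] Gf_bound \<epsilon> by (simp add: box_avg_const)

lemma u2_near:
  assumes "r' \<in> T" "r \<le> r'" "r' \<le> r + \<epsilon>" "z \<le> z'" "z' \<le> z + \<epsilon>"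
  shows "\<bar>(u r' z')\<^sup>2 - (box_avg u \<epsilon> r z)\<^sup>2\<bar> \<le> 2 * M * (CH * sqrt \<epsilon>)"
proof -
  have "\<bar>(u r' z')\<^sup>2 - (box_avg u \<epsilon> r z)\<^sup>2\<bar> = \<bar>u r' z' + box_avg u \<epsilon> r z\<bar> * \<bar>u r' z' - box_avg u \<epsilon> r z\<bar>"
    by (simp add: abs_mult[symmetric] power2_eq_square algebra_simps)
  also have "\<dots> \<le> (2 * M) * (CH * sqrt \<epsilon>)"
    by (intro mult_mono box_avg_u_near assms) (use u_bound[of r' z'] box_avg_u_bound M_nonneg in auto)
  finally show ?thesis .
qed

text \<open>Commutator of averaging with multiplication by u^2: on the square u^2 stays within
  O(sqrt \<epsilon>) of the squared average, and the weight q \<ge> 0 is averaged afterwards. In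
  \<open>box_avg_u2ux\<close> the weight is u_x, so that the error contains the average of |u_x|
  only.\<close>

lemma box_avg_u2q: "\<bar>box_avg (\<lambda>t x. (u t x)\<^sup>2 * (1 + w t x)) \<epsilon> r z - (box_avg u \<epsilon> r z)\<^sup>2 * box_avg q \<epsilon> r z\<bar>
    \<le> 2 * M * (CH * sqrt \<epsilon>) * box_avg q \<epsilon> r z"
proof -
  let ?f = "\<lambda>t x. (u t x)\<^sup>2 * (1 + w t x) - (box_avg u \<epsilon> r z)\<^sup>2 * (1 + w t x)"
  have "\<bar>box_avg ?f \<epsilon> r z - 0\<bar> \<le> box_avg (\<lambda>t x. 2 * M * (CH * sqrt \<epsilon>) * (1 + w t x)) \<epsilon> r z"
  proof (rule box_avg_diff_const_le[OF section_int_diff[OF u2q_section_int section_int_cmult[OF q_section_int]] section_int_cmult[OF q_section_int] \<epsilon>(1) T_AE r])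
    fix r' z' assume "r' \<in> T" "r \<le> r'" "r' \<le> r + \<epsilon>" "z \<le> z'" "z' \<le> z + \<epsilon>"
    from u2_near[OF this] show "\<bar>?f r' z' - 0\<bar> \<le> 2 * M * (CH * sqrt \<epsilon>) * (1 + w r' z')"
      using w_nonneg[of r' z'] unfolding left_diff_distrib[symmetric] diff_0_right abs_mult
      by (simp add: mult_right_mono)
  qed
  then show ?thesis by (simp add: box_avg_diff[OF u2q_section_int section_int_cmult[OF q_section_int]] box_avg_cmult)
qed

lemma box_avg_u2ux: "\<bar>box_avg (\<lambda>t x. (u t x)\<^sup>2 * ux t x) \<epsilon> r z - (box_avg u \<epsilon> r z)\<^sup>2 * box_avg ux \<epsilon> r z\<bar>
    \<le> 2 * M * (CH * sqrt \<epsilon>) * box_avg aux \<epsilon> r z"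
proof -
  let ?f = "\<lambda>t x. (u t x)\<^sup>2 * ux t x - (box_avg u \<epsilon> r z)\<^sup>2 * ux t x"
  have "\<bar>box_avg ?f \<epsilon> r z - 0\<bar> \<le> box_avg (\<lambda>t x. 2 * M * (CH * sqrt \<epsilon>) * \<bar>ux t x\<bar>) \<epsilon> r z"
  proof (rule box_avg_diff_const_le[OF section_int_diff[OF u2ux_section_int section_int_cmult[OF ux_section_int]] section_int_cmult[OF section_int_abs[OF ux_section_int]] \<epsilon>(1) T_AE r])
    fix r' z' assume "r' \<in> T" "r \<le> r'" "r' \<le> r + \<epsilon>" "z \<le> z'" "z' \<le> z + \<epsilon>"
    from u2_near[OF this] show "\<bar>?f r' z' - 0\<bar> \<le> 2 * M * (CH * sqrt \<epsilon>) * \<bar>ux r' z'\<bar>"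
      unfolding left_diff_distrib[symmetric] diff_0_right abs_mult
      by (intro mult_right_mono) auto
  qed
  then show ?thesis by (simp add: box_avg_diff[OF u2ux_section_int section_int_cmult[OF ux_section_int]] box_avg_cmult)
qed

lemma box_avg_aux_le: "2 * box_avg aux \<epsilon> r z \<le> box_avg q \<epsilon> r z" "0 \<le> box_avg aux \<epsilon> r z" "\<bar>box_avg ux \<epsilon> r z\<bar> \<le> box_avg aux \<epsilon> r z"
proof -
  have "box_avg (\<lambda>t x. 2 * \<bar>ux t x\<bar>) \<epsilon> r z \<le> box_avg q \<epsilon> r z"
    by (intro box_avg_mono_all section_int_cmult section_int_abs ux_section_int q_section_int \<epsilon> ux_le)
  then show "2 * box_avg aux \<epsilon> r z \<le> box_avg q \<epsilon> r z" by (simp add: box_avg_cmult)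
  show "\<bar>box_avg ux \<epsilon> r z\<bar> \<le> box_avg aux \<epsilon> r z" by (intro box_avg_abs_le ux_section_int \<epsilon>)
  then show "0 \<le> box_avg aux \<epsilon> r z" by simp
qed

text \<open>Young's inequality with a free weight l: the energy part is l \<epsilon> w, and
  \<epsilon> times the average of w is a time mean of the energy of an interval of length
  \<epsilon>, bounded by \<open>w_RN\<close>. Taking l large, then N large, then \<epsilon> small
  makes the right-hand side small after integration in time.\<close>

lemma sqrt_box_avg_aux:
  assumes l: "l > 0" and N: "N \<ge> 0"
  shows "sqrt \<epsilon> * box_avg aux \<epsilon> r z \<le> 1 / (4 * l) + l * (N * \<epsilon> + AR N \<epsilon> r)"
proof -
  have "box_avg (\<lambda>t x. sqrt \<epsilon> * \<bar>ux t x\<bar>) \<epsilon> r z \<le> box_avg (\<lambda>t x. (l * \<epsilon>) * w t x + 1 / (4 * l)) \<epsilon> r z"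
  proof (intro box_avg_mono_all section_int_cmult section_int_abs ux_section_int section_int_add w_section_int section_int_const \<epsilon>)
    fix t x
    have "0 \<le> (2 * l * sqrt \<epsilon> * \<bar>ux t x\<bar> - 1)\<^sup>2" by simp
    also have "\<dots> = 4 * l * l * (sqrt \<epsilon> * sqrt \<epsilon>) * (\<bar>ux t x\<bar> * \<bar>ux t x\<bar>) - 4 * l * (sqrt \<epsilon> * \<bar>ux t x\<bar>) + 1"
      by (simp add: power2_eq_square algebra_simps)
    also have "\<dots> = 4 * l * l * \<epsilon> * w t x - 4 * l * (sqrt \<epsilon> * \<bar>ux t x\<bar>) + 1"
      using \<epsilon> by (simp add: w_def power2_eq_square)
    finally have "4 * l * (sqrt \<epsilon> * \<bar>ux t x\<bar>) \<le> 4 * l * ((l * \<epsilon>) * w t x + 1 / (4 * l))"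
      using l by (simp add: algebra_simps)
    then show "sqrt \<epsilon> * \<bar>ux t x\<bar> \<le> (l * \<epsilon>) * w t x + 1 / (4 * l)" using l by simp
  qed
  then have 1: "sqrt \<epsilon> * box_avg aux \<epsilon> r z \<le> l * (\<epsilon> * box_avg w \<epsilon> r z) + 1 / (4 * l)"
    using \<epsilon> by (simp add: box_avg_cmult box_avg_add section_int_cmult w_section_int section_int_const box_avg_const mult.assoc)
  have "oint (\<lambda>r. oint (w r) z (z + \<epsilon>)) r (r + \<epsilon>) \<le> oint (\<lambda>r. N * \<epsilon> + RN N r) r (r + \<epsilon>)"
  proof (intro oint_mono section_int_oint w_section_int loc_int_add loc_int_const RN_li N)
    show "oint (w t) z (z + \<epsilon>) \<le> N * \<epsilon> + RN N t" for t using w_RN[OF N, of z "z + \<epsilon>" t] \<epsilon> by simp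
  qed (use \<epsilon> in simp)
  also have "\<dots> = N * \<epsilon> * \<epsilon> + oint (RN N) r (r + \<epsilon>)" by (simp add: oint_add loc_int_const RN_li N)
  finally have "(1 / \<epsilon>) * oint (\<lambda>r. oint (w r) z (z + \<epsilon>)) r (r + \<epsilon>) \<le> (1 / \<epsilon>) * (N * \<epsilon> * \<epsilon> + oint (RN N) r (r + \<epsilon>))"
    using \<epsilon> by (intro mult_left_mono) auto
  moreover have "\<epsilon> * box_avg w \<epsilon> r z = (1 / \<epsilon>) * oint (\<lambda>r. oint (w r) z (z + \<epsilon>)) r (r + \<epsilon>)"
    using \<epsilon> by (simp add: box_avg_def power2_eq_square)
  moreover have "(1 / \<epsilon>) * (N * \<epsilon> * \<epsilon> + oint (RN N) r (r + \<epsilon>)) = N * \<epsilon> + AR N \<epsilon> r"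
    using \<epsilon> by (simp add: AR_def distrib_left)
  ultimately have "\<epsilon> * box_avg w \<epsilon> r z \<le> N * \<epsilon> + AR N \<epsilon> r" by linarith
  then have "l * (\<epsilon> * box_avg w \<epsilon> r z) \<le> l * (N * \<epsilon> + AR N \<epsilon> r)" using l by simp
  then show ?thesis using 1 by linarith
qed

lemma path_speed_num: "\<bar>- 2 * m * a - box_avg rE \<epsilon> r z + (box_avg u \<epsilon> r z)\<^sup>2 * box_avg q \<epsilon> r z\<bar>
    \<le> 2 * M * (CH * sqrt \<epsilon>) * box_avg q \<epsilon> r z + 2 * \<bar>m\<bar> * \<bar>box_avg u \<epsilon> r z - a\<bar>"
proof -
  have "box_avg rE \<epsilon> r z = box_avg (\<lambda>t x. (u t x)\<^sup>2 * (1 + w t x)) \<epsilon> r z - 2 * m * box_avg u \<epsilon> r z"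
    unfolding rE_def[abs_def] by (simp add: box_avg_diff[OF u2q_section_int section_int_cmult[OF u_section_int]] box_avg_cmult)
  then have "- 2 * m * a - box_avg rE \<epsilon> r z + (box_avg u \<epsilon> r z)\<^sup>2 * box_avg q \<epsilon> r z
     = - (box_avg (\<lambda>t x. (u t x)\<^sup>2 * (1 + w t x)) \<epsilon> r z - (box_avg u \<epsilon> r z)\<^sup>2 * box_avg q \<epsilon> r z) + 2 * m * (box_avg u \<epsilon> r z - a)"
    by (simp add: algebra_simps)
  moreover have "\<bar>2 * m * (box_avg u \<epsilon> r z - a)\<bar> = 2 * \<bar>m\<bar> * \<bar>box_avg u \<epsilon> r z - a\<bar>" by (simp add: abs_mult)
  ultimately show ?thesis using box_avg_u2q by linarith
qed

lemma path_speed_eq: "path_speed a \<epsilon> r z + (box_avg u \<epsilon> r z)\<^sup>2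
    = (- 2 * m * a - box_avg rE \<epsilon> r z + (box_avg u \<epsilon> r z)\<^sup>2 * box_avg q \<epsilon> r z) / box_avg q \<epsilon> r z"
  using box_avg_q_ge1[OF \<epsilon>(1), of r z] by (simp add: path_speed_def field_simps)

text \<open>The commutator error in the numerator carries the average of q as a factor, which
  cancels on division; the other term is harmless because that average is at least 1.\<close>

lemma path_speed_near: "\<bar>path_speed a \<epsilon> r z + (box_avg u \<epsilon> r z)\<^sup>2\<bar> \<le> 2 * M * (CH * sqrt \<epsilon>) + 2 * \<bar>m\<bar> * \<bar>box_avg u \<epsilon> r z - a\<bar>"
proof -
  let ?Q = "box_avg q \<epsilon> r z" and ?B = "2 * \<bar>m\<bar> * \<bar>box_avg u \<epsilon> r z - a\<bar>"
  have Q: "1 \<le> ?Q" by (rule box_avg_q_ge1[OF \<epsilon>(1)])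
  have "?B * 1 \<le> ?B * ?Q" using Q by (intro mult_left_mono) auto
  then have "\<bar>- 2 * m * a - box_avg rE \<epsilon> r z + (box_avg u \<epsilon> r z)\<^sup>2 * ?Q\<bar> \<le> (2 * M * (CH * sqrt \<epsilon>) + ?B) * ?Q"
    using path_speed_num by (simp add: distrib_right)
  then show ?thesis unfolding path_speed_eq using Q by (simp add: pos_divide_le_eq)
qed

lemma path_speed_bound:
  assumes "\<bar>a\<bar> \<le> M" shows "\<bar>path_speed a \<epsilon> r z\<bar> \<le> C0"
proof -
  let ?Q = "box_avg q \<epsilon> r z"
  have Q: "1 \<le> ?Q" by (rule box_avg_q_ge1[OF \<epsilon>(1)])
  have "\<bar>box_avg (\<lambda>t x. (u t x)\<^sup>2 * (1 + w t x)) \<epsilon> r z - 0\<bar> \<le> box_avg (\<lambda>t x. M\<^sup>2 * (1 + w t x)) \<epsilon> r z"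
    by (rule box_avg_diff_const_le[OF u2q_section_int section_int_cmult[OF q_section_int] \<epsilon>(1) T_AE r])
      (use w_nonneg in \<open>auto simp: abs_mult intro!: mult_right_mono u2_le\<close>)
  then have 1: "\<bar>box_avg (\<lambda>t x. (u t x)\<^sup>2 * (1 + w t x)) \<epsilon> r z\<bar> \<le> M\<^sup>2 * ?Q" by (simp add: box_avg_cmult)
  have "box_avg rE \<epsilon> r z = box_avg (\<lambda>t x. (u t x)\<^sup>2 * (1 + w t x)) \<epsilon> r z - 2 * m * box_avg u \<epsilon> r z"
    unfolding rE_def[abs_def] by (simp add: box_avg_diff[OF u2q_section_int section_int_cmult[OF u_section_int]] box_avg_cmult)
  then have 2: "- 2 * m * a - box_avg rE \<epsilon> r z = 2 * m * (box_avg u \<epsilon> r z - a) - box_avg (\<lambda>t x. (u t x)\<^sup>2 * (1 + w t x)) \<epsilon> r z"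
    by (simp add: algebra_simps)
  have "\<bar>2 * m * (box_avg u \<epsilon> r z - a)\<bar> \<le> (2 * \<bar>m\<bar>) * (2 * M)"
    unfolding abs_mult by (intro mult_mono) (use box_avg_u_bound assms in auto)
  moreover have "(2 * \<bar>m\<bar>) * (2 * M) * 1 \<le> (2 * \<bar>m\<bar>) * (2 * M) * ?Q"
    using Q M_nonneg by (intro mult_left_mono) auto
  moreover have "C0 * ?Q = M\<^sup>2 * ?Q + (2 * \<bar>m\<bar>) * (2 * M) * ?Q" by (simp add: C0_def algebra_simps)
  ultimately have "\<bar>- 2 * m * a - box_avg rE \<epsilon> r z\<bar> \<le> C0 * ?Q"
    unfolding 2 using 1 by linarith
  then show ?thesis unfolding path_speed_def using Q by (simp add: pos_divide_le_eq)
qed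

text \<open>Transport at speed - u^2 cancels the term u^2 u_x in the rate of u and leaves the
  forcing. Besides the effect of freezing u to a, there remain one commutator from
  \<open>box_avg_u2ux\<close> and one from the speed, each of the order sqrt \<epsilon> times the
  average of |u_x|.\<close>

lemma value_speed_near:
  "\<bar>(box_avg ru \<epsilon> r z + box_avg ux \<epsilon> r z * path_speed a \<epsilon> r z) - box_avg Gf \<epsilon> r z\<bar>
     \<le> 4 * M * CH * (sqrt \<epsilon> * box_avg aux \<epsilon> r z) + \<bar>m\<bar> * \<bar>box_avg u \<epsilon> r z - a\<bar>"
proof -
  let ?Q = "box_avg q \<epsilon> r z" and ?W = "box_avg aux \<epsilon> r z" and ?b = "box_avg u \<epsilon> r z"
  let ?k = "2 * M * (CH * sqrt \<epsilon>)" and ?d = "2 * \<bar>m\<bar> * \<bar>box_avg u \<epsilon> r z - a\<bar>"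
  let ?n = "- 2 * m * a - box_avg rE \<epsilon> r z + ?b\<^sup>2 * ?Q"
  have Q: "1 \<le> ?Q" by (rule box_avg_q_ge1[OF \<epsilon>(1)])
  have W: "2 * ?W \<le> ?Q" "0 \<le> ?W" "\<bar>box_avg ux \<epsilon> r z\<bar> \<le> ?W" by (rule box_avg_aux_le)+
  have "box_avg ru \<epsilon> r z = box_avg (\<lambda>t x. (u t x)\<^sup>2 * ux t x) \<epsilon> r z + box_avg Gf \<epsilon> r z"
    unfolding ru_def[abs_def] by (rule box_avg_add[OF u2ux_section_int Gf_section_int])
  then have eq: "(box_avg ru \<epsilon> r z + box_avg ux \<epsilon> r z * path_speed a \<epsilon> r z) - box_avg Gf \<epsilon> r z
    = (box_avg (\<lambda>t x. (u t x)\<^sup>2 * ux t x) \<epsilon> r z - ?b\<^sup>2 * box_avg ux \<epsilon> r z) + box_avg ux \<epsilon> r z * (path_speed a \<epsilon> r z + ?b\<^sup>2)"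
    by (simp add: algebra_simps)
  have k0: "0 \<le> ?k" using M_nonneg CH_ge(2) \<epsilon> by simp
  have "\<bar>box_avg ux \<epsilon> r z * (path_speed a \<epsilon> r z + ?b\<^sup>2)\<bar> \<le> ?W * ((?k * ?Q + ?d) / ?Q)"
    unfolding abs_mult path_speed_eq abs_divide
    by (intro mult_mono W divide_mono path_speed_num) (use Q W k0 in auto)
  also have "\<dots> = ?k * ?W + (?W / ?Q) * ?d" using Q by (simp add: field_simps)
  \<comment> \<open>By 2 |u_x| \<le> q on averages, the error from freezing u to a loses the
    unbounded factor |u_x|.\<close>
  also have "(?W / ?Q) * ?d \<le> (1/2) * ?d"
    using W Q by (intro mult_right_mono) (auto simp: pos_divide_le_eq)
  finally have "\<bar>box_avg ux \<epsilon> r z * (path_speed a \<epsilon> r z + ?b\<^sup>2)\<bar> \<le> ?k * ?W + (1/2) * ?d" by simp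
  moreover have "2 * (?k * ?W) = 4 * M * CH * (sqrt \<epsilon> * ?W)" "(1/2) * ?d = \<bar>m\<bar> * \<bar>?b - a\<bar>" by simp_all
  ultimately show ?thesis unfolding eq using box_avg_u2ux by linarith
qed

end

lemma AR_le: "0 < \<epsilon> \<Longrightarrow> N \<ge> 0 \<Longrightarrow> AR N \<epsilon> r \<le> h"
proof -
  assume \<epsilon>: "0 < \<epsilon>" and N: "N \<ge> 0"
  have "oint (RN N) r (r + \<epsilon>) \<le> oint (\<lambda>r. h) r (r + \<epsilon>)"
    by (intro oint_mono RN_li N loc_int_const RN_bounds) (use \<epsilon> in simp)
  then show ?thesis using \<epsilon> by (simp add: AR_def pos_divide_le_eq)
qed

lemma value_speed_bound:
  assumes "0 < \<epsilon>" "\<epsilon> \<le> 1" "0 \<le> r" "\<bar>a\<bar> \<le> M"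
  shows "\<bar>box_avg ru \<epsilon> r z + box_avg ux \<epsilon> r z * path_speed a \<epsilon> r z\<bar> \<le> C1"
proof -
  \<comment> \<open>For a mere bound the weights l = 1 and N = 0 are enough, as the truncated energy
    never exceeds h.\<close>
  have "sqrt \<epsilon> * box_avg aux \<epsilon> r z \<le> 1/4 + h"
    using sqrt_box_avg_aux[OF assms(1-3), of 1 0 z] AR_le[OF assms(1), of 0 r] by simp
  then have "4 * M * CH * (sqrt \<epsilon> * box_avg aux \<epsilon> r z) \<le> 4 * M * CH * (1/4 + h)"
    using M_nonneg CH_ge(2) by (intro mult_left_mono) auto
  moreover have "\<bar>m\<bar> * \<bar>box_avg u \<epsilon> r z - a\<bar> \<le> \<bar>m\<bar> * (2 * M)"
    using box_avg_u_bound[OF assms(1-3), of z] assms(4) by (intro mult_left_mono) auto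
  moreover have "C1 = CG + 4 * M * CH * (1/4 + h) + \<bar>m\<bar> * (2 * M)" by (simp add: C1_def algebra_simps)
  ultimately show ?thesis using value_speed_near[OF assms(1-3), of z a] box_avg_G_bound[OF assms(1-3), of z] by linarith
qed

section \<open>Limits of the averages and first-order bounds\<close>

lemma rE_int: 
  assumes "0 \<le> d" "d \<le> 1"
  shows "\<bar>oint (rE r) x (x + d)\<bar> \<le> M\<^sup>2 * (1 + h) + 2 * \<bar>m\<bar> * M"
proof -
  have "\<bar>oint (rE r) x (x + d)\<bar> \<le> oint (\<lambda>z. \<bar>rE r z\<bar>) x (x + d)"
    using assms by (intro oint_abs_le section_intD(2) rE_section_int) simp
  also have "\<dots> \<le> oint (\<lambda>z. M\<^sup>2 * (1 + w r z) + 2 * \<bar>m\<bar> * M) x (x + d)"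
  proof (intro oint_mono loc_int_abs loc_int_add loc_int_cmult loc_int_const w_li section_intD(2) rE_section_int)
    fix z
    have "\<bar>(u r z)\<^sup>2 * (1 + w r z)\<bar> \<le> M\<^sup>2 * (1 + w r z)"
      using w_nonneg[of r z] by (auto simp: abs_mult intro!: mult_right_mono u2_le)
    moreover have "\<bar>2 * m * u r z\<bar> \<le> 2 * \<bar>m\<bar> * M"
      by (auto simp: abs_mult intro!: mult_left_mono u_bound)
    ultimately show "\<bar>rE r z\<bar> \<le> M\<^sup>2 * (1 + w r z) + 2 * \<bar>m\<bar> * M" unfolding rE_def by linarith
  qed (use assms in simp)
  also have "\<dots> = M\<^sup>2 * (d + oint (w r) x (x + d)) + 2 * \<bar>m\<bar> * M * d"
    by (simp add: oint_add oint_cmult loc_int_add loc_int_cmult loc_int_const w_li)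
  also have "\<dots> \<le> M\<^sup>2 * (1 + h) + 2 * \<bar>m\<bar> * M * 1"
    using w_short[of x "x + d" r] assms M_nonneg by (intro add_mono mult_left_mono) auto
  finally show ?thesis by simp
qed

lemma E_mono': "x \<le> y \<Longrightarrow> E t x \<le> E t y"
  by (rule profile.E_mono[OF prof_any])

text \<open>In time there is no pointwise law for E, only one for its integrals over intervals of
  length d. As E is increasing in x, its value at z lies between the means over [z - d, z] and
  [z, z + d]; these are Lipschitz in time, and at time t the spatial oscillation over 2 d is
  uniformly small by \<open>w_RN\<close>.\<close>

lemma E_lim:
  assumes t: "t \<in> T" and \<eta>: "\<eta> > 0"
  shows "\<exists>\<epsilon>0>0. \<forall>\<epsilon>. 0 < \<epsilon> \<longrightarrow> \<epsilon> \<le> \<epsilon>0 \<longrightarrow> (\<forall>x. \<bar>box_avg E \<epsilon> t x - E t x\<bar> \<le> \<eta>)"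
proof -
  obtain n where n: "RN (real n) t < \<eta> / 4"
    using order_tendstoD(2)[OF RN_tendsto, of "\<eta> / 4" t] \<eta> by (auto simp: eventually_sequentially)
  \<comment> \<open>The cap 1/2 keeps [x, x + 2 d] within one period, as \<open>w_RN\<close>
    requires; the other term makes (n + 1) 2 d at most \<eta>/4.\<close>
  define d where "d = min (1/2) (\<eta> / (8 * (real n + 1)))"
  have d: "0 < d" using \<eta> by (simp add: d_def)
  have d2: "d \<le> 1/2" unfolding d_def by (rule min.cobounded1)
  note d = d d2
  have "(real n + 1) * (2 * d) \<le> (real n + 1) * (2 * (\<eta> / (8 * (real n + 1))))"
    by (intro mult_left_mono) (auto simp: d_def)
  also have "\<dots> = \<eta> / 4" by (simp add: field_simps)
  finally have nd: "(real n + 1) * (2 * d) \<le> \<eta> / 4" .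
  have osc: "E t (x + 2 * d) - E t x \<le> \<eta> / 2" for x
  proof -
    have "E t (x + 2 * d) - E t x = 2 * d + oint (w t) x (x + 2 * d)"
      unfolding E_diff by (simp add: oint_add loc_int_const w_li)
    also have "\<dots> \<le> 2 * d + (real n * (2 * d) + RN (real n) t)"
      using w_RN[of "real n" x "x + 2 * d" t] d by simp
    also have "\<dots> \<le> \<eta> / 2" using nd n by (simp add: algebra_simps)
    finally show ?thesis .
  qed
  define C where "C = M\<^sup>2 * (1 + h) + 2 * \<bar>m\<bar> * M"
  have C: "0 \<le> C" using M_nonneg h_nonneg by (simp add: C_def)
  define \<epsilon>0 where "\<epsilon>0 = min d (\<eta> * d / (2 * (C + 1)))"
  have e0: "\<epsilon>0 > 0" using d \<eta> C by (simp add: \<epsilon>0_def)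
  have time: "\<bar>oint (E r) x (x + d) - oint (E t) x (x + d)\<bar> \<le> C * (r - t)" if "r \<in> T" "t \<le> r" for r x
  proof -
    have li: "loc_int (\<lambda>r. oint (rE r) x (x + d))" by (intro section_int_oint rE_section_int)
    have "\<bar>oint (\<lambda>r. oint (rE r) x (x + d)) t r\<bar> \<le> C * (r - t)"
      by (rule oint_bound[OF that(2) li]) (use d rE_int in \<open>auto simp: C_def\<close>)
    then show ?thesis using box_diff[OF E_section_int rE_section_int boxE' t that(1)] by simp
  qed
  have sand: "d * E r x \<le> oint (E r) x (x + d)" "oint (E r) x (x + d) \<le> d * E r (x + d)" for r x
  proof -
    have li: "loc_int (E r)" by (intro section_intD(2) E_section_int)
    have "oint (\<lambda>z. E r x) x (x + d) \<le> oint (E r) x (x + d)"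
      by (intro oint_mono li loc_int_const E_mono') (use d in auto)
    moreover have "oint (E r) x (x + d) \<le> oint (\<lambda>z. E r (x + d)) x (x + d)"
      by (intro oint_mono li loc_int_const E_mono') (use d in auto)
    ultimately show "d * E r x \<le> oint (E r) x (x + d)" "oint (E r) x (x + d) \<le> d * E r (x + d)"
      by (simp_all add: mult.commute)
  qed
  have main: "\<bar>E r z - E t x\<bar> \<le> \<eta>"
    if r: "r \<in> T" "t \<le> r" "r \<le> t + \<epsilon>" and z: "x \<le> z" "z \<le> x + \<epsilon>" and \<epsilon>: "\<epsilon> \<le> \<epsilon>0" for r z x \<epsilon>
  proof -
    have ed: "\<epsilon> \<le> d" using \<epsilon> by (simp add: \<epsilon>0_def)
    have "C * (r - t) \<le> (C + 1) * \<epsilon>0" using r \<epsilon> C by (intro mult_mono) auto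
    also have "\<dots> \<le> (C + 1) * (\<eta> * d / (2 * (C + 1)))" using C by (intro mult_left_mono) (auto simp: \<epsilon>0_def)
    also have "\<dots> = d * (\<eta> / 2)" using C by (simp add: field_simps)
    finally have small: "C * (r - t) \<le> d * (\<eta> / 2)" .
    have "d * E r z \<le> d * (E t (z + d) + \<eta> / 2)"
      using sand(1)[of r z] sand(2)[of t z] time[OF r(1,2), of z] small by (simp add: algebra_simps abs_le_iff)
    then have 1: "E r z \<le> E t (z + d) + \<eta> / 2" using d by simp
    have "E t (z + d) \<le> E t (x + 2 * d)" using z ed by (intro E_mono') simp
    with 1 osc[of x] have up: "E r z \<le> E t x + \<eta>" by linarith
    have "d * E t (z - d) \<le> d * (E r z + \<eta> / 2)"
      using sand(1)[of t "z - d"] sand(2)[of r "z - d"] time[OF r(1,2), of "z - d"] small by (simp add: algebra_simps abs_le_iff)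
    then have 2: "E t (z - d) \<le> E r z + \<eta> / 2" using d by simp
    have "E t x \<le> E t (z - d + 2 * d)" using z d by (intro E_mono') simp
    with 2 osc[of "z - d"] have "E t x \<le> E r z + \<eta>" by linarith
    with up show ?thesis by simp
  qed
  show ?thesis
  proof (intro exI[of _ \<epsilon>0] conjI allI impI e0)
    fix \<epsilon> x assume \<epsilon>: "0 < \<epsilon>" "\<epsilon> \<le> \<epsilon>0"
    have "\<bar>box_avg E \<epsilon> t x - E t x\<bar> \<le> box_avg (\<lambda>r z. \<eta>) \<epsilon> t x"
      by (rule box_avg_diff_const_le[OF E_section_int section_int_const \<epsilon>(1) T_AE T_nonneg[OF t]]) (use main \<epsilon> in blast)
    then show "\<bar>box_avg E \<epsilon> t x - E t x\<bar> \<le> \<eta>" using \<epsilon> by (simp add: box_avg_const)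
  qed
qed

lemma u_lim:
  assumes "t \<in> T" "0 < \<epsilon>" "\<epsilon> \<le> 1" shows "\<bar>box_avg u \<epsilon> t x - u t x\<bar> \<le> CH * sqrt \<epsilon>"
  using box_avg_u_near[OF assms(2,3) T_nonneg[OF assms(1)] assms(1), of x x] assms(2) by (simp add: abs_minus_commute)

lemma eps_small:
  assumes "t0 \<in> T" "s \<in> T" "\<eta> > 0" "\<delta> > 0"
  shows "\<exists>\<epsilon>>0. \<epsilon> \<le> 1 \<and> \<epsilon> \<le> \<delta> \<and> CH * sqrt \<epsilon> \<le> \<eta> \<and> (\<forall>x. \<bar>box_avg E \<epsilon> t0 x - E t0 x\<bar> \<le> \<eta>) \<and> (\<forall>x. \<bar>box_avg E \<epsilon> s x - E s x\<bar> \<le> \<eta>)"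
proof -
  obtain e1 where e1: "e1 > 0" "\<And>\<epsilon> x. 0 < \<epsilon> \<Longrightarrow> \<epsilon> \<le> e1 \<Longrightarrow> \<bar>box_avg E \<epsilon> t0 x - E t0 x\<bar> \<le> \<eta>"
    using E_lim[OF assms(1,3)] by blast
  obtain e2 where e2: "e2 > 0" "\<And>\<epsilon> x. 0 < \<epsilon> \<Longrightarrow> \<epsilon> \<le> e2 \<Longrightarrow> \<bar>box_avg E \<epsilon> s x - E s x\<bar> \<le> \<eta>"
    using E_lim[OF assms(2,3)] by blast
  define \<epsilon> where "\<epsilon> = min (min (min e1 e2) (min 1 \<delta>)) ((\<eta> / (CH + 1))\<^sup>2)"
  have p: "\<eta> / (CH + 1) > 0" using assms(3) CH_ge(2) by simp
  have e: "\<epsilon> > 0" "\<epsilon> \<le> e1" "\<epsilon> \<le> e2" "\<epsilon> \<le> 1" "\<epsilon> \<le> \<delta>" "\<epsilon> \<le> (\<eta> / (CH + 1))\<^sup>2"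
    using e1(1) e2(1) assms(4) p by (auto simp: \<epsilon>_def)
  have "sqrt \<epsilon> \<le> \<eta> / (CH + 1)" using e(6) p by (simp add: real_le_lsqrt)
  then have "(CH + 1) * sqrt \<epsilon> \<le> \<eta>" using CH_ge(2) by (simp add: pos_le_divide_eq mult.commute)
  moreover have "CH * sqrt \<epsilon> \<le> (CH + 1) * sqrt \<epsilon>" using e(1) by (simp add: algebra_simps)
  ultimately have "CH * sqrt \<epsilon> \<le> \<eta>" by linarith
  then show ?thesis using e e1(2) e2(2) by (intro exI[of _ \<epsilon>]) auto
qed

text \<open>The averaged path from x0 ends at a point whose energy level differs from \<beta> by at
  most 2 \<eta>. \<open>E_abs_ge\<close> and \<open>u_lip\<close> convert this into 2 \<eta> for the
  position and \<eta> for the value, and replacing u by its averages at both ends costs 2 \<eta>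
  more.\<close>

lemma path_crude:
  fixes x0 :: real
  assumes t0: "t0 \<in> T" and s: "s \<in> T" and le: "t0 \<le> s" and a: "\<bar>a\<bar> \<le> M"
  defines "\<beta> \<equiv> E t0 x0 - 2 * m * a * (s - t0)"
  shows "\<bar>X s \<beta> - x0\<bar> \<le> C0 * (s - t0)" "\<bar>u s (X s \<beta>) - u t0 x0\<bar> \<le> C1 * (s - t0)"
proof -
  have *: "\<bar>X s \<beta> - x0\<bar> \<le> C0 * (s - t0) + 2 * \<eta> \<and> \<bar>u s (X s \<beta>) - u t0 x0\<bar> \<le> C1 * (s - t0) + 3 * \<eta>" if \<eta>: "\<eta> > 0" for \<eta>
  proof -
    obtain \<epsilon> where \<epsilon>: "0 < \<epsilon>" "\<epsilon> \<le> 1" "CH * sqrt \<epsilon> \<le> \<eta>"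
      and E0: "\<bar>box_avg E \<epsilon> t0 x0 - E t0 x0\<bar> \<le> \<eta>" and Es: "\<And>x. \<bar>box_avg E \<epsilon> s x - E s x\<bar> \<le> \<eta>"
      using eps_small[OF t0 s \<eta>, of 1] by auto
    obtain y where y0: "y t0 = x0" and yE: "\<And>r. box_avg E \<epsilon> r (y r) = box_avg E \<epsilon> t0 x0 - 2 * m * a * (r - t0)"
      and dy: "\<And>r. r \<in> {t0..s} \<Longrightarrow> (y has_real_derivative path_speed a \<epsilon> r (y r)) (at r within {t0..s})"
      and dg: "\<And>r. r \<in> {t0..s} \<Longrightarrow> ((\<lambda>r. box_avg u \<epsilon> r (y r)) has_real_derivative box_avg ru \<epsilon> r (y r) + box_avg ux \<epsilon> r (y r) * path_speed a \<epsilon> r (y r)) (at r within {t0..s})"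
      using path_exists[OF \<epsilon>(1) T_nonneg[OF t0] le, of x0 a] by auto
    have r0: "0 \<le> r" if "r \<in> {t0..s}" for r using that T_nonneg[OF t0] by auto
    have "norm (y s - y t0) \<le> C0 * norm (s - t0)"
    proof (rule field_differentiable_bound[OF _ dy])
      show "norm (path_speed a \<epsilon> r (y r)) \<le> C0" if "r \<in> {t0..s}" for r
        using path_speed_bound[OF \<epsilon>(1,2) r0[OF that] a] by simp
    qed (use le in auto)
    then have ys: "\<bar>y s - x0\<bar> \<le> C0 * (s - t0)" using le y0 by simp
    have "norm (box_avg u \<epsilon> s (y s) - box_avg u \<epsilon> t0 (y t0)) \<le> C1 * norm (s - t0)"
    proof (rule field_differentiable_bound[OF _ dg])
      show "norm (box_avg ru \<epsilon> r (y r) + box_avg ux \<epsilon> r (y r) * path_speed a \<epsilon> r (y r)) \<le> C1" if "r \<in> {t0..s}" for r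
        using value_speed_bound[OF \<epsilon>(1,2) r0[OF that] a] by simp
    qed (use le in auto)
    then have gs: "\<bar>box_avg u \<epsilon> s (y s) - box_avg u \<epsilon> t0 x0\<bar> \<le> C1 * (s - t0)" using le y0 by simp
    have dE: "\<bar>E s (y s) - \<beta>\<bar> \<le> 2 * \<eta>" using E0 Es[of "y s"] yE[of s] by (simp add: \<beta>_def)
    interpret ps: profile "u s" "ux s" "e s" h M by (rule prof[OF s])
    have "\<bar>y s - X s \<beta>\<bar> \<le> 2 * \<eta>" using ps.E_abs_ge[of "y s" "X s \<beta>"] dE by simp
    moreover have "\<bar>u s (y s) - u s (X s \<beta>)\<bar> \<le> \<eta>" using ps.u_lip[of "y s" "X s \<beta>"] dE by simp
    moreover have "\<bar>box_avg u \<epsilon> s (y s) - u s (y s)\<bar> \<le> \<eta>" "\<bar>box_avg u \<epsilon> t0 x0 - u t0 x0\<bar> \<le> \<eta>"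
      using u_lim[OF s \<epsilon>(1,2), of "y s"] u_lim[OF t0 \<epsilon>(1,2), of x0] \<epsilon>(3) by auto
    ultimately show ?thesis using ys gs by linarith
  qed
  show "\<bar>X s \<beta> - x0\<bar> \<le> C0 * (s - t0)"
  proof (rule field_le_epsilon)
    fix \<eta> :: real assume "\<eta> > 0"
    then show "\<bar>X s \<beta> - x0\<bar> \<le> C0 * (s - t0) + \<eta>" using *[of "\<eta> / 2"] by simp
  qed
  show "\<bar>u s (X s \<beta>) - u t0 x0\<bar> \<le> C1 * (s - t0)"
  proof (rule field_le_epsilon)
    fix \<eta> :: real assume "\<eta> > 0"
    then show "\<bar>u s (X s \<beta>) - u t0 x0\<bar> \<le> C1 * (s - t0) + \<eta>" using *[of "\<eta> / 3"] by simp
  qed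
qed

lemma C_nonneg: "0 \<le> C0" "0 \<le> C1"
  using M_nonneg CH_ge(2) CG_nonneg h_nonneg by (auto simp: C0_def C1_def)

lemma X_time:
  assumes "t \<in> T" "s \<in> T"
  shows "\<bar>X s \<beta> - X t \<beta>\<bar> \<le> C0 * \<bar>s - t\<bar>" "\<bar>U s \<beta> - U t \<beta>\<bar> \<le> C1 * \<bar>s - t\<bar>"
proof -
  have *: "\<bar>X s \<beta> - X t \<beta>\<bar> \<le> C0 * (s - t) \<and> \<bar>U s \<beta> - U t \<beta>\<bar> \<le> C1 * (s - t)"
    if "t \<le> s" "t \<in> T" "s \<in> T" for s t
  proof -
    interpret pt: profile "u t" "ux t" "e t" h M by (rule prof) fact
    interpret ps: profile "u s" "ux s" "e s" h M by (rule prof) fact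
    show ?thesis
      using path_crude[OF that(2,3,1), of 0 "X t \<beta>"] M_nonneg by (simp add: pt.U_def ps.U_def)
  qed
  show "\<bar>X s \<beta> - X t \<beta>\<bar> \<le> C0 * \<bar>s - t\<bar>" "\<bar>U s \<beta> - U t \<beta>\<bar> \<le> C1 * \<bar>s - t\<bar>"
    using *[of t s] *[of s t] assms by (cases "t \<le> s"; simp add: abs_minus_commute)+
qed

definition C2 :: real where "C2 = \<bar>two_profiles.cG h M\<bar> * (C0 + C1)"

lemma C2_nonneg: "0 \<le> C2" using C_nonneg by (simp add: C2_def)

text \<open>The comparison of two profiles is applied to one solution at two different times, with
  the distances supplied by \<open>X_time\<close>.\<close>

lemma G_time:
  assumes "t \<in> T" "s \<in> T"
  shows "\<bar>Gf s (X s \<beta>) - Gf t (X t \<beta>)\<bar> \<le> C2 * \<bar>s - t\<bar>"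
proof -
  interpret ps: profile "u s" "ux s" "e s" h M by (rule prof) fact
  interpret pt: profile "u t" "ux t" "e t" h M by (rule prof) fact
  interpret two_profiles "u s" "ux s" "e s" "u t" "ux t" "e t" h M by unfold_locales
  have C: "C0 * \<bar>s - t\<bar> \<le> (C0 + C1) * \<bar>s - t\<bar>" "C1 * \<bar>s - t\<bar> \<le> (C0 + C1) * \<bar>s - t\<bar>"
    using C_nonneg by (intro mult_right_mono; simp)+
  have "\<bar>ps.G (X s \<beta>) - pt.G (X t \<beta>)\<bar> \<le> cG * ((C0 + C1) * \<bar>s - t\<bar>)"
    by (rule G_compare[OF _ _ h1]) (use X_time[OF assms] C order_trans in blast)+
  also have "\<dots> \<le> \<bar>cG\<bar> * ((C0 + C1) * \<bar>s - t\<bar>)"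
    using C_nonneg by (intro mult_right_mono) auto
  finally show ?thesis using assms by (simp add: Gf_eq C2_def mult.assoc)
qed

text \<open>The point z' is carried from time r' to time r along its energy level, which moves it by
  at most C0 \<epsilon>. What remains is an oscillation in space at the single time r, controlled by
  the energy above N.\<close>

lemma E_osc:
  assumes T: "r \<in> T" "r' \<in> T" and d: "\<bar>r - r'\<bar> \<le> \<epsilon>" "\<bar>z - z'\<bar> \<le> \<epsilon>" and \<epsilon>: "(C0 + 1) * \<epsilon> \<le> 1" and N: "N \<ge> 0"
  shows "\<bar>E r z - E r' z'\<bar> \<le> (N + 1) * (C0 + 1) * \<epsilon> + RN N r"
proof -
  interpret p: profile "u r" "ux r" "e r" h M by (rule prof) fact
  interpret p': profile "u r'" "ux r'" "e r'" h M by (rule prof) fact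
  define v where "v = X r (E r' z')"
  have "\<bar>v - z'\<bar> \<le> C0 * \<bar>r - r'\<bar>" unfolding v_def using X_time(1)[OF T(2,1), of "E r' z'"] by simp
  also have "\<dots> \<le> C0 * \<epsilon>" using d C_nonneg by (intro mult_left_mono) auto
  finally have vz: "\<bar>v - z\<bar> \<le> (C0 + 1) * \<epsilon>" using d by (simp add: algebra_simps)
  have *: "\<bar>E r y - E r x\<bar> \<le> (N + 1) * (C0 + 1) * \<epsilon> + RN N r" if "x \<le> y" "y - x \<le> (C0 + 1) * \<epsilon>" for x y
  proof -
    have "E r y - E r x = (y - x) + oint (w r) x y" unfolding E_diff by (simp add: oint_add loc_int_const w_li)
    also have "\<dots> \<le> (y - x) + (N * (y - x) + RN N r)" using w_RN[OF N that(1), of r] that \<epsilon> by simp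
    also have "\<dots> = (N + 1) * (y - x) + RN N r" by (simp add: algebra_simps)
    also have "(N + 1) * (y - x) \<le> (N + 1) * ((C0 + 1) * \<epsilon>)" using that N by (intro mult_left_mono) auto
    finally show ?thesis using E_mono'[OF that(1), of r] by (simp add: mult.assoc)
  qed
  have "E r v = E r' z'" by (simp add: v_def)
  then show ?thesis using *[of v z] *[of z v] vz by (cases "v \<le> z") (auto simp: abs_minus_commute)
qed

text \<open>Constants of the \<tau>^2 terms: u stays within C1 \<tau> of a along the path, the speed
  reacts to u - a with the factors 2 |m| and 2 M, and the forcing changes by C2 \<tau> in time and
  by K2 times the level shift 2 |m| M \<tau>.\<close>

definition C3 :: real where "C3 = (2 * \<bar>m\<bar> + 2 * M) * C1"
definition C4 :: real where "C4 = \<bar>m\<bar> * C1 + C2 + 2 * profile.K2 h M * \<bar>m\<bar> * M"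

text \<open>\<open>AR\<close> is the difference quotient over \<epsilon> of the primitive R of
  \<open>RN N\<close>, so a sliding mean of R is an antiderivative of it. The upper bound no longer
  contains \<epsilon>, hence N can be chosen before \<epsilon>.\<close>

lemma AR_antideriv:
  assumes \<epsilon>: "0 < \<epsilon>" "\<epsilon> \<le> 1" and N: "N \<ge> 0"
  shows "\<exists>H. (\<forall>r. (H has_real_derivative AR N \<epsilon> r) (at r)) \<and> (\<forall>s\<ge>0. 0 \<le> H s \<and> H s \<le> oint (RN N) 0 (s + 1))"
proof -
  define R where "R r = oint (RN N) 0 r" for r
  have cR: "continuous_on UNIV R" unfolding R_def by (intro oint_continuous RN_li N)
  have liR: "loc_int R" by (rule loc_int_continuous[OF cR])
  have R_mono: "R x \<le> R y" if "x \<le> y" for x y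
    unfolding R_def using oint_combine[OF RN_li[OF N], of 0 x y] oint_nonneg[OF that, of "RN N"] RN_bounds(1)[OF N] by simp
  define H where "H r = (1 / \<epsilon>) * (oint R 0 (r + \<epsilon>) - oint R 0 r)" for r
  have "(H has_real_derivative (1 / \<epsilon>) * (R (r + \<epsilon>) * 1 - R r)) (at r)" for r
    unfolding H_def[abs_def]
    by (intro DERIV_cmult DERIV_diff oint_FTC[OF cR] DERIV_chain2[OF oint_FTC[OF cR]])
      (auto intro!: derivative_eq_intros)
  moreover have "(1 / \<epsilon>) * (R (r + \<epsilon>) * 1 - R r) = AR N \<epsilon> r" for r
    unfolding AR_def R_def by (simp add: oint_diff_base RN_li N)
  ultimately have 1: "(H has_real_derivative AR N \<epsilon> r) (at r)" for r by metis
  have 2: "0 \<le> H s \<and> H s \<le> oint (RN N) 0 (s + 1)" if s: "0 \<le> s" for s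
  proof -
    have R0: "0 \<le> R r" if "0 \<le> r" for r using R_mono[OF that] by (simp add: R_def)
    have H: "H s = (1 / \<epsilon>) * oint R s (s + \<epsilon>)" unfolding H_def by (simp add: oint_diff_base liR)
    have "0 \<le> oint R s (s + \<epsilon>)" by (intro oint_nonneg R0) (use s \<epsilon> in auto)
    moreover have "oint R s (s + \<epsilon>) \<le> oint (\<lambda>r. R (s + 1)) s (s + \<epsilon>)"
      by (intro oint_mono liR loc_int_const R_mono) (use \<epsilon> in auto)
    ultimately show ?thesis unfolding H using \<epsilon> by (simp add: R_def[symmetric] pos_divide_le_eq)
  qed
  show ?thesis using 1 2 by blast
qed

text \<open>With the start value a = u t0 x0 the difference u - a is of order \<tau> along the path,
  so freezing u costs only \<tau>^2 over the step. The parameters are chosen in the order \<eta>, l,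
  N, \<epsilon>, each depending on the previous ones, while \<tau> stays fixed; \<eta> tends to 0 at
  the end.\<close>

lemma path_expansion:
  fixes x0 :: real
  assumes t0: "t0 \<in> T" and s: "s \<in> T" and le: "t0 \<le> s"
  defines "a \<equiv> u t0 x0"
  defines "\<beta> \<equiv> E t0 x0 - 2 * m * a * (s - t0)"
  shows "\<bar>X s \<beta> - x0 + a\<^sup>2 * (s - t0)\<bar> \<le> C3 * (s - t0)\<^sup>2"
    and "\<bar>u s (X s \<beta>) - a - Gf t0 x0 * (s - t0)\<bar> \<le> C4 * (s - t0)\<^sup>2"
proof -
  define \<tau> where "\<tau> = s - t0"
  define K2 where "K2 = profile.K2 h M"
  have K2: "0 \<le> K2" unfolding K2_def by (rule profile.K2_nonneg[OF prof[OF T0]])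
  have \<tau>: "0 \<le> \<tau>" using le by (simp add: \<tau>_def)
  have a: "\<bar>a\<bar> \<le> M" by (simp add: a_def u_bound)
  have mch: "0 \<le> M * CH" using M_nonneg CH_ge(2) by simp
  interpret ps: profile "u s" "ux s" "e s" h M by (rule prof[OF s])
  interpret p0: profile "u t0" "ux t0" "e t0" h M by (rule prof[OF t0])
  have *: "\<bar>X s \<beta> - x0 + a\<^sup>2 * \<tau>\<bar> \<le> C3 * \<tau>\<^sup>2 + \<eta> * ((4 * M + 2 * \<bar>m\<bar>) * \<tau> + 2) \<and>
      \<bar>u s (X s \<beta>) - a - Gf t0 x0 * \<tau>\<bar> \<le> C4 * \<tau>\<^sup>2 + \<eta> * ((M * CH + 1 + \<bar>m\<bar> + K2) * \<tau> + 4)" if \<eta>: "\<eta> > 0" for \<eta>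
  proof -
    \<comment> \<open>With this weight the constant term 4 M CH / (4 l) of Young's inequality
      becomes M CH \<eta>.\<close>
    define l where "l = 1 / \<eta>"
    have l: "l > 0" using \<eta> by (simp add: l_def)
    \<comment> \<open>D collects the coefficients of the averaged truncated energy: K2 from the
      oscillation of E inside the forcing, 4 M CH l from the commutators.\<close>
    define D where "D = K2 + 4 * M * CH * l"
    have D: "0 \<le> D" using K2 mch l by (simp add: D_def)
    have "(\<lambda>n. oint (RN (real n)) 0 (s + 1)) \<longlonglongrightarrow> 0" using T_nonneg[OF s] by (intro RN_oint_tendsto) simp
    then obtain n where n: "oint (RN (real n)) 0 (s + 1) < \<eta> / (D + 1)"
      using order_tendstoD(2)[of _ 0 sequentially "\<eta> / (D + 1)"] \<eta> D by (fastforce simp: eventually_sequentially)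
    define N where "N = real n"
    have N: "N \<ge> 0" by (simp add: N_def)
    have DR: "D * oint (RN N) 0 (s + 1) \<le> \<eta>"
    proof -
      have "D * oint (RN N) 0 (s + 1) \<le> D * (\<eta> / (D + 1))" using n D by (intro mult_left_mono) (auto simp: N_def)
      also have "\<dots> \<le> (D + 1) * (\<eta> / (D + 1))" using D \<eta> by (intro mult_right_mono) auto
      finally show ?thesis using D by simp
    qed
    \<comment> \<open>D2 collects the coefficients of \<epsilon>, including those that grow with N,
      which is why \<epsilon> comes last. The bound 1/(C0 + 1) in \<delta> is the smallness demanded
      by \<open>E_osc\<close>.\<close>
    define D2 where "D2 = C2 + K2 * ((N + 1) * (C0 + 1)) + 4 * M * CH * l * N"
    have D2: "0 \<le> D2" using C2_nonneg C_nonneg K2 N mch l by (simp add: D2_def)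
    define \<delta> where "\<delta> = min (1 / (C0 + 1)) (\<eta> / (D2 + 1))"
    have \<delta>: "\<delta> > 0" using D2 C_nonneg \<eta> by (simp add: \<delta>_def)
    obtain \<epsilon> where \<epsilon>: "0 < \<epsilon>" "\<epsilon> \<le> 1" "\<epsilon> \<le> \<delta>" "CH * sqrt \<epsilon> \<le> \<eta>"
      and E0: "\<bar>box_avg E \<epsilon> t0 x0 - E t0 x0\<bar> \<le> \<eta>" and Es: "\<And>x. \<bar>box_avg E \<epsilon> s x - E s x\<bar> \<le> \<eta>"
      using eps_small[OF t0 s \<eta> \<delta>] by auto
    have \<epsilon>C: "(C0 + 1) * \<epsilon> \<le> 1"
    proof -
      have "\<epsilon> \<le> 1 / (C0 + 1)" using \<epsilon>(3) by (simp add: \<delta>_def)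
      then show ?thesis using C_nonneg by (simp add: pos_le_divide_eq mult.commute)
    qed
    have \<epsilon>D: "D2 * \<epsilon> \<le> \<eta>"
    proof -
      have "\<epsilon> \<le> \<eta> / (D2 + 1)" using \<epsilon>(3) by (simp add: \<delta>_def)
      then have "\<epsilon> * (D2 + 1) \<le> \<eta>" using D2 by (simp add: pos_le_divide_eq)
      then show ?thesis using \<epsilon>(1) by (simp add: algebra_simps)
    qed
    obtain y where y0: "y t0 = x0" and yE: "\<And>r. box_avg E \<epsilon> r (y r) = box_avg E \<epsilon> t0 x0 - 2 * m * a * (r - t0)"
      and dy: "\<And>r. t0 \<le> r \<Longrightarrow> r \<le> s \<Longrightarrow> (y has_real_derivative path_speed a \<epsilon> r (y r)) (at r within {t0..s})"
      and dg: "\<And>r. t0 \<le> r \<Longrightarrow> r \<le> s \<Longrightarrow> ((\<lambda>r. box_avg u \<epsilon> r (y r)) has_real_derivative box_avg ru \<epsilon> r (y r) + box_avg ux \<epsilon> r (y r) * path_speed a \<epsilon> r (y r)) (at r within {t0..s})"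
      using path_exists[OF \<epsilon>(1) T_nonneg[OF t0] le, of x0 a] by blast
    have r0: "0 \<le> r" if "t0 \<le> r" for r using that T_nonneg[OF t0] by auto
    have ba: "\<bar>box_avg u \<epsilon> r (y r) - a\<bar> \<le> C1 * \<tau> + \<eta>" if r: "t0 \<le> r" "r \<le> s" for r
    proof -
      have "norm (box_avg u \<epsilon> r (y r) - box_avg u \<epsilon> t0 (y t0)) \<le> C1 * norm (r - t0)"
      proof (rule field_differentiable_bound[of "{t0..s}" "\<lambda>r. box_avg u \<epsilon> r (y r)"])
        show "((\<lambda>r. box_avg u \<epsilon> r (y r)) has_real_derivative box_avg ru \<epsilon> r (y r) + box_avg ux \<epsilon> r (y r) * path_speed a \<epsilon> r (y r)) (at r within {t0..s})"
          if "r \<in> {t0..s}" for r using dg that by simp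
        show "norm (box_avg ru \<epsilon> r (y r) + box_avg ux \<epsilon> r (y r) * path_speed a \<epsilon> r (y r)) \<le> C1" if "r \<in> {t0..s}" for r
          using value_speed_bound[OF \<epsilon>(1,2) r0 a, of r "y r"] that by simp
      qed (use r in auto)
      moreover have "C1 * norm (r - t0) \<le> C1 * \<tau>" using r C_nonneg by (intro mult_left_mono) (auto simp: \<tau>_def)
      moreover have "\<bar>box_avg u \<epsilon> t0 x0 - a\<bar> \<le> \<eta>" using u_lim[OF t0 \<epsilon>(1,2), of x0] \<epsilon>(4) by (simp add: a_def)
      ultimately show ?thesis using y0 by simp
    qed
    have bap: "0 \<le> C1 * \<tau> + \<eta>" using C_nonneg \<tau> \<eta> by simp
    have "\<bar>y s - y t0 - (- a\<^sup>2) * (s - t0)\<bar> \<le> (2 * M * \<eta> + (2 * \<bar>m\<bar> + 2 * M) * (C1 * \<tau> + \<eta>)) * (s - t0) + 0 * (0 - 0)"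
    proof (rule increment_bound[where H' = "\<lambda>r. 0", OF le dy])
      fix r assume r: "t0 \<le> r" "r \<le> s"
      let ?b = "box_avg u \<epsilon> r (y r)"
      have "\<bar>?b\<^sup>2 - a\<^sup>2\<bar> = \<bar>?b + a\<bar> * \<bar>?b - a\<bar>"
        by (simp add: abs_mult[symmetric] power2_eq_square algebra_simps)
      also have "\<dots> \<le> (2 * M) * (C1 * \<tau> + \<eta>)"
        using a box_avg_u_bound[OF \<epsilon>(1,2) r0[OF r(1)], of "y r"] M_nonneg by (intro mult_mono ba[OF r]) auto
      finally have 1: "\<bar>?b\<^sup>2 - a\<^sup>2\<bar> \<le> (2 * M) * (C1 * \<tau> + \<eta>)" .
      have 2: "2 * \<bar>m\<bar> * \<bar>?b - a\<bar> \<le> 2 * \<bar>m\<bar> * (C1 * \<tau> + \<eta>)" by (intro mult_left_mono ba[OF r]) simp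
      have 3: "2 * M * (CH * sqrt \<epsilon>) \<le> 2 * M * \<eta>" using \<epsilon>(4) M_nonneg by (intro mult_left_mono) auto
      have "\<bar>path_speed a \<epsilon> r (y r) - - a\<^sup>2\<bar> \<le> 2 * M * \<eta> + 2 * \<bar>m\<bar> * (C1 * \<tau> + \<eta>) + (2 * M) * (C1 * \<tau> + \<eta>)"
        using path_speed_near[OF \<epsilon>(1,2) r0[OF r(1)], of a "y r"] 1 2 3 by linarith
      then show "\<bar>path_speed a \<epsilon> r (y r) - - a\<^sup>2\<bar> \<le> 2 * M * \<eta> + (2 * \<bar>m\<bar> + 2 * M) * (C1 * \<tau> + \<eta>) + 0 * 0"
        by (simp add: distrib_right)
    qed auto
    then have ys: "\<bar>y s - x0 + a\<^sup>2 * \<tau>\<bar> \<le> C3 * \<tau>\<^sup>2 + \<eta> * ((4 * M + 2 * \<bar>m\<bar>) * \<tau>)"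
      by (simp add: y0 \<tau>_def[symmetric] C3_def power2_eq_square algebra_simps)
    obtain H where H: "\<And>r. (H has_real_derivative AR N \<epsilon> r) (at r)"
      and Hb: "\<And>s. 0 \<le> s \<Longrightarrow> 0 \<le> H s" "\<And>s. 0 \<le> s \<Longrightarrow> H s \<le> oint (RN N) 0 (s + 1)"
      using AR_antideriv[OF \<epsilon>(1,2) N] by blast
    have G_near: "\<bar>box_avg Gf \<epsilon> r (y r) - Gf t0 x0\<bar>
       \<le> C2 * (\<tau> + \<epsilon>) + K2 * ((N + 1) * (C0 + 1) * \<epsilon> + (\<eta> + 2 * \<bar>m\<bar> * M * \<tau>)) + K2 * AR N \<epsilon> r"
      if r: "t0 \<le> r" "r \<le> s" for r
    proof -
      let ?k = "C2 * (\<tau> + \<epsilon>) + K2 * ((N + 1) * (C0 + 1) * \<epsilon> + (\<eta> + 2 * \<bar>m\<bar> * M * \<tau>))"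
      have "\<bar>box_avg Gf \<epsilon> r (y r) - Gf t0 x0\<bar> \<le> box_avg (\<lambda>r z. ?k + K2 * RN N r) \<epsilon> r (y r)"
      proof (rule box_avg_diff_const_le[OF Gf_section_int section_int_add[OF section_int_const section_int_cmult[OF section_int_time[OF RN_li[OF N]]]] \<epsilon>(1) T_AE r0[OF r(1)]])
        fix r' z assume r': "r' \<in> T" "r \<le> r'" "r' \<le> r + \<epsilon>" and z: "y r \<le> z" "z \<le> y r + \<epsilon>"
        interpret p': profile "u r'" "ux r'" "e r'" h M by (rule prof[OF r'(1)])
        \<comment> \<open>The averaged E along the path is prescribed, so E at points of the square
          is known up to its oscillation there; the forcing at time t0 is Lipschitz in E.\<close>
        have "\<bar>box_avg E \<epsilon> r (y r) - E r' z\<bar> \<le> box_avg (\<lambda>r z. (N + 1) * (C0 + 1) * \<epsilon> + RN N r') \<epsilon> r (y r)"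
        proof (rule box_avg_diff_const_le[OF E_section_int section_int_const \<epsilon>(1) T_AE r0[OF r(1)]])
          fix r'' z' assume "r'' \<in> T" "r \<le> r''" "r'' \<le> r + \<epsilon>" "y r \<le> z'" "z' \<le> y r + \<epsilon>"
          then have "\<bar>E r' z - E r'' z'\<bar> \<le> (N + 1) * (C0 + 1) * \<epsilon> + RN N r'"
            by (intro E_osc[OF r'(1) _ _ _ \<epsilon>C N]) (use r' z in auto)
          then show "\<bar>E r'' z' - E r' z\<bar> \<le> (N + 1) * (C0 + 1) * \<epsilon> + RN N r'" by (simp add: abs_minus_commute)
        qed
        then have 1: "\<bar>box_avg E \<epsilon> r (y r) - E r' z\<bar> \<le> (N + 1) * (C0 + 1) * \<epsilon> + RN N r'" using \<epsilon>(1) by (simp add: box_avg_const)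
        have "\<bar>2 * m * a * (r - t0)\<bar> = (2 * \<bar>m\<bar>) * \<bar>a\<bar> * (r - t0)" using r by (simp add: abs_mult)
        also have "\<dots> \<le> (2 * \<bar>m\<bar>) * M * \<tau>" using r a M_nonneg by (intro mult_mono) (auto simp: \<tau>_def)
        finally have 2: "\<bar>E r' z - E t0 x0\<bar> \<le> ((N + 1) * (C0 + 1) * \<epsilon> + (\<eta> + 2 * \<bar>m\<bar> * M * \<tau>)) + RN N r'"
          using 1 E0 yE[of r] by linarith
        have "\<bar>Gf r' (X r' (E r' z)) - Gf t0 (X t0 (E r' z))\<bar> \<le> C2 * \<bar>r' - t0\<bar>" by (rule G_time[OF t0 r'(1)])
        also have "\<dots> \<le> C2 * (\<tau> + \<epsilon>)" using C2_nonneg r r' by (intro mult_left_mono) (auto simp: \<tau>_def)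
        finally have 3: "\<bar>Gf r' z - Gf t0 (X t0 (E r' z))\<bar> \<le> C2 * (\<tau> + \<epsilon>)" by simp
        have "\<bar>Gf t0 (X t0 (E r' z)) - Gf t0 x0\<bar> \<le> K2 * \<bar>E r' z - E t0 x0\<bar>"
          using p0.G_lip[of "X t0 (E r' z)" x0] by (simp add: Gf_eq[OF t0] K2_def)
        also have "\<dots> \<le> K2 * (((N + 1) * (C0 + 1) * \<epsilon> + (\<eta> + 2 * \<bar>m\<bar> * M * \<tau>)) + RN N r')"
          by (intro mult_left_mono 2 K2)
        finally show "\<bar>Gf r' z - Gf t0 x0\<bar> \<le> ?k + K2 * RN N r'" using 3 by (simp add: distrib_left)
      qed
      also have "\<dots> = ?k + K2 * AR N \<epsilon> r"
        using \<epsilon>(1) by (simp add: box_avg_add section_int_const section_int_cmult section_int_time RN_li N box_avg_const box_avg_cmult box_avg_time AR_def)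
      finally show ?thesis .
    qed
    define \<kappa> where "\<kappa> = (M * CH * \<eta> + 4 * M * CH * l * N * \<epsilon>) + \<bar>m\<bar> * (C1 * \<tau> + \<eta>)
      + (C2 * (\<tau> + \<epsilon>) + K2 * ((N + 1) * (C0 + 1) * \<epsilon> + (\<eta> + 2 * \<bar>m\<bar> * M * \<tau>)))"
    have "\<bar>box_avg u \<epsilon> s (y s) - box_avg u \<epsilon> t0 (y t0) - Gf t0 x0 * (s - t0)\<bar> \<le> \<kappa> * (s - t0) + D * (H s - H t0)"
    proof (rule increment_bound[where H' = "AR N \<epsilon>", OF le dg H])
      fix r assume r: "t0 \<le> r" "r \<le> s"
      have "4 * M * CH * (sqrt \<epsilon> * box_avg aux \<epsilon> r (y r)) \<le> 4 * M * CH * (1 / (4 * l) + l * (N * \<epsilon> + AR N \<epsilon> r))"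
        using mch by (intro mult_left_mono sqrt_box_avg_aux[OF \<epsilon>(1,2) r0[OF r(1)] l N]) auto
      also have "\<dots> = (M * CH * \<eta> + 4 * M * CH * l * N * \<epsilon>) + 4 * M * CH * l * AR N \<epsilon> r"
        by (simp add: l_def algebra_simps)
      finally have 1: "4 * M * CH * (sqrt \<epsilon> * box_avg aux \<epsilon> r (y r)) \<le> \<dots>" .
      have 2: "\<bar>m\<bar> * \<bar>box_avg u \<epsilon> r (y r) - a\<bar> \<le> \<bar>m\<bar> * (C1 * \<tau> + \<eta>)" by (intro mult_left_mono ba[OF r]) simp
      have "\<bar>box_avg ru \<epsilon> r (y r) + box_avg ux \<epsilon> r (y r) * path_speed a \<epsilon> r (y r) - Gf t0 x0\<bar> \<le> \<kappa> + (K2 * AR N \<epsilon> r + 4 * M * CH * l * AR N \<epsilon> r)"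
        unfolding \<kappa>_def
        using value_speed_near[OF \<epsilon>(1,2) r0[OF r(1)], of "y r" a] 1 2 G_near[OF r] by linarith
      then show "\<bar>box_avg ru \<epsilon> r (y r) + box_avg ux \<epsilon> r (y r) * path_speed a \<epsilon> r (y r) - Gf t0 x0\<bar> \<le> \<kappa> + D * AR N \<epsilon> r"
        by (simp add: D_def distrib_right)
    qed
    moreover have "D * (H s - H t0) \<le> \<eta>"
    proof -
      have "D * (H s - H t0) \<le> D * oint (RN N) 0 (s + 1)"
        using Hb(1)[OF T_nonneg[OF t0]] Hb(2)[OF T_nonneg[OF s]] D by (intro mult_left_mono) auto
      then show ?thesis using DR by linarith
    qed
    moreover have "\<kappa> * \<tau> \<le> C4 * \<tau>\<^sup>2 + \<eta> * ((M * CH + 1 + \<bar>m\<bar> + K2) * \<tau>)"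
    proof -
      have "\<kappa> = C4 * \<tau> + \<eta> * (M * CH + \<bar>m\<bar> + K2) + D2 * \<epsilon>"
        unfolding \<kappa>_def D2_def C4_def K2_def[symmetric] by (simp add: algebra_simps)
      then have "\<kappa> \<le> C4 * \<tau> + \<eta> * (M * CH + 1 + \<bar>m\<bar> + K2)" using \<epsilon>D by (simp add: algebra_simps)
      then have "\<kappa> * \<tau> \<le> (C4 * \<tau> + \<eta> * (M * CH + 1 + \<bar>m\<bar> + K2)) * \<tau>" using \<tau> by (intro mult_right_mono)
      then show ?thesis by (simp add: power2_eq_square distrib_right mult.assoc)
    qed
    ultimately have gs: "\<bar>box_avg u \<epsilon> s (y s) - box_avg u \<epsilon> t0 x0 - Gf t0 x0 * \<tau>\<bar>
        \<le> C4 * \<tau>\<^sup>2 + \<eta> * ((M * CH + 1 + \<bar>m\<bar> + K2) * \<tau>) + \<eta>"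
      using y0 by (simp add: \<tau>_def[symmetric])
    have dE: "\<bar>E s (y s) - \<beta>\<bar> \<le> 2 * \<eta>" using E0 Es[of "y s"] yE[of s] by (simp add: \<beta>_def)
    have 1: "\<bar>y s - X s \<beta>\<bar> \<le> 2 * \<eta>" using ps.E_abs_ge[of "y s" "X s \<beta>"] dE by simp
    have 2: "\<bar>u s (y s) - u s (X s \<beta>)\<bar> \<le> \<eta>" using ps.u_lip[of "y s" "X s \<beta>"] dE by simp
    have 3: "\<bar>box_avg u \<epsilon> s (y s) - u s (y s)\<bar> \<le> \<eta>" "\<bar>box_avg u \<epsilon> t0 x0 - a\<bar> \<le> \<eta>"
      using u_lim[OF s \<epsilon>(1,2), of "y s"] u_lim[OF t0 \<epsilon>(1,2), of x0] \<epsilon>(4) by (auto simp: a_def)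
    have "\<bar>X s \<beta> - x0 + a\<^sup>2 * \<tau>\<bar> \<le> C3 * \<tau>\<^sup>2 + \<eta> * ((4 * M + 2 * \<bar>m\<bar>) * \<tau>) + 2 * \<eta>"
      using ys 1 by linarith
    moreover have "\<bar>u s (X s \<beta>) - a - Gf t0 x0 * \<tau>\<bar> \<le> C4 * \<tau>\<^sup>2 + \<eta> * ((M * CH + 1 + \<bar>m\<bar> + K2) * \<tau>) + 4 * \<eta>"
      using gs 2 3 by linarith
    ultimately show ?thesis by (simp add: distrib_left mult.commute)
  qed
  have lim: "A \<le> B" if "\<And>\<eta>. \<eta> > 0 \<Longrightarrow> A \<le> B + \<eta> * K" "0 \<le> K" for A B K :: real
  proof (rule field_le_epsilon)
    fix \<eta> :: real assume "\<eta> > 0"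
    then have "A \<le> B + \<eta> / (K + 1) * K" using that(2) by (intro that(1)) simp
    also have "\<eta> / (K + 1) * K \<le> \<eta> / (K + 1) * (K + 1)" using that(2) \<open>\<eta> > 0\<close> by (intro mult_left_mono) auto
    finally show "A \<le> B + \<eta>" using that(2) by simp
  qed
  show "\<bar>X s \<beta> - x0 + a\<^sup>2 * (s - t0)\<bar> \<le> C3 * (s - t0)\<^sup>2"
    unfolding \<tau>_def[symmetric]
    by (rule lim[of _ _ "(4 * M + 2 * \<bar>m\<bar>) * \<tau> + 2"]) (use * M_nonneg \<tau> in auto)
  show "\<bar>u s (X s \<beta>) - a - Gf t0 x0 * (s - t0)\<bar> \<le> C4 * (s - t0)\<^sup>2"
    unfolding \<tau>_def[symmetric]
    by (rule lim[of _ _ "(M * CH + 1 + \<bar>m\<bar> + K2) * \<tau> + 4"]) (use * mch K2 \<tau> in auto)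
qed

end

subsection \<open>Stability in energy coordinates\<close>

lemma abs_diff_via:
  fixes x y k x' y' k' z :: real
  assumes "\<bar>x - y - k\<bar> \<le> c" "\<bar>x' - y' - k'\<bar> \<le> c" "\<bar>y - y'\<bar> \<le> \<mu>" "\<bar>k - k'\<bar> \<le> p" "\<bar>z - x'\<bar> \<le> q"
  shows "\<bar>x - z\<bar> \<le> \<mu> + p + q + 2 * c"
proof -
  have "\<bar>x - z\<bar> = \<bar>(x - y - k) + (y - y') + (k - k') - (x' - y' - k') - (z - x')\<bar>" by simp
  also have "\<dots> \<le> \<bar>x - y - k\<bar> + \<bar>y - y'\<bar> + \<bar>k - k'\<bar> + \<bar>x' - y' - k'\<bar> + \<bar>z - x'\<bar>"
    by linarith
  also have "\<dots> \<le> c + \<mu> + p + c + q" by (intro add_mono assms)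
  finally show ?thesis by simp
qed

context flow
begin

lemma T_dense:
  assumes "0 \<le> a" "a < b" shows "\<exists>t\<in>T. a < t \<and> t < b"
proof (rule ccontr)
  assume *: "\<not> (\<exists>t\<in>T. a < t \<and> t < b)"
  have "AE t in lborel. t \<notin> {a<..<b}"
    using T_AE by eventually_elim (use * assms in auto)
  then have "{a<..<b} \<in> null_sets lborel" by (subst (asm) AE_iff_null_sets[symmetric]) auto
  then show False using assms(2) by (simp add: null_sets_def)
qed

text \<open>Conservation (iii) fixes m at almost every time and says nothing about t = 0. At a fixed
  energy level X and U are Lipschitz in time up to 0, and the mean depends on them continuously by
  \<open>m_compare\<close>; so m is the mean of the initial datum, the same for every
  solution.\<close>

lemma mean_initial:
  assumes mean: "\<And>t. t \<in> T \<Longrightarrow> 0 < t \<Longrightarrow> profile.m (u t) (ux t) = m"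
  shows "profile.m (u 0) (ux 0) = m"
proof -
  define K where "K = \<bar>two_profiles.cm h M\<bar> * (C0 + C1)"
  have K: "0 \<le> K" using C_nonneg by (simp add: K_def)
  have *: "\<bar>m - profile.m (u 0) (ux 0)\<bar> \<le> K * t" if t: "t \<in> T" "0 < t" for t
  proof -
    interpret pt: profile "u t" "ux t" "e t" h M by (rule prof[OF t(1)])
    interpret p0: profile "u 0" "ux 0" "e 0" h M by (rule prof[OF T0])
    interpret two_profiles "u t" "ux t" "e t" "u 0" "ux 0" "e 0" h M by unfold_locales
    have C: "C0 * t \<le> (C0 + C1) * t" "C1 * t \<le> (C0 + C1) * t"
      using C_nonneg t(2) by (intro mult_right_mono; simp)+
    have X: "\<bar>X t b - X 0 b\<bar> \<le> (C0 + C1) * t" "\<bar>U t b - U 0 b\<bar> \<le> (C0 + C1) * t" for b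
    proof -
      have t': "\<bar>t - 0\<bar> = t" using t(2) by simp
      show "\<bar>X t b - X 0 b\<bar> \<le> (C0 + C1) * t" "\<bar>U t b - U 0 b\<bar> \<le> (C0 + C1) * t"
        using X_time[OF T0 t(1), of b] C unfolding t' by linarith+
    qed
    have "\<bar>pt.m - p0.m\<bar> \<le> cm * ((C0 + C1) * t)" by (rule m_compare[OF X])
    also have "\<dots> \<le> \<bar>cm\<bar> * ((C0 + C1) * t)" using C_nonneg t by (intro mult_right_mono) auto
    finally show ?thesis using mean[OF t] by (simp add: K_def mult.assoc)
  qed
  have "\<bar>m - profile.m (u 0) (ux 0)\<bar> \<le> 0"
  proof (rule field_le_epsilon)
    fix \<eta> :: real assume "\<eta> > 0"
    then obtain t where t: "t \<in> T" "0 < t" "t < \<eta> / (K + 1)" using T_dense[of 0 "\<eta> / (K + 1)"] K by auto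
    have "K * t \<le> (K + 1) * (\<eta> / (K + 1))" using t K by (intro mult_mono) auto
    then show "\<bar>m - profile.m (u 0) (ux 0)\<bar> \<le> 0 + \<eta>" using *[OF t(1,2)] K by simp
  qed
  then show ?thesis by simp
qed

end

section \<open>Two flows with the same initial datum\<close>

locale two_flows = f1: flow u1 ux1 T h M m G1 e1 + f2: flow u2 ux2 T h M m G2 e2
  for u1 ux1 u2 ux2 T h M m G1 e1 G2 e2 +
  assumes init: "u1 0 = u2 0" "ux1 0 = ux2 0" "e1 0 = e2 0"
begin

definition near :: "real \<Rightarrow> real \<Rightarrow> bool" where
  "near t \<mu> \<longleftrightarrow> (\<forall>\<beta>. \<bar>f1.X t \<beta> - f2.X t \<beta>\<bar> \<le> \<mu> \<and> \<bar>f1.U t \<beta> - f2.U t \<beta>\<bar> \<le> \<mu>)"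

text \<open>The part 2 M comes from the drift a^2, 2 |m| from the mismatch of end levels, |cG| from
  the forcing, and each remainder counts twice, once per solution. One constant serves for the
  growth factor and for the quadratic error.\<close>

definition K :: real where
  "K = 2 * M + 2 * \<bar>m\<bar> + \<bar>two_profiles.cG h M\<bar> + 2 * f1.C3 + 2 * f1.C4"

lemma C34_nonneg: "0 \<le> f1.C3" "0 \<le> f1.C4"
proof -
  interpret p: profile "u1 0" "ux1 0" "e1 0" h M by (rule f1.prof[OF f1.T0])
  show "0 \<le> f1.C3" "0 \<le> f1.C4"
    using f1.C_nonneg f1.M_nonneg f1.C2_nonneg p.K2_nonneg by (simp_all add: f1.C3_def f1.C4_def)
qed

lemma K_nonneg: "0 \<le> K" using C34_nonneg f1.M_nonneg by (simp add: K_def)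

text \<open>Paths of the two solutions that start on the same level \<beta>0 end on levels that
  differ by 2 |m| \<tau> |a1 - a2|. So \<beta>0 is chosen to bring the first path exactly to the
  given \<beta>', and the mismatch for the second solution is absorbed by its Lipschitz bounds in
  \<beta> at the final time.\<close>

lemma near_step:
  assumes t: "t \<in> T" and s: "s \<in> T" and le: "t \<le> s" and nr: "near t \<mu>"
  shows "near s ((1 + K * (s - t)) * \<mu> + K * (s - t)\<^sup>2)"
  unfolding near_def
proof
  fix \<beta>'
  define \<tau> where "\<tau> = s - t"
  have \<tau>: "0 \<le> \<tau>" using le by (simp add: \<tau>_def)
  interpret p1: profile "u1 t" "ux1 t" "e1 t" h M by (rule f1.prof[OF t])
  interpret p2: profile "u2 t" "ux2 t" "e2 t" h M by (rule f2.prof[OF t])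
  interpret pp: two_profiles "u1 t" "ux1 t" "e1 t" "u2 t" "ux2 t" "e2 t" h M by unfold_locales
  interpret s1: profile "u1 s" "ux1 s" "e1 s" h M by (rule f1.prof[OF s])
  interpret s2: profile "u2 s" "ux2 s" "e2 s" h M by (rule f2.prof[OF s])
  have dX: "\<bar>p1.X \<beta> - p2.X \<beta>\<bar> \<le> \<mu>" and dU: "\<bar>p1.U \<beta> - p2.U \<beta>\<bar> \<le> \<mu>" for \<beta> using nr by (auto simp: near_def)
  have \<mu>: "0 \<le> \<mu>" using dX[of 0] by simp
  obtain \<beta>0 where \<beta>0: "\<beta>0 - 2 * m * p1.U \<beta>0 * \<tau> = \<beta>'"
  proof -
    \<comment> \<open>U is continuous and bounded by M, so the map from start level to end level
      moves no point by more than \<open>?c\<close>; the intermediate value theorem applies on an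
      interval of that radius.\<close>
    let ?f = "\<lambda>\<beta>. \<beta> - 2 * m * p1.U \<beta> * \<tau>" and ?c = "2 * \<bar>m\<bar> * M * \<tau>"
    have b: "\<bar>2 * m * p1.U \<beta> * \<tau>\<bar> \<le> ?c" for \<beta>
      using \<tau> f1.M_nonneg by (auto simp: abs_mult p1.U_def intro!: mult_mono p1.u_bound)
    have "continuous_on UNIV p1.U"
    proof (rule continuous_onI)
      fix x e :: real assume "e > 0"
      have "dist (p1.U x') (p1.U x) \<le> e" if "dist x' x < e" for x'
      proof -
        have "1/2 * \<bar>x' - x\<bar> \<le> \<bar>x' - x\<bar>" by simp
        with p1.U_lip[of x' x] that show ?thesis unfolding dist_real_def by (meson less_imp_le order_trans)
      qed
      then show "\<exists>d>0. \<forall>x'\<in>UNIV. dist x' x < d \<longrightarrow> dist (p1.U x') (p1.U x) \<le> e"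
        using \<open>e > 0\<close> by blast
    qed
    then have "continuous_on UNIV ?f" by (intro continuous_intros)
    then have "continuous_on {\<beta>' - ?c..\<beta>' + ?c} ?f" by (rule continuous_on_subset) simp
    moreover have "?f (\<beta>' - ?c) \<le> \<beta>'" "\<beta>' \<le> ?f (\<beta>' + ?c)" "\<beta>' - ?c \<le> \<beta>' + ?c"
      using b[of "\<beta>' - ?c"] b[of "\<beta>' + ?c"] by linarith+
    ultimately show thesis using IVT'[of ?f "\<beta>' - ?c" \<beta>' "\<beta>' + ?c"] that by blast
  qed
  define a1 where "a1 = p1.U \<beta>0"
  define a2 where "a2 = p2.U \<beta>0"
  define \<beta>'' where "\<beta>'' = \<beta>0 - 2 * m * a2 * \<tau>"
  have 1: "\<bar>s1.X \<beta>' - p1.X \<beta>0 + a1\<^sup>2 * \<tau>\<bar> \<le> f1.C3 * \<tau>\<^sup>2"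
    "\<bar>s1.U \<beta>' - a1 - G1 t (p1.X \<beta>0) * \<tau>\<bar> \<le> f1.C4 * \<tau>\<^sup>2"
    using f1.path_expansion[OF t s le, of "p1.X \<beta>0"] \<beta>0 by (simp_all add: \<tau>_def[symmetric] a1_def p1.U_def s1.U_def)
  have 2: "\<bar>s2.X \<beta>'' - p2.X \<beta>0 + a2\<^sup>2 * \<tau>\<bar> \<le> f1.C3 * \<tau>\<^sup>2"
    "\<bar>s2.U \<beta>'' - a2 - G2 t (p2.X \<beta>0) * \<tau>\<bar> \<le> f1.C4 * \<tau>\<^sup>2"
    using f2.path_expansion[OF t s le, of "p2.X \<beta>0"] by (simp_all add: \<tau>_def[symmetric] a2_def p2.U_def s2.U_def \<beta>''_def)
  have da: "\<bar>a1 - a2\<bar> \<le> \<mu>" using dU[of \<beta>0] by (simp add: a1_def a2_def)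
  have "\<beta>' - \<beta>'' = (2 * m * \<tau>) * (a2 - a1)" using \<beta>0 by (simp add: \<beta>''_def a1_def algebra_simps)
  then have "\<bar>\<beta>' - \<beta>''\<bar> = (2 * \<bar>m\<bar> * \<tau>) * \<bar>a1 - a2\<bar>" using \<tau> by (simp add: abs_mult abs_minus_commute)
  also have "\<dots> \<le> (2 * \<bar>m\<bar> * \<tau>) * \<mu>" using \<tau> by (intro mult_left_mono da) auto
  finally have d\<beta>: "\<bar>\<beta>' - \<beta>''\<bar> \<le> 2 * (\<bar>m\<bar> * \<tau> * \<mu>)" by (simp add: mult.assoc)
  have 3: "\<bar>s2.X \<beta>' - s2.X \<beta>''\<bar> \<le> 2 * (\<bar>m\<bar> * \<tau> * \<mu>)" using s2.X_lip[of \<beta>' \<beta>''] d\<beta> by linarith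
  have 4: "\<bar>s2.U \<beta>' - s2.U \<beta>''\<bar> \<le> \<bar>m\<bar> * \<tau> * \<mu>" 
  proof -
    have "2 * \<bar>s2.U \<beta>' - s2.U \<beta>''\<bar> \<le> \<bar>\<beta>' - \<beta>''\<bar>" using s2.U_lip[of \<beta>' \<beta>''] by simp
    also note d\<beta>
    finally show ?thesis by simp
  qed
  have "a1\<^sup>2 * \<tau> - a2\<^sup>2 * \<tau> = (a1 + a2) * (a1 - a2) * \<tau>"
    by (simp add: power2_eq_square algebra_simps)
  then have "\<bar>a1\<^sup>2 * \<tau> - a2\<^sup>2 * \<tau>\<bar> = \<bar>a1 + a2\<bar> * \<bar>a1 - a2\<bar> * \<tau>"
    using \<tau> by (simp only: abs_mult abs_of_nonneg)
  also have "\<dots> \<le> (2 * M) * \<mu> * \<tau>"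
    using \<tau> da f1.M_nonneg p1.u_bound[of "p1.X \<beta>0"] p2.u_bound[of "p2.X \<beta>0"]
    by (intro mult_mono) (auto simp: a1_def a2_def p1.U_def p2.U_def)
  finally have 5: "\<bar>a1\<^sup>2 * \<tau> - a2\<^sup>2 * \<tau>\<bar> \<le> 2 * M * \<mu> * \<tau>" .
  have "\<bar>p1.G (p1.X \<beta>0) - p2.G (p2.X \<beta>0)\<bar> \<le> pp.cG * \<mu>"
    by (rule pp.G_compare[OF dX dU f1.h1])
  also have "\<dots> \<le> \<bar>pp.cG\<bar> * \<mu>" using \<mu> by (intro mult_right_mono) auto
  finally have "\<bar>G1 t (p1.X \<beta>0) - G2 t (p2.X \<beta>0)\<bar> * \<tau> \<le> \<bar>pp.cG\<bar> * \<mu> * \<tau>"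
    unfolding f1.Gf_eq[OF t] f2.Gf_eq[OF t] using \<tau> by (intro mult_right_mono)
  then have 6: "\<bar>G1 t (p1.X \<beta>0) * \<tau> - G2 t (p2.X \<beta>0) * \<tau>\<bar> \<le> \<bar>pp.cG\<bar> * \<mu> * \<tau>"
    using \<tau> unfolding left_diff_distrib[symmetric] by (simp add: abs_mult)
  let ?S = "2 * f1.C3 + 2 * f1.C4"
  have K: "(1 + K * \<tau>) * \<mu> + K * \<tau>\<^sup>2 = \<mu> + (2 * M + \<bar>pp.cG\<bar> + 2 * \<bar>m\<bar> + ?S) * (\<mu> * \<tau>)
      + (2 * M + 2 * \<bar>m\<bar> + \<bar>pp.cG\<bar>) * \<tau>\<^sup>2 + ?S * \<tau>\<^sup>2"
    by (simp add: K_def algebra_simps)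
  have RHS: "\<mu> + A * (\<mu> * \<tau>) + 2 * (c * \<tau>\<^sup>2) \<le> (1 + K * \<tau>) * \<mu> + K * \<tau>\<^sup>2"
    if "A \<le> 2 * M + \<bar>pp.cG\<bar> + 2 * \<bar>m\<bar> + ?S" "2 * c \<le> ?S" for A c
  proof -
    have "A * (\<mu> * \<tau>) \<le> (2 * M + \<bar>pp.cG\<bar> + 2 * \<bar>m\<bar> + ?S) * (\<mu> * \<tau>)"
      using that(1) \<mu> \<tau> by (intro mult_right_mono) auto
    moreover have "(2 * c) * \<tau>\<^sup>2 \<le> ?S * \<tau>\<^sup>2" using that(2) by (intro mult_right_mono) auto
    moreover have "0 \<le> (2 * M + 2 * \<bar>m\<bar> + \<bar>pp.cG\<bar>) * \<tau>\<^sup>2" using f1.M_nonneg by simp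
    ultimately show ?thesis unfolding K by simp
  qed
  have "\<bar>s1.X \<beta>' - s2.X \<beta>'\<bar> \<le> \<mu> + 2 * M * \<mu> * \<tau> + 2 * (\<bar>m\<bar> * \<tau> * \<mu>) + 2 * (f1.C3 * \<tau>\<^sup>2)"
  proof (rule abs_diff_via)
    show "\<bar>s1.X \<beta>' - p1.X \<beta>0 - - (a1\<^sup>2 * \<tau>)\<bar> \<le> f1.C3 * \<tau>\<^sup>2" "\<bar>s2.X \<beta>'' - p2.X \<beta>0 - - (a2\<^sup>2 * \<tau>)\<bar> \<le> f1.C3 * \<tau>\<^sup>2"
      using 1(1) 2(1) by simp_all
    show "\<bar>- (a1\<^sup>2 * \<tau>) - - (a2\<^sup>2 * \<tau>)\<bar> \<le> 2 * M * \<mu> * \<tau>" using 5 by (simp add: abs_minus_commute)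
  qed (rule dX 3)+
  also have "\<dots> = \<mu> + (2 * M + 2 * \<bar>m\<bar>) * (\<mu> * \<tau>) + 2 * (f1.C3 * \<tau>\<^sup>2)" by (simp add: algebra_simps)
  also have "\<dots> \<le> (1 + K * \<tau>) * \<mu> + K * \<tau>\<^sup>2" using C34_nonneg by (intro RHS) auto
  finally have X: "\<bar>s1.X \<beta>' - s2.X \<beta>'\<bar> \<le> (1 + K * \<tau>) * \<mu> + K * \<tau>\<^sup>2" .
  have "\<bar>s1.U \<beta>' - s2.U \<beta>'\<bar> \<le> \<mu> + \<bar>pp.cG\<bar> * \<mu> * \<tau> + \<bar>m\<bar> * \<tau> * \<mu> + 2 * (f1.C4 * \<tau>\<^sup>2)"
    by (rule abs_diff_via[OF 1(2) 2(2) da 6 4])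
  also have "\<dots> = \<mu> + (\<bar>pp.cG\<bar> + \<bar>m\<bar>) * (\<mu> * \<tau>) + 2 * (f1.C4 * \<tau>\<^sup>2)" by (simp add: algebra_simps)
  also have "\<dots> \<le> (1 + K * \<tau>) * \<mu> + K * \<tau>\<^sup>2" using C34_nonneg f1.M_nonneg by (intro RHS) auto
  finally have U: "\<bar>s1.U \<beta>' - s2.U \<beta>'\<bar> \<le> (1 + K * \<tau>) * \<mu> + K * \<tau>\<^sup>2" .
  show "\<bar>f1.X s \<beta>' - f2.X s \<beta>'\<bar> \<le> (1 + K * (s - t)) * \<mu> + K * (s - t)\<^sup>2 \<and>
      \<bar>f1.U s \<beta>' - f2.U s \<beta>'\<bar> \<le> (1 + K * (s - t)) * \<mu> + K * (s - t)\<^sup>2"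
    using X U by (simp only: \<tau>_def) 
qed

lemma near_mono: "near t \<mu> \<Longrightarrow> \<mu> \<le> \<nu> \<Longrightarrow> near t \<nu>"
  unfolding near_def by (blast intro: order_trans)

lemma near_0: "near 0 0"
  by (simp add: near_def init)

text \<open>Each of the n steps contributes at most 4 K \<delta>^2, amplified by at most exp (2 K
  S); as n \<delta> = S, the total is O(\<delta>).\<close>

lemma near_bound:
  assumes S: "S \<in> T" and n: "n > 0"
  defines "\<delta> \<equiv> S / real n"
  shows "near S (4 * K * \<delta> * S * exp (2 * K * S))"
proof (cases "S = 0")
  case True
  then show ?thesis using near_0 by simp
next
  case False
  then have Sp: "S > 0" using f1.T_nonneg[OF S] by simp
  have \<delta>: "\<delta> > 0" "real n * \<delta> = S" using Sp n by (auto simp: \<delta>_def)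
  have "\<exists>t. t \<in> T \<and> real i * \<delta> < t \<and> t < (real i + 1) * \<delta>" for i
    using f1.T_dense[of "real i * \<delta>" "(real i + 1) * \<delta>"] \<delta> by (auto simp: algebra_simps)
  then obtain c where c: "\<And>i. c i \<in> T" "\<And>i. real i * \<delta> < c i" "\<And>i. c i < (real i + 1) * \<delta>" by metis
  \<comment> \<open>The expansions hold only between times in T, so the multiples of \<delta> are
    replaced by nearby points of T. Consecutive ones may be 2 \<delta> apart, which explains (2
    \<delta>)^2 = 4 \<delta>^2 and the exponent 2 K.\<close>
  define g where "g i = (if i = 0 then 0 else if i = n then S else c i)" for i
  have gT: "g i \<in> T" for i using c(1) S f1.T0 by (simp add: g_def)
  have lo: "real i * \<delta> \<le> g i" for i using c(2)[of i] \<delta> by (auto simp: g_def)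
  have hi: "g i \<le> (real i + 1) * \<delta>" for i using c(3)[of i] \<delta> by (auto simp: g_def algebra_simps)
  have hi': "g i \<le> real (Suc i) * \<delta>" for i using hi[of i] by (simp add: add.commute)
  have step: "g i \<le> g (Suc i)" "g (Suc i) - g i \<le> 2 * \<delta>" for i
  proof -
    show "g i \<le> g (Suc i)" using hi'[of i] lo[of "Suc i"] by linarith
    show "g (Suc i) - g i \<le> 2 * \<delta>" using hi[of "Suc i"] lo[of i] by (simp add: algebra_simps)
  qed
  have "near (g i) (4 * K * \<delta>\<^sup>2 * real i * exp (2 * K * \<delta> * real i))" for i
  proof (induction i)
    case 0
    show ?case using near_0 by (simp add: g_def)
  next
    case (Suc i)
    let ?\<mu> = "4 * K * \<delta>\<^sup>2 * real i * exp (2 * K * \<delta> * real i)" and ?\<tau> = "g (Suc i) - g i"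
    have \<mu>: "0 \<le> ?\<mu>" using K_nonneg by simp
    have \<tau>: "0 \<le> ?\<tau>" "?\<tau> \<le> 2 * \<delta>" using step[of i] by auto
    have "1 + K * ?\<tau> \<le> 1 + 2 * K * \<delta>" using mult_left_mono[OF \<tau>(2) K_nonneg] by simp
    also have "\<dots> \<le> exp (2 * K * \<delta>)" by (rule exp_ge_add_one_self)
    finally have 1: "(1 + K * ?\<tau>) * ?\<mu> \<le> exp (2 * K * \<delta>) * ?\<mu>" by (intro mult_right_mono \<mu>)
    have "K * ?\<tau>\<^sup>2 \<le> K * (2 * \<delta>)\<^sup>2" using \<tau> by (intro mult_left_mono power_mono K_nonneg)
    also have "\<dots> = 4 * K * \<delta>\<^sup>2 * 1" by (simp add: power2_eq_square)
    also have "\<dots> \<le> 4 * K * \<delta>\<^sup>2 * exp (2 * K * \<delta> * real (Suc i))"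
      using K_nonneg \<delta> by (intro mult_left_mono) auto
    finally have 2: "K * ?\<tau>\<^sup>2 \<le> 4 * K * \<delta>\<^sup>2 * exp (2 * K * \<delta> * real (Suc i))" .
    have "exp (2 * K * \<delta>) * ?\<mu> = 4 * K * \<delta>\<^sup>2 * real i * exp (2 * K * \<delta> * real (Suc i))"
      by (simp add: exp_add[symmetric] algebra_simps)
    then have "(1 + K * ?\<tau>) * ?\<mu> + K * ?\<tau>\<^sup>2 \<le> 4 * K * \<delta>\<^sup>2 * real i * exp (2 * K * \<delta> * real (Suc i)) + 4 * K * \<delta>\<^sup>2 * exp (2 * K * \<delta> * real (Suc i))"
      using 1 2 by linarith
    also have "\<dots> = 4 * K * \<delta>\<^sup>2 * real (Suc i) * exp (2 * K * \<delta> * real (Suc i))" by (simp add: algebra_simps)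
    finally show ?case by (rule near_mono[OF near_step[OF gT gT step(1) Suc.IH]])
  qed
  from this[of n] have "near S (4 * K * \<delta>\<^sup>2 * real n * exp (2 * K * \<delta> * real n))" using n by (simp add: g_def)
  moreover have "4 * K * \<delta>\<^sup>2 * real n * exp (2 * K * \<delta> * real n) = 4 * K * \<delta> * (real n * \<delta>) * exp (2 * K * (real n * \<delta>))"
    by (simp add: power2_eq_square mult_ac)
  ultimately show ?thesis by (simp add: \<delta>(2))
qed

lemma near_zero:
  assumes S: "S \<in> T" shows "near S 0"
proof -
  have "(\<lambda>n. 4 * K * (S * (1 / real n)) * S * exp (2 * K * S)) \<longlonglongrightarrow> 4 * K * (S * 0) * S * exp (2 * K * S)"
    by (intro tendsto_intros lim_1_over_n)
  then have lim: "(\<lambda>n. 4 * K * (S / real n) * S * exp (2 * K * S)) \<longlonglongrightarrow> 0" by simp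
  have ev: "\<forall>\<^sub>F n in sequentially. near S (4 * K * (S / real n) * S * exp (2 * K * S))"
    by (rule eventually_sequentiallyI[of 1]) (use near_bound[OF S] in simp)
  have "\<bar>f1.X S \<beta> - f2.X S \<beta>\<bar> \<le> 0 \<and> \<bar>f1.U S \<beta> - f2.U S \<beta>\<bar> \<le> 0" for \<beta>
    by (intro conjI; rule tendsto_lowerbound[OF lim _ sequentially_bot]; rule eventually_mono[OF ev])
      (auto simp: near_def)
  then show ?thesis by (simp add: near_def)
qed

text \<open>Since X1 = X2, the point on the level E1(x) is x in both solutions, and its value is the
  common U.\<close>

theorem flows_agree:
  assumes S: "S \<in> T" shows "u1 S x = u2 S x"
proof -
  interpret p1: profile "u1 S" "ux1 S" "e1 S" h M by (rule f1.prof[OF S])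
  interpret p2: profile "u2 S" "ux2 S" "e2 S" h M by (rule f2.prof[OF S])
  have "p1.X b = p2.X b" "p1.U b = p2.U b" for b using near_zero[OF S] by (auto simp: near_def)
  then have "p1.X (p1.E x) = p2.X (p1.E x)" "p1.U (p1.E x) = p2.U (p1.E x)" by blast+
  then show ?thesis by (simp add: p1.U_def p2.U_def)
qed

end

subsection \<open>Consequences of the weak identities\<close>

text \<open>The half-lines form an intersection-stable generator of the Borel sets, so all set
  integrals vanish, and a density is determined by its set integrals.\<close>

lemma AE_zero_if_lessThan_integrals_zero:
  fixes f :: "real \<Rightarrow> real"
  assumes f: "integrable lborel f" and z: "\<And>a. (LINT x:{..<a}|lborel. f x) = 0"
  shows "AE x in lborel. f x = 0"
proof (rule density_unique_real[OF f, of "\<lambda>x. 0"])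
  fix A assume "A \<in> sets (lborel :: real measure)"
  then have A: "A \<in> sigma_sets UNIV (range (\<lambda>a::real. {..<a}))"
    by (simp add: borel_Iio)
  have si: "set_integrable lborel B f" if "B \<in> sets borel" for B
    unfolding set_integrable_def using that by (intro integrable_mult_indicator f) simp
  have UNIV0: "(LINT x:UNIV|lborel. f x) = 0"
  proof -
    have "(\<lambda>n. LINT x:{..<real n}|lborel. f x) \<longlonglongrightarrow> (LINT x:(\<Union>n. {..<real n})|lborel. f x)"
      by (rule set_integral_cont_up) (auto simp: incseq_def intro: si)
    moreover have "(\<Union>n. {..<real n}) = UNIV" using reals_Archimedean2 by auto
    ultimately show ?thesis using z by (simp add: LIMSEQ_const_iff)
  qed
  have "(LINT x:A|lborel. f x) = 0"
  proof (rule sigma_sets_induct_disjoint[OF _ _ A])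
    show "Int_stable (range (\<lambda>a::real. {..<a}))"
    proof -
      have "{..<a} \<inter> {..<b} = {..<min a b}" for a b :: real by auto
      then show ?thesis by (auto simp: Int_stable_def)
    qed
    show "(LINT x:A|lborel. f x) = 0" if "A \<in> range lessThan" for A using that z by auto
    show "(LINT x:UNIV - A|lborel. f x) = 0"
      if "A \<in> sigma_sets UNIV (range lessThan)" "(LINT x:A|lborel. f x) = 0" for A
    proof -
      have As: "A \<in> sets borel" using that(1) by (simp add: borel_Iio)
      have "(LINT x:A \<union> (UNIV - A)|lborel. f x) = (LINT x:A|lborel. f x) + (LINT x:UNIV - A|lborel. f x)"
        using As by (intro set_integral_Un si) auto
      then show ?thesis using that(2) UNIV0 by simp
    qed
    show "(LINT x:(\<Union>i. A i)|lborel. f x) = 0"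
      if "disjoint_family A" "range A \<subseteq> sigma_sets UNIV (range lessThan)" "\<And>i. (LINT x:A i|lborel. f x) = 0" for A :: "nat \<Rightarrow> real set"
    proof -
      have As: "A i \<in> sets borel" for i using that(2) by (auto simp: borel_Iio)
      have "(LINT x:(\<Union>i. A i)|lborel. f x) = (\<Sum>i. LINT x:A i|lborel. f x)"
        by (rule lebesgue_integral_countable_add) (use that(1) As in \<open>auto simp: disjoint_family_on_def intro!: si\<close>)
      then show ?thesis using that(3) by simp
    qed
  qed (auto simp: set_lebesgue_integral_def)
  then show "(LINT x:A|lborel. f x) = (LINT x:A|lborel. 0)" by simp
qed auto

lemma AE_zero_if_oint_zero:
  assumes f: "loc_int f" and z: "\<And>b. c \<le> b \<Longrightarrow> oint f c b = 0"
  shows "AE x in lborel. c \<le> x \<longrightarrow> f x = 0"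
proof -
  have "AE x in lborel. x \<in> {c..c + real n} \<longrightarrow> f x = 0" for n :: nat
  proof -
    let ?g = "\<lambda>x. indicator {c..c + real n} x * f x"
    have "AE x in lborel. ?g x = 0"
    proof (rule AE_zero_if_lessThan_integrals_zero)
      show "integrable lborel ?g" using loc_int_set[OF f, of c "c + real n"] by (simp add: set_integrable_def)
      fix a :: real
      have fm: "f \<in> borel_measurable borel" using f by (simp add: loc_int_def)
      show "(LINT x:{..<a}|lborel. ?g x) = 0"
      proof (cases "c \<le> a")
        case True
        have "(LINT x:{..<a}|lborel. ?g x) = (LINT x:{c..min a (c + real n)}|lborel. f x)"
          unfolding set_lebesgue_integral_def
        proof (rule integral_cong_AE)
          show "AE x in lborel. indicator {..<a} x *\<^sub>R ?g x = indicator {c..min a (c + real n)} x *\<^sub>R f x"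
            using AE_lborel_singleton[of a] by eventually_elim (auto simp: indicator_def)
        qed (use fm in measurable)
        also have "\<dots> = oint f c (min a (c + real n))" using True by (simp add: oint_Icc)
        finally show ?thesis using z[of "min a (c + real n)"] True by simp
      next
        case False
        then have "indicator {..<a} x *\<^sub>R ?g x = 0" for x by (auto simp: indicator_def)
        then show ?thesis
          unfolding set_lebesgue_integral_def by (intro integral_eq_zero_AE AE_I2)
      qed
    qed
    then show ?thesis by eventually_elim (auto simp: indicator_def)
  qed
  then have "AE x in lborel. \<forall>n::nat. x \<in> {c..c + real n} \<longrightarrow> f x = 0" unfolding AE_all_countable by blast
  then show ?thesis
  proof eventually_elim
    case (elim x)
    obtain n :: nat where "x - c \<le> real n" using real_arch_simple by blast
    then show ?case using elim[rule_format, of n] by simp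
  qed
qed

lemma periodic_int: 
  fixes f :: "real \<Rightarrow> 'a" assumes "\<And>x. f (x + 1) = f x" shows "f (x + of_int n) = f x"
proof (induction n rule: int_induct[of _ 0])
  case (step1 i)
  then show ?case using assms[of "x + of_int i"] by (simp add: add.assoc)
next
  case (step2 i)
  then show ?case using assms[of "x + of_int i - 1"] by (simp add: algebra_simps)
qed simp

lemma periodic_frac:
  fixes f :: "real \<Rightarrow> 'a" assumes "\<And>x. f (x + 1) = f x" shows "f x = f (frac x)"
  using periodic_int[of f "frac x" "\<lfloor>x\<rfloor>", OF assms] by (simp add: frac_def)

text \<open>With c the midpoint and r the half-length of the arc, cos (2 pi (x - c)) - cos (2 pi r)
  is smooth, periodic and positive exactly on the arc; \<open>kbump\<close> of its n-fold multiple
  tends to the indicator.\<close>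

lemma smooth_periodic_indicator:
  assumes ab: "0 \<le> a" "a < b" "b \<le> 1"
  shows "\<exists>\<rho>::nat \<Rightarrow> real \<Rightarrow> real. (\<forall>n. smooth1 (\<rho> n) \<and> periodic1 (\<rho> n) \<and> (\<forall>x. 0 \<le> \<rho> n x \<and> \<rho> n x \<le> 1)) \<and>
    (\<forall>x. 0 \<le> x \<longrightarrow> x \<le> 1 \<longrightarrow> (\<lambda>n. \<rho> n x) \<longlonglongrightarrow> indicator {a<..<b} x)"
proof -
  define c where "c = (a + b) / 2"
  define r where "r = (b - a) / 2"
  have "c + r = b" "c - r = a" by (simp_all add: c_def r_def field_simps)
  then have r: "0 < r" "r \<le> 1/2" "r \<le> c" "c \<le> 1 - r" using ab by auto
  define \<rho> where "\<rho> n x = kbump (real n * (cos (2 * pi * (x - c)) - cos (2 * pi * r)))" for n :: nat and x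
  have "smooth1 (\<lambda>x. (2 * pi) * x + (- 2 * pi * c))" by (rule smooth1_affine)
  then have sc: "smooth1 (\<lambda>x. cos (2 * pi * (x - c)))"
    using smooth1_comp[OF smooth1_cos] by (simp add: algebra_simps)
  have s: "smooth1 (\<rho> n)" for n
  proof -
    have "smooth1 (\<lambda>x. real n * (cos (2 * pi * (x - c)) + (- cos (2 * pi * r))))"
      by (rule smooth1_mult[OF smooth1_const smooth1_add[OF sc smooth1_const]])
    from smooth1_comp[OF smooth1_kbump this] show ?thesis unfolding \<rho>_def by simp
  qed
  have p: "periodic1 (\<rho> n)" for n
  proof -
    have "cos (2 * pi * (x + 1 - c)) = cos (2 * pi * (x - c))" for x
    proof -
      have "2 * pi * (x + 1 - c) = 2 * pi * (x - c) + 2 * pi" by (simp add: algebra_simps)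
      then show ?thesis by (simp only: cos_periodic)
    qed
    then show ?thesis by (simp add: periodic1_def \<rho>_def)
  qed
  have lim: "(\<lambda>n. \<rho> n x) \<longlonglongrightarrow> indicator {a<..<b} x" if x: "0 \<le> x" "x \<le> 1" for x
  proof -
    define y where "y = \<bar>x - c\<bar>"
    have y: "0 \<le> y" "y \<le> 1 - r" using x r by (auto simp: y_def)
    have cy: "cos (2 * pi * (x - c)) = cos (2 * pi * y)"
    proof (cases "x \<ge> c")
      case False
      then have "2 * pi * y = - (2 * pi * (x - c))" by (simp add: y_def algebra_simps)
      then show ?thesis by (simp only: cos_minus)
    qed (simp add: y_def)
    have iff: "cos (2 * pi * r) < cos (2 * pi * y) \<longleftrightarrow> y < r"
    proof (cases "y \<le> 1/2")
      case True
      then show ?thesis using y r by (subst cos_mono_less_eq) auto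
    next
      case False
      \<comment> \<open>Here y is a distance on the line and exceeds 1/2; the distance on the circle
        is then 1 - y, still at least r.\<close>
      have "cos (2 * pi * y) = cos (2 * pi * (1 - y))"
        using cos_periodic[of "- (2 * pi * y)"] by (simp add: algebra_simps)
      moreover have "cos (2 * pi * (1 - y)) \<le> cos (2 * pi * r)"
        using False y r by (subst cos_mono_le_eq) auto
      ultimately show ?thesis using False r by simp
    qed
    have "y < r \<longleftrightarrow> x \<in> {a<..<b}" by (auto simp: y_def c_def r_def abs_if field_simps)
    then have eq: "indicator {a<..<b} x = (if 0 < cos (2 * pi * (x - c)) - cos (2 * pi * r) then 1 else (0::real))"
      using iff by (simp add: cy indicator_def)
    show ?thesis unfolding \<rho>_def eq by (rule kbump_limit)
  qed
  show ?thesis using s p lim kbump_bounds by (intro exI[of _ \<rho>]) (auto simp: \<rho>_def)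
qed

lemma oint_test_limit:
  assumes f: "loc_int f" and ab: "0 \<le> a" "a < b" "b \<le> 1"
    and \<rho>: "\<And>n. continuous_on UNIV (\<rho> n)" "\<And>n x. 0 \<le> \<rho> n x \<and> \<rho> n x \<le> 1"
    and lim: "\<And>x. 0 \<le> x \<Longrightarrow> x \<le> 1 \<Longrightarrow> (\<lambda>n. \<rho> n x) \<longlonglongrightarrow> indicator {a<..<b} x"
  shows "(\<lambda>n::nat. oint (\<lambda>x. f x * \<rho> n x) 0 1) \<longlonglongrightarrow> oint f a b"
proof -
  have fm[measurable]: "f \<in> borel_measurable borel" using f by (simp add: loc_int_def)
  have rm[measurable]: "\<rho> n \<in> borel_measurable borel" for n using \<rho>(1) by (intro borel_measurable_continuous_onI)
  have "(\<lambda>n. \<integral>x. indicator {0..1} x * (f x * \<rho> n x) \<partial>lborel) \<longlonglongrightarrow> (\<integral>x. indicator {0..1} x * (f x * indicator {a<..<b} x) \<partial>lborel)"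
  proof (rule integral_dominated_convergence[where w="\<lambda>x. indicator {0..1} x * \<bar>f x\<bar>"])
    show "integrable lborel (\<lambda>x. indicator {0..1} x * \<bar>f x\<bar>)"
      using loc_int_set[OF loc_int_abs[OF f], of 0 1] by (simp add: set_integrable_def)
    show "AE x in lborel. (\<lambda>n. indicator {0..1} x * (f x * \<rho> n x)) \<longlonglongrightarrow> indicator {0..1} x * (f x * indicator {a<..<b} x)"
    proof (rule AE_I2)
      fix x :: real
      show "(\<lambda>n. indicator {0..1} x * (f x * \<rho> n x)) \<longlonglongrightarrow> indicator {0..1} x * (f x * indicator {a<..<b} x)"
        by (cases "x \<in> {0..1}") (auto intro!: tendsto_intros lim)
    qed
    show "AE x in lborel. norm (indicator {0..1} x * (f x * \<rho> n x)) \<le> indicator {0..1} x * \<bar>f x\<bar>" for n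
      using \<rho>(2) by (auto simp: abs_mult intro!: AE_I2 mult_left_mono mult_left_le)
  qed measurable
  moreover have "(\<integral>x. indicator {0..1} x * (f x * indicator {a<..<b} x) \<partial>lborel) = (\<integral>x. indicator {a..b} x * f x \<partial>lborel)"
  proof (rule integral_cong_AE)
    show "AE x in lborel. indicator {0..1} x * (f x * indicator {a<..<b} x) = indicator {a..b} x * f x"
      using AE_lborel_singleton[of a] AE_lborel_singleton[of b]
      by eventually_elim (use ab in \<open>auto simp: indicator_def\<close>)
  qed measurable
  ultimately show ?thesis using ab by (simp add: oint_Icc set_lebesgue_integral_def)
qed

text \<open>The value at t = 0 is left free, so that testing also reads off the initial
  datum.\<close>

definition cutoff :: "(real \<Rightarrow> real) \<Rightarrow> bool" where
  "cutoff \<eta> \<longleftrightarrow> smooth1 \<eta> \<and> (\<exists>S. \<forall>t\<ge>S. \<eta> t = 0)"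

lemma smooth1_oint:
  assumes "smooth1 f" shows "smooth1 (\<lambda>x. oint f a x)" "deriv (\<lambda>x. oint f a x) = f"
proof -
  have d: "((\<lambda>x. oint f a x) has_real_derivative f x) (at x)" for x
    by (rule oint_FTC[OF smooth1_continuous[OF assms]])
  show "smooth1 (\<lambda>x. oint f a x)" by (rule smooth1_antideriv[OF assms d])
  show "deriv (\<lambda>x. oint f a x) = f" using DERIV_imp_deriv[OF d] by blast
qed

lemma smooth1_oint_deriv:
  assumes "smooth1 \<phi>" shows "\<phi> x = \<phi> a + oint (deriv \<phi>) a x" "loc_int (deriv \<phi>)"
proof -
  have c: "continuous_on UNIV (deriv \<phi>)" by (intro smooth1_continuous smooth1_deriv assms)
  then show "loc_int (deriv \<phi>)" by (rule loc_int_continuous)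
  have "((\<lambda>x. \<phi> x - oint (deriv \<phi>) a x) has_real_derivative deriv \<phi> x - deriv \<phi> x) (at x)" for x
    by (intro DERIV_diff smooth1_has_deriv assms oint_FTC c)
  then have "\<phi> x - oint (deriv \<phi>) a x = \<phi> a - oint (deriv \<phi>) a a" by (intro DERIV_isconst_all) simp
  then show "\<phi> x = \<phi> a + oint (deriv \<phi>) a x" by simp
qed

lemma halfline_integral:
  assumes "0 \<le> S" "\<And>t. t > S \<Longrightarrow> f t = 0"
  shows "(LINT t:{0..}|lborel. f t) = oint f 0 S"
  unfolding oint_Icc[OF assms(1)] set_lebesgue_integral_def
  by (intro Bochner_Integration.integral_cong) (use assms(2) in \<open>auto simp: indicator_def not_le\<close>)

text \<open>The primitive \<eta> of a smooth \<zeta> on [0, b], normalised to vanish after b, is a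
  cutoff. Integration of the B-term by parts against F = A0 + int B leaves a vanishing integral of
  (A - F) \<zeta>, the initial value being matched by F 0 = A0. Letting \<zeta> tend to the
  indicator of (0, b), the integral of A - F over [0, b] vanishes.\<close>

lemma weak_time_derivative:
  assumes A: "loc_int A" and B: "loc_int B"
    and weak: "\<And>\<eta>. cutoff \<eta> \<Longrightarrow> (LINT t:{0..}|lborel. A t * deriv \<eta> t + B t * \<eta> t) = - A0 * \<eta> 0"
  shows "AE t in lborel. 0 \<le> t \<longrightarrow> A t = A0 + oint B 0 t"
proof -
  define F where "F t = A0 + oint B 0 t" for t
  have cF: "continuous_on UNIV F" unfolding F_def by (intro continuous_intros oint_continuous B)
  have AF: "loc_int (\<lambda>t. A t - F t)" by (intro loc_int_diff A loc_int_continuous cF)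
  have F0: "F t = F 0 + oint B 0 t" for t by (simp add: F_def)
  have z: "oint (\<lambda>t. A t - F t) 0 b = 0" if b: "0 \<le> b" for b
  proof (cases "b = 0")
    case False
    then have b: "0 < b" using b by simp
    define \<zeta> where "\<zeta> n t = kbump (real n * t) * kbump (real n * (b - t))" for n :: nat and t
    have s\<zeta>: "smooth1 (\<zeta> n)" for n
    proof -
      have 1: "smooth1 (\<lambda>t. kbump (real n * t + 0))" "smooth1 (\<lambda>t. kbump ((- real n) * t + real n * b))"
        by (rule smooth1_comp[OF smooth1_kbump smooth1_affine])+
      have "(\<lambda>t. kbump (real n * t + 0) * kbump ((- real n) * t + real n * b)) = \<zeta> n"
        by (rule ext) (simp add: \<zeta>_def algebra_simps)
      then show ?thesis using smooth1_mult[OF 1] by simp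
    qed
    have \<zeta>0: "\<zeta> n t = 0" if "t \<ge> b" for n t
      using that by (simp add: \<zeta>_def kbump_eq mult_nonneg_nonpos not_less)
    have "oint (\<lambda>t. (A t - F t) * \<zeta> n t) 0 b = 0" for n
    proof -
      define \<eta> where "\<eta> t = oint (\<zeta> n) b t" for t
      have s\<eta>: "smooth1 \<eta>" and d\<eta>: "deriv \<eta> = \<zeta> n" unfolding \<eta>_def using smooth1_oint[OF s\<zeta>] by auto
      have \<eta>0: "\<eta> t = 0" if "t \<ge> b" for t
      proof -
        have "\<eta> t = oint (\<lambda>x. 0) b t" unfolding \<eta>_def by (rule oint_cong) (use that \<zeta>0 in auto)
        then show ?thesis by simp
      qed
      have cut: "cutoff \<eta>" unfolding cutoff_def using s\<eta> \<eta>0 by blast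
      have l\<zeta>: "loc_int (\<zeta> n)" by (intro loc_int_continuous smooth1_continuous s\<zeta>)
      have c\<zeta>: "continuous_on UNIV (\<zeta> n)" and c\<eta>: "continuous_on UNIV \<eta>" by (intro smooth1_continuous s\<zeta> s\<eta>)+
      have "oint (\<lambda>t. A t * \<zeta> n t + B t * \<eta> t) 0 b = - A0 * \<eta> 0"
        using weak[OF cut] halfline_integral[of b "\<lambda>t. A t * deriv \<eta> t + B t * \<eta> t"] b \<zeta>0 \<eta>0 by (simp add: d\<eta>)
      moreover have "oint (\<lambda>t. B t * \<eta> t + F t * \<zeta> n t) 0 b = F b * \<eta> b - F 0 * \<eta> 0"
        by (rule oint_by_parts[OF B l\<zeta> F0]) (simp add: \<eta>_def oint_combine l\<zeta>)
      moreover have "F b * \<eta> b - F 0 * \<eta> 0 = - A0 * \<eta> 0" by (simp add: \<eta>0 F_def)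
      moreover have lA: "loc_int (\<lambda>t. A t * \<zeta> n t)" "loc_int (\<lambda>t. B t * \<eta> t)" "loc_int (\<lambda>t. F t * \<zeta> n t)"
        using loc_int_mult_continuous[OF A c\<zeta>] loc_int_mult_continuous[OF B c\<eta>] loc_int_mult_continuous[OF loc_int_continuous[OF cF] c\<zeta>]
        by (simp_all add: mult.commute)
      ultimately have "oint (\<lambda>t. A t * \<zeta> n t) 0 b = oint (\<lambda>t. F t * \<zeta> n t) 0 b"
        by (simp add: oint_add)
      then show ?thesis using lA by (simp add: left_diff_distrib oint_diff)
    qed
    moreover have "(\<lambda>n. oint (\<lambda>t. (A t - F t) * \<zeta> n t) 0 b) \<longlonglongrightarrow> oint (\<lambda>t. A t - F t) 0 b"
    proof -
      let ?f = "\<lambda>t. A t - F t"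
      have fm[measurable]: "?f \<in> borel_measurable borel" using AF by (simp add: loc_int_def)
      have zm[measurable]: "\<zeta> n \<in> borel_measurable borel" for n
        by (intro borel_measurable_continuous_onI smooth1_continuous s\<zeta>)
      have z1: "\<bar>\<zeta> n t\<bar> \<le> 1" for n t
        using kbump_bounds[of "real n * t"] kbump_bounds[of "real n * (b - t)"] by (simp add: \<zeta>_def mult_le_one)
      have "(\<lambda>n. \<integral>x. indicator {0..b} x * (?f x * \<zeta> n x) \<partial>lborel) \<longlonglongrightarrow> (\<integral>x. indicator {0..b} x * ?f x \<partial>lborel)"
      proof (rule integral_dominated_convergence[where w="\<lambda>x. indicator {0..b} x * \<bar>?f x\<bar>"])
        show "integrable lborel (\<lambda>x. indicator {0..b} x * \<bar>?f x\<bar>)"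
          using loc_int_set[OF loc_int_abs[OF AF], of 0 b] by (simp add: set_integrable_def)
        show "AE x in lborel. (\<lambda>n. indicator {0..b} x * (?f x * \<zeta> n x)) \<longlonglongrightarrow> indicator {0..b} x * ?f x"
          using AE_lborel_singleton[of 0] AE_lborel_singleton[of b]
        proof eventually_elim
          case (elim x)
          show ?case
          proof (cases "x \<in> {0..b}")
            case True
            then have x: "x > 0" "b - x > 0" using elim by auto
            have "(\<lambda>n. \<zeta> n x) \<longlonglongrightarrow> 1 * 1"
              unfolding \<zeta>_def using kbump_limit[of x] kbump_limit[of "b - x"] x by (intro tendsto_mult) auto
            then have "(\<lambda>n. indicator {0..b} x * (?f x * \<zeta> n x)) \<longlonglongrightarrow> indicator {0..b} x * (?f x * (1 * 1))"
              by (intro tendsto_intros)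
            then show ?thesis by simp
          qed simp
        qed
        show "AE x in lborel. norm (indicator {0..b} x * (?f x * \<zeta> n x)) \<le> indicator {0..b} x * \<bar>?f x\<bar>" for n
          using z1 by (auto simp: abs_mult intro!: AE_I2 mult_left_mono mult_left_le)
      qed measurable
      then show ?thesis using b by (simp add: oint_Icc set_lebesgue_integral_def)
    qed
    ultimately show ?thesis by (simp add: LIMSEQ_const_iff)
  qed simp
  have "AE t in lborel. 0 \<le> t \<longrightarrow> A t - F t = 0" by (rule AE_zero_if_oint_zero[OF AF z])
  then show ?thesis by eventually_elim (auto simp: F_def)
qed

lemma periodic_oint_step:
  assumes f: "loc_int f" and per: "\<And>x. f (x + 1) = f x" and z: "\<And>b. 0 < b \<Longrightarrow> b \<le> 1 \<Longrightarrow> oint f 0 b = 0"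
  shows "oint f 0 b = 0"
proof -
  let ?H = "\<lambda>b. oint f 0 b"
  have H: "?H (x + 1) = ?H x" for x
    using oint_combine[OF f, of 0 x "x+1"] oint_periodic[OF f per, of x] z[of 1] by simp
  have "?H b = ?H (frac b)" by (rule periodic_frac[of ?H, OF H])
  also have "\<dots> = 0"
  proof (cases "0 < frac b")
    case True
    then show ?thesis using z[of "frac b"] frac_lt_1[of b] by simp
  next
    case False
    then have "frac b = 0" using frac_ge_0[of b] by linarith
    then show ?thesis by (simp only: oint_same)
  qed
  finally show ?thesis .
qed

lemma H1_per_loc_int:
  assumes "H1_per g g'"
  shows "loc_int g" "loc_int g'" "loc_int (\<lambda>x. (g x)\<^sup>2)" "loc_int (\<lambda>x. (g' x)\<^sup>2)"
    "\<And>x. g (x + 1) = g x" "\<And>x. g' (x + 1) = g' x"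
proof -
  have m[measurable]: "g \<in> borel_measurable borel" "g' \<in> borel_measurable borel" using assms by (auto simp: H1_per_def)
  show per: "\<And>x. g (x + 1) = g x" "\<And>x. g' (x + 1) = g' x" using assms by (auto simp: H1_per_def periodic1_def)
  show sq: "loc_int (\<lambda>x. (g x)\<^sup>2)" "loc_int (\<lambda>x. (g' x)\<^sup>2)"
    using assms per by (auto intro!: loc_int_periodicI simp: H1_per_def)
  have le: "\<bar>y\<bar> \<le> 1 + y\<^sup>2" for y :: real
    using zero_le_power2[of "\<bar>y\<bar> - 1"] abs_ge_zero[of y] by (simp add: power2_eq_square algebra_simps)
  show "loc_int g" "loc_int g'"
    by (rule loc_int_dominated[OF loc_int_add[OF loc_int_const sq(1)] m(1) le],
        rule loc_int_dominated[OF loc_int_add[OF loc_int_const sq(2)] m(2) le])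
qed

text \<open>The lemma of du Bois-Reymond on the circle. The constant test function shows that g' has
  mean zero, hence a periodic primitive F. Any periodic \<rho> minus its mean is the derivative of a
  periodic \<phi>; as k = g - F - k0 has mean zero too, testing with \<phi> makes the integral of k
  \<rho> vanish.\<close>

lemma H1_per_regularity:
  assumes H: "H1_per g g'"
  shows "oint g' 0 1 = 0"
    and "AE x in lborel. g x = oint g 0 1 - oint (\<lambda>x. oint g' 0 x) 0 1 + oint g' 0 x"
proof -
  note li = H1_per_loc_int[OF H]
  define F where "F x = oint g' 0 x" for x
  have weak: "oint (\<lambda>x. g x * deriv \<phi> x) 0 1 = - oint (\<lambda>x. g' x * \<phi> x) 0 1" if "smooth1 \<phi>" "periodic1 \<phi>" for \<phi>
    using H that by (simp add: H1_per_def weak_deriv_per_def oint_Icc)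
  have "oint (\<lambda>x. g x * deriv (\<lambda>x. 1) x) 0 1 = - oint (\<lambda>x. g' x * 1) 0 1"
    by (rule weak[OF smooth1_const]) (simp add: periodic1_def)
  then show g'0: "oint g' 0 1 = 0" by simp
  have cF: "continuous_on UNIV F" unfolding F_def by (intro oint_continuous li)
  define k0 where "k0 = oint g 0 1 - oint F 0 1"
  define k where "k x = g x - F x - k0" for x
  have kli: "loc_int k" unfolding k_def by (intro loc_int_diff loc_int_const li loc_int_continuous cF)
  have Fper: "F (x + 1) = F x" for x
    using oint_combine[OF li(2), of 0 x "x+1"] oint_periodic[OF li(2,6), of x] g'0 by (simp add: F_def)
  have kper: "k (x + 1) = k x" for x by (simp add: k_def li Fper)
  have test: "oint (\<lambda>x. k x * \<rho> x) 0 1 = 0" if \<rho>: "smooth1 \<rho>" "periodic1 \<rho>" for \<rho>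
  proof -
    define r0 where "r0 = oint \<rho> 0 1"
    define \<phi> where "\<phi> x = oint (\<lambda>x. \<rho> x + (- r0)) 0 x" for x
    have s: "smooth1 (\<lambda>x. \<rho> x + (- r0))" by (intro smooth1_add \<rho> smooth1_const)
    have s\<phi>: "smooth1 \<phi>" and d\<phi>: "deriv \<phi> = (\<lambda>x. \<rho> x + (- r0))"
      unfolding \<phi>_def using smooth1_oint[OF s] by auto
    have rl: "loc_int \<rho>" by (intro loc_int_continuous smooth1_continuous \<rho>)
    have sl: "loc_int (\<lambda>x. \<rho> x + (- r0))" by (intro loc_int_add rl loc_int_const)
    have z1: "oint (\<lambda>x. \<rho> x + (- r0)) 0 1 = 0" by (subst oint_add[OF rl loc_int_const]) (simp add: r0_def)
    have per: "\<rho> (x + 1) + (- r0) = \<rho> x + (- r0)" for x using \<rho>(2) by (simp add: periodic1_def)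
    have p\<phi>: "periodic1 \<phi>" unfolding periodic1_def
      using oint_combine[OF sl, of 0 _ "_ + 1"] oint_periodic[OF sl per] z1 by (metis \<phi>_def add.right_neutral)
    have \<phi>01: "\<phi> 0 = 0" "\<phi> 1 = 0" using z1 by (auto simp: \<phi>_def)
    have c: "continuous_on UNIV (deriv \<phi>)" "continuous_on UNIV \<phi>" by (intro smooth1_continuous smooth1_deriv s\<phi>)+
    have "oint (\<lambda>x. g' x * \<phi> x + F x * deriv \<phi> x) 0 1 = F 1 * \<phi> 1 - F 0 * \<phi> 0"
      by (rule oint_by_parts[OF li(2) smooth1_oint_deriv(2)[OF s\<phi>] _ smooth1_oint_deriv(1)[OF s\<phi>]]) (simp add: F_def)
    then have 1: "oint (\<lambda>x. g' x * \<phi> x) 0 1 + oint (\<lambda>x. F x * deriv \<phi> x) 0 1 = 0"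
      using loc_int_mult_continuous[OF li(2) c(2)] loc_int_continuous[OF continuous_on_mult[OF cF c(1)]]
      by (simp add: oint_add mult.commute \<phi>01)
    have l1: "loc_int (\<lambda>x. g x * deriv \<phi> x)" "loc_int (\<lambda>x. F x * deriv \<phi> x)"
      using loc_int_mult_continuous[OF li(1) c(1)] loc_int_continuous[OF continuous_on_mult[OF cF c(1)]] by (simp_all add: mult.commute)
    have 2: "oint (\<lambda>x. (g x - F x) * deriv \<phi> x) 0 1 = 0"
      using weak[OF s\<phi> p\<phi>] 1 l1 by (simp add: left_diff_distrib oint_diff)
    have dl: "loc_int (deriv \<phi>)" by (rule smooth1_oint_deriv(2)[OF s\<phi>])
    have l2: "loc_int (\<lambda>x. (g x - F x) * deriv \<phi> x)" using l1 by (simp add: left_diff_distrib loc_int_diff)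
    have "oint (\<lambda>x. k x * deriv \<phi> x) 0 1 = oint (\<lambda>x. (g x - F x) * deriv \<phi> x - k0 * deriv \<phi> x) 0 1"
      by (simp add: k_def algebra_simps)
    also have "\<dots> = 0 - k0 * oint (deriv \<phi>) 0 1" by (simp only: oint_diff[OF l2 loc_int_cmult[OF dl]] oint_cmult 2)
    also have "oint (deriv \<phi>) 0 1 = 0" using z1 by (simp add: d\<phi>)
    finally have 3: "oint (\<lambda>x. k x * deriv \<phi> x) 0 1 = 0" by simp
    have k0': "oint k 0 1 = 0" unfolding k_def by (simp add: oint_diff li loc_int_diff loc_int_const loc_int_continuous[OF cF] k0_def)
    have rc: "continuous_on UNIV \<rho>" by (intro smooth1_continuous \<rho>)
    have l3: "loc_int (\<lambda>x. k x * \<rho> x)" using loc_int_mult_continuous[OF kli rc] by (simp add: mult.commute)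
    have "oint (\<lambda>x. k x * deriv \<phi> x) 0 1 = oint (\<lambda>x. k x * \<rho> x - r0 * k x) 0 1" by (simp add: d\<phi> algebra_simps)
    also have "\<dots> = oint (\<lambda>x. k x * \<rho> x) 0 1" by (simp only: oint_diff[OF l3 loc_int_cmult[OF kli]] oint_cmult k0')
    finally show ?thesis using 3 by simp
  qed
  have z: "oint k 0 b = 0" if b: "0 < b" "b \<le> 1" for b
  proof -
    obtain \<rho> :: "nat \<Rightarrow> real \<Rightarrow> real" where \<rho>: "\<And>n. smooth1 (\<rho> n)" "\<And>n. periodic1 (\<rho> n)" "\<And>n x. 0 \<le> \<rho> n x \<and> \<rho> n x \<le> 1"
      "\<And>x. 0 \<le> x \<Longrightarrow> x \<le> 1 \<Longrightarrow> (\<lambda>n. \<rho> n x) \<longlonglongrightarrow> indicator {0<..<b} x"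
      using smooth_periodic_indicator[of 0 b] b by auto
    have "(\<lambda>n. oint (\<lambda>x. k x * \<rho> n x) 0 1) \<longlonglongrightarrow> oint k 0 b"
      by (rule oint_test_limit[OF kli _ b(1,2) smooth1_continuous[OF \<rho>(1)] \<rho>(3,4)]) simp
    then show ?thesis using test[OF \<rho>(1,2)] by (simp add: LIMSEQ_const_iff)
  qed
  have z0: "oint k 0 b = 0" for b by (rule periodic_oint_step[OF kli kper z])
  have "oint k c b = 0" for b c using z0[of b] z0[of c] oint_combine[OF kli, of 0 c b] by simp
  then have "AE x in lborel. - real n \<le> x \<longrightarrow> k x = 0" for n :: nat by (intro AE_zero_if_oint_zero[OF kli])
  then have "AE x in lborel. \<forall>n::nat. - real n \<le> x \<longrightarrow> k x = 0" unfolding AE_all_countable by blast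
  then show "AE x in lborel. g x = oint g 0 1 - oint (\<lambda>x. oint g' 0 x) 0 1 + oint g' 0 x"
  proof eventually_elim
    case (elim x)
    obtain n :: nat where "- x \<le> real n" using real_arch_simple by blast
    then have "k x = 0" using elim[rule_format, of n] by simp
    then show ?case by (simp add: k_def k0_def F_def[abs_def])
  qed
qed

text \<open>The exceptional null set of the weak identity depends on the test function. Countably
  many test functions approximate the indicators of (0, b) with rational b; continuity in b and
  periodicity then give all b outside one null set. Periodicity is asked of F t - F 0 only, since E
  itself grows by 1 + h in each period.\<close>

lemma box_identity:
  assumes F: "section_int F" and p: "section_int p"
    and Fper: "\<And>t x. t \<in> T \<Longrightarrow> F t (x + 1) - F 0 (x + 1) = F t x - F 0 x" and T: "AE t in lborel. 0 \<le> t \<longrightarrow> t \<in> T"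
    and pper: "\<And>t x. p t (x + 1) = p t x"
    and weak: "\<And>\<rho>. smooth1 \<rho> \<Longrightarrow> periodic1 \<rho> \<Longrightarrow> AE t in lborel. 0 \<le> t \<longrightarrow>
      oint (\<lambda>x. F t x * \<rho> x) 0 1 = oint (\<lambda>x. F 0 x * \<rho> x) 0 1 + oint (\<lambda>r. oint (\<lambda>x. p r x * \<rho> x) 0 1) 0 t"
  shows "AE t in lborel. 0 \<le> t \<longrightarrow> (\<forall>b. oint (F t) 0 b = oint (F 0) 0 b + oint (\<lambda>r. oint (p r) 0 b) 0 t)"
proof -
  have one: "AE t in lborel. 0 \<le> t \<longrightarrow> oint (F t) 0 b = oint (F 0) 0 b + oint (\<lambda>r. oint (p r) 0 b) 0 t"
    if b: "0 < b" "b \<le> 1" for b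
  proof -
    obtain \<rho> :: "nat \<Rightarrow> real \<Rightarrow> real" where \<rho>: "\<And>n. smooth1 (\<rho> n)" "\<And>n. periodic1 (\<rho> n)" "\<And>n x. 0 \<le> \<rho> n x \<and> \<rho> n x \<le> 1"
      "\<And>x. 0 \<le> x \<Longrightarrow> x \<le> 1 \<Longrightarrow> (\<lambda>n. \<rho> n x) \<longlonglongrightarrow> indicator {0<..<b} x"
      using smooth_periodic_indicator[of 0 b] b by auto
    have rc: "continuous_on UNIV (\<rho> n)" for n by (intro smooth1_continuous \<rho>)
    have lim: "(\<lambda>n. oint (\<lambda>x. f x * \<rho> n x) 0 1) \<longlonglongrightarrow> oint f 0 b" if "loc_int f" for f
      by (rule oint_test_limit[OF that _ b(1,2) rc \<rho>(3,4)]) simp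
    have "AE t in lborel. \<forall>n. 0 \<le> t \<longrightarrow>
      oint (\<lambda>x. F t x * \<rho> n x) 0 1 = oint (\<lambda>x. F 0 x * \<rho> n x) 0 1 + oint (\<lambda>r. oint (\<lambda>x. p r x * \<rho> n x) 0 1) 0 t"
      unfolding AE_all_countable using weak[OF \<rho>(1,2)] by blast
    then show ?thesis
    proof eventually_elim
      case (elim t)
      show ?case
      proof
        assume t: "0 \<le> t"
        define g where "g n r = oint (\<lambda>x. p r x * \<rho> n x) 0 1" for n r
        have pr: "section_int (\<lambda>r x. p r x * \<rho> n x)" for n
        proof (rule section_int_dominated[OF section_int_abs[OF p]])
          have "(\<lambda>z. p (fst z) (snd z)) \<in> borel_measurable borel" using section_int_measurable[OF p] by (simp add: split_beta')
          moreover have "(\<lambda>z. \<rho> n (snd z)) \<in> borel_measurable (borel :: (real \<times> real) measure)"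
            by (intro borel_measurable_continuous_onI continuous_on_compose2[OF rc] continuous_intros) simp
          ultimately show "(\<lambda>(r, x). p r x * \<rho> n x) \<in> borel_measurable borel"
            unfolding split_beta' by (rule borel_measurable_times)
          show "\<bar>p r x * \<rho> n x\<bar> \<le> \<bar>p r x\<bar>" for r x
            using \<rho>(3)[of n x] by (simp add: abs_mult mult_left_le)
        qed
        have gli: "loc_int (g n)" for n unfolding g_def by (intro section_int_oint pr)
        have "(\<lambda>n. oint (g n) 0 t) \<longlonglongrightarrow> oint (\<lambda>r. oint (p r) 0 b) 0 t"
        proof -
          have "(\<lambda>n. \<integral>r. indicator {0..t} r * g n r \<partial>lborel) \<longlonglongrightarrow> (\<integral>r. indicator {0..t} r * oint (p r) 0 b \<partial>lborel)"
          proof (rule integral_dominated_convergence[where w="\<lambda>r. indicator {0..t} r * oint (\<lambda>x. \<bar>p r x\<bar>) 0 1"])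
            show "(\<lambda>r. indicator {0..t} r * oint (p r) 0 b) \<in> borel_measurable lborel"
              using loc_int_measurable[OF section_int_oint[OF p, of 0 b]] by simp
            show "(\<lambda>r. indicator {0..t} r * g n r) \<in> borel_measurable lborel" for n
              using loc_int_measurable[OF gli, of n] by simp
            show "integrable lborel (\<lambda>r. indicator {0..t} r * oint (\<lambda>x. \<bar>p r x\<bar>) 0 1)"
              using loc_int_set[OF section_int_oint[OF section_int_abs[OF p]], of 0 t] by (simp add: set_integrable_def)
            show "AE r in lborel. (\<lambda>n. indicator {0..t} r * g n r) \<longlonglongrightarrow> indicator {0..t} r * oint (p r) 0 b"
              unfolding g_def by (intro AE_I2 tendsto_mult tendsto_const lim section_intD(2) p)
            have "\<bar>g n r\<bar> \<le> oint (\<lambda>x. \<bar>p r x\<bar>) 0 1" for n r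
            proof -
              have "\<bar>g n r\<bar> \<le> oint (\<lambda>x. \<bar>p r x * \<rho> n x\<bar>) 0 1" unfolding g_def by (intro oint_abs_le section_intD(2) pr) simp
              also have "\<dots> \<le> oint (\<lambda>x. \<bar>p r x\<bar>) 0 1"
                by (intro oint_mono loc_int_abs section_intD(2) pr p) (use \<rho>(3) in \<open>auto simp: abs_mult mult_left_le\<close>)
              finally show ?thesis .
            qed
            then show "AE r in lborel. norm (indicator {0..t} r * g n r) \<le> indicator {0..t} r * oint (\<lambda>x. \<bar>p r x\<bar>) 0 1" for n
              by (intro AE_I2) (auto simp: abs_mult intro!: mult_left_mono)
          qed
          then show ?thesis using t by (simp add: oint_Icc set_lebesgue_integral_def)
        qed
        then have "(\<lambda>n. oint (\<lambda>x. F 0 x * \<rho> n x) 0 1 + oint (g n) 0 t) \<longlonglongrightarrow> oint (F 0) 0 b + oint (\<lambda>r. oint (p r) 0 b) 0 t"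
          by (intro tendsto_add lim section_intD(2) F)
        moreover have "(\<lambda>n. oint (\<lambda>x. F 0 x * \<rho> n x) 0 1 + oint (g n) 0 t) = (\<lambda>n. oint (\<lambda>x. F t x * \<rho> n x) 0 1)"
          using elim t by (simp add: g_def[abs_def])
        ultimately have "(\<lambda>n. oint (\<lambda>x. F t x * \<rho> n x) 0 1) \<longlonglongrightarrow> oint (F 0) 0 b + oint (\<lambda>r. oint (p r) 0 b) 0 t" by simp
        from LIMSEQ_unique[OF lim[OF section_intD(2)[OF F]] this]
        show "oint (F t) 0 b = oint (F 0) 0 b + oint (\<lambda>r. oint (p r) 0 b) 0 t" .
      qed
    qed
  qed
  have "AE t in lborel. \<forall>b\<in>{b \<in> \<rat>. 0 < b \<and> b \<le> 1}. 0 \<le> t \<longrightarrow> oint (F t) 0 b = oint (F 0) 0 b + oint (\<lambda>r. oint (p r) 0 b) 0 t"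
    using one by (subst AE_ball_countable) (auto intro: countable_subset[OF _ countable_rat])
  with T show ?thesis
  proof eventually_elim
    case (elim t)
    show ?case
    proof (intro impI allI)
      fix b assume t: "0 \<le> t"
      then have tT: "t \<in> T" using elim by simp
      define H where "H b = oint (F t) 0 b - oint (F 0) 0 b - oint (\<lambda>r. oint (p r) 0 b) 0 t" for b
      define Q where "Q x = oint (\<lambda>r. p r x) 0 t" for x
      have Q: "loc_int Q" unfolding Q_def by (rule oint_loc_int[OF loc_int2_swap[OF section_intD(1)[OF p]]])
      define k where "k x = F t x - F 0 x - Q x" for x
      have kl: "loc_int k" unfolding k_def by (intro loc_int_diff section_intD(2) F Q)
      have Hk: "H b = oint k 0 b" for b
        unfolding H_def k_def oint_Fubini[OF section_intD(1)[OF p]] Q_def[symmetric]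
        by (simp add: oint_diff loc_int_diff section_intD(2) F Q)
      have cH: "continuous_on UNIV H" unfolding Hk by (rule oint_continuous[OF kl])
      have Hrat: "H b = 0" if "b \<in> \<rat>" "0 < b" "b \<le> 1" for b
        using elim(2) t that by (simp add: H_def)
      have H01: "H b = 0" if b: "0 < b" "b \<le> 1" for b
      proof (rule ccontr)
        assume nz: "H b \<noteq> 0"
        have "isCont H b" using cH by (simp add: continuous_on_eq_continuous_at)
        then have "\<forall>\<^sub>F x in at b. H x \<noteq> 0"
          using nz by (intro tendsto_imp_eventually_ne) (simp_all add: isCont_def)
        then obtain d where d: "d > 0" "\<And>x. x \<noteq> b \<Longrightarrow> dist x b < d \<Longrightarrow> H x \<noteq> 0" by (auto simp: eventually_at)
        have "max 0 (b - d) < b" using d b by simp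
        then obtain q where q: "q \<in> \<rat>" "max 0 (b - d) < q" "q < b" using Rats_dense_in_real by blast
        then have "H q = 0" using Hrat b by simp
        moreover have "dist q b < d" using q by (simp add: dist_real_def)
        ultimately show False using d(2)[of q] q by simp
      qed
      have "H b = 0" unfolding Hk
      proof (rule periodic_oint_step[OF kl])
        show "k (x + 1) = k x" for x using Fper[OF tT, of x] pper by (simp add: k_def Q_def)
        show "oint k 0 b = 0" if "0 < b" "b \<le> 1" for b using H01[OF that] by (simp add: Hk)
      qed
      then show "oint (F t) 0 b = oint (F 0) 0 b + oint (\<lambda>r. oint (p r) 0 b) 0 t" by (simp add: H_def)
    qed
  qed
qed

subsection \<open>From the weak identities to the evolution of the energy potential\<close>

lemma AE_halfline_ex:
  assumes "AE t in lborel. (0::real) \<le> t \<longrightarrow> P t" shows "\<exists>t\<ge>0. P t"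
proof (rule ccontr)
  assume *: "\<not> (\<exists>t\<ge>0. P t)"
  have "AE t in lborel. t \<notin> {0..(1::real)}"
    using assms by eventually_elim (use * in auto)
  then have "{0..1::real} \<in> null_sets lborel" by (subst (asm) AE_iff_null_sets[symmetric]) auto
  then show False by (simp add: null_sets_def)
qed

lemma cutoff_deriv_zero:
  assumes "smooth1 \<eta>" "\<And>t. t \<ge> S \<Longrightarrow> \<eta> t = 0" "t > S"
  shows "deriv \<eta> t = 0"
proof -
  have "((\<lambda>t. 0) has_real_derivative 0) (at t)" by simp
  then have "(\<eta> has_real_derivative 0) (at t)"
    by (rule has_field_derivative_transform_within_open[of _ _ _ "{S<..}"]) (use assms in auto)
  then show ?thesis by (rule DERIV_imp_deriv)
qed

lemma weak_rearrange:
  assumes li: "loc_int A" "loc_int B1" "loc_int B2" and cut: "cutoff \<eta>"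
    and eq: "(LINT t:{0..}|lborel. A t * deriv \<eta> t - B1 t * \<eta> t) = - (LINT t:{0..}|lborel. B2 t * \<eta> t) - A0 * \<eta> 0"
  shows "(LINT t:{0..}|lborel. A t * deriv \<eta> t + (B2 t - B1 t) * \<eta> t) = - A0 * \<eta> 0"
proof -
  obtain S' where s: "smooth1 \<eta>" and S': "\<And>t. t \<ge> S' \<Longrightarrow> \<eta> t = 0" using cut by (auto simp: cutoff_def)
  define S where "S = max 0 S'"
  have S: "0 \<le> S" "\<And>t. t > S \<Longrightarrow> \<eta> t = 0" "\<And>t. t > S \<Longrightarrow> deriv \<eta> t = 0"
    using S' cutoff_deriv_zero[OF s S'] by (auto simp: S_def)
  have c: "continuous_on UNIV \<eta>" "continuous_on UNIV (deriv \<eta>)" by (intro smooth1_continuous smooth1_deriv s)+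
  have l: "loc_int (\<lambda>t. A t * deriv \<eta> t)" "loc_int (\<lambda>t. B1 t * \<eta> t)" "loc_int (\<lambda>t. B2 t * \<eta> t)"
    using loc_int_mult_continuous[OF li(1) c(2)] loc_int_mult_continuous[OF li(2) c(1)] loc_int_mult_continuous[OF li(3) c(1)]
    by (simp_all add: mult.commute)
  have "oint (\<lambda>t. A t * deriv \<eta> t - B1 t * \<eta> t) 0 S = - oint (\<lambda>t. B2 t * \<eta> t) 0 S - A0 * \<eta> 0"
    using eq S by (simp add: halfline_integral[OF S(1)])
  then have "oint (\<lambda>t. A t * deriv \<eta> t) 0 S - oint (\<lambda>t. B1 t * \<eta> t) 0 S = - oint (\<lambda>t. B2 t * \<eta> t) 0 S - A0 * \<eta> 0"
    by (simp add: oint_diff l)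
  moreover have "oint (\<lambda>t. A t * deriv \<eta> t + (B2 t - B1 t) * \<eta> t) 0 S
      = oint (\<lambda>t. A t * deriv \<eta> t) 0 S + (oint (\<lambda>t. B2 t * \<eta> t) 0 S - oint (\<lambda>t. B1 t * \<eta> t) 0 S)"
    unfolding left_diff_distrib by (simp add: oint_add oint_diff loc_int_diff l)
  ultimately have "oint (\<lambda>t. A t * deriv \<eta> t + (B2 t - B1 t) * \<eta> t) 0 S = - A0 * \<eta> 0" by simp
  then show ?thesis using S by (simp add: halfline_integral[OF S(1)])
qed

lemma section_int_mult_bounded:
  assumes f: "section_int f" and c: "continuous_on UNIV \<phi>" and B: "\<And>x. \<bar>\<phi> x\<bar> \<le> B"
  shows "section_int (\<lambda>t x. f t x * \<phi> x)"
proof (rule section_int_dominated[OF section_int_cmult[OF section_int_abs[OF f], of B]])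
  have "(\<lambda>z. f (fst z) (snd z)) \<in> borel_measurable borel" using section_int_measurable[OF f] by (simp add: split_beta')
  moreover have "(\<lambda>z. \<phi> (snd z)) \<in> borel_measurable (borel :: (real \<times> real) measure)"
    by (intro borel_measurable_continuous_onI continuous_on_compose2[OF c] continuous_intros) simp
  ultimately show "(\<lambda>(t, x). f t x * \<phi> x) \<in> borel_measurable borel"
    unfolding split_beta' by (rule borel_measurable_times)
  show "\<bar>f t x * \<phi> x\<bar> \<le> B * \<bar>f t x\<bar>" for t x
    using mult_right_mono[OF B abs_ge_zero, of x "f t x"] by (simp add: abs_mult mult.commute)
qed

lemma periodic_continuous_bounded:
  fixes \<phi> :: "real \<Rightarrow> real"
  assumes "continuous_on UNIV \<phi>" "\<And>x. \<phi> (x + 1) = \<phi> x"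
  shows "\<exists>B. \<forall>x. \<bar>\<phi> x\<bar> \<le> B"
proof -
  have "bounded (\<phi> ` {0..1})"
    by (intro compact_imp_bounded compact_continuous_image continuous_on_subset[OF assms(1)]) auto
  then have "\<exists>B. \<forall>x\<in>{0..1}. \<bar>\<phi> x\<bar> \<le> B" by (simp add: bounded_iff)
  then obtain B where B: "\<And>x. x \<in> {0..1} \<Longrightarrow> \<bar>\<phi> x\<bar> \<le> B" by blast
  have "\<bar>\<phi> x\<bar> \<le> B" for x
    using B[of "frac x"] periodic_frac[of \<phi> x, OF assms(2)] frac_ge_0[of x] frac_lt_1[of x] by simp
  then show ?thesis by blast
qed

lemma loc_int_mult_right: "loc_int f \<Longrightarrow> continuous_on UNIV g \<Longrightarrow> loc_int (\<lambda>x. f x * g x)"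
  using loc_int_mult_continuous[of f g] by (simp add: mult.commute)

text \<open>A solution normalised on a null set of times: every slice is in H1 with one bound, the
  slice at 0 is the initial datum, and the other slices off S vanish. The energy c1 at times in S is
  identified with h in \<open>c1_eq\<close>.\<close>

locale weak_sol =
  fixes u ux :: "real \<Rightarrow> real \<Rightarrow> real" and S :: "real set" and h m C c1 :: real
  assumes u_meas: "(\<lambda>(t, x). u t x) \<in> borel_measurable borel"
    and ux_meas: "(\<lambda>(t, x). ux t x) \<in> borel_measurable borel"
    and H1: "H1_per (u t) (ux t)"
    and bd: "(LINT x:{0..1}|lborel. (u t x)\<^sup>2 + (ux t x)\<^sup>2) \<le> C"
    and off: "t \<notin> S \<Longrightarrow> t \<noteq> 0 \<Longrightarrow> u t = (\<lambda>x. 0) \<and> ux t = (\<lambda>x. 0)"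
    and S_AE: "AE t in lborel. 0 \<le> t \<longrightarrow> t \<in> S" and S_pos: "t \<in> S \<Longrightarrow> 0 < t"
    and energy: "t \<in> S \<Longrightarrow> (LINT x:{0..1}|lborel. (ux t x)\<^sup>2) = c1"
    and mean: "t \<in> S \<Longrightarrow> (LINT x:{0..1}|lborel. u t x - u t x * (ux t x)\<^sup>2) = m"
    and h: "(LINT x:{0..1}|lborel. (ux 0 x)\<^sup>2) = h" and h1: "h \<noteq> 1"
    and weak4: "cutoff \<eta> \<Longrightarrow> smooth1 \<phi> \<Longrightarrow> periodic1 \<phi> \<Longrightarrow>
      (LINT t:{0..}|lborel. LINT x:{0..1}|lborel.
          (ux t x)\<^sup>2 * (deriv \<eta> t * \<phi> x) - (u t x)\<^sup>2 * (ux t x)\<^sup>2 * (\<eta> t * deriv \<phi> x))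
      = - (LINT t:{0..}|lborel. LINT x:{0..1}|lborel. (2 * u t x * ux t x - 2 * ux t x * m) * (\<eta> t * \<phi> x))
        - (LINT x:{0..1}|lborel. (ux 0 x)\<^sup>2 * (\<eta> 0 * \<phi> x))"
    and weak2: "cutoff \<eta> \<Longrightarrow> smooth1 \<phi> \<Longrightarrow> periodic1 \<phi> \<Longrightarrow>
      (LINT t:{0..}|lborel. LINT x:{0..1}|lborel.
          u t x * (deriv \<eta> t * \<phi> x) - 1/3 * (u t x) ^ 3 * (\<eta> t * deriv \<phi> x))
      = - (LINT t:{0..}|lborel. LINT x:{0..1}|lborel.
            (dxinv (\<lambda>y. u t y - u t y * (ux t y)\<^sup>2) x - ff h u ux t) * (\<eta> t * \<phi> x))
        - (LINT x:{0..1}|lborel. u 0 x * (\<eta> 0 * \<phi> x))"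
begin

lemmas li = H1_per_loc_int[OF H1]
lemmas reg = H1_per_regularity[OF H1]

definition kc :: "real \<Rightarrow> real" where "kc t = oint (u t) 0 1 - oint (\<lambda>x. oint (ux t) 0 x) 0 1"
text \<open>The absolutely continuous representative of u, given by a formula from which joint
  measurability in (t, x) can be read off. The three summands 1 + C of \<open>M\<close> bound the
  mean of u, the mean of the primitive of u_x and that primitive itself.\<close>

definition v :: "real \<Rightarrow> real \<Rightarrow> real" where "v t x = kc t + oint (ux t) 0 x"
definition M :: real where "M = 3 * (1 + C)"

lemma v_ae: "AE x in lborel. u t x = v t x"
  using reg(2)[of t] by (simp add: v_def kc_def)

lemma v_diff: "v t y - v t x = oint (ux t) x y"
  by (simp add: v_def oint_diff_base li)

lemma v_AC: "v t x = v t 0 + oint (ux t) 0 x" by (simp add: v_def)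

lemma v_per: "v t (x + 1) = v t x"
  using v_diff[of t "x+1" x] oint_periodic[OF li(2,6), of t x] reg(1)[of t] by simp

lemma v_cont: "continuous_on UNIV (v t)"
  unfolding v_def by (intro continuous_intros oint_continuous li)

lemma v_meas: "(\<lambda>(t, x). v t x) \<in> borel_measurable borel"
proof -
  have W: "(\<lambda>(t, x). oint (ux t) 0 x) \<in> borel_measurable borel" by (rule oint_measurable2[OF ux_meas])
  have k: "kc \<in> borel_measurable borel"
    unfolding kc_def[abs_def] by (intro borel_measurable_diff oint_measurable u_meas W)
  have "(\<lambda>z. kc (fst z)) \<in> borel_measurable (borel :: (real \<times> real) measure)"
    by (rule measurable_compose[OF _ k]) (simp add: borel_measurable_continuous_onI continuous_on_fst)
  then show ?thesis using W by (simp add: v_def split_beta')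
qed

lemma abs_le_1_square: "\<bar>y\<bar> \<le> 1 + y\<^sup>2" for y :: real
  using zero_le_power2[of "\<bar>y\<bar> - 1"] abs_ge_zero[of y] by (simp add: power2_eq_square algebra_simps)

lemma sq_bounds: "oint (\<lambda>x. (u t x)\<^sup>2) 0 1 \<le> C" "oint (\<lambda>x. (ux t x)\<^sup>2) 0 1 \<le> C"
proof -
  have "oint (\<lambda>x. (u t x)\<^sup>2 + (ux t x)\<^sup>2) 0 1 \<le> C" using bd[of t] by (simp add: oint_Icc)
  then have "oint (\<lambda>x. (u t x)\<^sup>2) 0 1 + oint (\<lambda>x. (ux t x)\<^sup>2) 0 1 \<le> C" by (simp add: oint_add li)
  moreover have "0 \<le> oint (\<lambda>x. (u t x)\<^sup>2) 0 1" "0 \<le> oint (\<lambda>x. (ux t x)\<^sup>2) 0 1" by (simp_all add: oint_nonneg)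
  ultimately show "oint (\<lambda>x. (u t x)\<^sup>2) 0 1 \<le> C" "oint (\<lambda>x. (ux t x)\<^sup>2) 0 1 \<le> C" by linarith+
qed

lemma abs_bounds: "oint (\<lambda>x. \<bar>u t x\<bar>) 0 1 \<le> 1 + C" "oint (\<lambda>x. \<bar>ux t x\<bar>) 0 1 \<le> 1 + C"
proof -
  have "oint (\<lambda>x. \<bar>u t x\<bar>) 0 1 \<le> oint (\<lambda>x. 1 + (u t x)\<^sup>2) 0 1"
    by (intro oint_mono loc_int_abs loc_int_add loc_int_const li abs_le_1_square) simp
  then show "oint (\<lambda>x. \<bar>u t x\<bar>) 0 1 \<le> 1 + C" using sq_bounds(1)[of t] by (simp add: oint_add loc_int_const li)
  have "oint (\<lambda>x. \<bar>ux t x\<bar>) 0 1 \<le> oint (\<lambda>x. 1 + (ux t x)\<^sup>2) 0 1"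
    by (intro oint_mono loc_int_abs loc_int_add loc_int_const li abs_le_1_square) simp
  then show "oint (\<lambda>x. \<bar>ux t x\<bar>) 0 1 \<le> 1 + C" using sq_bounds(2)[of t] by (simp add: oint_add loc_int_const li)
qed

lemma v_bound: "\<bar>v t x\<bar> \<le> M"
proof -
  have i: "\<bar>oint (ux t) 0 x\<bar> \<le> 1 + C" if "0 \<le> x" "x \<le> 1" for x
  proof -
    have "\<bar>oint (ux t) 0 x\<bar> \<le> oint (\<lambda>x. \<bar>ux t x\<bar>) 0 x" by (intro oint_abs_le that li)
    also have "\<dots> \<le> oint (\<lambda>x. \<bar>ux t x\<bar>) 0 1" by (intro oint_subset_le loc_int_abs li that) auto
    finally show ?thesis using abs_bounds(2)[of t] by simp
  qed
  have "\<bar>oint (\<lambda>x. oint (ux t) 0 x) 0 1\<bar> \<le> (1 + C) * (1 - 0)"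
    by (intro oint_bound loc_int_continuous oint_continuous li i) auto
  moreover have "\<bar>oint (u t) 0 1\<bar> \<le> 1 + C" using oint_abs_le[of 0 1 "u t"] li(1)[of t] abs_bounds(1)[of t] by simp
  ultimately have "\<bar>kc t\<bar> \<le> 2 * (1 + C)" unfolding kc_def by simp
  then have b: "\<bar>v t x\<bar> \<le> M" if "0 \<le> x" "x \<le> 1" for x using i[OF that] by (simp add: v_def M_def)
  show ?thesis
    using b[of "frac x"] periodic_frac[of "v t" x, OF v_per] frac_ge_0[of x] frac_lt_1[of x] by simp
qed

definition w :: "real \<Rightarrow> real \<Rightarrow> real" where "w t x = (ux t x)\<^sup>2"

lemma w_li: "loc_int (w t)" using li(4)[of t] by (simp add: w_def[abs_def])

lemma um: "u t \<in> borel_measurable borel" "ux t \<in> borel_measurable borel" "v t \<in> borel_measurable borel"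
  using li(1)[of t] li(2)[of t] loc_int_continuous[OF v_cont, of t] by (simp_all add: loc_int_def)

lemma vux_li: "loc_int (\<lambda>x. v t x * ux t x)"
  by (rule loc_int_mult_continuous[OF li(2) v_cont])

lemma v_square_AC: "(v t x)\<^sup>2 = (v t 0)\<^sup>2 + oint (\<lambda>x. 2 * (v t x * ux t x)) 0 x"
proof -
  have "oint (\<lambda>x. ux t x * v t x + v t x * ux t x) 0 x = v t x * v t x - v t 0 * v t 0"
    by (rule oint_by_parts[OF li(2) li(2) v_AC v_AC])
  moreover have "(\<lambda>x. ux t x * v t x + v t x * ux t x) = (\<lambda>x. 2 * (v t x * ux t x))" by (simp add: fun_eq_iff)
  ultimately show ?thesis by (simp add: power2_eq_square)
qed

lemma v2ux_li: "loc_int (\<lambda>x. (v t x)\<^sup>2 * ux t x)"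
  by (rule loc_int_mult_continuous[OF li(2)]) (intro continuous_intros v_cont)

lemma v_cube_AC: "1/3 * (v t x) ^ 3 = 1/3 * (v t 0) ^ 3 + oint (\<lambda>x. (v t x)\<^sup>2 * ux t x) 0 x"
proof -
  have "oint (\<lambda>x. 2 * (v t x * ux t x) * v t x + (v t x)\<^sup>2 * ux t x) 0 x = (v t x)\<^sup>2 * v t x - (v t 0)\<^sup>2 * v t 0"
    by (rule oint_by_parts[OF loc_int_cmult[OF vux_li] li(2) v_square_AC v_AC])
  moreover have "(\<lambda>x. 2 * (v t x * ux t x) * v t x + (v t x)\<^sup>2 * ux t x) = (\<lambda>x. 3 * ((v t x)\<^sup>2 * ux t x))"
    by (simp add: fun_eq_iff power2_eq_square)
  moreover have "(v t y)\<^sup>2 * v t y = (v t y) ^ 3" for y by (simp add: power2_eq_square power3_eq_cube)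
  ultimately have "3 * oint (\<lambda>x. (v t x)\<^sup>2 * ux t x) 0 x = (v t x) ^ 3 - (v t 0) ^ 3" by (simp only: oint_cmult)
  then show ?thesis by simp
qed

text \<open>In (iv) with a spatially constant test function the flux drops out, and the source is
  the derivative of the periodic function v^2 - 2 m v, so the energy keeps its initial
  value.\<close>

lemma energy_conserved_AE: "AE t in lborel. 0 \<le> t \<longrightarrow> oint (w t) 0 1 = h"
proof -
  have Am: "(\<lambda>t. oint (w t) 0 1) \<in> borel_measurable borel"
  proof (rule oint_measurable)
    have "(\<lambda>z. ux (fst z) (snd z)) \<in> borel_measurable borel" using ux_meas by (simp add: split_beta')
    then show "(\<lambda>(t, x). w t x) \<in> borel_measurable borel" unfolding w_def split_beta' by measurable
  qed
  have A: "loc_int (\<lambda>t. oint (w t) 0 1)"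
  proof (rule loc_int_dominated[OF loc_int_const Am])
    show "\<bar>oint (w t) 0 1\<bar> \<le> C" for t
      using sq_bounds(2)[of t] oint_nonneg[of 0 1 "w t"] by (simp add: w_def[abs_def])
  qed
  have "AE t in lborel. 0 \<le> t \<longrightarrow> oint (w t) 0 1 = h + oint (\<lambda>t. 0) 0 t"
  proof (rule weak_time_derivative[OF A loc_int_const])
    fix \<eta> assume cut: "cutoff \<eta>"
    have z: "(LINT x:{0..1}|lborel. (2 * u t x * ux t x - 2 * ux t x * m) * (\<eta> t * 1)) = 0" for t
    proof -
      have "(LINT x:{0..1}|lborel. (2 * u t x * ux t x - 2 * ux t x * m) * (\<eta> t * 1))
          = oint (\<lambda>x. \<eta> t * (2 * u t x * ux t x - 2 * ux t x * m)) 0 1" by (simp add: oint_Icc mult.commute)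
      also have "\<dots> = \<eta> t * oint (\<lambda>x. 2 * u t x * ux t x - 2 * ux t x * m) 0 1" by (rule oint_cmult)
      also have "oint (\<lambda>x. 2 * u t x * ux t x - 2 * ux t x * m) 0 1
          = oint (\<lambda>x. 2 * (v t x * ux t x) - 2 * m * ux t x) 0 1"
      proof (rule oint_cong_AE)
        show "AE x in lborel. 2 * u t x * ux t x - 2 * ux t x * m = 2 * (v t x * ux t x) - 2 * m * ux t x"
          using v_ae[of t] by eventually_elim (simp add: mult.assoc mult.left_commute)
      qed (use um in measurable)
      also have "\<dots> = oint (\<lambda>x. 2 * (v t x * ux t x)) 0 1 - 2 * m * oint (ux t) 0 1"
        by (simp only: oint_diff[OF loc_int_cmult[OF vux_li] loc_int_cmult[OF li(2)]] oint_cmult)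
      also have "\<dots> = 0" using v_square_AC[of t 1] v_per[of t 0] reg(1)[of t] by simp
      finally show ?thesis by simp
    qed
    have i: "(LINT x:{0..1}|lborel. (ux t x)\<^sup>2 * (deriv \<eta> t * 1) - (u t x)\<^sup>2 * (ux t x)\<^sup>2 * (\<eta> t * deriv (\<lambda>x. 1) x))
        = oint (w t) 0 1 * deriv \<eta> t" for t
    proof -
      have "oint (\<lambda>x. deriv \<eta> t * w t x) 0 1 = deriv \<eta> t * oint (w t) 0 1" by (rule oint_cmult)
      then show ?thesis by (simp add: oint_Icc w_def mult.commute)
    qed
    have "(LINT t:{0..}|lborel. oint (w t) 0 1 * deriv \<eta> t) = - (LINT x:{0..1}|lborel. (ux 0 x)\<^sup>2 * (\<eta> 0 * 1))"
      using weak4[OF cut smooth1_const[of 1]] unfolding z i by (simp add: periodic1_def set_lebesgue_integral_def)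
    then show "(LINT t:{0..}|lborel. oint (w t) 0 1 * deriv \<eta> t + 0 * \<eta> t) = - h * \<eta> 0"
      using h by simp
  qed
  then show ?thesis by simp
qed

lemma c1_eq: "c1 = h"
proof -
  have *: "AE t in lborel. 0 \<le> t \<longrightarrow> t \<in> S \<and> oint (w t) 0 1 = h"
    using S_AE energy_conserved_AE by eventually_elim auto
  obtain t where "t \<in> S" "oint (w t) 0 1 = h" using AE_halfline_ex[OF *] by blast
  then show ?thesis using energy[of t] by (simp add: oint_Icc w_def[abs_def])
qed

lemma w_total: "t \<in> insert 0 S \<Longrightarrow> oint (\<lambda>x. (ux t x)\<^sup>2) 0 1 = h"
  using energy[of t] h c1_eq by (auto simp: oint_Icc)

sublocale pf: pre_flow v ux "insert 0 S" h M m
proof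
  have h0: "0 \<le> h" using w_total[of 0] oint_nonneg[of 0 1 "\<lambda>x. (ux 0 x)\<^sup>2"] by simp
  show "oint (\<lambda>x. (ux t x)\<^sup>2) 0 1 \<le> h" for t
    using w_total[of t] off[of t] h0 by (cases "t \<in> insert 0 S") auto
  show "oint (\<lambda>x. (ux t x)\<^sup>2) 0 1 = h" if "t \<in> insert 0 S" for t by (rule w_total[OF that])
qed (fact v_meas ux_meas li(4) v_diff v_per li(6) v_bound insertI1)+

lemma pfw: "pf.w = w" by (simp add: fun_eq_iff pf.w_def w_def)

lemmas w_section_int = pf.w_section_int[unfolded pfw]
lemmas v2q_section_int = pf.u2q_section_int[unfolded pfw]
lemmas W_section_int = pf.W_section_int[unfolded pfw]

definition rE :: "real \<Rightarrow> real \<Rightarrow> real" where "rE t x = (v t x)\<^sup>2 * (1 + w t x) - 2 * m * v t x"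

lemma rE_section_int: "section_int rE"
  unfolding rE_def[abs_def] by (intro section_int_diff section_int_cmult v2q_section_int pf.u_section_int)

text \<open>The formulas of \<open>profile\<close> written out for all times at once, so that joint
  measurability can be shown and the forcing also makes sense off \<open>insert 0 S\<close>, where
  it vanishes.\<close>

definition mm :: "real \<Rightarrow> real" where "mm t = oint (\<lambda>x. v t x * (1 - w t x)) 0 1"
definition Pf :: "real \<Rightarrow> real \<Rightarrow> real" where "Pf t x = oint (\<lambda>y. v t y * (1 - w t y) - mm t) 0 x"
definition Gf :: "real \<Rightarrow> real \<Rightarrow> real" where
  "Gf t x = Pf t x - 1 / (1 - h) * oint (\<lambda>y. (1 - w t y) * Pf t y) 0 1"

lemma Gf_profile: "t \<in> insert 0 S \<Longrightarrow> profile.G (v t) (ux t) h x = Gf t x"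
proof -
  assume t: "t \<in> insert 0 S"
  interpret p: profile "v t" "ux t" "0" h M by (rule pf.prof[OF t])
  have wp: "p.w = w t" using pf.w_prof[of t] by (simp add: pfw)
  have "p.m = mm t" by (simp add: p.m_def mm_def wp)
  then have "p.P = Pf t" by (simp add: fun_eq_iff p.P_def Pf_def wp)
  then show ?thesis by (simp add: p.G_def Gf_def wp)
qed

lemma measurable_time: "f \<in> borel_measurable borel \<Longrightarrow> (\<lambda>z. f (fst z)) \<in> borel_measurable (borel :: (real \<times> real) measure)"
  for f :: "real \<Rightarrow> real"
  by (rule measurable_compose[where g=f]) (simp_all add: borel_measurable_continuous_onI continuous_on_fst)

lemma Gf_meas: "(\<lambda>(t, x). Gf t x) \<in> borel_measurable borel"
proof -
  have v': "(\<lambda>z. v (fst z) (snd z)) \<in> borel_measurable borel" using v_meas by (simp add: split_beta')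
  have ux': "(\<lambda>z. ux (fst z) (snd z)) \<in> borel_measurable borel" using ux_meas by (simp add: split_beta')
  have w': "(\<lambda>z. w (fst z) (snd z)) \<in> borel_measurable borel" unfolding w_def using ux' by measurable
  have f: "(\<lambda>z. v (fst z) (snd z) * (1 - w (fst z) (snd z))) \<in> borel_measurable borel"
    using v' w' by measurable
  have mm: "mm \<in> borel_measurable borel"
    unfolding mm_def[abs_def] by (rule oint_measurable) (use f in \<open>simp add: split_beta'\<close>)
  have "(\<lambda>z. v (fst z) (snd z) * (1 - w (fst z) (snd z)) - mm (fst z)) \<in> borel_measurable borel"
    by (intro borel_measurable_diff f measurable_time mm)
  then have P: "(\<lambda>(t, x). Pf t x) \<in> borel_measurable borel"
    unfolding Pf_def by (intro oint_measurable2) (simp add: split_beta')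
  then have P': "(\<lambda>z. Pf (fst z) (snd z)) \<in> borel_measurable borel" by (simp add: split_beta')
  have g: "(\<lambda>z. (1 - w (fst z) (snd z)) * Pf (fst z) (snd z)) \<in> borel_measurable borel"
    using P' w' by measurable
  have "(\<lambda>t. oint (\<lambda>y. (1 - w t y) * Pf t y) 0 1) \<in> borel_measurable borel"
    by (rule oint_measurable) (use g in \<open>simp add: split_beta'\<close>)
  from measurable_time[OF this] P'
  have "(\<lambda>z. Pf (fst z) (snd z) - 1 / (1 - h) * oint (\<lambda>y. (1 - w (fst z) y) * Pf (fst z) y) 0 1) \<in> borel_measurable borel"
    by (intro borel_measurable_diff borel_measurable_times borel_measurable_const)
  then show ?thesis by (simp add: Gf_def split_beta')
qed

lemma Gf_section_int: "section_int Gf"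
proof (rule section_int_dominated[OF section_int_const Gf_meas])
  fix t x
  interpret p0: profile "v 0" "ux 0" "0" h M by (rule pf.prof) simp
  show "\<bar>Gf t x\<bar> \<le> p0.K2 * (1 + h)\<^sup>2 / \<bar>1 - h\<bar>"
  proof (cases "t \<in> insert 0 S")
    case True
    interpret p: profile "v t" "ux t" "0" h M by (rule pf.prof[OF True])
    show ?thesis using p.G_bound[OF h1, of x] Gf_profile[OF True, of x] by simp
  next
    case False
    then have "u t = (\<lambda>x. 0)" "ux t = (\<lambda>x. 0)" using off by auto
    moreover have "oint (\<lambda>x. 0) 0 = (\<lambda>x. 0)" by (simp add: fun_eq_iff)
    ultimately have v0: "v t = (\<lambda>x. 0)" by (simp add: v_def[abs_def] kc_def)
    have "Pf t x = 0" for x by (simp add: Pf_def mm_def v0)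
    then have "Gf t x = 0" by (simp add: Gf_def)
    then show ?thesis using p0.K2_nonneg by simp
  qed
qed

lemma flux_AE: "AE x in lborel. u t x - u t x * (ux t x)\<^sup>2 = v t x * (1 - w t x)"
  using v_ae[of t] by eventually_elim (simp add: w_def algebra_simps)

lemma w_measurable: "w t \<in> borel_measurable borel" using w_li[of t] by (simp add: loc_int_def)

lemma mean_eq: "(LINT x:{0..1}|lborel. u t x - u t x * (ux t x)\<^sup>2) = mm t"
proof -
  have "oint (\<lambda>x. u t x - u t x * (ux t x)\<^sup>2) 0 1 = oint (\<lambda>x. v t x * (1 - w t x)) 0 1"
    by (rule oint_cong_AE[OF _ _ flux_AE]) (use um w_measurable in measurable)
  then show ?thesis by (simp add: mm_def oint_Icc)
qed

lemma dxinv_eq: "dxinv (\<lambda>y. u t y - u t y * (ux t y)\<^sup>2) x = Pf t x"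
proof -
  have "dxinv (\<lambda>y. u t y - u t y * (ux t y)\<^sup>2) x = oint (\<lambda>y. u t y - u t y * (ux t y)\<^sup>2 - mm t) 0 x"
    unfolding dxinv_def Sproj_def Smean_def mean_eq oint_def by (simp add: zero_ereal_def)
  also have "\<dots> = Pf t x"
    unfolding Pf_def
  proof (rule oint_cong_AE)
    show "AE y in lborel. u t y - u t y * (ux t y)\<^sup>2 - mm t = v t y * (1 - w t y) - mm t"
      using flux_AE[of t] by eventually_elim simp
  qed (use um w_measurable in measurable)
  finally show ?thesis .
qed

lemma forcing_eq: "dxinv (\<lambda>y. u t y - u t y * (ux t y)\<^sup>2) x - ff h u ux t = Gf t x"
  unfolding ff_def dxinv_eq Gf_def by (simp add: oint_Icc w_def)

definition ru :: "real \<Rightarrow> real \<Rightarrow> real" where "ru t x = (v t x)\<^sup>2 * ux t x + Gf t x"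

lemma ru_section_int: "section_int ru"
  unfolding ru_def[abs_def] by (intro section_int_add pf.u2ux_section_int Gf_section_int)

text \<open>The x-derivative is moved from \<phi> to v^3 / 3. As v is only absolutely continuous,
  its derivative v^2 u_x is understood through \<open>v_cube_AC\<close>.\<close>

lemma weak_u:
  assumes \<phi>: "smooth1 \<phi>" "periodic1 \<phi>"
  shows "AE t in lborel. 0 \<le> t \<longrightarrow>
    oint (\<lambda>x. v t x * \<phi> x) 0 1 = oint (\<lambda>x. v 0 x * \<phi> x) 0 1 + oint (\<lambda>r. oint (\<lambda>x. ru r x * \<phi> x) 0 1) 0 t"
proof -
  have c: "continuous_on UNIV \<phi>" "continuous_on UNIV (deriv \<phi>)" by (intro smooth1_continuous smooth1_deriv \<phi>)+
  have per: "\<phi> (x + 1) = \<phi> x" for x using \<phi>(2) by (simp add: periodic1_def)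
  obtain B where B: "\<And>x. \<bar>\<phi> x\<bar> \<le> B" using periodic_continuous_bounded[OF c(1) per] by blast
  have cm: "\<phi> \<in> borel_measurable borel" "deriv \<phi> \<in> borel_measurable borel"
    using c by (auto intro: borel_measurable_continuous_onI)
  define A where "A t = oint (\<lambda>x. v t x * \<phi> x) 0 1" for t
  define B1 where "B1 t = - oint (\<lambda>x. (v t x)\<^sup>2 * ux t x * \<phi> x) 0 1" for t
  define B2 where "B2 t = oint (\<lambda>x. Gf t x * \<phi> x) 0 1" for t
  have nA: "loc_int A" and nB1: "loc_int B1" and nB2: "loc_int B2"
    unfolding A_def B1_def B2_def
    by (intro section_int_oint section_int_mult_bounded[OF _ c(1) B] pf.u_section_int Gf_section_int
        loc_int_uminus section_int_mult_bounded[OF pf.u2ux_section_int c(1) B])+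
  have cube_li: "loc_int (\<lambda>x. 1/3 * (v t x) ^ 3 * deriv \<phi> x)" for t
    by (intro loc_int_continuous continuous_intros v_cont c)
  have parts: "oint (\<lambda>x. 1/3 * (v t x) ^ 3 * deriv \<phi> x) 0 1 = B1 t" for t
  proof -
    have "oint (\<lambda>x. (v t x)\<^sup>2 * ux t x * \<phi> x + 1/3 * (v t x) ^ 3 * deriv \<phi> x) 0 1
        = 1/3 * (v t 1) ^ 3 * \<phi> 1 - 1/3 * (v t 0) ^ 3 * \<phi> 0"
      by (rule oint_by_parts[OF v2ux_li smooth1_oint_deriv(2)[OF \<phi>(1)] v_cube_AC smooth1_oint_deriv(1)[OF \<phi>(1)]])
    also have "\<dots> = 0" using v_per[of t 0] per[of 0] by simp
    finally show ?thesis
      using loc_int_mult_right[OF v2ux_li c(1), of t] cube_li[of t] by (simp add: oint_add B1_def)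
  qed
  have "AE t in lborel. 0 \<le> t \<longrightarrow> A t = A 0 + oint (\<lambda>t. B2 t - B1 t) 0 t"
  proof (rule weak_time_derivative[OF nA loc_int_diff[OF nB2 nB1]])
    fix \<eta> assume cut: "cutoff \<eta>"
    have i1: "(LINT x:{0..1}|lborel. u t x * (deriv \<eta> t * \<phi> x) - 1/3 * (u t x) ^ 3 * (\<eta> t * deriv \<phi> x))
        = A t * deriv \<eta> t - B1 t * \<eta> t" for t
    proof -
      have "oint (\<lambda>x. u t x * (deriv \<eta> t * \<phi> x) - 1/3 * (u t x) ^ 3 * (\<eta> t * deriv \<phi> x)) 0 1
          = oint (\<lambda>x. deriv \<eta> t * (v t x * \<phi> x) - \<eta> t * (1/3 * (v t x) ^ 3 * deriv \<phi> x)) 0 1"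
      proof (rule oint_cong_AE)
        show "AE x in lborel. u t x * (deriv \<eta> t * \<phi> x) - 1/3 * (u t x) ^ 3 * (\<eta> t * deriv \<phi> x)
            = deriv \<eta> t * (v t x * \<phi> x) - \<eta> t * (1/3 * (v t x) ^ 3 * deriv \<phi> x)"
          using v_ae[of t] by eventually_elim (simp add: mult_ac)
      qed (use um[of t] cm in measurable)
      also have "\<dots> = deriv \<eta> t * A t - \<eta> t * B1 t"
        unfolding A_def parts[symmetric]
        by (simp only: oint_diff[OF loc_int_cmult[OF loc_int_continuous[OF continuous_on_mult[OF v_cont c(1)]]] loc_int_cmult[OF cube_li]] oint_cmult)
      finally show ?thesis by (simp add: oint_Icc mult.commute)
    qed
    have i2: "(LINT x:{0..1}|lborel. (dxinv (\<lambda>y. u t y - u t y * (ux t y)\<^sup>2) x - ff h u ux t) * (\<eta> t * \<phi> x)) = B2 t * \<eta> t" for t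
    proof -
      have "oint (\<lambda>x. \<eta> t * (Gf t x * \<phi> x)) 0 1 = \<eta> t * B2 t" unfolding B2_def by (rule oint_cmult)
      then show ?thesis unfolding forcing_eq by (simp add: oint_Icc mult_ac)
    qed
    have i0: "(LINT x:{0..1}|lborel. u 0 x * (\<eta> 0 * \<phi> x)) = A 0 * \<eta> 0"
    proof -
      have "oint (\<lambda>x. u 0 x * (\<eta> 0 * \<phi> x)) 0 1 = oint (\<lambda>x. \<eta> 0 * (v 0 x * \<phi> x)) 0 1"
      proof (rule oint_cong_AE)
        show "AE x in lborel. u 0 x * (\<eta> 0 * \<phi> x) = \<eta> 0 * (v 0 x * \<phi> x)"
          using v_ae[of 0] by eventually_elim (simp add: mult_ac)
      qed (use um[of 0] cm in measurable)
      then show ?thesis unfolding A_def by (simp add: oint_cmult oint_Icc mult.commute)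
    qed
    show "(LINT t:{0..}|lborel. A t * deriv \<eta> t + (B2 t - B1 t) * \<eta> t) = - A 0 * \<eta> 0"
      by (rule weak_rearrange[OF nA nB1 nB2 cut]) (use weak2[OF cut \<phi>] in \<open>simp only: i1 i2 i0\<close>)
  qed
  moreover have "B2 t - B1 t = oint (\<lambda>x. ru t x * \<phi> x) 0 1" for t
    unfolding B1_def B2_def ru_def distrib_right
    using loc_int_mult_right[OF v2ux_li c(1), of t] loc_int_mult_right[OF section_intD(2)[OF Gf_section_int] c(1), of t]
    by (simp add: oint_add)
  ultimately show ?thesis by (simp add: A_def)
qed

section \<open>The equation of the energy potential\<close>

abbreviation W :: "real \<Rightarrow> real \<Rightarrow> real" where "W t \<equiv> oint (w t) 0"

text \<open>Inserting the primitive \<phi> of \<psi> into (iv) and integrating by parts replaces w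
  by its primitive W. As \<phi> is periodic only for \<psi> of mean zero, the equation for W is
  obtained up to a function of t alone.\<close>

lemma weak_W:
  assumes \<rho>: "smooth1 \<rho>" "periodic1 \<rho>"
  defines "\<psi> \<equiv> \<lambda>x. \<rho> x - oint \<rho> 0 1"
  shows "AE t in lborel. 0 \<le> t \<longrightarrow>
    oint (\<lambda>x. W t x * \<psi> x) 0 1 = oint (\<lambda>x. W 0 x * \<psi> x) 0 1 + oint (\<lambda>r. oint (\<lambda>x. rE r x * \<psi> x) 0 1) 0 t"
proof -
  define \<phi> where "\<phi> x = oint \<psi> 0 x" for x
  have rl: "loc_int \<rho>" by (intro loc_int_continuous smooth1_continuous \<rho>)
  have s\<psi>: "smooth1 \<psi>" unfolding \<psi>_def using smooth1_add[OF \<rho>(1) smooth1_const[of "- oint \<rho> 0 1"]] by simp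
  have p\<psi>: "\<psi> (x + 1) = \<psi> x" for x using \<rho>(2) by (simp add: periodic1_def \<psi>_def)
  have c\<psi>: "continuous_on UNIV \<psi>" by (intro smooth1_continuous s\<psi>)
  have l\<psi>: "loc_int \<psi>" by (rule loc_int_continuous[OF c\<psi>])
  have z: "oint \<psi> 0 1 = 0" unfolding \<psi>_def by (subst oint_diff[OF rl loc_int_const]) simp
  have s\<phi>: "smooth1 \<phi>" and d\<phi>: "deriv \<phi> = \<psi>" unfolding \<phi>_def using smooth1_oint[OF s\<psi>] by auto
  have per: "\<phi> (x + 1) = \<phi> x" for x
    using oint_combine[OF l\<psi>, of 0 x "x+1"] oint_periodic[OF l\<psi> p\<psi>, of x] z by (simp add: \<phi>_def)
  have p\<phi>: "periodic1 \<phi>" using per by (simp add: periodic1_def)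
  have c\<phi>: "continuous_on UNIV \<phi>" by (intro smooth1_continuous s\<phi>)
  have \<phi>AC: "\<phi> x = \<phi> 0 + oint \<psi> 0 x" for x by (simp add: \<phi>_def)
  have \<phi>01: "\<phi> 0 = 0" "\<phi> 1 = 0" using z by (auto simp: \<phi>_def)
  obtain B where B: "\<And>x. \<bar>\<psi> x\<bar> \<le> B" using periodic_continuous_bounded[OF c\<psi> p\<psi>] by blast
  have cm: "\<phi> \<in> borel_measurable borel" "\<psi> \<in> borel_measurable borel"
    using c\<phi> c\<psi> by (auto intro: borel_measurable_continuous_onI)
  \<comment> \<open>The two functions add up to \<open>rE\<close>: the first is the flux v^2 w, the
    second a primitive of the source 2 v u_x - 2 m u_x.\<close>
  let ?f1 = "\<lambda>t x. (v t x)\<^sup>2 * (1 + w t x) - (v t x)\<^sup>2"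
  let ?f2 = "\<lambda>t x. (v t x)\<^sup>2 - 2 * m * v t x"
  have v2_section_int: "section_int (\<lambda>t x. (v t x)\<^sup>2)"
  proof (rule section_int_dominated[OF section_int_const])
    have "(\<lambda>z. v (fst z) (snd z)) \<in> borel_measurable borel" using v_meas by (simp add: split_beta')
    then show "(\<lambda>(t, x). (v t x)\<^sup>2) \<in> borel_measurable borel" unfolding split_beta' by measurable
    show "\<bar>(v t x)\<^sup>2\<bar> \<le> M\<^sup>2" for t x using pf.u2_le[of t x] by simp
  qed
  have f1n: "section_int ?f1" by (intro section_int_diff v2q_section_int v2_section_int)
  have f2n: "section_int ?f2" by (intro section_int_diff section_int_cmult v2_section_int pf.u_section_int)
  have f1: "?f1 t x = (v t x)\<^sup>2 * w t x" for t x by (simp add: algebra_simps)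
  define A where "A t = - oint (\<lambda>x. W t x * \<psi> x) 0 1" for t
  define B1 where "B1 t = oint (\<lambda>x. ?f1 t x * \<psi> x) 0 1" for t
  define B2 where "B2 t = - oint (\<lambda>x. ?f2 t x * \<psi> x) 0 1" for t
  have nA: "loc_int A" unfolding A_def by (intro loc_int_uminus section_int_oint section_int_mult_bounded[OF W_section_int c\<psi> B])
  have nB1: "loc_int B1" unfolding B1_def by (intro section_int_oint section_int_mult_bounded[OF f1n c\<psi> B])
  have nB2: "loc_int B2" unfolding B2_def by (intro loc_int_uminus section_int_oint section_int_mult_bounded[OF f2n c\<psi> B])
  have partsA: "oint (\<lambda>x. w t x * \<phi> x) 0 1 = A t" for t
  proof -
    have "oint (\<lambda>x. w t x * \<phi> x + W t x * \<psi> x) 0 1 = W t 1 * \<phi> 1 - W t 0 * \<phi> 0"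
      by (rule oint_by_parts[OF w_li l\<psi> _ \<phi>AC]) simp
    moreover have "loc_int (\<lambda>x. W t x * \<psi> x)" by (intro loc_int_continuous continuous_intros oint_continuous w_li c\<psi>)
    ultimately show ?thesis
      using loc_int_mult_right[OF w_li c\<phi>, of t] by (simp add: oint_add A_def \<phi>01)
  qed
  let ?J' = "\<lambda>t x. 2 * (v t x * ux t x) - 2 * m * ux t x"
  have J'l: "loc_int (?J' t)" for t by (intro loc_int_diff loc_int_cmult vux_li li)
  have parts2: "oint (\<lambda>x. ?J' t x * \<phi> x) 0 1 = B2 t" for t
  proof -
    have "?f2 t x = ?f2 t 0 + oint (?J' t) 0 x" for x
    proof -
      have d: "oint (?J' t) 0 x = oint (\<lambda>x. 2 * (v t x * ux t x)) 0 x - 2 * m * oint (ux t) 0 x"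
        by (simp only: oint_diff[OF loc_int_cmult[OF vux_li] loc_int_cmult[OF li(2)]] oint_cmult)
      show ?thesis
        unfolding d by (subst v_square_AC[of t x], subst v_AC[of t x]) (simp add: algebra_simps)
    qed
    then have "oint (\<lambda>x. ?J' t x * \<phi> x + ?f2 t x * \<psi> x) 0 1 = ?f2 t 1 * \<phi> 1 - ?f2 t 0 * \<phi> 0"
      by (rule oint_by_parts[OF J'l l\<psi> _ \<phi>AC])
    then show ?thesis
      using loc_int_mult_right[OF J'l c\<phi>, of t] loc_int_mult_right[OF section_intD(2)[OF f2n] c\<psi>, of t]
      by (simp add: oint_add B2_def \<phi>01)
  qed
  have "AE t in lborel. 0 \<le> t \<longrightarrow> A t = A 0 + oint (\<lambda>t. B2 t - B1 t) 0 t"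
  proof (rule weak_time_derivative[OF nA loc_int_diff[OF nB2 nB1]])
    fix \<eta> assume cut: "cutoff \<eta>"
    have i1: "(LINT x:{0..1}|lborel. (ux t x)\<^sup>2 * (deriv \<eta> t * \<phi> x) - (u t x)\<^sup>2 * (ux t x)\<^sup>2 * (\<eta> t * deriv \<phi> x))
        = A t * deriv \<eta> t - B1 t * \<eta> t" for t
    proof -
      have "oint (\<lambda>x. (ux t x)\<^sup>2 * (deriv \<eta> t * \<phi> x) - (u t x)\<^sup>2 * (ux t x)\<^sup>2 * (\<eta> t * deriv \<phi> x)) 0 1
          = oint (\<lambda>x. deriv \<eta> t * (w t x * \<phi> x) - \<eta> t * (?f1 t x * \<psi> x)) 0 1"
      proof (rule oint_cong_AE)
        show "AE x in lborel. (ux t x)\<^sup>2 * (deriv \<eta> t * \<phi> x) - (u t x)\<^sup>2 * (ux t x)\<^sup>2 * (\<eta> t * deriv \<phi> x)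
            = deriv \<eta> t * (w t x * \<phi> x) - \<eta> t * (?f1 t x * \<psi> x)"
          unfolding f1 d\<phi> using v_ae[of t] by eventually_elim (simp add: w_def mult_ac)
      qed (use um[of t] cm w_measurable[of t] in \<open>unfold d\<phi>, measurable\<close>)
      also have "\<dots> = deriv \<eta> t * A t - \<eta> t * B1 t"
        unfolding partsA[symmetric] B1_def
        by (simp only: oint_diff[OF loc_int_cmult[OF loc_int_mult_right[OF w_li c\<phi>]] loc_int_cmult[OF loc_int_mult_right[OF section_intD(2)[OF f1n] c\<psi>]]] oint_cmult)
      finally show ?thesis by (simp add: oint_Icc mult.commute)
    qed
    have i2: "(LINT x:{0..1}|lborel. (2 * u t x * ux t x - 2 * ux t x * m) * (\<eta> t * \<phi> x)) = B2 t * \<eta> t" for t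
    proof -
      have "oint (\<lambda>x. (2 * u t x * ux t x - 2 * ux t x * m) * (\<eta> t * \<phi> x)) 0 1 = oint (\<lambda>x. \<eta> t * (?J' t x * \<phi> x)) 0 1"
      proof (rule oint_cong_AE)
        show "AE x in lborel. (2 * u t x * ux t x - 2 * ux t x * m) * (\<eta> t * \<phi> x) = \<eta> t * (?J' t x * \<phi> x)"
          using v_ae[of t] by eventually_elim (simp add: mult_ac)
      qed (use um[of t] cm in measurable)
      also have "\<dots> = \<eta> t * B2 t" unfolding oint_cmult parts2 ..
      finally show ?thesis by (simp add: oint_Icc mult.commute)
    qed
    have i0: "(LINT x:{0..1}|lborel. (ux 0 x)\<^sup>2 * (\<eta> 0 * \<phi> x)) = A 0 * \<eta> 0"
    proof -
      have "oint (\<lambda>x. \<eta> 0 * (w 0 x * \<phi> x)) 0 1 = \<eta> 0 * A 0" unfolding oint_cmult partsA ..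
      then show ?thesis by (simp add: oint_Icc w_def mult_ac)
    qed
    show "(LINT t:{0..}|lborel. A t * deriv \<eta> t + (B2 t - B1 t) * \<eta> t) = - A 0 * \<eta> 0"
      by (rule weak_rearrange[OF nA nB1 nB2 cut]) (use weak4[OF cut s\<phi> p\<phi>] in \<open>simp only: i1 i2 i0\<close>)
  qed
  moreover have "B2 t - B1 t = - oint (\<lambda>x. rE t x * \<psi> x) 0 1" for t
  proof -
    have "oint (\<lambda>x. rE t x * \<psi> x) 0 1 = oint (\<lambda>x. ?f1 t x * \<psi> x + ?f2 t x * \<psi> x) 0 1"
      by (rule oint_cong) (simp add: rE_def algebra_simps)
    also have "\<dots> = B1 t - B2 t"
      unfolding B1_def B2_def
      by (simp add: oint_add[OF loc_int_mult_right[OF section_intD(2)[OF f1n] c\<psi>] loc_int_mult_right[OF section_intD(2)[OF f2n] c\<psi>]])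
    finally show ?thesis by simp
  qed
  ultimately have "AE t in lborel. 0 \<le> t \<longrightarrow> A t = A 0 + oint (\<lambda>t. - oint (\<lambda>x. rE t x * \<psi> x) 0 1) 0 t" by simp
  then show ?thesis by eventually_elim (auto simp: A_def oint_uminus)
qed

text \<open>The integration constant of the energy potential is chosen such that the potential
  satisfies the transport equation and not only its derivative in space.\<close>
definition ee :: "real \<Rightarrow> real" where
  "ee t = oint (W 0) 0 1 - oint (W t) 0 1 + oint (\<lambda>r. oint (rE r) 0 1) 0 t"

definition Ef :: "real \<Rightarrow> real \<Rightarrow> real" where "Ef t x = ee t + (x + W t x)"

lemma ee_loc: "loc_int ee"
  unfolding ee_def[abs_def]
  by (intro loc_int_add loc_int_diff loc_int_const section_int_oint W_section_int loc_int_continuous oint_continuous rE_section_int)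

lemma Ef_section_int: "section_int Ef"
  unfolding Ef_def[abs_def] by (intro section_int_add section_int_time ee_loc section_int_space_id W_section_int)

lemma Ef_profile: "profile.E (ux t) (ee t) = Ef t"
  using profile.E_def[OF pf.prof_any[of t], where e="ee t"] pf.w_prof[of t] by (simp add: fun_eq_iff Ef_def pfw)

text \<open>The function \<rho> splits into its mean and a part of mean zero. \<open>weak_W\<close>
  covers the latter, and \<open>ee\<close> is defined so that the former balances exactly.\<close>

lemma weak_E:
  assumes \<rho>: "smooth1 \<rho>" "periodic1 \<rho>"
  shows "AE t in lborel. 0 \<le> t \<longrightarrow>
    oint (\<lambda>x. Ef t x * \<rho> x) 0 1 = oint (\<lambda>x. Ef 0 x * \<rho> x) 0 1 + oint (\<lambda>r. oint (\<lambda>x. rE r x * \<rho> x) 0 1) 0 t"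
proof -
  define r0 where "r0 = oint \<rho> 0 1"
  have c: "continuous_on UNIV \<rho>" by (intro smooth1_continuous \<rho>)
  have rl: "loc_int \<rho>" by (rule loc_int_continuous[OF c])
  have split: "oint (\<lambda>x. f x * \<rho> x) 0 1 = oint (\<lambda>x. f x * (\<rho> x - r0)) 0 1 + r0 * oint f 0 1" if "loc_int f" for f
  proof -
    have "oint (\<lambda>x. f x * (\<rho> x - r0)) 0 1 = oint (\<lambda>x. f x * \<rho> x - r0 * f x) 0 1" by (simp add: algebra_simps)
    then show ?thesis by (simp add: oint_diff[OF loc_int_mult_right[OF that c] loc_int_cmult[OF that]] oint_cmult)
  qed
  have Wl: "loc_int (W t)" for t by (rule section_intD(2)[OF W_section_int])
  have xl: "loc_int (\<lambda>x. x)" by (rule loc_int_continuous) auto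
  define x0 where "x0 = oint (\<lambda>x. x * \<rho> x) 0 1"
  have E: "oint (\<lambda>x. Ef t x * \<rho> x) 0 1 = ee t * r0 + (x0 + (oint (\<lambda>x. W t x * (\<rho> x - r0)) 0 1 + r0 * oint (W t) 0 1))" for t
  proof -
    have "oint (\<lambda>x. Ef t x * \<rho> x) 0 1 = oint (\<lambda>x. ee t * \<rho> x + (x * \<rho> x + W t x * \<rho> x)) 0 1"
      by (simp add: Ef_def algebra_simps)
    also have "\<dots> = ee t * r0 + (x0 + oint (\<lambda>x. W t x * \<rho> x) 0 1)"
      unfolding r0_def x0_def
      by (simp add: oint_add oint_cmult loc_int_add loc_int_cmult rl loc_int_mult_right[OF xl c] loc_int_mult_right[OF Wl c])
    finally show ?thesis by (simp add: split[OF Wl])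
  qed
  have p: "oint (\<lambda>r. oint (\<lambda>x. rE r x * \<rho> x) 0 1) 0 t
      = oint (\<lambda>r. oint (\<lambda>x. rE r x * (\<rho> x - r0)) 0 1) 0 t + r0 * oint (\<lambda>r. oint (rE r) 0 1) 0 t" for t
  proof -
    have per: "\<rho> (x + 1) - r0 = \<rho> x - r0" for x using \<rho>(2) by (simp add: periodic1_def)
    have c': "continuous_on UNIV (\<lambda>x. \<rho> x - r0)" by (intro continuous_intros c)
    obtain B where B: "\<And>x. \<bar>\<rho> x - r0\<bar> \<le> B" using periodic_continuous_bounded[OF c' per] by blast
    show ?thesis
      unfolding split[OF section_intD(2)[OF rE_section_int]]
      by (simp add: oint_add[OF section_int_oint[OF section_int_mult_bounded[OF rE_section_int c' B]] loc_int_cmult[OF section_int_oint[OF rE_section_int]]] oint_cmult)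
  qed
  have "AE t in lborel. 0 \<le> t \<longrightarrow>
    oint (\<lambda>x. W t x * (\<rho> x - r0)) 0 1 = oint (\<lambda>x. W 0 x * (\<rho> x - r0)) 0 1 + oint (\<lambda>r. oint (\<lambda>x. rE r x * (\<rho> x - r0)) 0 1) 0 t"
    using weak_W[OF \<rho>] by (simp add: r0_def)
  then show ?thesis
  proof eventually_elim
    case (elim t)
    show ?case
    proof
      assume "0 \<le> t"
      with elim show "oint (\<lambda>x. Ef t x * \<rho> x) 0 1 = oint (\<lambda>x. Ef 0 x * \<rho> x) 0 1 + oint (\<lambda>r. oint (\<lambda>x. rE r x * \<rho> x) 0 1) 0 t"
        unfolding E p by (simp add: ee_def algebra_simps)
    qed
  qed
qed

definition good :: "real set" where
  "good = {t \<in> insert 0 S. (\<forall>b. oint (Ef t) 0 b = oint (Ef 0) 0 b + oint (\<lambda>r. oint (rE r) 0 b) 0 t) \<and>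
     (\<forall>b. oint (v t) 0 b = oint (v 0) 0 b + oint (\<lambda>r. oint (ru r) 0 b) 0 t)}"

lemma good_AE: "AE t in lborel. 0 \<le> t \<longrightarrow> t \<in> good"
proof -
  have T: "AE t in lborel. 0 \<le> t \<longrightarrow> t \<in> insert 0 S" using S_AE by eventually_elim auto
  have Gper: "Gf t (x + 1) = Gf t x" for t x
  proof -
    have l: "loc_int (\<lambda>y. v t y * (1 - w t y))"
      by (intro loc_int_mult_continuous[OF _ v_cont] loc_int_diff loc_int_const w_li)
    have "Pf t (x + 1) - Pf t x = oint (\<lambda>y. v t y * (1 - w t y) - mm t) x (x + 1)"
      unfolding Pf_def by (intro oint_diff_base loc_int_diff l loc_int_const)
    also have "\<dots> = oint (\<lambda>y. v t y * (1 - w t y) - mm t) 0 1"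
      by (intro oint_periodic loc_int_diff l loc_int_const) (simp add: v_per w_def li)
    also have "\<dots> = 0" by (simp add: oint_diff[OF l loc_int_const] mm_def)
    finally show ?thesis by (simp add: Gf_def)
  qed
  have E: "AE t in lborel. 0 \<le> t \<longrightarrow> (\<forall>b. oint (Ef t) 0 b = oint (Ef 0) 0 b + oint (\<lambda>r. oint (rE r) 0 b) 0 t)"
  proof (rule box_identity[OF Ef_section_int rE_section_int _ T _ weak_E])
    fix t x assume t: "t \<in> insert 0 S"
    \<comment> \<open>Over a period W gains the energy h, the same at time 0 and at all times of S;
      hence the difference of E between these times is periodic.\<close>
    have "W t (x + 1) - W t x = h" if "t \<in> insert 0 S" for t
      using oint_diff_base[OF w_li, of t 0 "x+1" x] oint_periodic[OF w_li, of t x] w_total[OF that]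
      by (simp add: w_def[abs_def] li)
    from this[OF t] this[of 0] show "Ef t (x + 1) - Ef 0 (x + 1) = Ef t x - Ef 0 x" by (simp add: Ef_def)
  qed (simp_all add: rE_def v_per w_def li)
  have V: "AE t in lborel. 0 \<le> t \<longrightarrow> (\<forall>b. oint (v t) 0 b = oint (v 0) 0 b + oint (\<lambda>r. oint (ru r) 0 b) 0 t)"
    by (rule box_identity[OF pf.u_section_int ru_section_int _ T _ weak_u]) (simp_all add: ru_def v_per li Gper)
  from T E V show ?thesis by eventually_elim (auto simp: good_def)
qed

lemma good_subset: "good \<subseteq> insert 0 S" by (auto simp: good_def)

lemma zero_good: "0 \<in> good" by (simp add: good_def)

text \<open>T is allowed to be smaller than \<open>good\<close>, because two solutions have to be
  treated on a common set of times.\<close>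

lemma good_flow:
  assumes "T \<subseteq> good" "0 \<in> T" "AE t in lborel. 0 \<le> t \<longrightarrow> t \<in> T"
  shows "flow v ux T h M m Gf ee"
proof (intro flow.intro pre_flow.intro flow_axioms.intro)
  have T: "t \<in> insert 0 S" if "t \<in> T" for t using that assms(1) good_subset by auto
  show "oint (\<lambda>x. (ux t x)\<^sup>2) 0 1 = h" if "t \<in> T" for t by (rule w_total[OF T[OF that]])
  show "0 \<le> t" if "t \<in> T" for t using T[OF that] S_pos[of t] by auto
  show "Gf t x = profile.G (v t) (ux t) h x" if "t \<in> T" for t x using Gf_profile[OF T[OF that]] by simp
  show "oint (profile.E (ux t) (ee t)) 0 b = oint (profile.E (ux 0) (ee 0)) 0 b
      + oint (\<lambda>r. oint (\<lambda>x. (v r x)\<^sup>2 * (1 + (ux r x)\<^sup>2) - 2 * m * v r x) 0 b) 0 t" if "t \<in> T" for t b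
    using that assms(1) unfolding Ef_profile by (auto simp: good_def rE_def[abs_def] w_def)
  show "oint (v t) 0 b = oint (v 0) 0 b + oint (\<lambda>r. oint (\<lambda>x. (v r x)\<^sup>2 * ux r x + Gf r x) 0 b) 0 t" if "t \<in> T" for t b
    using that assms(1) by (auto simp: good_def ru_def[abs_def])
qed (fact v_meas ux_meas li(4) v_diff v_per li(6) pf.w_le v_bound assms h1 ee_loc Gf_section_int)+

lemma mean_good:
  assumes "t \<in> good" "0 < t" shows "profile.m (v t) (ux t) = m"
proof -
  have t: "t \<in> S" using assms good_subset by auto
  then have t': "t \<in> insert 0 S" by simp
  interpret p: profile "v t" "ux t" "0" h M by (rule pf.prof[OF t'])
  have "p.w = w t" using pf.w_prof[of t] by (simp add: pfw)
  then have "p.m = mm t" by (simp add: p.m_def mm_def)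
  then show ?thesis using mean[OF t] mean_eq[of t] by simp
qed

end

subsection \<open>Uniqueness\<close>

lemma halfline_cong:
  assumes m: "(\<lambda>z. f (fst z) (snd z)) \<in> borel_measurable (borel :: (real \<times> real) measure)"
    "(\<lambda>z. g (fst z) (snd z)) \<in> borel_measurable (borel :: (real \<times> real) measure)"
    and eq: "AE t in lborel. 0 \<le> t \<longrightarrow> (\<forall>x. f t x = g t x)"
  shows "(LINT t:{0..}|lborel. LINT x:{0..1}|lborel. f t x) = (LINT t:{0..}|lborel. LINT x:{0..1}|lborel. (g t x :: real))"
proof (rule set_lebesgue_integral_cong_AE)
  show "(\<lambda>t. LINT x:{0..1}|lborel. f t x) \<in> borel_measurable lborel"
    using oint_measurable[of f 0 1] m(1) by (simp add: oint_Icc split_beta')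
  show "(\<lambda>t. LINT x:{0..1}|lborel. g t x) \<in> borel_measurable lborel"
    using oint_measurable[of g 0 1] m(2) by (simp add: oint_Icc split_beta')
  show "AE t\<in>{0..} in lborel. (LINT x:{0..1}|lborel. f t x) = (LINT x:{0..1}|lborel. g t x)"
    using eq by eventually_elim simp
qed simp

lemma fst_snd_measurable [measurable]:
  "fst \<in> borel_measurable (borel :: (real \<times> real) measure)"
  "snd \<in> borel_measurable (borel :: (real \<times> real) measure)"
  by (simp_all add: borel_measurable_continuous_onI continuous_on_fst continuous_on_snd)

section \<open>Measurability of the integrands in the weak identities\<close>

context
  fixes u ux :: "real \<Rightarrow> real \<Rightarrow> real" and \<eta> \<phi> :: "real \<Rightarrow> real"
  assumes u: "(\<lambda>(t, x). u t x) \<in> borel_measurable (borel :: (real \<times> real) measure)"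
    and ux: "(\<lambda>(t, x). ux t x) \<in> borel_measurable (borel :: (real \<times> real) measure)"
    and \<eta>: "smooth1 \<eta>" and \<phi>: "smooth1 \<phi>"
begin

lemma joint_measurable:
  "(\<lambda>z. u (fst z) (snd z)) \<in> borel_measurable borel" "(\<lambda>z. ux (fst z) (snd z)) \<in> borel_measurable borel"
  "\<eta> \<in> borel_measurable borel" "\<phi> \<in> borel_measurable borel"
  "deriv \<eta> \<in> borel_measurable borel" "deriv \<phi> \<in> borel_measurable borel"
  using u ux by (auto simp: split_beta' intro!: borel_measurable_continuous_onI smooth1_continuous smooth1_deriv \<eta> \<phi>)

lemma flux_measurable: "(\<lambda>z. u (fst z) (snd z) - u (fst z) (snd z) * (ux (fst z) (snd z))\<^sup>2) \<in> borel_measurable borel"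
  using joint_measurable by measurable

lemma Smean_measurable: "(\<lambda>t. Smean (\<lambda>x. u t x - u t x * (ux t x)\<^sup>2)) \<in> borel_measurable borel"
proof -
  have "(\<lambda>t. oint (\<lambda>x. u t x - u t x * (ux t x)\<^sup>2) 0 1) \<in> borel_measurable borel"
    by (rule oint_measurable) (use flux_measurable in \<open>simp add: split_beta'\<close>)
  then show ?thesis by (simp add: Smean_def oint_Icc)
qed

lemma dxinv_measurable:
  "(\<lambda>z. dxinv (\<lambda>y. u (fst z) y - u (fst z) y * (ux (fst z) y)\<^sup>2) (snd z)) \<in> borel_measurable borel"
proof -
  have 1: "(\<lambda>z. u (fst z) (snd z) - u (fst z) (snd z) * (ux (fst z) (snd z))\<^sup>2
      - Smean (\<lambda>x. u (fst z) x - u (fst z) x * (ux (fst z) x)\<^sup>2)) \<in> borel_measurable borel"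
    by (intro borel_measurable_diff flux_measurable measurable_compose[OF fst_snd_measurable(1) Smean_measurable])
  have "(\<lambda>(t, x). oint (\<lambda>y. u t y - u t y * (ux t y)\<^sup>2 - Smean (\<lambda>x. u t x - u t x * (ux t x)\<^sup>2)) 0 x) \<in> borel_measurable borel"
    by (rule oint_measurable2) (use 1 in \<open>simp add: split_beta'\<close>)
  then show ?thesis by (simp add: dxinv_def Sproj_def oint_def zero_ereal_def split_beta')
qed

lemma ff_measurable: "(\<lambda>t. ff h u ux t) \<in> borel_measurable borel"
proof -
  have "(\<lambda>z. (1 - (ux (fst z) (snd z))\<^sup>2) * dxinv (\<lambda>y. u (fst z) y - u (fst z) y * (ux (fst z) y)\<^sup>2) (snd z)) \<in> borel_measurable borel"
    using joint_measurable dxinv_measurable by measurable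
  then have "(\<lambda>t. oint (\<lambda>y. (1 - (ux t y)\<^sup>2) * dxinv (\<lambda>x. u t x - u t x * (ux t x)\<^sup>2) y) 0 1) \<in> borel_measurable borel"
    by (intro oint_measurable) (simp add: split_beta')
  then show ?thesis unfolding ff_def by (simp add: oint_Icc)
qed

lemma integrands_measurable:
  "(\<lambda>z. (ux (fst z) (snd z))\<^sup>2 * (deriv \<eta> (fst z) * \<phi> (snd z)) - (u (fst z) (snd z))\<^sup>2 * (ux (fst z) (snd z))\<^sup>2 * (\<eta> (fst z) * deriv \<phi> (snd z))) \<in> borel_measurable borel"
  "(\<lambda>z. u (fst z) (snd z) * (deriv \<eta> (fst z) * \<phi> (snd z)) - 1/3 * (u (fst z) (snd z)) ^ 3 * (\<eta> (fst z) * deriv \<phi> (snd z))) \<in> borel_measurable borel"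
  "(\<lambda>z. (dxinv (\<lambda>y. u (fst z) y - u (fst z) y * (ux (fst z) y)\<^sup>2) (snd z) - ff h u ux (fst z)) * (\<eta> (fst z) * \<phi> (snd z))) \<in> borel_measurable borel"
  "m \<in> borel_measurable borel \<Longrightarrow> (\<lambda>z. (2 * u (fst z) (snd z) * ux (fst z) (snd z) - 2 * ux (fst z) (snd z) * m (fst z)) * (\<eta> (fst z) * \<phi> (snd z))) \<in> borel_measurable borel"
proof -
  note [measurable] = joint_measurable dxinv_measurable ff_measurable
  show "(\<lambda>z. (ux (fst z) (snd z))\<^sup>2 * (deriv \<eta> (fst z) * \<phi> (snd z)) - (u (fst z) (snd z))\<^sup>2 * (ux (fst z) (snd z))\<^sup>2 * (\<eta> (fst z) * deriv \<phi> (snd z))) \<in> borel_measurable borel"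
    by measurable
  show "(\<lambda>z. u (fst z) (snd z) * (deriv \<eta> (fst z) * \<phi> (snd z)) - 1/3 * (u (fst z) (snd z)) ^ 3 * (\<eta> (fst z) * deriv \<phi> (snd z))) \<in> borel_measurable borel"
    by measurable
  show "(\<lambda>z. (dxinv (\<lambda>y. u (fst z) y - u (fst z) y * (ux (fst z) y)\<^sup>2) (snd z) - ff h u ux (fst z)) * (\<eta> (fst z) * \<phi> (snd z))) \<in> borel_measurable borel"
    by measurable
  show "(\<lambda>z. (2 * u (fst z) (snd z) * ux (fst z) (snd z) - 2 * ux (fst z) (snd z) * m (fst z)) * (\<eta> (fst z) * \<phi> (snd z))) \<in> borel_measurable borel"
    if [measurable]: "m \<in> borel_measurable borel" by measurable
qed

end

text \<open>Redefining a solution on a null set of times, in particular as the initial datum at time 0,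
  does not affect the weak identities.\<close>
lemma adm_cons_sol_weak_sol:
  assumes H0: "H1_per u0 u0x" and h: "(LINT x:{0..1}|lborel. (u0x x)\<^sup>2) = h" and h1: "h \<noteq> 1"
    and sol: "adm_cons_sol u0 u0x u ux"
  shows "\<exists>us uxs S m c1 C0. (\<forall>C\<ge>C0. weak_sol us uxs S h m C c1) \<and> us 0 = u0 \<and> uxs 0 = u0x \<and> (\<forall>t\<in>S. us t = u t)"
proof -
  define mS where "mS t = Smean (\<lambda>x. u t x - u t x * (ux t x)\<^sup>2)" for t
  note sol' = sol[unfolded adm_cons_sol_def Let_def h]
  have um: "(\<lambda>(t, x). u t x) \<in> borel_measurable (borel :: (real \<times> real) measure)"
    and uxm: "(\<lambda>(t, x). ux t x) \<in> borel_measurable (borel :: (real \<times> real) measure)"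
    and H: "AE t in lborel. t \<ge> 0 \<longrightarrow> H1_per (u t) (ux t)"
    and bd: "\<exists>C. AE t in lborel. t \<ge> 0 \<longrightarrow> (LINT x:{0..1}|lborel. (u t x)\<^sup>2 + (ux t x)\<^sup>2) \<le> C"
    and cons: "\<exists>c1 c2. AE t in lborel. t \<ge> 0 \<longrightarrow>
        (LINT x:{0..1}|lborel. (ux t x)\<^sup>2) = c1 \<and> (LINT x:{0..1}|lborel. u t x - u t x * (ux t x)\<^sup>2) = c2"
    and w2: "\<forall>psi. test_fun psi \<longrightarrow>
        (LINT t:{0..}|lborel. LINT x:{0..1}|lborel. u t x * pdt psi t x - 1/3 * (u t x) ^ 3 * pdx psi t x)
        = - (LINT t:{0..}|lborel. LINT x:{0..1}|lborel.
            (dxinv (\<lambda>y. u t y - u t y * (ux t y)\<^sup>2) x - ff h u ux t) * psi t x)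
          - (LINT x:{0..1}|lborel. u0 x * psi 0 x)"
    and w4: "\<forall>psi. test_fun psi \<longrightarrow>
        (LINT t:{0..}|lborel. LINT z:{0..1}|lborel.
            (ux t z)\<^sup>2 * pdt psi t z - (u t z)\<^sup>2 * (ux t z)\<^sup>2 * pdx psi t z)
        = - (LINT t:{0..}|lborel. LINT z:{0..1}|lborel. (2 * u t z * ux t z - 2 * ux t z * mS t) * psi t z)
          - (LINT z:{0..1}|lborel. (u0x z)\<^sup>2 * psi 0 z)"
    using sol' unfolding mS_def by blast+
  obtain C1 where bd: "AE t in lborel. t \<ge> 0 \<longrightarrow> (LINT x:{0..1}|lborel. (u t x)\<^sup>2 + (ux t x)\<^sup>2) \<le> C1" using bd by blast
  obtain c1 m where cons: "AE t in lborel. t \<ge> 0 \<longrightarrow>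
        (LINT x:{0..1}|lborel. (ux t x)\<^sup>2) = c1 \<and> (LINT x:{0..1}|lborel. u t x - u t x * (ux t x)\<^sup>2) = m" using cons by blast
  define Q where "Q t \<longleftrightarrow> t \<ge> 0 \<longrightarrow> H1_per (u t) (ux t) \<and> (LINT x:{0..1}|lborel. (u t x)\<^sup>2 + (ux t x)\<^sup>2) \<le> C1 \<and>
    (LINT x:{0..1}|lborel. (ux t x)\<^sup>2) = c1 \<and> (LINT x:{0..1}|lborel. u t x - u t x * (ux t x)\<^sup>2) = m" for t
  have "AE t in lborel. Q t" using H bd cons by eventually_elim (auto simp: Q_def)
  then obtain N where N: "{t \<in> space lborel. \<not> Q t} \<subseteq> N" "emeasure lborel N = 0" "N \<in> sets lborel"
    by (rule AE_E)
  define S where "S = {t. 0 < t \<and> t \<notin> N}"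
  have S_sets[measurable]: "S \<in> sets borel"
  proof -
    have "S = {0<..} - N" by (auto simp: S_def)
    then show ?thesis using N(3) by simp
  qed
  have Nnull: "N \<in> null_sets lborel" using N by auto
  have S_AE: "AE t in lborel. 0 \<le> t \<longrightarrow> t \<in> S"
    using AE_not_in[OF Nnull] AE_lborel_singleton[of 0] by eventually_elim (auto simp: S_def)
  have QS: "H1_per (u t) (ux t)" "(LINT x:{0..1}|lborel. (u t x)\<^sup>2 + (ux t x)\<^sup>2) \<le> C1"
    "(LINT x:{0..1}|lborel. (ux t x)\<^sup>2) = c1" "(LINT x:{0..1}|lborel. u t x - u t x * (ux t x)\<^sup>2) = m" if "t \<in> S" for t
  proof -
    have "Q t" using that N(1) by (auto simp: S_def)
    then show "H1_per (u t) (ux t)" "(LINT x:{0..1}|lborel. (u t x)\<^sup>2 + (ux t x)\<^sup>2) \<le> C1"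
    "(LINT x:{0..1}|lborel. (ux t x)\<^sup>2) = c1" "(LINT x:{0..1}|lborel. u t x - u t x * (ux t x)\<^sup>2) = m"
      using that by (auto simp: Q_def S_def)
  qed
  have S0: "0 \<notin> S" by (simp add: S_def)
  define us where "us t = (if t \<in> S then u t else if t = 0 then u0 else (\<lambda>x. 0))" for t
  define uxs where "uxs t = (if t \<in> S then ux t else if t = 0 then u0x else (\<lambda>x. 0))" for t
  have us: "us t = u t" "uxs t = ux t" if "t \<in> S" for t using that by (simp_all add: us_def uxs_def)
  have us0: "us 0 = u0" "uxs 0 = u0x" using S0 by (simp_all add: us_def uxs_def)
  have [measurable]: "u0 \<in> borel_measurable borel" "u0x \<in> borel_measurable borel" using H0 by (auto simp: H1_per_def)
  have [measurable]: "(\<lambda>z. u (fst z) (snd z)) \<in> borel_measurable borel" "(\<lambda>z. ux (fst z) (snd z)) \<in> borel_measurable borel"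
    using um uxm by (simp_all add: split_beta')
  have "(\<lambda>z. if fst z \<in> S then u (fst z) (snd z) else if fst z = 0 then u0 (snd z) else 0) \<in> borel_measurable borel"
    "(\<lambda>z. if fst z \<in> S then ux (fst z) (snd z) else if fst z = 0 then u0x (snd z) else 0) \<in> borel_measurable borel"
    by measurable
  moreover have "us t x = (if t \<in> S then u t x else if t = 0 then u0 x else 0)"
    "uxs t x = (if t \<in> S then ux t x else if t = 0 then u0x x else 0)" for t x
    by (simp_all add: us_def uxs_def)
  ultimately have usm: "(\<lambda>(t, x). us t x) \<in> borel_measurable (borel :: (real \<times> real) measure)"
    and uxsm: "(\<lambda>(t, x). uxs t x) \<in> borel_measurable (borel :: (real \<times> real) measure)"
    by (simp_all add: split_beta')
  have eq_S: "AE t in lborel. 0 \<le> t \<longrightarrow> us t = u t \<and> uxs t = ux t \<and> mS t = m"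
    using S_AE
  proof eventually_elim
    case (elim t)
    then show ?case using us[of t] QS(4)[of t] by (simp add: mS_def Smean_def)
  qed
  have H1_0: "H1_per (\<lambda>x. 0) (\<lambda>x. 0)"
    by (simp add: H1_per_def periodic1_def weak_deriv_per_def set_integrable_def set_lebesgue_integral_def)
  define C0 where "C0 = max C1 (max (LINT x:{0..1}|lborel. (u0 x)\<^sup>2 + (u0x x)\<^sup>2) 0)"
  have "weak_sol us uxs S h m C c1" if C: "C \<ge> C0" for C
  proof
    show "H1_per (us t) (uxs t)" for t using QS(1)[of t] H0 H1_0 by (simp add: us_def uxs_def)
    show "(LINT x:{0..1}|lborel. (us t x)\<^sup>2 + (uxs t x)\<^sup>2) \<le> C" for t
    proof -
      have "C1 \<le> C" "(LINT x:{0..1}|lborel. (u0 x)\<^sup>2 + (u0x x)\<^sup>2) \<le> C" "0 \<le> C" using C by (simp_all add: C0_def)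
      then show ?thesis using QS(2)[of t] by (auto simp: us_def uxs_def set_lebesgue_integral_def)
    qed
    show "us t = (\<lambda>x. 0) \<and> uxs t = (\<lambda>x. 0)" if "t \<notin> S" "t \<noteq> 0" for t using that by (simp add: us_def uxs_def)
    show "0 < t" if "t \<in> S" for t using that by (simp add: S_def)
    show "(LINT x:{0..1}|lborel. (uxs t x)\<^sup>2) = c1" if "t \<in> S" for t using QS(3)[OF that] us[OF that] by simp
    show "(LINT x:{0..1}|lborel. us t x - us t x * (uxs t x)\<^sup>2) = m" if "t \<in> S" for t using QS(4)[OF that] us[OF that] by simp
    show "(LINT x:{0..1}|lborel. (uxs 0 x)\<^sup>2) = h" using h by (simp add: us0)
  next
    fix \<eta> \<phi> assume cut: "cutoff \<eta>" and \<phi>: "smooth1 \<phi>" "periodic1 \<phi>"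
    have \<eta>: "smooth1 \<eta>" using cut by (simp add: cutoff_def)
    have test: "test_fun (\<lambda>t x. \<eta> t * \<phi> x)"
      using cut \<phi> test_fun_separated by (auto simp: cutoff_def)
    have mSm: "mS \<in> borel_measurable borel" unfolding mS_def by (rule Smean_measurable[OF um uxm \<eta> \<phi>(1)])
    have mm: "(\<lambda>t. m) \<in> borel_measurable borel" by simp
    show "(LINT t:{0..}|lborel. LINT x:{0..1}|lborel.
          (uxs t x)\<^sup>2 * (deriv \<eta> t * \<phi> x) - (us t x)\<^sup>2 * (uxs t x)\<^sup>2 * (\<eta> t * deriv \<phi> x))
      = - (LINT t:{0..}|lborel. LINT x:{0..1}|lborel. (2 * us t x * uxs t x - 2 * uxs t x * m) * (\<eta> t * \<phi> x))
        - (LINT x:{0..1}|lborel. (uxs 0 x)\<^sup>2 * (\<eta> 0 * \<phi> x))"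
    proof -
      have "(LINT t:{0..}|lborel. LINT x:{0..1}|lborel.
          (uxs t x)\<^sup>2 * (deriv \<eta> t * \<phi> x) - (us t x)\<^sup>2 * (uxs t x)\<^sup>2 * (\<eta> t * deriv \<phi> x))
        = (LINT t:{0..}|lborel. LINT x:{0..1}|lborel.
          (ux t x)\<^sup>2 * (deriv \<eta> t * \<phi> x) - (u t x)\<^sup>2 * (ux t x)\<^sup>2 * (\<eta> t * deriv \<phi> x))"
        by (rule halfline_cong[OF integrands_measurable(1)[OF usm uxsm \<eta> \<phi>(1)] integrands_measurable(1)[OF um uxm \<eta> \<phi>(1)]])
          (use eq_S in eventually_elim, simp)
      moreover have "(LINT t:{0..}|lborel. LINT x:{0..1}|lborel. (2 * us t x * uxs t x - 2 * uxs t x * m) * (\<eta> t * \<phi> x))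
        = (LINT t:{0..}|lborel. LINT x:{0..1}|lborel. (2 * u t x * ux t x - 2 * ux t x * mS t) * (\<eta> t * \<phi> x))"
        by (rule halfline_cong[OF integrands_measurable(4)[OF usm uxsm \<eta> \<phi>(1) mm] integrands_measurable(4)[OF um uxm \<eta> \<phi>(1) mSm]])
          (use eq_S in eventually_elim, simp)
      ultimately show ?thesis
        using w4[rule_format, OF test] unfolding pdt_separated[OF \<eta>] pdx_separated[OF \<phi>(1)] us0 by simp
    qed
    show "(LINT t:{0..}|lborel. LINT x:{0..1}|lborel.
          us t x * (deriv \<eta> t * \<phi> x) - 1/3 * (us t x) ^ 3 * (\<eta> t * deriv \<phi> x))
      = - (LINT t:{0..}|lborel. LINT x:{0..1}|lborel.
            (dxinv (\<lambda>y. us t y - us t y * (uxs t y)\<^sup>2) x - ff h us uxs t) * (\<eta> t * \<phi> x))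
        - (LINT x:{0..1}|lborel. us 0 x * (\<eta> 0 * \<phi> x))"
    proof -
      have "(LINT t:{0..}|lborel. LINT x:{0..1}|lborel.
          us t x * (deriv \<eta> t * \<phi> x) - 1/3 * (us t x) ^ 3 * (\<eta> t * deriv \<phi> x))
        = (LINT t:{0..}|lborel. LINT x:{0..1}|lborel.
          u t x * (deriv \<eta> t * \<phi> x) - 1/3 * (u t x) ^ 3 * (\<eta> t * deriv \<phi> x))"
        by (rule halfline_cong[OF integrands_measurable(2)[OF usm uxsm \<eta> \<phi>(1)] integrands_measurable(2)[OF um uxm \<eta> \<phi>(1)]])
          (use eq_S in eventually_elim, simp)
      moreover have "(LINT t:{0..}|lborel. LINT x:{0..1}|lborel.
            (dxinv (\<lambda>y. us t y - us t y * (uxs t y)\<^sup>2) x - ff h us uxs t) * (\<eta> t * \<phi> x))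
        = (LINT t:{0..}|lborel. LINT x:{0..1}|lborel.
            (dxinv (\<lambda>y. u t y - u t y * (ux t y)\<^sup>2) x - ff h u ux t) * (\<eta> t * \<phi> x))"
        by (rule halfline_cong[OF integrands_measurable(3)[OF usm uxsm \<eta> \<phi>(1)] integrands_measurable(3)[OF um uxm \<eta> \<phi>(1)]])
          (use eq_S in eventually_elim, simp add: ff_def)
      ultimately show ?thesis
        using w2[rule_format, OF test] unfolding pdt_separated[OF \<eta>] pdx_separated[OF \<phi>(1)] us0 by simp
    qed
  qed (fact usm uxsm S_AE h1)+
  then show ?thesis using us0 us by blast
qed

theorem theorem5p1:
  fixes u0 u0x :: "real \<Rightarrow> real"
    and u ux v vx :: "real \<Rightarrow> real \<Rightarrow> real"
  assumes "H1_per u0 u0x"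
    and "(LINT x:{0..1}|lborel. (u0x x)\<^sup>2) \<noteq> 1"
    and "adm_cons_sol u0 u0x u ux"
    and "adm_cons_sol u0 u0x v vx"
  shows "AE t in lborel. t \<ge> 0 \<longrightarrow> (AE x in lborel. u t x = v t x)"
proof -
  define h where "h = (LINT x:{0..1}|lborel. (u0x x)\<^sup>2)"
  have h1: "h \<noteq> 1" using assms(2) by (simp add: h_def)
  note weak = adm_cons_sol_weak_sol[OF assms(1) h_def[symmetric] h1]
  obtain us uxs S m c C0 where A: "\<And>C. C \<ge> C0 \<Longrightarrow> weak_sol us uxs S h m C c" "us 0 = u0" "uxs 0 = u0x"
    and uS: "\<And>t. t \<in> S \<Longrightarrow> us t = u t" using weak[OF assms(3)] by blast
  obtain vs vxs S' m' c' C0' where B: "\<And>C. C \<ge> C0' \<Longrightarrow> weak_sol vs vxs S' h m' C c'" "vs 0 = u0" "vxs 0 = u0x"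
    and vS: "\<And>t. t \<in> S' \<Longrightarrow> vs t = v t" using weak[OF assms(4)] by blast
  \<comment> \<open>One C for both solutions gives the same supremum bound M, as
    \<open>two_flows\<close> demands.\<close>
  define C where "C = max C0 C0'"
  interpret A: weak_sol us uxs S h m C c by (rule A(1)) (simp add: C_def)
  interpret B: weak_sol vs vxs S' h m' C c' by (rule B(1)) (simp add: C_def)
  define T where "T = A.good \<inter> B.good"
  have T_AE: "AE t in lborel. 0 \<le> t \<longrightarrow> t \<in> T"
    using A.good_AE B.good_AE by eventually_elim (auto simp: T_def)
  have T: "T \<subseteq> A.good" "T \<subseteq> B.good" "0 \<in> T" using A.zero_good B.zero_good by (auto simp: T_def)
  interpret fA: flow A.v uxs T h A.M m A.Gf A.ee by (rule A.good_flow[OF T(1,3) T_AE])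
  interpret fB: flow B.v vxs T h B.M m' B.Gf B.ee by (rule B.good_flow[OF T(2,3) T_AE])
  have init: "A.v 0 = B.v 0" "uxs 0 = vxs 0" "A.ee 0 = B.ee 0"
    by (rule ext, simp_all add: A(2,3) B(2,3) A.v_def B.v_def A.kc_def B.kc_def A.ee_def B.ee_def)
  \<comment> \<open>Each conserved mean equals the mean of the common slice at time 0.\<close>
  have "m = m'"
    using fA.mean_initial[OF A.mean_good] fB.mean_initial[OF B.mean_good] T init by auto
  then have "flow B.v vxs T h A.M m B.Gf B.ee" using fB.flow_axioms by simp
  then interpret two_flows A.v uxs B.v vxs T h A.M m A.Gf A.ee B.Gf B.ee
    by (intro two_flows.intro two_flows_axioms.intro fA.flow_axioms init)
  have agree: "A.v t x = B.v t x" if "t \<in> T" for t x by (rule flows_agree[OF that])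
  show ?thesis
    using T_AE A.S_AE B.S_AE
  proof eventually_elim
    case (elim t)
    show ?case
    proof
      assume "t \<ge> 0"
      with elim have t: "t \<in> T" "t \<in> S" "t \<in> S'" by auto
      show "AE x in lborel. u t x = v t x"
        using A.v_ae[of t] B.v_ae[of t] by eventually_elim (use agree[OF t(1)] uS[OF t(2)] vS[OF t(3)] in auto)
    qed
  qed
qed

end
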